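(* Let $V, H$ be real separable Hilbert spaces with $V$ compactly and densely embedded in $H$, with embedding constant $C_{V,H}$, let $T>0$, and let $a:[0,T]\times V\times V\to\mathbb{R}$ be such that $a(t;\cdot,\cdot)$ is bilinear for every $t\in[0,T]$, $a(\cdot;u,v)$ is Lebesgue measurable on $[0,T]$ for all fixed $u,v\in V$, and there are constants $\mu,\eta>0$ with $a(t;u,u)\ge\mu\|u\|_V^2$ and $|a(t;u,v)|\le\eta\|u\|_V\|v\|_V$ for all $u,v\in V$, $t\in[0,T]$. Let $\mathcal{A}(t):V\to V^*$ be given by $\langle\mathcal{A}(t)u,v\rangle_{V^*\times V}=a(t;u,v)$. Let $0\le\gamma<\frac{\mu}{C_{V,H}^2}$, let $\mathcal{Q}\in L^2(0,T;\mathcal{H})$ with $\mathcal{Q}(t)=\mathcal{Q}^*(t)$ and $\mathcal{Q}(t)\ge-\gamma^2$ for almost every $t\in[0,T]$, and let $\mathcal{P}_0\in\mathcal{H}$ with $\mathcal{P}_0=\mathcal{P}_0^*$ and $\mathcal{P}_0\ge-\gamma$. Let $(N_k)_{k\in\mathbb{N}}$ be a sequence of positive integers with $N_k\to\infty$ as $k\to\infty$, and let $\tau_k=\frac{T}{N_k}$ with $\sup_{k\in\mathbb{N}}\tau_k<\frac{\mu}{2C_{V,H}^2}$. Let $\mathcal{P}_{\tau_k}$ and $\widehat{\mathcal{P}}_{\tau_k}$ be the piecewise constant and the piecewise linear approximate solutions obtained from the backward Euler scheme with step size $\tau_k$. Then there exist a subsequence $(N_{k'})_{k'\in\mathbb{N}}$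 and $\mathcal{P}\in L^\infty(0,T;\mathcal{H})\cap L^2(0,T;\mathcal{V})$ with $\mathcal{P}'\in L^2(0,T;\mathcal{V}^* )$ (so that $\mathcal{P}\in\mathcal{W}_1(0,T)$) such that, as $k'\to\infty$, $$\mathcal{P}_{\tau_{k'}}\rightharpoonup\mathcal{P}\ \text{ in } L^2(0,T;\mathcal{V}),$$ $$\widehat{\mathcal{P}}_{\tau_{k'}}\stackrel{\ast}{\rightharpoonup}\mathcal{P}\ \text{ and }\ \mathcal{P}_{\tau_{k'}}\stackrel{\ast}{\rightharpoonup}\mathcal{P}\ \text{ in } L^\infty(0,T;\mathcal{H}),$$ $$\widehat{\mathcal{P}}'_{\tau_{k'}}\rightharpoonup\mathcal{P}'\ \text{ in } L^2(0,T;\mathcal{V}^* ).$$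
   Context: $\rightharpoonup$ denotes weak convergence and $\stackrel{\ast}{\rightharpoonup}$ weak* convergence ($L^\infty(0,T;\mathcal{H})$ being the dual of $L^1(0,T;\mathcal{H})$); primes on functions of $t$ denote weak derivatives. The embedding constant $C_{V,H}$ satisfies $\|v\|_H\le C_{V,H}\|v\|_V$ for all $v\in V$. $H$ is identified with its dual, giving the Gelfand triple $V\hookrightarrow H\cong H^*\hookrightarrow V^*$; the pairing $\langle\cdot,\cdot\rangle_{V^*\times V}$ extends the inner product $(\cdot,\cdot)_H$. For separable Hilbert spaces $X,Y$, $\mathcal{HS}(X,Y)$ is the Hilbert space of Hilbert--Schmidt operators $X\to Y$ with inner product $(T,S)_{\mathcal{HS}(X,Y)}=\sum_n(Te_n,Se_n)_Y$, $(e_n)$ any orthonormal basis of $X$. Put $$\mathcal{V}=\mathcal{HS}(V^*,H)\cap\mathcal{HS}(H,V),\quad \mathcal{H}=\mathcal{HS}(H,H),\quad \mathcal{V}^*=\mathcal{HS}(V,H)+\mathcal{HS}(H,V^* ),$$ all regarded as subsets of the bounded operators from $V$ to $V^*$. $\mathcal{V}$ has the inner product $(R,S)_{\mathcal{V}}=(R,S)_{\mathcal{HS}(V^*,H)}+(R,S)_{\mathcal{HS}(H,V)}$, $\mathcal{H}$ has the inner product of $\mathcal{HS}(H,H)$, and $\mathcal{V}^*$ is the dual of $\mathcal{V}$ with the dual norm; the duality pairing extends the inner product of $\mathcal{H}$, so $\mathcal{V}\hookrightarrow\mathcal{H}\cong\mathcal{H}^*\hookrightarrow\mathcal{V}^*$.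 $\mathcal{W}_1(0,T)=\{u\in L^2(0,T;\mathcal{V}): u'\in L^1(0,T;\mathcal{H})+L^2(0,T;\mathcal{V}^* )\}$. For a self-adjoint $P\in\mathcal{H}$ and $\beta\in\mathbb{R}$, $P\ge\beta$ means every eigenvalue of $P$ is $\ge\beta$, i.e. $((P-\beta I)u,u)_H\ge0$ for all $u\in H$; in particular, writing $P\geq\beta$ includes that $P$ is self-adjoint. Backward Euler scheme with step size $\tau=T/N$: put $t_n=n\tau$, $Q_n=\frac1\tau\int_{t_{n-1}}^{t_n}\mathcal{Q}(t)\,dt$, $A_n=\frac1\tau\int_{t_{n-1}}^{t_n}\mathcal{A}(t)\,dt$ (i.e. $\langle A_nu,v\rangle_{V^*\times V}=\frac1\tau\int_{t_{n-1}}^{t_n}a(t;u,v)\,dt$), with dual operator $A_n^*$, $P_0=\mathcal{P}_0$, and let $(P_n)_{n=1}^N$ with $P_n\in\mathcal{V}$, $P_n\ge-\gamma$, be the solution (which exists under the stated hypotheses) of $$\frac{P_n-P_{n-1}}{\tau}+A_n^*P_n+P_nA_n+P_n^2=Q_n,\quad n=1,\dots,N.$$ For $t\in(t_{n-1},t_n]$, $n=1,\dots,N$, set $\mathcal{P}_\tau(t)=P_n$ and $\widehat{\mathcal{P}}_\tau(t)=\frac{P_n-P_{n-1}}{\tau}(t-t_{n-1})+P_{n-1}$, with $\widehat{\mathcal{P}}_\tau(0)=\mathcal{P}_\tau(0)=P_0$. *)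

theory Defs
  imports "HOL-Analysis.Analysis"
begin

section \<open>Hilbert--Schmidt operators\<close>

text \<open>
  The dual \<^typ>\<open>'v \<Rightarrow>\<^sub>L real\<close> of a Hilbert space is a Hilbert space for the operator norm, but its
  type is not an instance of \<^class>\<open>real_inner\<close>. The inner product of a Hilbert space is
  therefore recovered from its norm by polarization when orthonormal bases are introduced.
\<close>

definition polar_inner :: "'a::real_normed_vector \<Rightarrow> 'a \<Rightarrow> real" where
  "polar_inner x y = ((norm (x + y))\<^sup>2 - (norm (x - y))\<^sup>2) / 4"

lemma polar_inner_eq_inner: "polar_inner x y = inner x (y::'a::real_inner)"
  by (simp add: polar_inner_def power2_norm_eq_inner inner_add inner_diff inner_commute)

definition orthonormal_basis :: "'a::real_normed_vector set \<Rightarrow> bool" where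
  "orthonormal_basis B \<longleftrightarrow>
     (\<forall>x\<in>B. \<forall>y\<in>B. polar_inner x y = (if x = y then 1 else 0)) \<and> closure (span B) = UNIV"

text \<open>None of the sums below depends on the choice of the basis.\<close>

definition some_basis :: "'a::real_normed_vector set" where
  "some_basis = (SOME B. orthonormal_basis B)"

definition hilbert_schmidt :: "('a::real_normed_vector \<Rightarrow>\<^sub>L 'b::real_normed_vector) \<Rightarrow> bool" where
  "hilbert_schmidt T \<longleftrightarrow> (\<lambda>e. (norm (blinfun_apply T e))\<^sup>2) summable_on some_basis"

definition hs_inner :: "('a::real_normed_vector \<Rightarrow>\<^sub>L 'b::real_inner) \<Rightarrow> ('a \<Rightarrow>\<^sub>L 'b) \<Rightarrow> real" where
  "hs_inner T S = (\<Sum>\<^sub>\<infinity>e\<in>some_basis. inner (blinfun_apply T e) (blinfun_apply S e))"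


section \<open>The Gelfand triple and the operator spaces\<close>

type_synonym 'v dual = "'v \<Rightarrow>\<^sub>L real"
type_synonym 'v oper = "'v \<Rightarrow>\<^sub>L ('v \<Rightarrow>\<^sub>L real)"

text \<open>
  The embedding of V into H is an operator \<^term>\<open>j\<close>. The induced embedding of H into the dual of
  V sends \<^term>\<open>h\<close> to the functional \<^term>\<open>\<lambda>v. inner h (blinfun_apply j v)\<close>.
\<close>

definition dual_emb ::
    "('v::real_normed_vector \<Rightarrow>\<^sub>L 'h::real_inner) \<Rightarrow> 'h \<Rightarrow>\<^sub>L 'v dual" where
  "dual_emb j = Blinfun (\<lambda>h. blinfun_inner_left h o\<^sub>L j)"

lemma dual_emb_apply: "blinfun_apply (blinfun_apply (dual_emb j) h) v = inner h (blinfun_apply j v)"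
proof -
  have "bounded_linear (\<lambda>h. blinfun_inner_left h o\<^sub>L j)"
    by (intro bounded_linear_intros)
  then show ?thesis
    by (simp add: dual_emb_def bounded_linear_Blinfun_apply inner_commute)
qed

text \<open>
  Operators between the spaces of the triple, regarded as operators from V to its dual. For a
  densely embedded V these maps are injective, so that the operator is recovered by
  \<^const>\<open>the_inv\<close>. The suffixes name the domain and the range, D being the dual of V.
\<close>

definition from_HH ::
    "('v::real_normed_vector \<Rightarrow>\<^sub>L 'h::real_inner) \<Rightarrow> ('h \<Rightarrow>\<^sub>L 'h) \<Rightarrow> 'v oper" where
  "from_HH j T = dual_emb j o\<^sub>L T o\<^sub>L j"

definition from_HV ::
    "('v::real_normed_vector \<Rightarrow>\<^sub>L 'h::real_inner) \<Rightarrow> ('h \<Rightarrow>\<^sub>L 'v) \<Rightarrow> 'v oper" where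
  "from_HV j T = dual_emb j o\<^sub>L j o\<^sub>L T o\<^sub>L j"

definition from_DH ::
    "('v::real_normed_vector \<Rightarrow>\<^sub>L 'h::real_inner) \<Rightarrow> ('v dual \<Rightarrow>\<^sub>L 'h) \<Rightarrow> 'v oper" where
  "from_DH j T = dual_emb j o\<^sub>L T o\<^sub>L dual_emb j o\<^sub>L j"

definition from_VH ::
    "('v::real_normed_vector \<Rightarrow>\<^sub>L 'h::real_inner) \<Rightarrow> ('v \<Rightarrow>\<^sub>L 'h) \<Rightarrow> 'v oper" where
  "from_VH j T = dual_emb j o\<^sub>L T"

definition from_HD ::
    "('v::real_normed_vector \<Rightarrow>\<^sub>L 'h::real_inner) \<Rightarrow> ('h \<Rightarrow>\<^sub>L 'v dual) \<Rightarrow> 'v oper" where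
  "from_HD j T = T o\<^sub>L j"

abbreviation as_HH :: "('v::real_normed_vector \<Rightarrow>\<^sub>L 'h::real_inner) \<Rightarrow> 'v oper \<Rightarrow> 'h \<Rightarrow>\<^sub>L 'h" where
  "as_HH j \<equiv> the_inv (from_HH j)"

abbreviation as_HV :: "('v::real_normed_vector \<Rightarrow>\<^sub>L 'h::real_inner) \<Rightarrow> 'v oper \<Rightarrow> 'h \<Rightarrow>\<^sub>L 'v" where
  "as_HV j \<equiv> the_inv (from_HV j)"

abbreviation as_DH :: "('v::real_normed_vector \<Rightarrow>\<^sub>L 'h::real_inner) \<Rightarrow> 'v oper \<Rightarrow> 'v dual \<Rightarrow>\<^sub>L 'h" where
  "as_DH j \<equiv> the_inv (from_DH j)"

text \<open>
  \<open>opV\<close> is HS(V*,H) \<open>\<inter>\<close> HS(H,V), \<open>opH\<close> is HS(H,H) and \<open>opD\<close>, the dual of \<open>opV\<close>,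
  is HS(V,H) + HS(H,V*).
\<close>

definition opV :: "('v::real_inner \<Rightarrow>\<^sub>L 'h::real_inner) \<Rightarrow> 'v oper set" where
  "opV j = from_DH j ` Collect hilbert_schmidt \<inter> from_HV j ` Collect hilbert_schmidt"

definition opH :: "('v::real_inner \<Rightarrow>\<^sub>L 'h::real_inner) \<Rightarrow> 'v oper set" where
  "opH j = from_HH j ` Collect hilbert_schmidt"

definition opD :: "('v::real_inner \<Rightarrow>\<^sub>L 'h::real_inner) \<Rightarrow> 'v oper set" where
  "opD j = {from_VH j K + from_HD j L |K L. hilbert_schmidt K \<and> hilbert_schmidt L}"

definition innerV :: "('v::real_inner \<Rightarrow>\<^sub>L 'h::real_inner) \<Rightarrow> 'v oper \<Rightarrow> 'v oper \<Rightarrow> real" where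
  "innerV j R S = hs_inner (as_DH j R) (as_DH j S) + hs_inner (as_HV j R) (as_HV j S)"

definition innerH :: "('v::real_inner \<Rightarrow>\<^sub>L 'h::real_inner) \<Rightarrow> 'v oper \<Rightarrow> 'v oper \<Rightarrow> real" where
  "innerH j R S = hs_inner (as_HH j R) (as_HH j S)"

definition normV :: "('v::real_inner \<Rightarrow>\<^sub>L 'h::real_inner) \<Rightarrow> 'v oper \<Rightarrow> real" where
  "normV j R = sqrt (innerV j R R)"

definition normH :: "('v::real_inner \<Rightarrow>\<^sub>L 'h::real_inner) \<Rightarrow> 'v oper \<Rightarrow> real" where
  "normH j R = sqrt (innerH j R R)"

text \<open>
  The duality pairing extending \<^const>\<open>innerH\<close>. HS(V,H) is paired with HS(V*,H) through an
  orthonormal basis of V and its image under the Riesz map \<^const>\<open>blinfun_inner_left\<close>, which is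
  an orthonormal basis of V*; HS(H,V*) is paired with HS(H,V) through an orthonormal basis of H.
  If \<^term>\<open>R = from_HH j T\<close>, then both \<^term>\<open>K = T o\<^sub>L j\<close>, \<^term>\<open>L = 0\<close> and
  \<^term>\<open>K = 0\<close>, \<^term>\<open>L = dual_emb j o\<^sub>L T\<close> give \<^term>\<open>innerH j R S\<close>. The value does not
  depend on the decomposition of \<^term>\<open>R\<close>: on the rank-one operators
  \<^term>\<open>from_HH j T\<close> with \<^term>\<open>\<forall>h. blinfun_apply T h = inner h (blinfun_apply j u) *\<^sub>R blinfun_apply j v\<close>,
  whose span is dense in \<open>opV\<close>, it is \<^term>\<open>blinfun_apply (blinfun_apply R u) v\<close>.
\<close>

definition pairing :: "('v::real_inner \<Rightarrow>\<^sub>L 'h::real_inner) \<Rightarrow> 'v oper \<Rightarrow> 'v oper \<Rightarrow> real" where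
  "pairing j R S = (THE x. \<exists>K L. hilbert_schmidt K \<and> hilbert_schmidt L \<and>
     R = from_VH j K + from_HD j L \<and>
     x = (\<Sum>\<^sub>\<infinity>e\<in>some_basis.
            inner (blinfun_apply K e) (blinfun_apply (as_DH j S) (blinfun_inner_left e)))
       + (\<Sum>\<^sub>\<infinity>e\<in>some_basis.
            blinfun_apply (blinfun_apply L e) (blinfun_apply (as_HV j S) e)))"

definition normD :: "('v::real_inner \<Rightarrow>\<^sub>L 'h::real_inner) \<Rightarrow> 'v oper \<Rightarrow> real" where
  "normD j R = (SUP S\<in>{S \<in> opV j. normV j S \<le> 1}. \<bar>pairing j R S\<bar>)"

definition self_adjoint_op :: "('v::real_inner \<Rightarrow>\<^sub>L 'h::real_inner) \<Rightarrow> 'v oper \<Rightarrow> bool" where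
  "self_adjoint_op j R \<longleftrightarrow>
     (\<forall>u w. inner (blinfun_apply (as_HH j R) u) w = inner u (blinfun_apply (as_HH j R) w))"

definition op_ge :: "('v::real_inner \<Rightarrow>\<^sub>L 'h::real_inner) \<Rightarrow> 'v oper \<Rightarrow> real \<Rightarrow> bool" where
  "op_ge j R \<beta> \<longleftrightarrow> R \<in> opH j \<and> self_adjoint_op j R \<and>
     (\<forall>u. inner (blinfun_apply (as_HH j R) u - \<beta> *\<^sub>R u) u \<ge> 0)"


section \<open>Bochner spaces\<close>

text \<open>
  \<open>X\<close> is a subspace of a vector space and \<open>N\<close> a norm on \<open>X\<close>, in general different from
  the norm of the ambient type; this is why the Bochner integral of the library does not apply.
  Functions are not identified when they agree almost everywhere.
\<close>

definition bochner_measurable ::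
    "'b::real_vector set \<Rightarrow> ('b \<Rightarrow> real) \<Rightarrow> real measure \<Rightarrow> (real \<Rightarrow> 'b) \<Rightarrow> bool" where
  "bochner_measurable X N M f \<longleftrightarrow>
     (AE t in M. f t \<in> X) \<and>
     (\<exists>s. (\<forall>n. simple_function M (s n) \<and> s n ` space M \<subseteq> X) \<and>
          (AE t in M. (\<lambda>n. N (f t - s n t)) \<longlonglongrightarrow> 0))"

definition bochner_Lp ::
    "nat \<Rightarrow> 'b::real_vector set \<Rightarrow> ('b \<Rightarrow> real) \<Rightarrow> real measure \<Rightarrow> (real \<Rightarrow> 'b) set" where
  "bochner_Lp p X N M = {f. bochner_measurable X N M f \<and> integrable M (\<lambda>t. N (f t) ^ p)}"

definition bochner_Lp_norm ::
    "nat \<Rightarrow> ('b \<Rightarrow> real) \<Rightarrow> real measure \<Rightarrow> (real \<Rightarrow> 'b) \<Rightarrow> real" where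
  "bochner_Lp_norm p N M f = root p (\<integral>t. N (f t) ^ p \<partial>M)"

definition bochner_Linf ::
    "'b::real_vector set \<Rightarrow> ('b \<Rightarrow> real) \<Rightarrow> real measure \<Rightarrow> (real \<Rightarrow> 'b) set" where
  "bochner_Linf X N M = {f. bochner_measurable X N M f \<and> (\<exists>c. AE t in M. N (f t) \<le> c)}"

definition has_bochner_int ::
    "'b::real_vector set \<Rightarrow> ('b \<Rightarrow> real) \<Rightarrow> real measure \<Rightarrow> (real \<Rightarrow> 'b) \<Rightarrow> 'b \<Rightarrow> bool" where
  "has_bochner_int X N M f I \<longleftrightarrow> bochner_measurable X N M f \<and> I \<in> X \<and>
     (\<exists>s. (\<forall>n. Bochner_Integration.simple_bochner_integrable M (s n) \<and> s n ` space M \<subseteq> X) \<and>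
          (\<lambda>n. \<integral>\<^sup>+t. ennreal (N (f t - s n t)) \<partial>M) \<longlonglongrightarrow> 0 \<and>
          (\<lambda>n. N (Bochner_Integration.simple_bochner_integral M (s n) - I)) \<longlonglongrightarrow> 0)"

definition bochner_int ::
    "'b::real_vector set \<Rightarrow> ('b \<Rightarrow> real) \<Rightarrow> real measure \<Rightarrow> (real \<Rightarrow> 'b) \<Rightarrow> 'b" where
  "bochner_int X N M f = (THE I. has_bochner_int X N M f I)"

definition bochner_Lp_dual ::
    "nat \<Rightarrow> 'b::real_vector set \<Rightarrow> ('b \<Rightarrow> real) \<Rightarrow> real measure \<Rightarrow> ((real \<Rightarrow> 'b) \<Rightarrow> real) set" where
  "bochner_Lp_dual p X N M = {\<Phi>.
     (\<forall>f\<in>bochner_Lp p X N M. \<forall>g\<in>bochner_Lp p X N M. \<Phi> (\<lambda>t. f t + g t) = \<Phi> f + \<Phi> g) \<and>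
     (\<forall>c. \<forall>f\<in>bochner_Lp p X N M. \<Phi> (\<lambda>t. c *\<^sub>R f t) = c * \<Phi> f) \<and>
     (\<exists>B. \<forall>f\<in>bochner_Lp p X N M. \<bar>\<Phi> f\<bar> \<le> B * bochner_Lp_norm p N M f)}"

definition weakly_converges_Lp ::
    "nat \<Rightarrow> 'b::real_vector set \<Rightarrow> ('b \<Rightarrow> real) \<Rightarrow> real measure \<Rightarrow>
     (nat \<Rightarrow> real \<Rightarrow> 'b) \<Rightarrow> (real \<Rightarrow> 'b) \<Rightarrow> bool" where
  "weakly_converges_Lp p X N M F f \<longleftrightarrow>
     (\<forall>k. F k \<in> bochner_Lp p X N M) \<and> f \<in> bochner_Lp p X N M \<and>
     (\<forall>\<Phi>\<in>bochner_Lp_dual p X N M. (\<lambda>k. \<Phi> (F k)) \<longlonglongrightarrow> \<Phi> f)"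

text \<open>Weak* convergence in the space of essentially bounded functions as the dual of the space of
  integrable functions, for a Hilbert space \<open>X\<close> with inner product \<open>ip\<close>.\<close>

definition weakstar_converges_Linf ::
    "'b::real_vector set \<Rightarrow> ('b \<Rightarrow> real) \<Rightarrow> ('b \<Rightarrow> 'b \<Rightarrow> real) \<Rightarrow> real measure \<Rightarrow>
     (nat \<Rightarrow> real \<Rightarrow> 'b) \<Rightarrow> (real \<Rightarrow> 'b) \<Rightarrow> bool" where
  "weakstar_converges_Linf X N ip M F f \<longleftrightarrow>
     (\<forall>k. F k \<in> bochner_Linf X N M) \<and> f \<in> bochner_Linf X N M \<and>
     (\<forall>g\<in>bochner_Lp 1 X N M. (\<lambda>k. \<integral>t. ip (F k t) (g t) \<partial>M) \<longlonglongrightarrow> (\<integral>t. ip (f t) (g t) \<partial>M))"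

definition test_function :: "real \<Rightarrow> (real \<Rightarrow> real) \<Rightarrow> bool" where
  "test_function T \<phi> \<longleftrightarrow>
     (\<forall>n x. (deriv ^^ n) \<phi> field_differentiable (at x)) \<and>
     (\<exists>c d. 0 < c \<and> d < T \<and> (\<forall>x. x \<notin> {c..d} \<longrightarrow> \<phi> x = 0))"

definition has_weak_derivative ::
    "'b::real_vector set \<Rightarrow> ('b \<Rightarrow> real) \<Rightarrow> real \<Rightarrow> (real \<Rightarrow> 'b) \<Rightarrow> (real \<Rightarrow> 'b) \<Rightarrow> bool" where
  "has_weak_derivative X N T f g \<longleftrightarrow>
     f \<in> bochner_Lp 1 X N (lebesgue_on {0<..<T}) \<and> g \<in> bochner_Lp 1 X N (lebesgue_on {0<..<T}) \<and>
     (\<forall>\<phi>. test_function T \<phi> \<longrightarrow>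
        bochner_int X N (lebesgue_on {0<..<T}) (\<lambda>t. deriv \<phi> t *\<^sub>R f t)
        = - bochner_int X N (lebesgue_on {0<..<T}) (\<lambda>t. \<phi> t *\<^sub>R g t))"

definition W1 :: "('v::real_inner \<Rightarrow>\<^sub>L 'h::real_inner) \<Rightarrow> real \<Rightarrow> (real \<Rightarrow> 'v oper) set" where
  "W1 j T = {u \<in> bochner_Lp 2 (opV j) (normV j) (lebesgue_on {0<..<T}).
     \<exists>g\<in>bochner_Lp 1 (opH j) (normH j) (lebesgue_on {0<..<T}).
     \<exists>h\<in>bochner_Lp 2 (opD j) (normD j) (lebesgue_on {0<..<T}).
       has_weak_derivative (opD j) (normD j) T u (\<lambda>t. g t + h t)}"


section \<open>The backward Euler scheme\<close>

definition op_of_form :: "('v::real_normed_vector \<Rightarrow> 'v \<Rightarrow> real) \<Rightarrow> 'v oper" where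
  "op_of_form b = Blinfun (\<lambda>u. Blinfun (b u))"

lemma op_of_form_apply:
  assumes "bounded_bilinear b"
  shows "blinfun_apply (blinfun_apply (op_of_form b) u) v = b u v"
proof -
  interpret bounded_bilinear b by fact
  have *: "blinfun_apply (Blinfun (b u)) = b u" for u
    by (rule bounded_linear_Blinfun_apply[OF bounded_linear_right])
  obtain K where K: "\<And>u v. norm (b u v) \<le> norm u * norm v * K" "K \<ge> 0"
    using nonneg_bounded by blast
  have "bounded_linear (\<lambda>u. Blinfun (b u))"
  proof (rule bounded_linear_intro[where K = K])
    fix u
    have "norm (Blinfun (b u)) \<le> K * norm u"
    proof (rule norm_blinfun_bound)
      show "norm (blinfun_apply (Blinfun (b u)) v) \<le> K * norm u * norm v" for v
        using K(1)[of u v] by (simp add: * ac_simps)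
    qed (use K(2) in simp)
    then show "norm (Blinfun (b u)) \<le> norm u * K"
      by (simp add: mult.commute)
  qed (auto intro!: blinfun_eqI simp: * add_left scaleR_left plus_blinfun.rep_eq scaleR_blinfun.rep_eq)
  from bounded_linear_Blinfun_apply[OF this] show ?thesis
    by (simp add: op_of_form_def *)
qed

definition dual_op :: "'v::real_normed_vector oper \<Rightarrow> 'v oper" where
  "dual_op A = op_of_form (\<lambda>u v. blinfun_apply (blinfun_apply A v) u)"

definition avg_A ::
    "(real \<Rightarrow> 'v::real_normed_vector \<Rightarrow> 'v \<Rightarrow> real) \<Rightarrow> real \<Rightarrow> nat \<Rightarrow> 'v oper" where
  "avg_A a \<tau> n = op_of_form (\<lambda>u v.
     (1 / \<tau>) * (\<integral>t. a t u v \<partial>lebesgue_on {(real n - 1) * \<tau>..real n * \<tau>}))"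

definition avg_Q ::
    "('v::real_inner \<Rightarrow>\<^sub>L 'h::real_inner) \<Rightarrow> (real \<Rightarrow> 'v oper) \<Rightarrow> real \<Rightarrow> nat \<Rightarrow> 'v oper" where
  "avg_Q j Q \<tau> n = (1 / \<tau>) *\<^sub>R
     bochner_int (opH j) (normH j) (lebesgue_on {(real n - 1) * \<tau>..real n * \<tau>}) Q"

text \<open>
  The scheme is an equation between operators from V to its dual. There the product of the dual
  operator of \<open>A\<^sub>n\<close> with \<open>P\<^sub>n\<close> uses \<open>P\<^sub>n\<close> as an operator from H to V, the product of
  \<open>P\<^sub>n\<close> with \<open>A\<^sub>n\<close> uses it as an operator from V* to H, and its square uses it as an
  operator on H.
\<close>

definition backward_euler ::
    "('v::real_inner \<Rightarrow>\<^sub>L 'h::real_inner) \<Rightarrow> (real \<Rightarrow> 'v \<Rightarrow> 'v \<Rightarrow> real) \<Rightarrow> (real \<Rightarrow> 'v oper) \<Rightarrow>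
     'v oper \<Rightarrow> real \<Rightarrow> real \<Rightarrow> nat \<Rightarrow> (nat \<Rightarrow> 'v oper) \<Rightarrow> bool" where
  "backward_euler j a Q P0 \<gamma> \<tau> N P \<longleftrightarrow> P 0 = P0 \<and>
     (\<forall>n\<in>{1..N}. P n \<in> opV j \<and> op_ge j (P n) (- \<gamma>) \<and>
        (1 / \<tau>) *\<^sub>R (P n - P (n - 1))
        + (dual_op (avg_A a \<tau> n) o\<^sub>L as_HV j (P n) o\<^sub>L j)
        + (dual_emb j o\<^sub>L as_DH j (P n) o\<^sub>L avg_A a \<tau> n)
        + from_HH j (as_HH j (P n) o\<^sub>L as_HH j (P n))
        = avg_Q j Q \<tau> n)"

text \<open>
  For \<^term>\<open>t \<in> {(real n - 1) * \<tau><..real n * \<tau>}\<close> the index \<^term>\<open>nat \<lceil>t / \<tau>\<rceil>\<close> is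
  \<^term>\<open>n\<close>. At \<^term>\<open>t = 0\<close> it is \<^term>\<open>0::nat\<close>, and both interpolants have the value
  \<^term>\<open>P (0::nat)\<close> because of truncated subtraction.
\<close>

definition pw_const :: "real \<Rightarrow> (nat \<Rightarrow> 'b) \<Rightarrow> real \<Rightarrow> 'b" where
  "pw_const \<tau> P t = P (nat \<lceil>t / \<tau>\<rceil>)"

definition pw_linear :: "real \<Rightarrow> (nat \<Rightarrow> 'b::real_vector) \<Rightarrow> real \<Rightarrow> 'b" where
  "pw_linear \<tau> P t = (let n = nat \<lceil>t / \<tau>\<rceil> in
     (t - (real n - 1) * \<tau>) *\<^sub>R ((1 / \<tau>) *\<^sub>R (P n - P (n - 1))) + P (n - 1))"

end

(*
By compactness V has an orthonormal basis B whose images in H are orthogonal. In the coefficients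
(R b) c of an operator R with respect to B, the spaces opV, opH and opD become weighted l2 spaces
over B x B, with weights satisfying wD * wV = wH^2, so that the pairing of opD with opV is the
inner product of opH. Tested with P_n, the elliptic part A_n^* P_n + P_n A_n gives at least
mu ||P_n||_V^2, while P_n >= -gamma gives (P_n^2, P_n)_H >= -gamma ||P_n||_H^2; the latter is
absorbed by half of the former since ||P||_H^2 <= C^2/2 ||P||_V^2 and gamma C^2 <= mu. Summing over
the steps bounds the interpolants in L^2(opV) and L^infinity(opH), and the difference quotients in
L^2(opD). A weakly convergent subsequence exists by weak sequential compactness of L^2; the
two interpolants have the same limit because their squared distance in L^2(opH) is at most a
constant times tau, and the weak derivative passes to the limit coordinate by coordinate.
*)

theory Submission
  imports Defs "HOL-Library.Function_Algebras" "HOL-Library.Diagonal_Subsequence"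
begin

section \<open>Weak sequential compactness in spaces with a complete semi-inner product\<close>

text \<open>The obstacle is one of setting. \<open>opV\<close>, \<open>opH\<close> and
  \<open>opD\<close> are subsets of one operator type whose own norm is none of theirs, and
  functions of time are not identified when they agree almost everywhere. So each space is mapped
  isometrically into a single type \<open>ell2\<close>, to which the integral of the library
  applies, and the square-integrable functions form a complete space with a possibly degenerate
  form. As \<open>ell2\<close> is common to the three spaces, the coordinate vector of a member of
  \<open>opD\<close> can be reread as that of a member of \<open>opV\<close>; this gives the dual
  norm and the pairing.

  The coercivity estimate rests on the symmetry of the matrix of \<open>P n\<close>: the two
  Hilbert--Schmidt parts of its norm in \<open>opV\<close> are then equal, and the pairing of the
  elliptic part with \<open>P n\<close> is twice a sum of values of the averaged form on the
  diagonal. The initial value lies only in \<open>opH\<close>, which is why the piecewise linear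
  interpolant is studied in \<open>opH\<close> while the piecewise constant one is bounded in
  \<open>opV\<close>.\<close>

lemma quadratic_nonneg_imp:
  fixes a b c :: real
  assumes "\<And>t. 0 \<le> a * t\<^sup>2 + 2 * b * t + c"
  shows "b\<^sup>2 \<le> a * c"
proof (cases "a = 0")
  case True
  have "b = 0"
  proof (rule ccontr)
    assume "b \<noteq> 0"
    \<comment> \<open>At this point the affine function takes the value -1.\<close>
    with assms[of "- (c + 1) / (2 * b)"] True show False by (simp add: field_simps)
  qed
  then show ?thesis using True by simp
next
  case False
  have "c \<ge> 0" using assms[of 0] by simp
  have "a > 0"
  proof (rule ccontr)
    assume "\<not> a > 0"
    with False have a: "a < 0" by simp
    \<comment> \<open>Large enough for \<open>a * t\<close> to outweigh
      \<open>2 * \<bar>b\<bar> + c + 1\<close>; the last summand gives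
      \<open>t \<ge> 1\<close>.\<close>
    define t where "t = (\<bar>b\<bar> * 2 + c + 1) / (- a) + 1"
    have t1: "t \<ge> 1" using a \<open>c \<ge> 0\<close> by (simp add: t_def divide_nonneg_neg)
    have at: "a * t \<le> - (\<bar>b\<bar> * 2 + c + 1)"
      using a by (simp add: t_def field_simps)
    have "a * t\<^sup>2 \<le> - (\<bar>b\<bar> * 2 + c + 1) * t"
      using mult_right_mono[OF at, of t] t1 by (simp add: power2_eq_square mult.assoc)
    also have "\<dots> = - (2 * (\<bar>b\<bar> * t)) - c * t - t" by (simp add: algebra_simps)
    finally have "a * t\<^sup>2 \<le> - (2 * (\<bar>b\<bar> * t)) - c * t - t" .
    moreover have "b * t \<le> \<bar>b\<bar> * t" by (rule mult_right_mono) (use t1 in auto)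
    moreover have "c * t \<ge> c" using t1 \<open>c \<ge> 0\<close> by (simp add: mult_le_cancel_left1)
    ultimately have "a * t\<^sup>2 + 2 * (b * t) + c < 0" using t1 by linarith
    then have "a * t\<^sup>2 + 2 * b * t + c < 0" by (simp add: mult.assoc)
    then show False using assms[of t] by simp
  qed
  \<comment> \<open>The vertex of the parabola.\<close>
  then show ?thesis
    using assms[of "- b / a"] by (simp add: field_simps power2_eq_square)
qed

text \<open>The form \<open>s\<close> may be degenerate, as functions are not identified when they agree almost everywhere.\<close>

locale semi_hilbert =
  fixes S :: "'f::real_vector set" and s :: "'f \<Rightarrow> 'f \<Rightarrow> real"
  assumes subspace_S: "subspace S"
    and sym: "\<lbrakk>x \<in> S; y \<in> S\<rbrakk> \<Longrightarrow> s x y = s y x"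
    and add_left: "\<lbrakk>x \<in> S; y \<in> S; z \<in> S\<rbrakk> \<Longrightarrow> s (x + y) z = s x z + s y z"
    and scale_left: "\<lbrakk>x \<in> S; y \<in> S\<rbrakk> \<Longrightarrow> s (c *\<^sub>R x) y = c * s x y"
    and nonneg: "x \<in> S \<Longrightarrow> 0 \<le> s x x"
    and complete: "\<And>X :: nat \<Rightarrow> 'f. \<lbrakk>\<And>n. X n \<in> S;
        \<And>e. e > 0 \<Longrightarrow> \<exists>N. \<forall>m\<ge>N. \<forall>n\<ge>N. s (X m - X n) (X m - X n) < e\<rbrakk>
      \<Longrightarrow> \<exists>x\<in>S. (\<lambda>n. s (X n - x) (X n - x)) \<longlonglongrightarrow> 0"
begin

lemmas add_S = subspace_add[OF subspace_S]
lemmas scale_S = subspace_scale[OF subspace_S]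
lemmas diff_S = subspace_diff[OF subspace_S]

lemma add_right: "\<lbrakk>x \<in> S; y \<in> S; z \<in> S\<rbrakk> \<Longrightarrow> s x (y + z) = s x y + s x z"
  using add_left sym add_S by metis

lemma scale_right: "\<lbrakk>x \<in> S; y \<in> S\<rbrakk> \<Longrightarrow> s x (c *\<^sub>R y) = c * s x y"
  using scale_left sym scale_S by metis

lemma diff_left: assumes "x \<in> S" "y \<in> S" "z \<in> S" shows "s (x - y) z = s x z - s y z"
  using add_left[of "x - y" y z] assms diff_S by simp

lemma diff_right: "\<lbrakk>x \<in> S; y \<in> S; z \<in> S\<rbrakk> \<Longrightarrow> s x (y - z) = s x y - s x z"
  using diff_left sym diff_S by metis

lemmas expand = add_left add_right scale_left scale_right diff_left diff_right add_S scale_S diff_S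

text \<open>The discriminant of the square of \<open>x + t y\<close> is nonpositive. As the
  discriminant bound covers a vanishing leading coefficient, a degenerate form causes no special
  case.\<close>

lemma cauchy_schwarz:
  assumes "x \<in> S" "y \<in> S"
  shows "(s x y)\<^sup>2 \<le> s x x * s y y"
proof -
  have "0 \<le> s y y * t\<^sup>2 + 2 * s x y * t + s x x" for t
  proof -
    have "0 \<le> s (x + t *\<^sub>R y) (x + t *\<^sub>R y)" using assms by (intro nonneg add_S scale_S)
    also have "\<dots> = s y y * t\<^sup>2 + 2 * s x y * t + s x x"
      using assms by (simp add: expand sym[of y x] power2_eq_square algebra_simps)
    finally show ?thesis .
  qed
  then show ?thesis by (metis quadratic_nonneg_imp mult.commute)
qed

lemma tendsto_left:
  assumes "\<And>n. X n \<in> S" "x \<in> S" "y \<in> S" and lim: "(\<lambda>n. s (X n - x) (X n - x)) \<longlonglongrightarrow> 0"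
  shows "(\<lambda>n. s (X n) y) \<longlonglongrightarrow> s x y"
proof -
  have 0: "(\<lambda>n. sqrt (s (X n - x) (X n - x) * s y y)) \<longlonglongrightarrow> 0"
    using tendsto_real_sqrt[OF tendsto_mult_right[OF lim, of "s y y"]] by simp
  have "norm (s (X n) y - s x y) \<le> sqrt (s (X n - x) (X n - x) * s y y)" for n
    using real_sqrt_le_mono[OF cauchy_schwarz[of "X n - x" y]] assms by (simp add: diff_left diff_S)
  then have "(\<lambda>n. s (X n) y - s x y) \<longlonglongrightarrow> 0"
    by (intro Lim_null_comparison[OF _ 0]) simp
  then show ?thesis by (simp add: LIM_zero_iff)
qed

text \<open>Only the values on \<open>S\<close> are constrained, since a functional is a function on
  the whole ambient type.\<close>

definition dual :: "('f \<Rightarrow> real) set" where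
  "dual = {L. (\<forall>x\<in>S. \<forall>y\<in>S. L (x + y) = L x + L y) \<and> (\<forall>c. \<forall>x\<in>S. L (c *\<^sub>R x) = c * L x)
     \<and> (\<exists>K. \<forall>x\<in>S. \<bar>L x\<bar> \<le> K * sqrt (s x x))}"

text \<open>A minimizer of \<open>s y y - 2 * L y\<close> represents \<open>L\<close>. This
  variational route needs no orthogonal complement of the kernel, so vectors of zero length do no
  harm.\<close>

lemma riesz:
  assumes L: "L \<in> dual"
  obtains z where "z \<in> S" "\<And>y. y \<in> S \<Longrightarrow> L y = s z y"
proof -
  have Ladd: "\<And>x y. \<lbrakk>x \<in> S; y \<in> S\<rbrakk> \<Longrightarrow> L (x + y) = L x + L y"
    and Lscale: "\<And>c x. x \<in> S \<Longrightarrow> L (c *\<^sub>R x) = c * L x"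
    using L by (auto simp: dual_def)
  obtain K where K: "\<And>x. x \<in> S \<Longrightarrow> \<bar>L x\<bar> \<le> K * sqrt (s x x)"
    using L unfolding dual_def by blast
  define F where "F y = s y y - 2 * L y" for y
  have Fge: "F y \<ge> - K\<^sup>2" if "y \<in> S" for y
  proof -
    have "0 \<le> (sqrt (s y y) - K)\<^sup>2" by simp
    also have "\<dots> = s y y + K\<^sup>2 - 2 * (K * sqrt (s y y))"
      using nonneg[OF that] by (simp add: power2_diff)
    finally show ?thesis using K[OF that] by (simp add: F_def)
  qed
  have bdd: "bdd_below (F ` S)" using Fge by (auto simp: bdd_below_def)
  define d where "d = Inf (F ` S)"
  have ne: "F ` S \<noteq> {}" using subspace_0[OF subspace_S] by blast
  have dle: "d \<le> F y" if "y \<in> S" for y unfolding d_def using bdd that by (simp add: cInf_lower)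
  have "\<exists>y\<in>S. F y < d + 1 / real (Suc n)" for n
    using cInf_lessD[OF ne, of "d + 1 / real (Suc n)"] by (simp add: d_def)
  then obtain Y where Y: "\<And>n. Y n \<in> S" "\<And>n. F (Y n) < d + 1 / real (Suc n)" by metis
  \<comment> \<open>The parallelogram identity, in which the linear terms cancel; it makes a
    minimizing sequence Cauchy because the midpoint has value at least \<open>d\<close>.\<close>
  have par: "s (y - z) (y - z) = 2 * F y + 2 * F z - 4 * F ((1/2) *\<^sub>R (y + z))" if "y \<in> S" "z \<in> S" for y z
    using that by (simp add: F_def expand Ladd Lscale sym[of z y] algebra_simps)
  have dist: "s (Y m - Y n) (Y m - Y n) < 2 / real (Suc m) + 2 / real (Suc n)" for m n
    using par[OF Y(1) Y(1), of m n] Y(2)[of m] Y(2)[of n] dle[of "(1/2) *\<^sub>R (Y m + Y n)"] Y(1)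
    by (simp add: add_S scale_S)
  have "\<exists>x\<in>S. (\<lambda>n. s (Y n - x) (Y n - x)) \<longlonglongrightarrow> 0"
  proof (rule complete[OF Y(1)])
    fix e :: real assume "e > 0"
    then obtain N where N: "1 / real (Suc N) < e / 4" using nat_approx_posE[of "e / 4"] by auto
    have "s (Y m - Y n) (Y m - Y n) < e" if "m \<ge> N" "n \<ge> N" for m n
    proof -
      have "1 / real (Suc m) \<le> 1 / real (Suc N)" "1 / real (Suc n) \<le> 1 / real (Suc N)"
        using that by (simp_all add: frac_le)
      then show ?thesis using dist[of m n] N by simp
    qed
    then show "\<exists>N. \<forall>m\<ge>N. \<forall>n\<ge>N. s (Y m - Y n) (Y m - Y n) < e" by blast
  qed
  then obtain x where x: "x \<in> S" "(\<lambda>n. s (Y n - x) (Y n - x)) \<longlonglongrightarrow> 0" by blast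
  have Flim: "(\<lambda>n. F (Y n)) \<longlonglongrightarrow> d"
  proof (rule tendsto_sandwich[OF _ _ tendsto_const])
    show "(\<lambda>n. d + 1 / real (Suc n)) \<longlonglongrightarrow> d"
      using tendsto_add[OF tendsto_const[of d] LIMSEQ_inverse_real_of_nat] by (simp add: inverse_eq_divide)
    show "\<forall>\<^sub>F n in sequentially. F (Y n) \<le> d + 1 / real (Suc n)" using Y(2) by (simp add: less_imp_le)
  qed (use dle Y(1) in auto)
  have "L y = s x y" if y: "y \<in> S" for y
  proof -
    \<comment> \<open>Minimality along the direction \<open>y\<close>, obtained at
      \<open>Y n\<close> and passed to the limit. A quadratic without constant term that is
      nonnegative everywhere has no linear term.\<close>
    have "0 \<le> s y y * t\<^sup>2 + 2 * (s x y - L y) * t + 0" for t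
    proof -
      have lim: "(\<lambda>n. F (Y n) + 2 * t * s (Y n) y + t\<^sup>2 * s y y - 2 * t * L y)
        \<longlonglongrightarrow> d + 2 * t * s x y + t\<^sup>2 * s y y - 2 * t * L y"
        by (intro tendsto_intros Flim tendsto_left[OF Y(1) x(1) y x(2)])
      have "d \<le> F (Y n) + 2 * t * s (Y n) y + t\<^sup>2 * s y y - 2 * t * L y" for n
        using dle[of "Y n + t *\<^sub>R y"] Y(1)[of n] y
        by (simp add: F_def expand Ladd Lscale sym[of y "Y n"] power2_eq_square algebra_simps)
      then have "d \<le> d + 2 * t * s x y + t\<^sup>2 * s y y - 2 * t * L y"
        by (intro LIMSEQ_le_const[OF lim]) blast
      then show ?thesis by (simp add: algebra_simps)
    qed
    from quadratic_nonneg_imp[OF this] show ?thesis by simp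
  qed
  with x(1) show ?thesis by (rule that)
qed

text \<open>Instead of a dense sequence of test vectors, take the set \<open>Y\<close> of all
  vectors on which the sequence converges. It is a complete subspace containing every
  \<open>X k\<close>, so the limit functional is represented in \<open>Y\<close>, and so is the
  restriction to \<open>Y\<close> of any bounded functional.\<close>

lemma weak_limit_exists:
  assumes X: "\<And>n. X n \<in> S" and K: "\<And>n. s (X n) (X n) \<le> K"
    and conv: "\<And>m. convergent (\<lambda>k. s (X k) (X m))"
  obtains x where "x \<in> S" "\<And>\<Phi>. \<Phi> \<in> dual \<Longrightarrow> (\<lambda>k. \<Phi> (X k)) \<longlonglongrightarrow> \<Phi> x"
proof -
  have K0: "K \<ge> 0" using nonneg[OF X] K[of 0] order_trans by blast
  define Y where "Y = {y \<in> S. convergent (\<lambda>k. s (X k) y)}"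
  have YS: "y \<in> S" if "y \<in> Y" for y using that by (simp add: Y_def)
  have subY: "subspace Y"
  proof (rule subspaceI)
    have "s (X k) 0 = 0" for k using scale_right[OF X X, of k 0 0] by simp
    then show "0 \<in> Y" using subspace_0[OF subspace_S] by (simp add: Y_def convergent_const)
    show "x + y \<in> Y" if "x \<in> Y" "y \<in> Y" for x y
      using that X by (auto simp: Y_def expand intro: convergent_add)
    show "c *\<^sub>R x \<in> Y" if "x \<in> Y" for c x
      using that X by (auto simp: Y_def expand intro!: convergent_mult convergent_const)
  qed
  interpret Y: semi_hilbert Y s
  proof
    show "subspace Y" by (rule subY)
    fix Z :: "nat \<Rightarrow> 'f"
    assume Z: "\<And>n. Z n \<in> Y"
      and C: "\<And>e. 0 < e \<Longrightarrow> \<exists>N. \<forall>m\<ge>N. \<forall>n\<ge>N. s (Z m - Z n) (Z m - Z n) < e"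
    have ZS: "Z n \<in> S" for n using Z YS by blast
    obtain z where z: "z \<in> S" "(\<lambda>n. s (Z n - z) (Z n - z)) \<longlonglongrightarrow> 0"
      using complete[OF ZS C] by blast
    have "Cauchy (\<lambda>k. s (X k) z)"
    proof (rule CauchyI)
      fix e :: real assume e: "e > 0"
      have lim0: "(\<lambda>n. sqrt (K * s (Z n - z) (Z n - z))) \<longlonglongrightarrow> 0"
        using tendsto_real_sqrt[OF tendsto_mult_left[OF z(2), of K]] by simp
      obtain n where n: "sqrt (K * s (Z n - z) (Z n - z)) < e / 3"
        using order_tendstoD(2)[OF lim0, of "e/3"] e
        by (metis (mono_tags, lifting) eventually_happens' sequentially_bot zero_less_divide_iff zero_less_numeral)
      \<comment> \<open>Uniform in \<open>k\<close> because the norms of the \<open>X k\<close> are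
        bounded; the three thirds of \<open>e\<close> then combine.\<close>
      have close: "\<bar>s (X k) (Z n) - s (X k) z\<bar> < e / 3" for k
      proof -
        have "(s (X k) (Z n - z))\<^sup>2 \<le> s (X k) (X k) * s (Z n - z) (Z n - z)"
          using X ZS z(1) by (intro cauchy_schwarz diff_S)
        also have "\<dots> \<le> K * s (Z n - z) (Z n - z)"
          using K ZS z(1) by (intro mult_right_mono nonneg diff_S)
        finally have "\<bar>s (X k) (Z n - z)\<bar> \<le> sqrt (K * s (Z n - z) (Z n - z))"
          using real_sqrt_le_mono by fastforce
        then show ?thesis using n X ZS z(1) by (simp add: diff_right)
      qed
      have "Cauchy (\<lambda>k. s (X k) (Z n))" using Z[of n] by (auto simp: Y_def Cauchy_convergent_iff)
      then obtain M where M: "\<And>k l. k \<ge> M \<Longrightarrow> l \<ge> M \<Longrightarrow> \<bar>s (X k) (Z n) - s (X l) (Z n)\<bar> < e / 3"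
        using CauchyD[of "\<lambda>k. s (X k) (Z n)" "e/3"] e by fastforce
      have "norm (s (X k) z - s (X l) z) < e" if "k \<ge> M" "l \<ge> M" for k l
        using M[OF that] close[of k] close[of l] unfolding real_norm_def by linarith
      then show "\<exists>M. \<forall>m\<ge>M. \<forall>n\<ge>M. norm (s (X m) z - s (X n) z) < e" by blast
    qed
    then have "z \<in> Y" using z(1) by (simp add: Y_def Cauchy_convergent_iff)
    then show "\<exists>x\<in>Y. (\<lambda>n. s (Z n - x) (Z n - x)) \<longlonglongrightarrow> 0" using z(2) by blast
  qed (use YS sym add_left scale_left nonneg in auto)
  have XY: "X k \<in> Y" for k using X conv by (simp add: Y_def)
  define l where "l y = lim (\<lambda>k. s (X k) y)" for y
  have l: "(\<lambda>k. s (X k) y) \<longlonglongrightarrow> l y" if "y \<in> Y" for y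
    using that by (simp add: Y_def l_def convergent_LIMSEQ_iff)
  have ldual: "l \<in> Y.dual"
  proof -
    have 1: "l (x + y) = l x + l y" if "x \<in> Y" "y \<in> Y" for x y
    proof (rule LIMSEQ_unique[OF l])
      show "x + y \<in> Y" using that by (rule Y.add_S)
      show "(\<lambda>k. s (X k) (x + y)) \<longlonglongrightarrow> l x + l y"
        using tendsto_add[OF l[OF that(1)] l[OF that(2)]] that X YS by (simp add: add_right)
    qed
    have 2: "l (c *\<^sub>R x) = c * l x" if "x \<in> Y" for c x
    proof (rule LIMSEQ_unique[OF l])
      show "c *\<^sub>R x \<in> Y" using that by (rule Y.scale_S)
      show "(\<lambda>k. s (X k) (c *\<^sub>R x)) \<longlonglongrightarrow> c * l x"
        using tendsto_mult_left[OF l[OF that], of c] that X YS by (simp add: scale_right)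
    qed
    have 3: "\<bar>l x\<bar> \<le> sqrt K * sqrt (s x x)" if "x \<in> Y" for x
    proof (rule LIMSEQ_le_const2[OF tendsto_rabs[OF l[OF that]]])
      have "\<bar>s (X k) x\<bar> \<le> sqrt K * sqrt (s x x)" for k
      proof -
        have "(s (X k) x)\<^sup>2 \<le> K * s x x"
          using cauchy_schwarz[OF X YS[OF that], of k] mult_right_mono[OF K nonneg[OF YS[OF that]], of k]
          by linarith
        then show ?thesis using real_sqrt_le_mono by (fastforce simp flip: real_sqrt_mult)
      qed
      then show "\<exists>N. \<forall>n\<ge>N. \<bar>s (X n) x\<bar> \<le> sqrt K * sqrt (s x x)" by blast
    qed
    show ?thesis using 1 2 3 unfolding Y.dual_def by blast
  qed
  obtain x where x: "x \<in> Y" "\<And>y. y \<in> Y \<Longrightarrow> l y = s x y" using Y.riesz[OF ldual] by blast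
  have "(\<lambda>k. \<Phi> (X k)) \<longlonglongrightarrow> \<Phi> x" if "\<Phi> \<in> dual" for \<Phi>
  proof -
    have "\<Phi> \<in> Y.dual" using that YS by (fastforce simp: dual_def Y.dual_def)
    then obtain z where z: "z \<in> Y" "\<And>y. y \<in> Y \<Longrightarrow> \<Phi> y = s z y" using Y.riesz by blast
    have "(\<lambda>k. s (X k) z) \<longlonglongrightarrow> s x z" using l[OF z(1)] x(2)[OF z(1)] by simp
    then show ?thesis using z x(1) XY Y.sym by simp
  qed
  with YS[OF x(1)] show ?thesis by (rule that)
qed

text \<open>A diagonal argument in which the members of the sequence serve as their own test
  vectors.\<close>

theorem weak_seq_compact:
  assumes X: "\<And>n. X n \<in> S" and K: "\<And>n. s (X n) (X n) \<le> K"
  obtains r x where "strict_mono (r :: nat \<Rightarrow> nat)" "x \<in> S"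
    "\<And>\<Phi>. \<Phi> \<in> dual \<Longrightarrow> (\<lambda>k. \<Phi> (X (r k))) \<longlonglongrightarrow> \<Phi> x"
proof -
  interpret subseqs "\<lambda>m r. convergent (\<lambda>k. s (X (r k)) (X m))"
  proof
    fix m and r :: "nat \<Rightarrow> nat"
    have "\<bar>s (X (r k)) (X m)\<bar> \<le> K" for k
    proof -
      have "(s (X (r k)) (X m))\<^sup>2 \<le> s (X (r k)) (X (r k)) * s (X m) (X m)"
        by (rule cauchy_schwarz[OF X X])
      also have "\<dots> \<le> K * K" using K nonneg[OF X] order_trans[OF nonneg[OF X] K] by (intro mult_mono) auto
      finally show ?thesis
        using order_trans[OF nonneg[OF X] K] by (metis abs_le_square_iff abs_of_nonneg power2_eq_square)
    qed
    then have "bounded (range (\<lambda>k. s (X (r k)) (X m)))" by (auto simp: bounded_iff)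
    from bounded_imp_convergent_subsequence[OF this]
    show "\<exists>r'. strict_mono r' \<and> convergent (\<lambda>k. s (X ((r \<circ> r') k)) (X m))"
      by (auto simp: convergent_def o_def)
  qed
  have conv: "convergent (\<lambda>k. s (X (diagseq k)) (X m))" for m
  proof -
    \<comment> \<open>Only from index \<open>Suc m\<close> on is the diagonal sequence a subsequence
      of the one selected for \<open>m\<close>; hence the shift, removed afterwards.\<close>
    have "convergent (\<lambda>k. s (X ((diagseq \<circ> ((+) (Suc m))) k)) (X m))"
    proof (rule diagseq_holds)
      show "convergent (\<lambda>k. s (X ((u \<circ> r) k)) (X n))"
        if "strict_mono r" "convergent (\<lambda>k. s (X (u k)) (X n))" for r u n
        using convergent_subseq_convergent[OF that(2,1)] by (simp add: o_def)
    qed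
    then have "convergent (\<lambda>k. s (X (diagseq (k + Suc m))) (X m))" by (simp add: add.commute)
    then show ?thesis by (rule convergent_ignore_initial_segment[THEN iffD1])
  qed
  obtain x where "x \<in> S" "\<And>\<Phi>. \<Phi> \<in> dual \<Longrightarrow> (\<lambda>k. \<Phi> (X (diagseq k))) \<longlonglongrightarrow> \<Phi> x"
    using weak_limit_exists[of "\<lambda>k. X (diagseq k)" K] X K conv by blast
  with subseq_diagseq show ?thesis by (rule that)
qed

end

section \<open>Square-summable sequences\<close>

lemma summable_on_prod_of_squares:
  fixes f g :: "'a \<Rightarrow> real"
  assumes "(\<lambda>x. (f x)\<^sup>2) summable_on A" "(\<lambda>x. (g x)\<^sup>2) summable_on A"
  shows "(\<lambda>x. f x * g x) summable_on A"
proof -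
  have "(\<lambda>x. norm (f x * f x)) summable_on A" "(\<lambda>x. norm (g x * g x)) summable_on A"
    using assms by (simp_all add: power2_eq_square)
  from abs_summable_product[OF this] show ?thesis by (rule abs_summable_summable)
qed

lemma summable_on_squares_add:
  fixes f g :: "'a \<Rightarrow> real"
  assumes "(\<lambda>x. (f x)\<^sup>2) summable_on A" "(\<lambda>x. (g x)\<^sup>2) summable_on A"
  shows "(\<lambda>x. (f x + g x)\<^sup>2) summable_on A"
proof -
  have "(\<lambda>x. (f x)\<^sup>2 + (g x)\<^sup>2 + 2 * (f x * g x)) summable_on A"
    by (intro summable_on_add summable_on_cmult_right assms summable_on_prod_of_squares)
  then show ?thesis by (simp add: power2_sum algebra_simps)
qed

lemma summable_on_squares_cmult:
  fixes f :: "'a \<Rightarrow> real"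
  assumes "(\<lambda>x. (f x)\<^sup>2) summable_on A"
  shows "(\<lambda>x. (c * f x)\<^sup>2) summable_on A"
  using summable_on_cmult_right[OF assms, of "c\<^sup>2"] by (simp add: power_mult_distrib)

lemma summable_on_nonneg_comparison:
  fixes f g :: "'a \<Rightarrow> real"
  assumes "g summable_on A" "\<And>x. x \<in> A \<Longrightarrow> 0 \<le> f x" "\<And>x. x \<in> A \<Longrightarrow> f x \<le> g x"
  shows "f summable_on A"
  using assms by (auto intro: summable_on_comparison_test)

text \<open>Tonelli for sums: nonnegativity turns the existence of the iterated sum into summability
  over the product.\<close>

lemma has_sum_Times_nonneg_iff:
  fixes f :: "'a \<times> 'b \<Rightarrow> real"
  assumes nn: "\<And>x y. \<lbrakk>x \<in> A; y \<in> B\<rbrakk> \<Longrightarrow> 0 \<le> f (x, y)"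
    and g: "\<And>x. x \<in> A \<Longrightarrow> ((\<lambda>y. f (x, y)) has_sum g x) B"
  shows "(f has_sum S) (A \<times> B) \<longleftrightarrow> (g has_sum S) A"
proof
  assume "(f has_sum S) (A \<times> B)"
  then show "(g has_sum S) A" by (rule has_sum_SigmaD) (use g in auto)
next
  assume S: "(g has_sum S) A"
  have "f summable_on A \<times> B"
    by (rule summable_on_SigmaI[OF g]) (use S nn in \<open>auto simp: summable_on_def\<close>)
  then show "(f has_sum S) (A \<times> B)"
    by (intro has_sum_SigmaI[OF _ S]) (use g in auto)
qed

lemma has_sum_swap_iff:
  "(f has_sum S) (A \<times> B) \<longleftrightarrow> ((\<lambda>(x, y). f (y, x)) has_sum S) (B \<times> A)"
  by (rule has_sum_reindex_bij_witness[where i = prod.swap and j = prod.swap]) auto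

text \<open>Pointwise operations, so that a set of functions such as
  \<open>bochner_Lp 2 X N M\<close> can be a subspace in the sense of
  \<open>semi_hilbert\<close>.\<close>

instantiation "fun" :: (type, real_vector) real_vector
begin

definition scaleR_fun_def: "c *\<^sub>R f = (\<lambda>x. c *\<^sub>R f x)"

instance
  by standard (auto simp: scaleR_fun_def plus_fun_def algebra_simps)

end

text \<open>The common target of all coordinate maps. Making it a type lets it be an instance of the
  classes that measurability and the Bochner integral ask for.\<close>

typedef ell2 = "{x :: nat \<Rightarrow> real. (\<lambda>n. (x n)\<^sup>2) summable_on UNIV}"
  morphisms coord Abs_ell2
  by (rule exI[of _ "\<lambda>_. 0"]) simp

setup_lifting type_definition_ell2

instantiation ell2 :: real_vector
begin

lift_definition zero_ell2 :: ell2 is "\<lambda>_. 0" by simp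
lift_definition plus_ell2 :: "ell2 \<Rightarrow> ell2 \<Rightarrow> ell2" is "\<lambda>x y n. x n + y n"
  by (rule summable_on_squares_add)
lift_definition uminus_ell2 :: "ell2 \<Rightarrow> ell2" is "\<lambda>x n. - x n" by simp
lift_definition minus_ell2 :: "ell2 \<Rightarrow> ell2 \<Rightarrow> ell2" is "\<lambda>x y n. x n - y n"
  using summable_on_squares_add[of _ UNIV "\<lambda>n. - _ n"] by fastforce
lift_definition scaleR_ell2 :: "real \<Rightarrow> ell2 \<Rightarrow> ell2" is "\<lambda>c x n. c * x n"
  by (rule summable_on_squares_cmult)

instance
  by standard (transfer; auto simp: algebra_simps)+

end

instantiation ell2 :: real_inner
begin

definition inner_ell2 :: "ell2 \<Rightarrow> ell2 \<Rightarrow> real" where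
  "inner_ell2 x y = (\<Sum>\<^sub>\<infinity>n. coord x n * coord y n)"
definition norm_ell2 :: "ell2 \<Rightarrow> real" where "norm_ell2 x = sqrt (inner x x)"
definition sgn_ell2 :: "ell2 \<Rightarrow> ell2" where "sgn_ell2 x = x /\<^sub>R norm x"
definition dist_ell2 :: "ell2 \<Rightarrow> ell2 \<Rightarrow> real" where "dist_ell2 x y = norm (x - y)"
definition uniformity_ell2 :: "(ell2 \<times> ell2) filter" where
  "uniformity_ell2 = (INF e\<in>{0 <..}. principal {(x, y). dist x y < e})"
definition open_ell2 :: "ell2 set \<Rightarrow> bool" where
  "open_ell2 U \<longleftrightarrow> (\<forall>x\<in>U. eventually (\<lambda>(x', y). x' = x \<longrightarrow> y \<in> U) uniformity)"

instance
proof
  have sq: "(\<lambda>n. (coord x n)\<^sup>2) summable_on UNIV" for x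
    using coord[of x] by simp
  have pr: "(\<lambda>n. coord x n * coord y n) summable_on UNIV" for x y
    by (intro summable_on_prod_of_squares sq)
  fix x y z :: ell2 and r :: real
  show "inner x y = inner y x" by (simp add: inner_ell2_def mult.commute)
  show "inner (x + y) z = inner x z + inner y z"
    by (simp add: inner_ell2_def plus_ell2.rep_eq distrib_right infsum_add pr)
  show "inner (r *\<^sub>R x) y = r * inner x y"
    by (simp add: inner_ell2_def scaleR_ell2.rep_eq mult.assoc infsum_cmult_right pr)
  show "0 \<le> inner x x" by (simp add: inner_ell2_def infsum_nonneg)
  show "inner x x = 0 \<longleftrightarrow> x = 0"
  proof
    assume "inner x x = 0"
    then have "coord x n * coord x n = 0" for n
      using pr unfolding inner_ell2_def by (intro nonneg_infsum_le_0D[where f = "\<lambda>n. coord x n * coord x n" and A = UNIV]) auto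
    then show "x = 0" by (intro coord_inject[THEN iffD1]) (auto simp: zero_ell2.rep_eq)
  qed (simp add: inner_ell2_def zero_ell2.rep_eq)
qed (simp_all add: norm_ell2_def sgn_ell2_def dist_ell2_def uniformity_ell2_def open_ell2_def)

end

lemma coord_summable: "(\<lambda>n. (coord x n)\<^sup>2) summable_on UNIV"
  using coord[of x] by simp

lemma norm_ell2_sq: "(norm x)\<^sup>2 = (\<Sum>\<^sub>\<infinity>n. (coord x n)\<^sup>2)"
  unfolding power2_norm_eq_inner inner_ell2_def by (simp add: power2_eq_square)

lemma sum_coord_le_norm: "finite F \<Longrightarrow> (\<Sum>n\<in>F. (coord x n)\<^sup>2) \<le> (norm x)\<^sup>2"
  unfolding norm_ell2_sq by (rule finite_sum_le_infsum[OF coord_summable]) auto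

lemma norm_le_of_finite_sums:
  assumes "\<And>F. finite F \<Longrightarrow> (\<Sum>n\<in>F. (coord x n)\<^sup>2) \<le> e\<^sup>2" "e \<ge> 0"
  shows "norm x \<le> e"
proof -
  have "(norm x)\<^sup>2 \<le> e\<^sup>2"
    unfolding norm_ell2_sq using assms by (intro infsum_le_finite_sums coord_summable) auto
  then show ?thesis using assms(2) by (rule power2_le_imp_le)
qed

text \<open>The coordinatewise limit \<open>y\<close> is the limit: a finite partial sum of the
  squared distance to \<open>y\<close> is a limit of partial sums of squared distances within the
  sequence, with a bound independent of the finite set.\<close>

instance ell2 :: banach
proof
  fix X :: "nat \<Rightarrow> ell2"
  assume C: "Cauchy X"
  have coord_le: "\<bar>coord x n\<bar> \<le> norm x" for x n
    using sum_coord_le_norm[of "{n}" x] by (simp add: abs_le_square_iff[of _ "norm x", simplified])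
  have "Cauchy (\<lambda>k. coord (X k) n)" for n
  proof (rule CauchyI)
    fix e :: real assume "e > 0"
    then obtain M where M: "\<forall>m\<ge>M. \<forall>k\<ge>M. norm (X m - X k) < e" using CauchyD[OF C] by blast
    have "norm (coord (X m) n - coord (X k) n) < e" if "m \<ge> M" "k \<ge> M" for m k
      using coord_le[of "X m - X k" n] M that by (auto simp: minus_ell2.rep_eq intro: le_less_trans)
    then show "\<exists>M. \<forall>m\<ge>M. \<forall>k\<ge>M. norm (coord (X m) n - coord (X k) n) < e" by blast
  qed
  then have "\<exists>l. (\<lambda>k. coord (X k) n) \<longlonglongrightarrow> l" for n by (simp add: Cauchy_convergent_iff convergent_def)
  then obtain y where y: "\<And>n. (\<lambda>k. coord (X k) n) \<longlonglongrightarrow> y n" by metis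
  have fin: "(\<Sum>n\<in>F. (coord (X m) n - y n)\<^sup>2) \<le> e\<^sup>2"
    if M: "\<And>k. k \<ge> M \<Longrightarrow> norm (X m - X k) < e" and "finite F" for F m M e
  proof (rule LIMSEQ_le_const2)
    show "(\<lambda>k. \<Sum>n\<in>F. (coord (X m) n - coord (X k) n)\<^sup>2) \<longlonglongrightarrow> (\<Sum>n\<in>F. (coord (X m) n - y n)\<^sup>2)"
      by (intro tendsto_intros y)
    have "(\<Sum>n\<in>F. (coord (X m) n - coord (X k) n)\<^sup>2) \<le> e\<^sup>2" if "k \<ge> M" for k
      using sum_coord_le_norm[OF \<open>finite F\<close>, of "X m - X k"] power_mono[OF less_imp_le[OF M[OF that]], of 2]
      by (simp add: minus_ell2.rep_eq)
    then show "\<exists>N. \<forall>k\<ge>N. (\<Sum>n\<in>F. (coord (X m) n - coord (X k) n)\<^sup>2) \<le> e\<^sup>2" by blast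
  qed
  have diff: "(\<lambda>n. (coord (X m) n - y n)\<^sup>2) summable_on UNIV"
    if "\<And>k. k \<ge> M \<Longrightarrow> norm (X m - X k) < e" for m M e
    by (rule nonneg_bounded_partial_sums_imp_summable_on[where C = "e\<^sup>2"])
       (use fin[OF that] in \<open>auto intro!: eventually_finite_subsets_at_top_weakI\<close>)
  obtain M where M: "\<forall>m\<ge>M. \<forall>k\<ge>M. norm (X m - X k) < 1"
    using CauchyD[OF C, of 1] by auto
  \<comment> \<open>This is \<open>y\<close> written as \<open>X M\<close> minus the difference
    \<open>X M - y\<close>, both square-summable.\<close>
  have "(\<lambda>n. (coord (X M) n + (-1) * (coord (X M) n - y n))\<^sup>2) summable_on UNIV"
    by (intro summable_on_squares_add summable_on_squares_cmult diff[of M M 1] coord_summable) (use M in auto)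
  then have "y \<in> {x. (\<lambda>n. (x n)\<^sup>2) summable_on UNIV}" by (simp add: algebra_simps)
  then have ry: "coord (Abs_ell2 y) = y" by (rule Abs_ell2_inverse)
  have "X \<longlonglongrightarrow> Abs_ell2 y"
  proof (rule LIMSEQ_I)
    fix e :: real assume e: "e > 0"
    then obtain M where M: "\<forall>m\<ge>M. \<forall>k\<ge>M. norm (X m - X k) < e / 2"
      using CauchyD[OF C, of "e/2"] by auto
    have "norm (X m - Abs_ell2 y) \<le> e / 2" if "m \<ge> M" for m
      by (rule norm_le_of_finite_sums)
         (use fin[of M m "e/2"] M that e in \<open>auto simp: minus_ell2.rep_eq ry\<close>)
    then show "\<exists>M. \<forall>m\<ge>M. norm (X m - Abs_ell2 y) < e" using e by (intro exI[of _ M]) fastforce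
  qed
  then show "convergent X" by (auto simp: convergent_def)
qed

text \<open>Finitely supported rational sequences, coded by lists, are dense; the balls of radius
  \<open>1 / (n + 1)\<close> about them are a countable basis.\<close>

instance ell2 :: second_countable_topology
proof
  define q where "q l = Abs_ell2 (\<lambda>n. if n < length l then real_of_rat (l ! n) else 0)" for l
  have coord_q: "coord (q l) = (\<lambda>n. if n < length l then real_of_rat (l ! n) else 0)" for l
  proof -
    have "(\<lambda>n. (if n < length l then real_of_rat (l ! n) else 0)\<^sup>2) summable_on {..<length l}"
      by (rule summable_on_finite) simp
    then have "(\<lambda>n. (if n < length l then real_of_rat (l ! n) else 0)\<^sup>2) summable_on UNIV"
      by (subst summable_on_cong_neutral[of "{..<length l}" UNIV]) auto
    then show ?thesis unfolding q_def by (intro Abs_ell2_inverse) simp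
  qed
  define BB where "BB = (\<lambda>(l, n). ball (q l) (1 / real (Suc n))) ` UNIV"
  have dense: "\<exists>l. dist (q l) x < e" if e: "e > 0" for x e
  proof -
    have "((\<lambda>n. (coord x n)\<^sup>2) has_sum (norm x)\<^sup>2) UNIV"
      using coord_summable[of x] by (simp add: norm_ell2_sq)
    then have lim: "(\<lambda>N. \<Sum>n<N. (coord x n)\<^sup>2) \<longlonglongrightarrow> (norm x)\<^sup>2"
      using has_sum_imp_sums sums_def by blast
    have "(norm x)\<^sup>2 - (e/2)\<^sup>2 < (norm x)\<^sup>2" using e by simp
    then obtain N where N: "(norm x)\<^sup>2 - (e/2)\<^sup>2 < (\<Sum>n<N. (coord x n)\<^sup>2)"
      using order_tendstoD(1)[OF lim] by (metis eventually_happens' sequentially_bot)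
    \<comment> \<open>An error \<open>d\<close> in each of \<open>N\<close> coordinates costs at
      most \<open>N * d^2\<close>, hence at most \<open>(e/2)^2\<close>; the added 1 admits
      \<open>N = 0\<close>.\<close>
    define d where "d = (e/2) / (real N + 1)"
    have d: "d > 0" using e by (simp add: d_def)
    have "\<exists>r. \<bar>coord x n - real_of_rat r\<bar> < d" for n
    proof -
      obtain r where "coord x n < real_of_rat r" "real_of_rat r < coord x n + d"
        using of_rat_dense[of "coord x n" "coord x n + d"] d by auto
      then show ?thesis by (intro exI[of _ r]) auto
    qed
    then obtain r where r: "\<And>n. \<bar>coord x n - real_of_rat (r n)\<bar> < d" by metis
    define l where "l = map r [0..<N]"
    define y where "y = q l - x"
    have cy: "coord y n = (if n < N then real_of_rat (r n) - coord x n else - coord x n)" for n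
      by (simp add: y_def minus_ell2.rep_eq coord_q l_def)
    have split: "(norm y)\<^sup>2 = (\<Sum>n<N. (coord y n)\<^sup>2) + (\<Sum>\<^sub>\<infinity>n\<in>{N..}. (coord y n)\<^sup>2)" for y
    proof -
      have "(\<Sum>\<^sub>\<infinity>n\<in>{..<N} \<union> {N..}. (coord y n)\<^sup>2) = (\<Sum>\<^sub>\<infinity>n\<in>{..<N}. (coord y n)\<^sup>2) + (\<Sum>\<^sub>\<infinity>n\<in>{N..}. (coord y n)\<^sup>2)"
        by (intro infsum_Un_disjoint) (auto intro: summable_on_subset_banach[OF coord_summable])
      moreover have "{..<N} \<union> {N..} = UNIV" by auto
      ultimately show ?thesis by (simp add: norm_ell2_sq)
    qed
    have "(\<Sum>\<^sub>\<infinity>n\<in>{N..}. (coord y n)\<^sup>2) = (\<Sum>\<^sub>\<infinity>n\<in>{N..}. (coord x n)\<^sup>2)"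
      by (intro infsum_cong) (auto simp: cy)
    then have t: "(\<Sum>\<^sub>\<infinity>n\<in>{N..}. (coord y n)\<^sup>2) < (e/2)\<^sup>2" using split[of x] N by simp
    have "(coord y n)\<^sup>2 \<le> d\<^sup>2" if "n < N" for n
      using r[of n] d that by (intro abs_le_square_iff[THEN iffD1]) (simp add: cy abs_minus_commute)
    then have "(\<Sum>n<N. (coord y n)\<^sup>2) \<le> (\<Sum>n<N. d\<^sup>2)" by (intro sum_mono) simp
    also have "\<dots> \<le> ((real N + 1) * d)\<^sup>2"
    proof -
      have "real N \<le> (real N + 1)\<^sup>2" by (simp add: power2_eq_square algebra_simps)
      from mult_right_mono[OF this, of "d\<^sup>2"] show ?thesis by (simp add: power_mult_distrib)
    qed
    also have "(real N + 1) * d = e / 2" by (simp add: d_def field_simps)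
    finally have "(norm y)\<^sup>2 < 2 * (e/2)\<^sup>2" using split[of y] t by simp
    also have "\<dots> < e\<^sup>2" using e by (simp add: power2_eq_square)
    finally show ?thesis using e by (intro exI[of _ l]) (auto simp: dist_norm y_def intro: power2_less_imp_less)
  qed
  have "topological_basis BB"
  proof (rule topological_basisI)
    show "open U" if "U \<in> BB" for U using that by (auto simp: BB_def)
    fix U :: "ell2 set" and x
    assume "open U" "x \<in> U"
    then obtain e where e: "e > 0" "ball x e \<subseteq> U" by (meson openE)
    obtain n where n: "1 / real (Suc n) < e / 2" using nat_approx_posE[of "e/2"] e by auto
    obtain l where l: "dist (q l) x < 1 / real (Suc n)" using dense[of "1 / real (Suc n)" x] by auto
    have "ball (q l) (1 / real (Suc n)) \<subseteq> ball x e"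
    proof
      fix z assume "z \<in> ball (q l) (1 / real (Suc n))"
      then show "z \<in> ball x e" using l n dist_triangle[of x z "q l"] by (auto simp: dist_commute)
    qed
    then show "\<exists>B'\<in>BB. x \<in> B' \<and> B' \<subseteq> U"
      using l e(2) by (intro bexI[of _ "ball (q l) (1 / real (Suc n))"]) (auto simp: BB_def)
  qed
  moreover have "countable BB" unfolding BB_def by (intro countable_image) simp
  ultimately show "\<exists>B :: ell2 set set. countable B \<and> open = generate_topology B"
    using topological_basis_imp_subbasis by blast
qed

section \<open>Orthonormal bases and Hilbert--Schmidt operators\<close>

lemma semi_hilbert_inner: "semi_hilbert (UNIV :: 'a::{real_inner,banach} set) inner"
proof
  fix X :: "nat \<Rightarrow> 'a"
  assume C: "\<And>e. 0 < e \<Longrightarrow> \<exists>N. \<forall>m\<ge>N. \<forall>n\<ge>N. inner (X m - X n) (X m - X n) < e"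
  have "Cauchy X"
  proof (rule CauchyI)
    fix e :: real assume e: "e > 0"
    obtain N where N: "\<forall>m\<ge>N. \<forall>n\<ge>N. inner (X m - X n) (X m - X n) < e\<^sup>2" using C[of "e\<^sup>2"] e by auto
    have "norm (X m - X n) < e" if "m \<ge> N" "n \<ge> N" for m n
      by (rule power2_less_imp_less) (use N that e in \<open>auto simp: power2_norm_eq_inner\<close>)
    then show "\<exists>N. \<forall>m\<ge>N. \<forall>n\<ge>N. norm (X m - X n) < e" by blast
  qed
  then obtain x where "X \<longlonglongrightarrow> x" by (auto simp: Cauchy_convergent_iff convergent_def)
  then have "(\<lambda>n. X n - x) \<longlonglongrightarrow> 0" by (simp add: LIM_zero_iff)
  from tendsto_inner[OF this this] show "\<exists>x\<in>UNIV. (\<lambda>n. inner (X n - x) (X n - x)) \<longlonglongrightarrow> 0" by auto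
qed (auto simp: inner_add_left subspace_UNIV intro: inner_commute)

lemma riesz_representation:
  fixes \<phi> :: "'a::{real_inner,banach} \<Rightarrow> real"
  assumes "bounded_linear \<phi>"
  obtains z where "\<And>y. \<phi> y = inner z y"
proof -
  interpret semi_hilbert "UNIV :: 'a set" inner by (rule semi_hilbert_inner)
  interpret \<phi>: bounded_linear \<phi> by fact
  obtain K where "\<And>x. norm (\<phi> x) \<le> norm x * K" using \<phi>.bounded by blast
  then have "\<phi> \<in> dual"
    unfolding dual_def by (auto simp: \<phi>.add \<phi>.scaleR norm_eq_sqrt_inner mult.commute intro!: exI[of _ K])
  from riesz[OF this] show ?thesis using that by auto
qed

definition orthonormal :: "'a::real_inner set \<Rightarrow> bool" where
  "orthonormal B \<longleftrightarrow> (\<forall>x\<in>B. \<forall>y\<in>B. inner x y = (if x = y then 1 else 0))"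

text \<open>Completeness as triviality of the orthogonal complement: the form that Zorn's lemma and
  the uniqueness arguments deliver. In a Hilbert space it amounts to density of the span.\<close>

definition onb :: "'a::real_inner set \<Rightarrow> bool" where
  "onb B \<longleftrightarrow> orthonormal B \<and> (\<forall>y. (\<forall>b\<in>B. inner y b = 0) \<longrightarrow> y = 0)"

lemma onb_orthonormal: "onb B \<Longrightarrow> orthonormal B"
  by (simp add: onb_def)

lemma onb_zero: "onb B \<Longrightarrow> (\<And>b. b \<in> B \<Longrightarrow> inner y b = 0) \<Longrightarrow> y = 0"
  by (simp add: onb_def)

lemma orthonormal_inner: "\<lbrakk>orthonormal B; x \<in> B; y \<in> B\<rbrakk> \<Longrightarrow> inner x y = (if x = y then 1 else 0)"
  by (simp add: orthonormal_def)

lemma norm_diff_projection: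
  assumes "orthonormal B" "finite F" "F \<subseteq> B"
  shows "(norm (x - (\<Sum>b\<in>F. inner x b *\<^sub>R b)))\<^sup>2 = (norm x)\<^sup>2 - (\<Sum>b\<in>F. (inner x b)\<^sup>2)"
proof -
  let ?p = "\<Sum>b\<in>F. inner x b *\<^sub>R b"
  have 1: "inner x ?p = (\<Sum>b\<in>F. (inner x b)\<^sup>2)"
    by (simp add: inner_sum_right power2_eq_square)
  have "inner ?p b = inner x b" if "b \<in> F" for b
  proof -
    have "inner ?p b = (\<Sum>c\<in>F. inner x c * inner c b)" by (simp add: inner_sum_left)
    also have "\<dots> = (\<Sum>c\<in>F. if c = b then inner x b else 0)"
      using assms that by (intro sum.cong) (auto simp: orthonormal_inner[OF assms(1)] subset_iff)
    finally show ?thesis using that assms by simp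
  qed
  then have "inner ?p ?p = (\<Sum>b\<in>F. (inner x b)\<^sup>2)"
    by (simp add: inner_sum_right[of ?p] power2_eq_square cong: sum.cong)
  with 1 show ?thesis
    by (simp add: power2_norm_eq_inner inner_diff_left inner_diff_right inner_commute[of ?p x])
qed

lemma bessel_finite:
  assumes "orthonormal B" "finite F" "F \<subseteq> B"
  shows "(\<Sum>b\<in>F. (inner x b)\<^sup>2) \<le> (norm x)\<^sup>2"
  using norm_diff_projection[OF assms, of x] zero_le_power2[of "norm (x - (\<Sum>b\<in>F. inner x b *\<^sub>R b))"] by linarith

lemma bessel_summable:
  assumes "orthonormal B"
  shows "(\<lambda>b. (inner x b)\<^sup>2) summable_on B"
  by (rule nonneg_bounded_partial_sums_imp_summable_on[where C = "(norm x)\<^sup>2"])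
     (use bessel_finite[OF assms] in \<open>auto intro!: eventually_finite_subsets_at_top_weakI\<close>)

lemma bessel:
  assumes "orthonormal B"
  shows "(\<Sum>\<^sub>\<infinity>b\<in>B. (inner x b)\<^sup>2) \<le> (norm x)\<^sup>2"
  by (rule infsum_le_finite_sums[OF bessel_summable]) (use assms bessel_finite in auto)

lemma infsum_cauchy_schwarz:
  fixes f g :: "'a \<Rightarrow> real"
  assumes f: "(\<lambda>x. (f x)\<^sup>2) summable_on A" and g: "(\<lambda>x. (g x)\<^sup>2) summable_on A"
  shows "\<bar>\<Sum>\<^sub>\<infinity>x\<in>A. f x * g x\<bar> \<le> sqrt (\<Sum>\<^sub>\<infinity>x\<in>A. (f x)\<^sup>2) * sqrt (\<Sum>\<^sub>\<infinity>x\<in>A. (g x)\<^sup>2)"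
proof -
  have fg: "(\<lambda>x. f x * g x) summable_on A" by (intro summable_on_prod_of_squares f g)
  have "0 \<le> (\<Sum>\<^sub>\<infinity>x\<in>A. (g x)\<^sup>2) * t\<^sup>2 + 2 * (\<Sum>\<^sub>\<infinity>x\<in>A. f x * g x) * t + (\<Sum>\<^sub>\<infinity>x\<in>A. (f x)\<^sup>2)" for t
  proof -
    have "0 \<le> (\<Sum>\<^sub>\<infinity>x\<in>A. (f x + t * g x)\<^sup>2)" by (simp add: infsum_nonneg)
    also have "\<dots> = (\<Sum>\<^sub>\<infinity>x\<in>A. t\<^sup>2 * (g x)\<^sup>2 + 2 * t * (f x * g x) + (f x)\<^sup>2)"
      by (intro infsum_cong) (simp add: power2_eq_square algebra_simps)
    also have "\<dots> = t\<^sup>2 * (\<Sum>\<^sub>\<infinity>x\<in>A. (g x)\<^sup>2) + 2 * t * (\<Sum>\<^sub>\<infinity>x\<in>A. f x * g x) + (\<Sum>\<^sub>\<infinity>x\<in>A. (f x)\<^sup>2)"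
      using f g fg by (simp add: infsum_add summable_on_add summable_on_cmult_right infsum_cmult_right)
    finally show ?thesis by (simp add: algebra_simps)
  qed
  from quadratic_nonneg_imp[OF this]
  have "(\<Sum>\<^sub>\<infinity>x\<in>A. f x * g x)\<^sup>2 \<le> (\<Sum>\<^sub>\<infinity>x\<in>A. (f x)\<^sup>2) * (\<Sum>\<^sub>\<infinity>x\<in>A. (g x)\<^sup>2)" by (simp add: mult.commute)
  from real_sqrt_le_mono[OF this] show ?thesis by (simp add: real_sqrt_mult)
qed

lemma has_sum_single:
  fixes f :: "'a \<Rightarrow> real"
  assumes "a \<in> A" "\<And>x. x \<in> A \<Longrightarrow> x \<noteq> a \<Longrightarrow> f x = 0"
  shows "(f has_sum f a) A"
proof -
  have "(f has_sum f a) {a}" using has_sum_finite[of "{a}" f] by simp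
  then show ?thesis by (subst has_sum_cong_neutral[of "{a}" A f f]) (use assms in auto)
qed

text \<open>The vector with the given coefficients is the Riesz representative of the functional
  that pairs coefficients, bounded by Cauchy--Schwarz and Bessel. No infinite sum of vectors is
  formed.\<close>

lemma exists_with_coefficients:
  fixes B :: "'a::{real_inner,banach} set"
  assumes B: "orthonormal B" and c: "(\<lambda>b. (c b)\<^sup>2) summable_on B"
  obtains z where "\<And>y. ((\<lambda>b. c b * inner y b) has_sum inner z y) B" "\<And>b. b \<in> B \<Longrightarrow> inner z b = c b"
proof -
  define \<phi> where "\<phi> y = (\<Sum>\<^sub>\<infinity>b\<in>B. c b * inner y b)" for y
  have sm: "(\<lambda>b. c b * inner y b) summable_on B" for y
    by (intro summable_on_prod_of_squares c bessel_summable B)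
  have "bounded_linear \<phi>"
  proof (rule bounded_linear_intro[where K = "sqrt (\<Sum>\<^sub>\<infinity>b\<in>B. (c b)\<^sup>2)"])
    show "\<phi> (x + y) = \<phi> x + \<phi> y" for x y
      by (simp add: \<phi>_def inner_add_left distrib_left infsum_add sm)
    show "\<phi> (r *\<^sub>R x) = r *\<^sub>R \<phi> x" for r x
      by (simp add: \<phi>_def mult.left_commute infsum_cmult_right sm)
    fix x
    have "norm (\<phi> x) \<le> sqrt (\<Sum>\<^sub>\<infinity>b\<in>B. (c b)\<^sup>2) * sqrt (\<Sum>\<^sub>\<infinity>b\<in>B. (inner x b)\<^sup>2)"
      unfolding \<phi>_def real_norm_def by (intro infsum_cauchy_schwarz c bessel_summable B)
    also have "\<dots> \<le> sqrt (\<Sum>\<^sub>\<infinity>b\<in>B. (c b)\<^sup>2) * norm x"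
      using real_sqrt_le_mono[OF bessel[OF B, of x]] by (intro mult_left_mono) (auto intro: infsum_nonneg)
    finally show "norm (\<phi> x) \<le> norm x * sqrt (\<Sum>\<^sub>\<infinity>b\<in>B. (c b)\<^sup>2)" by (simp add: mult.commute)
  qed
  then obtain z where z: "\<And>y. \<phi> y = inner z y" using riesz_representation by blast
  have hs: "((\<lambda>b. c b * inner y b) has_sum inner z y) B" for y
    using has_sum_infsum[OF sm, of y] by (simp add: z[symmetric] \<phi>_def)
  have "inner z b = c b" if "b \<in> B" for b
    using has_sum_unique[OF hs[of b] has_sum_single[OF that]] that
    by (auto simp: orthonormal_inner[OF B])
  with hs show ?thesis by (rule that)
qed

lemma onb_expansion:
  fixes B :: "'a::{real_inner,banach} set"
  assumes B: "onb B"
  shows "((\<lambda>b. inner x b * inner y b) has_sum inner x y) B"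
proof -
  obtain z where z: "\<And>y. ((\<lambda>b. inner x b * inner y b) has_sum inner z y) B" "\<And>b. b \<in> B \<Longrightarrow> inner z b = inner x b"
    using exists_with_coefficients[OF onb_orthonormal[OF B] bessel_summable[OF onb_orthonormal[OF B], of x]] by blast
  have "inner (z - x) b = 0" if "b \<in> B" for b using z(2)[OF that] by (simp add: inner_diff_left)
  then have "z - x = 0" by (rule onb_zero[OF B])
  then show ?thesis using z(1) by simp
qed

lemma parseval:
  fixes B :: "'a::{real_inner,banach} set"
  assumes "onb B"
  shows "((\<lambda>b. (inner x b)\<^sup>2) has_sum (norm x)\<^sup>2) B"
  unfolding power2_norm_eq_inner using onb_expansion[OF assms, of x x] by (simp add: power2_eq_square)

lemma orthonormal_basis_iff_onb:
  fixes B :: "'a::{real_inner,banach} set"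
  shows "orthonormal_basis B \<longleftrightarrow> onb B"
proof
  assume B: "orthonormal_basis B"
  have z: "y = 0" if y: "\<forall>b\<in>B. inner y b = 0" for y
  proof -
    have "span B \<subseteq> {x. inner y x = 0}"
      by (rule span_minimal) (use y in \<open>auto simp: subspace_def inner_add_right\<close>)
    moreover have "closed {x. inner y x = 0}" by (intro closed_Collect_eq continuous_intros)
    ultimately have "closure (span B) \<subseteq> {x. inner y x = 0}" by (rule closure_minimal)
    moreover have "y \<in> closure (span B)" using B by (simp add: orthonormal_basis_def)
    ultimately have "y \<in> {x. inner y x = 0}" by (rule subsetD)
    then have "inner y y = 0" by simp
    then show ?thesis by simp
  qed
  have "orthonormal B"
    using B by (simp add: orthonormal_def orthonormal_basis_def polar_inner_eq_inner)
  then show "onb B" unfolding onb_def by (intro conjI allI impI z)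
next
  assume B: "onb B"
  have "x \<in> closure (span B)" for x
  proof (subst closure_approachable, intro allI impI)
    fix e :: real assume e: "e > 0"
    have "\<forall>\<^sub>F F in finite_subsets_at_top B. (norm x)\<^sup>2 - e\<^sup>2 < (\<Sum>b\<in>F. (inner x b)\<^sup>2)"
      using parseval[OF B, of x] e unfolding has_sum_def by (intro order_tendstoD) auto
    then obtain F where F: "finite F" "F \<subseteq> B" "(norm x)\<^sup>2 - e\<^sup>2 < (\<Sum>b\<in>F. (inner x b)\<^sup>2)"
      unfolding eventually_finite_subsets_at_top by blast
    let ?p = "\<Sum>b\<in>F. inner x b *\<^sub>R b"
    have "(norm (x - ?p))\<^sup>2 < e\<^sup>2" using norm_diff_projection[OF onb_orthonormal[OF B] F(1,2), of x] F(3) by simp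
    then have "norm (x - ?p) < e" by (rule power2_less_imp_less) (use e in simp)
    then have "dist ?p x < e" by (simp only: dist_norm norm_minus_commute[of ?p x])
    moreover have "?p \<in> span B" using F(2) by (intro span_sum span_scale span_base) blast
    ultimately show "\<exists>y\<in>span B. dist y x < e" by blast
  qed
  then have "closure (span B) = UNIV" by blast
  then show "orthonormal_basis B"
    using onb_orthonormal[OF B] by (simp add: orthonormal_def orthonormal_basis_def polar_inner_eq_inner)
qed

text \<open>The choice behind \<open>some_basis\<close> is meaningful once some basis is known to
  exist. This is why many of the facts on Hilbert--Schmidt operators take an \<open>onb\<close> for
  each space as a hypothesis.\<close>

lemma onb_some_basis:
  fixes B :: "'a::{real_inner,banach} set"
  assumes "onb B"
  shows "onb (some_basis :: 'a set)"
proof -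
  have "orthonormal_basis (some_basis :: 'a set)"
    unfolding some_basis_def by (rule someI[where x = B]) (simp add: orthonormal_basis_iff_onb assms)
  then show ?thesis by (simp only: orthonormal_basis_iff_onb)
qed

text \<open>Distinct members have squared distance 2, so points of a countable dense set chosen
  within 1/2 of them are distinct.\<close>

lemma orthonormal_countable:
  fixes B :: "'a::{real_inner,second_countable_topology} set"
  assumes B: "orthonormal B"
  shows "countable B"
proof -
  obtain D :: "'a set" where D: "countable D" "\<And>X. open X \<Longrightarrow> X \<noteq> {} \<Longrightarrow> \<exists>d\<in>D. d \<in> X"
    using countable_dense_setE by blast
  have "\<exists>d\<in>D. d \<in> ball b (1/2)" for b by (rule D(2)) auto
  then obtain f where f: "\<And>b. f b \<in> D" "\<And>b. f b \<in> ball b (1/2)" by metis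
  have "inj_on f B"
  proof
    fix b c assume bc: "b \<in> B" "c \<in> B" "f b = f c"
    have "dist b c < 1" using f(2)[of b] f(2)[of c] bc(3) dist_triangle_half_r[of "f c" b 1 c] by (simp add: dist_commute)
    then have "(norm (b - c))\<^sup>2 < 1" by (simp add: dist_norm power_less_one_iff)
    then show "b = c" using bc(1,2) 
      by (auto simp: power2_norm_eq_inner inner_diff_left inner_diff_right orthonormal_inner[OF B] split: if_splits)
  qed
  moreover have "countable (f ` B)" using f(1) D(1) by (meson countable_subset image_subsetI)
  ultimately show ?thesis using countable_image_inj_eq by blast
qed

lemma blinfun_eq_on_onb:
  fixes T S :: "'a::{real_inner,banach} \<Rightarrow>\<^sub>L 'b::real_normed_vector"
  assumes B: "onb B" and eq: "\<And>b. b \<in> B \<Longrightarrow> blinfun_apply T b = blinfun_apply S b"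
  shows "T = S"
proof -
  have "span B \<subseteq> {x. blinfun_apply T x = blinfun_apply S x}"
    by (rule span_minimal) (use eq in \<open>auto simp: subspace_def blinfun.add_right blinfun.scaleR_right\<close>)
  moreover have "closed {x. blinfun_apply T x = blinfun_apply S x}"
    by (intro closed_Collect_eq continuous_intros)
  ultimately have "closure (span B) \<subseteq> {x. blinfun_apply T x = blinfun_apply S x}" by (rule closure_minimal)
  then show ?thesis using B by (auto simp: orthonormal_basis_iff_onb[symmetric] orthonormal_basis_def intro: blinfun_eqI)
qed

lemma eq_if_onb_coefficients:
  fixes x y :: "'a::real_inner"
  assumes "onb B" "\<And>b. b \<in> B \<Longrightarrow> inner x b = inner y b"
  shows "x = y"
proof -
  have "x - y = 0" by (rule onb_zero[OF assms(1)]) (simp add: inner_diff_left assms(2))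
  then show ?thesis by simp
qed

text \<open>The matrix defines a form on pairs of vectors by a double sum. The products of squared
  coefficients of \<open>u\<close> and \<open>v\<close> sum to the product of the squared norms, so
  Cauchy--Schwarz bounds the form by the Hilbert--Schmidt norm \<open>M\<close>, and Riesz in the
  second argument yields the operator.\<close>

lemma blinfun_with_matrix:
  fixes B :: "'a::{real_inner,banach} set" and C :: "'b::{real_inner,banach} set"
  assumes B: "onb B" and C: "onb C"
    and m: "(\<lambda>(b, c). (m b c)\<^sup>2) summable_on B \<times> C"
  obtains T :: "'a \<Rightarrow>\<^sub>L 'b" where "\<And>b c. \<lbrakk>b \<in> B; c \<in> C\<rbrakk> \<Longrightarrow> inner (blinfun_apply T b) c = m b c"
proof -
  have prod: "((\<lambda>(b, c). (inner u b * inner v c)\<^sup>2) has_sum (norm u)\<^sup>2 * (norm v)\<^sup>2) (B \<times> C)" for u v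
  proof (subst has_sum_Times_nonneg_iff)
    show "((\<lambda>c. case (b, c) of (b, c) \<Rightarrow> (inner u b * inner v c)\<^sup>2) has_sum ((inner u b)\<^sup>2 * (norm v)\<^sup>2)) C" for b
      using has_sum_cmult_right[OF parseval[OF C, of v], of "(inner u b)\<^sup>2"] by (simp add: power_mult_distrib)
    show "((\<lambda>b. (inner u b)\<^sup>2 * (norm v)\<^sup>2) has_sum (norm u)\<^sup>2 * (norm v)\<^sup>2) B"
      by (intro has_sum_cmult_left parseval B)
  qed auto
  define M where "M = sqrt (\<Sum>\<^sub>\<infinity>p\<in>B \<times> C. (case_prod m p)\<^sup>2)"
  define \<beta> where "\<beta> u v = (\<Sum>\<^sub>\<infinity>p\<in>B \<times> C. case_prod m p * (inner u (fst p) * inner v (snd p)))" for u v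
  have m2: "(\<lambda>p. (case_prod m p)\<^sup>2) summable_on B \<times> C" using m by (simp add: case_prod_unfold)
  have p2: "((\<lambda>p. (inner u (fst p) * inner v (snd p))\<^sup>2) has_sum (norm u)\<^sup>2 * (norm v)\<^sup>2) (B \<times> C)" for u v
    using prod[of u v] by (simp add: case_prod_unfold)
  have sm: "(\<lambda>p. case_prod m p * (inner u (fst p) * inner v (snd p))) summable_on B \<times> C" for u v
    by (intro summable_on_prod_of_squares m2) (use p2 in \<open>auto simp: summable_on_def\<close>)
  have \<beta>_le: "\<bar>\<beta> u v\<bar> \<le> M * (norm u * norm v)" for u v
    using infsum_cauchy_schwarz[OF m2 has_sum_imp_summable[OF p2[of u v]]] infsumI[OF p2[of u v]]
    by (simp add: \<beta>_def M_def real_sqrt_mult)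
  have \<beta>_add1: "\<beta> (u + u') v = \<beta> u v + \<beta> u' v" for u u' v
    unfolding \<beta>_def infsum_add[OF sm sm, symmetric] by (simp add: inner_add_left algebra_simps)
  have \<beta>_add2: "\<beta> u (v + v') = \<beta> u v + \<beta> u v'" for u v v'
    unfolding \<beta>_def infsum_add[OF sm sm, symmetric] by (simp add: inner_add_left algebra_simps)
  have \<beta>_sc1: "\<beta> (r *\<^sub>R u) v = r * \<beta> u v" for r u v
    unfolding \<beta>_def infsum_cmult_right[OF sm, symmetric] by (simp add: algebra_simps)
  have \<beta>_sc2: "\<beta> u (r *\<^sub>R v) = r * \<beta> u v" for r u v
    unfolding \<beta>_def infsum_cmult_right[OF sm, symmetric] by (simp add: algebra_simps)
  have "\<exists>z. \<forall>v. \<beta> u v = inner z v" for u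
  proof -
    have "bounded_linear (\<beta> u)"
      by (rule bounded_linear_intro[where K = "M * norm u"])
         (use \<beta>_le[of u] in \<open>auto simp: \<beta>_add2 \<beta>_sc2 mult.assoc mult.left_commute mult.commute\<close>)
    then show ?thesis using riesz_representation by metis
  qed
  then obtain t where t: "\<And>u v. \<beta> u v = inner (t u) v" by metis
  have "bounded_linear t"
  proof (rule bounded_linear_intro[where K = M])
    show "t (x + y) = t x + t y" for x y
    proof -
      have "inner (t (x + y)) z = inner (t x + t y) z" for z
        by (simp add: inner_add_left \<beta>_add1 flip: t)
      then show ?thesis by (metis vector_eq_rdot)
    qed
    show "t (r *\<^sub>R x) = r *\<^sub>R t x" for r x
    proof -
      have "inner (t (r *\<^sub>R x)) z = inner (r *\<^sub>R t x) z" for z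
        by (simp add: \<beta>_sc1 flip: t)
      then show ?thesis by (metis vector_eq_rdot)
    qed
    fix u
    have "norm (t u) * norm (t u) \<le> (norm u * M) * norm (t u)"
      using \<beta>_le[of u "t u"] by (simp add: t power2_norm_eq_inner[symmetric] power2_eq_square mult_ac)
    moreover have "0 \<le> norm u * M" by (simp add: M_def infsum_nonneg)
    ultimately show "norm (t u) \<le> norm u * M"
      by (cases "norm (t u) = 0") (auto simp: mult_le_cancel_right)
  qed
  then have app: "blinfun_apply (Blinfun t) = t" by (rule bounded_linear_Blinfun_apply)
  have "inner (t b) c = m b c" if bc: "b \<in> B" "c \<in> C" for b c
  proof -
    have "((\<lambda>p. case_prod m p * (inner b (fst p) * inner c (snd p))) has_sum
        case_prod m (b, c) * (inner b (fst (b, c)) * inner c (snd (b, c)))) (B \<times> C)"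
    proof (rule has_sum_single)
      fix p assume p: "p \<in> B \<times> C" "p \<noteq> (b, c)"
      obtain b' c' where p': "p = (b', c')" by (cases p)
      have "inner b b' = 0 \<or> inner c c' = 0"
        using p bc orthonormal_inner[OF onb_orthonormal[OF B], of b b'] orthonormal_inner[OF onb_orthonormal[OF C], of c c']
        unfolding p' by (cases "b = b'") auto
      then show "case_prod m p * (inner b (fst p) * inner c (snd p)) = 0" by (auto simp: p')
    qed (use bc in simp)
    from infsumI[OF this] have "\<beta> b c = m b c * (inner b b * inner c c)" unfolding \<beta>_def by simp
    also have "inner b b = 1" using orthonormal_inner[OF onb_orthonormal[OF B] bc(1) bc(1)] by simp
    also have "inner c c = 1" using orthonormal_inner[OF onb_orthonormal[OF C] bc(2) bc(2)] by simp
    finally show ?thesis unfolding t by simp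
  qed
  then show ?thesis by (intro that[of "Blinfun t"]) (simp only: app)
qed

section \<open>Double sums of matrix entries and independence of the basis\<close>

lemma has_sum_norm_sq_iff_matrix:
  fixes T :: "'a::real_normed_vector \<Rightarrow>\<^sub>L 'b::{real_inner,banach}"
  assumes "onb C"
  shows "((\<lambda>b. (norm (blinfun_apply T b))\<^sup>2) has_sum S) B
    \<longleftrightarrow> ((\<lambda>(b, c). (inner (blinfun_apply T b) c)\<^sup>2) has_sum S) (B \<times> C)"
  by (rule has_sum_Times_nonneg_iff[symmetric]) (use parseval[OF assms] in auto)

lemma adjoint_exists:
  fixes T :: "'a::{real_inner,banach} \<Rightarrow>\<^sub>L 'b::real_inner"
  obtains t where "\<And>x c. inner (blinfun_apply T x) c = inner (t c) x"
proof -
  have "\<exists>z. \<forall>x. inner (blinfun_apply T x) c = inner z x" for c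
  proof -
    have "bounded_linear (\<lambda>x. inner (blinfun_apply T x) c)" by (intro bounded_linear_intros)
    then show ?thesis by (metis riesz_representation)
  qed
  then show ?thesis using that by metis
qed

lemma has_sum_norm_sq_adjoint:
  fixes T :: "'a::{real_inner,banach} \<Rightarrow>\<^sub>L 'b::{real_inner,banach}"
  assumes t: "\<And>x c. inner (blinfun_apply T x) c = inner (t c) x" and B: "onb B" and C: "onb C"
  shows "((\<lambda>b. (norm (blinfun_apply T b))\<^sup>2) has_sum S) B \<longleftrightarrow> ((\<lambda>c. (norm (t c))\<^sup>2) has_sum S) C"
proof -
  have "((\<lambda>c. (norm (t c))\<^sup>2) has_sum S) C \<longleftrightarrow> ((\<lambda>(c, b). (inner (t c) b)\<^sup>2) has_sum S) (C \<times> B)"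
    by (rule has_sum_Times_nonneg_iff[symmetric]) (use parseval[OF B] in auto)
  also have "\<dots> \<longleftrightarrow> ((\<lambda>(b, c). (inner (blinfun_apply T b) c)\<^sup>2) has_sum S) (B \<times> C)"
    by (subst has_sum_swap_iff) (simp add: t)
  finally show ?thesis using has_sum_norm_sq_iff_matrix[OF C, where T = T and S = S and B = B] by simp
qed

text \<open>Both sums equal the sum over \<open>C\<close> for the adjoint, in which the basis of the
  domain does not occur.\<close>

lemma has_sum_norm_sq_basis_change:
  fixes T :: "'a::{real_inner,banach} \<Rightarrow>\<^sub>L 'b::{real_inner,banach}"
  assumes "onb A" "onb B" "onb (C :: 'b set)"
  shows "((\<lambda>b. (norm (blinfun_apply T b))\<^sup>2) has_sum S) A \<longleftrightarrow> ((\<lambda>b. (norm (blinfun_apply T b))\<^sup>2) has_sum S) B"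
proof -
  obtain t where t: "\<And>x c. inner (blinfun_apply T x) c = inner (t c) x" using adjoint_exists by blast
  show ?thesis
    using has_sum_norm_sq_adjoint[OF t assms(1,3), of S] has_sum_norm_sq_adjoint[OF t assms(2,3), of S] by simp
qed

lemma hilbert_schmidt_iff_onb:
  fixes T :: "'a::{real_inner,banach} \<Rightarrow>\<^sub>L 'b::{real_inner,banach}"
  assumes "onb B" "onb (C :: 'b set)"
  shows "hilbert_schmidt T \<longleftrightarrow> (\<lambda>e. (norm (blinfun_apply T e))\<^sup>2) summable_on B"
  unfolding hilbert_schmidt_def summable_on_def
  using has_sum_norm_sq_basis_change[OF onb_some_basis[OF assms(1)] assms] by simp

lemma hilbert_schmidt_iff_matrix:
  fixes T :: "'a::{real_inner,banach} \<Rightarrow>\<^sub>L 'b::{real_inner,banach}"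
  assumes "onb B" "onb C"
  shows "hilbert_schmidt T \<longleftrightarrow> (\<lambda>(b, c). (inner (blinfun_apply T b) c)\<^sup>2) summable_on B \<times> C"
  unfolding hilbert_schmidt_iff_onb[OF assms] summable_on_def has_sum_norm_sq_iff_matrix[OF assms(2)] ..

lemma hs_matrix_product_summable:
  fixes T S :: "'a::{real_inner,banach} \<Rightarrow>\<^sub>L 'b::{real_inner,banach}"
  assumes "onb (B :: 'a set)" "onb (C :: 'b set)" "hilbert_schmidt T" "hilbert_schmidt S"
  shows "(\<lambda>(b, c). inner (blinfun_apply T b) c * inner (blinfun_apply S b) c) summable_on B \<times> C"
  using assms(3,4) summable_on_prod_of_squares[of "\<lambda>p. inner (blinfun_apply T (fst p)) (snd p)" "B \<times> C"
      "\<lambda>p. inner (blinfun_apply S (fst p)) (snd p)"]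
  unfolding hilbert_schmidt_iff_matrix[OF assms(1,2)] by (simp add: case_prod_unfold)

lemma hilbert_schmidt_add:
  fixes T S :: "'a::{real_inner,banach} \<Rightarrow>\<^sub>L 'b::{real_inner,banach}"
  assumes "onb (B :: 'a set)" "onb (C :: 'b set)" "hilbert_schmidt T" "hilbert_schmidt S"
  shows "hilbert_schmidt (T + S)"
  using assms(3,4) summable_on_squares_add[of "\<lambda>p. inner (blinfun_apply T (fst p)) (snd p)" "B \<times> C"
      "\<lambda>p. inner (blinfun_apply S (fst p)) (snd p)"]
  unfolding hilbert_schmidt_iff_matrix[OF assms(1,2)] by (simp add: case_prod_unfold blinfun.add_left inner_add_left)

lemma hilbert_schmidt_scaleR:
  "hilbert_schmidt T \<Longrightarrow> hilbert_schmidt (c *\<^sub>R T)"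
  unfolding hilbert_schmidt_def
  using summable_on_cmult_right[of "\<lambda>e. (norm (blinfun_apply T e))\<^sup>2" some_basis "c\<^sup>2"]
  by (simp add: blinfun.scaleR_left power_mult_distrib)

text \<open>Polarization reduces the claim to squared norms, whose sums do not depend on the basis.
  This makes \<open>hs_inner\<close>, defined through \<open>some_basis\<close>, computable in any
  basis.\<close>

lemma hs_inner_product_has_sum:
  fixes T S :: "'a::{real_inner,banach} \<Rightarrow>\<^sub>L 'b::{real_inner,banach}"
  assumes "onb (B :: 'a set)" "onb (C :: 'b set)" "hilbert_schmidt T" "hilbert_schmidt S"
  shows "((\<lambda>e. inner (blinfun_apply T e) (blinfun_apply S e)) has_sum hs_inner T S) B"
proof -
  have A: "onb (some_basis :: 'a set)" by (rule onb_some_basis[OF assms(1)])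
  have d: "hilbert_schmidt (T - S)"
    using hilbert_schmidt_add[OF assms(1,2,3) hilbert_schmidt_scaleR[OF assms(4), of "-1"]] by simp
  define s1 where "s1 = (\<Sum>\<^sub>\<infinity>e\<in>some_basis. (norm (blinfun_apply (T + S) e))\<^sup>2)"
  define s2 where "s2 = (\<Sum>\<^sub>\<infinity>e\<in>some_basis. (norm (blinfun_apply (T - S) e))\<^sup>2)"
  have s1: "((\<lambda>e. (norm (blinfun_apply (T + S) e))\<^sup>2) has_sum s1) some_basis"
    using hilbert_schmidt_add[OF assms] unfolding hilbert_schmidt_def s1_def by simp
  have s2: "((\<lambda>e. (norm (blinfun_apply (T - S) e))\<^sup>2) has_sum s2) some_basis"
    using d unfolding hilbert_schmidt_def s2_def by simp
  have pol: "inner (blinfun_apply T e) (blinfun_apply S e)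
      = (1/4) * (norm (blinfun_apply (T + S) e))\<^sup>2 + (- 1/4) * (norm (blinfun_apply (T - S) e))\<^sup>2" for e
    using polar_inner_eq_inner[of "blinfun_apply T e" "blinfun_apply S e"]
    by (simp add: polar_inner_def blinfun.add_left blinfun.diff_left)
  have pol_sum: "((\<lambda>e. inner (blinfun_apply T e) (blinfun_apply S e)) has_sum (1/4) * s1 + (- 1/4) * s2) X"
    if "((\<lambda>e. (norm (blinfun_apply (T + S) e))\<^sup>2) has_sum s1) X" "((\<lambda>e. (norm (blinfun_apply (T - S) e))\<^sup>2) has_sum s2) X" for X
    unfolding pol by (intro has_sum_cmult_right has_sum_add that)
  have eq: "hs_inner T S = (1/4) * s1 + (- 1/4) * s2"
    unfolding hs_inner_def by (rule infsumI[OF pol_sum[OF s1 s2]])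
  show ?thesis
    unfolding eq by (rule pol_sum) (use s1 s2 has_sum_norm_sq_basis_change[OF A assms(1,2)] in blast)+
qed

lemma hs_inner_matrix_has_sum:
  fixes T S :: "'a::{real_inner,banach} \<Rightarrow>\<^sub>L 'b::{real_inner,banach}"
  assumes "onb (B :: 'a set)" "onb (C :: 'b set)" "hilbert_schmidt T" "hilbert_schmidt S"
  shows "((\<lambda>(b, c). inner (blinfun_apply T b) c * inner (blinfun_apply S b) c) has_sum hs_inner T S) (B \<times> C)"
  by (rule has_sum_SigmaI[OF _ hs_inner_product_has_sum[OF assms] hs_matrix_product_summable[OF assms]])
     (use onb_expansion[OF assms(2)] in simp)

section \<open>The Riesz isomorphism; operators from and into the dual\<close>

definition riesz_map :: "'a::{real_inner,banach} \<Rightarrow>\<^sub>L ('a \<Rightarrow>\<^sub>L real)" where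
  "riesz_map = Blinfun blinfun_inner_left"

lemma riesz_map_apply: "blinfun_apply riesz_map = blinfun_inner_left"
  unfolding riesz_map_def by (rule bounded_linear_Blinfun_apply[OF bounded_linear_blinfun_inner_left])

lemma norm_blinfun_inner_left: "norm (blinfun_inner_left x) = norm x"
proof (rule antisym)
  show "norm (blinfun_inner_left x) \<le> norm x"
    by (rule norm_blinfun_bound) (use Cauchy_Schwarz_ineq2 in \<open>auto simp: mult.commute\<close>)
  show "norm x \<le> norm (blinfun_inner_left x)"
  proof (cases "x = 0")
    case False
    have "norm x * norm x \<le> norm (blinfun_inner_left x) * norm x"
      using norm_blinfun[of "blinfun_inner_left x" x] by (simp add: power2_norm_eq_inner[symmetric] power2_eq_square)
    with False show ?thesis by simp
  qed simp
qed

lemma blinfun_inner_left_surj: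
  fixes f :: "'a::{real_inner,banach} \<Rightarrow>\<^sub>L real"
  shows "\<exists>z. f = blinfun_inner_left z"
proof -
  obtain z where "\<And>y. blinfun_apply f y = inner z y"
    using riesz_representation[OF blinfun.bounded_linear_right] by blast
  then have "f = blinfun_inner_left z" by (intro blinfun_eqI) (simp add: inner_commute)
  then show ?thesis by blast
qed

lemma blinfun_inner_left_linear: "linear blinfun_inner_left"
  by (rule bounded_linear.linear[OF bounded_linear_blinfun_inner_left])

lemma blinfun_inner_left_inj: "inj blinfun_inner_left"
proof (rule injI)
  fix x y :: 'a
  assume "blinfun_inner_left x = blinfun_inner_left y"
  then have "norm (blinfun_inner_left (x - y)) = 0" by (simp add: linear_diff[OF blinfun_inner_left_linear])
  then show "x = y" by (simp add: norm_blinfun_inner_left)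
qed

definition riesz_inv :: "('a::{real_inner,banach} \<Rightarrow>\<^sub>L real) \<Rightarrow>\<^sub>L 'a" where
  "riesz_inv = Blinfun (inv blinfun_inner_left)"

lemma riesz_inv_apply: "blinfun_apply riesz_inv = inv blinfun_inner_left"
proof -
  have lin: "inv blinfun_inner_left (f + g) = inv blinfun_inner_left f + inv blinfun_inner_left g"
    "inv blinfun_inner_left (c *\<^sub>R f) = c *\<^sub>R inv blinfun_inner_left f"
    "norm (inv blinfun_inner_left f) \<le> norm f * 1" for f g :: "'a \<Rightarrow>\<^sub>L real" and c
  proof -
    obtain x y where "f = blinfun_inner_left x" "g = blinfun_inner_left y" using blinfun_inner_left_surj by metis
    then show "inv blinfun_inner_left (f + g) = inv blinfun_inner_left f + inv blinfun_inner_left g"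
      "inv blinfun_inner_left (c *\<^sub>R f) = c *\<^sub>R inv blinfun_inner_left f"
      "norm (inv blinfun_inner_left f) \<le> norm f * 1"
      by (simp_all add: inv_f_f[OF blinfun_inner_left_inj] norm_blinfun_inner_left
          flip: linear_add[OF blinfun_inner_left_linear] linear_scale[OF blinfun_inner_left_linear])
  qed
  show ?thesis unfolding riesz_inv_def
    by (intro bounded_linear_Blinfun_apply bounded_linear_intro[where K = 1] lin)
qed

lemma riesz_inv_inner_left [simp]: "blinfun_apply riesz_inv (blinfun_inner_left x) = x"
  by (simp add: riesz_inv_apply inv_f_f[OF blinfun_inner_left_inj])

lemma inner_left_riesz_inv [simp]: "blinfun_inner_left (blinfun_apply riesz_inv f) = f"
  using blinfun_inner_left_surj[of f] by auto

lemma inner_riesz_inv [simp]: "inner (blinfun_apply riesz_inv f) v = blinfun_apply f v"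
  by (metis blinfun_inner_left.rep_eq inner_commute inner_left_riesz_inv)

lemma norm_riesz_inv [simp]: "norm (blinfun_apply riesz_inv f) = norm f"
  by (metis inner_left_riesz_inv norm_blinfun_inner_left)

lemma polar_inner_inner_left: "polar_inner (blinfun_inner_left x) (blinfun_inner_left y) = inner x y"
  unfolding polar_inner_eq_inner[symmetric] polar_inner_def
  by (simp add: norm_blinfun_inner_left flip: linear_add[OF blinfun_inner_left_linear] linear_diff[OF blinfun_inner_left_linear])

lemma closure_image_isometry:
  assumes "\<And>x. g (f x) = x" "\<And>y. f (g y) = y" "continuous_on UNIV f"  "closure S = UNIV"
  shows "closure (f ` S) = UNIV"
proof -
  have "f ` closure S \<subseteq> closure (f ` S)" using assms(3) 
    by (intro image_closure_subset) (auto intro: continuous_on_subset closure_subset[THEN subsetD])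
  moreover have "y \<in> f ` UNIV" for y using assms(2)[of y] by (metis rangeI)
  ultimately show ?thesis using assms(4) by auto
qed

text \<open>The Riesz map is a bijective isometry, so it preserves the polarized inner product and
  carries dense spans to dense spans in both directions.\<close>

lemma orthonormal_basis_dual_iff:
  fixes A :: "'a::{real_inner,banach} set"
  shows "orthonormal_basis (blinfun_inner_left ` A) \<longleftrightarrow> onb A"
proof -
  have "closure (span A) = UNIV" if "closure (span (blinfun_inner_left ` A)) = UNIV"
  proof -
    have "closure (blinfun_apply riesz_inv ` span (blinfun_inner_left ` A)) = UNIV"
      by (rule closure_image_isometry[where g = blinfun_inner_left]) (use that in \<open>auto intro: continuous_intros\<close>)
    then show ?thesis by (simp add: span_linear_image[OF blinfun_inner_left_linear] image_image)
  qed
  moreover have "closure (span (blinfun_inner_left ` A)) = UNIV" if "closure (span A) = UNIV"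
    unfolding span_linear_image[OF blinfun_inner_left_linear]
    by (rule closure_image_isometry[where g = "blinfun_apply riesz_inv"])
       (use that in \<open>auto intro: linear_continuous_on bounded_linear_blinfun_inner_left\<close>)
  ultimately show ?thesis
    unfolding orthonormal_basis_iff_onb[symmetric] orthonormal_basis_def
    by (auto simp: polar_inner_inner_left polar_inner_eq_inner inj_eq[OF blinfun_inner_left_inj])
qed

text \<open>The basis chosen in the dual is pulled back to a basis \<open>A\<close> of the space
  itself. Sums over it become sums over \<open>A\<close>, which may then be exchanged for any other
  basis.\<close>

lemma some_basis_dual:
  assumes "onb (B :: 'a::{real_inner,banach} set)"
  obtains A where "onb A" "(some_basis :: ('a \<Rightarrow>\<^sub>L real) set) = blinfun_inner_left ` A"
proof -
  have "orthonormal_basis (blinfun_inner_left ` B)" using assms by (simp add: orthonormal_basis_dual_iff)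
  then have o: "orthonormal_basis (some_basis :: ('a \<Rightarrow>\<^sub>L real) set)"
    unfolding some_basis_def by (rule someI)
  have "(some_basis :: ('a \<Rightarrow>\<^sub>L real) set) = blinfun_inner_left ` (blinfun_apply riesz_inv ` some_basis)"
    by (simp add: image_image)
  with o show ?thesis using that orthonormal_basis_dual_iff by metis
qed

lemma hilbert_schmidt_dual_domain:
  fixes T :: "('a::{real_inner,banach} \<Rightarrow>\<^sub>L real) \<Rightarrow>\<^sub>L 'b::{real_inner,banach}"
  assumes "onb (B :: 'a set)" "onb (C :: 'b set)"
  shows "hilbert_schmidt T \<longleftrightarrow> hilbert_schmidt (T o\<^sub>L riesz_map)"
proof -
  obtain A where A: "onb A" "(some_basis :: ('a \<Rightarrow>\<^sub>L real) set) = blinfun_inner_left ` A"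
    using some_basis_dual[OF assms(1)] .
  have "hilbert_schmidt T \<longleftrightarrow> (\<lambda>a. (norm (blinfun_apply (T o\<^sub>L riesz_map) a))\<^sup>2) summable_on A"
    unfolding hilbert_schmidt_def A(2)
    by (subst summable_on_reindex) (auto simp: o_def riesz_map_apply intro: inj_on_subset[OF blinfun_inner_left_inj])
  then show ?thesis by (simp add: hilbert_schmidt_iff_onb[OF A(1) assms(2)])
qed

lemma hs_inner_dual_domain:
  fixes T S :: "('a::{real_inner,banach} \<Rightarrow>\<^sub>L real) \<Rightarrow>\<^sub>L 'b::{real_inner,banach}"
  assumes "onb (B :: 'a set)" "onb (C :: 'b set)" "hilbert_schmidt T" "hilbert_schmidt S"
  shows "hs_inner T S = hs_inner (T o\<^sub>L riesz_map) (S o\<^sub>L riesz_map)"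
proof -
  obtain A where A: "onb A" "(some_basis :: ('a \<Rightarrow>\<^sub>L real) set) = blinfun_inner_left ` A"
    using some_basis_dual[OF assms(1)] .
  have "hs_inner T S = (\<Sum>\<^sub>\<infinity>a\<in>A. inner (blinfun_apply (T o\<^sub>L riesz_map) a) (blinfun_apply (S o\<^sub>L riesz_map) a))"
    unfolding hs_inner_def A(2)
    by (subst infsum_reindex) (auto simp: o_def riesz_map_apply intro: inj_on_subset[OF blinfun_inner_left_inj])
  also have "\<dots> = hs_inner (T o\<^sub>L riesz_map) (S o\<^sub>L riesz_map)"
    using assms by (intro infsumI hs_inner_product_has_sum[OF A(1) assms(2)]) (simp_all flip: hilbert_schmidt_dual_domain)
  finally show ?thesis .
qed

lemma hilbert_schmidt_dual_range:
  fixes T :: "'b::real_normed_vector \<Rightarrow>\<^sub>L ('a::{real_inner,banach} \<Rightarrow>\<^sub>L real)"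
  shows "hilbert_schmidt T \<longleftrightarrow> hilbert_schmidt (riesz_inv o\<^sub>L T)"
  by (simp add: hilbert_schmidt_def)

section \<open>Bochner spaces over subspaces of the sequence space\<close>

text \<open>Completeness makes changes on a null set harmless. Functions with values in
  \<open>X\<close> have them there only almost everywhere, and the coordinate map is linear only on
  \<open>X\<close>, so this is needed throughout.\<close>

lemma (in complete_measure) borel_measurable_AE_eq:
  assumes f: "f \<in> borel_measurable M" and eq: "AE x in M. f x = g x"
  shows "g \<in> borel_measurable M"
proof (rule measurableI)
  fix A :: "'b set" assume A: "A \<in> sets borel"
  obtain Z where Z: "Z \<in> null_sets M" "{x \<in> space M. f x \<noteq> g x} \<subseteq> Z"
    using eq by (auto elim!: AE_E simp: null_sets_def)
  have eq: "g -` A \<inter> space M = (f -` A \<inter> space M - Z) \<union> (g -` A \<inter> space M \<inter> Z)"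
    using Z(2) by auto
  have "g -` A \<inter> space M \<inter> Z \<in> sets M" by (rule complete[OF _ Z(1)]) auto
  moreover have "f -` A \<inter> space M \<in> sets M" using f A by (rule measurable_sets)
  ultimately have "(f -` A \<inter> space M - Z) \<union> (g -` A \<inter> space M \<inter> Z) \<in> sets M"
    using null_setsD2[OF Z(1)] by (intro sets.Un sets.Diff)
  then show "g -` A \<inter> space M \<in> sets M" by (subst eq)
qed auto

lemma complete_measure_lebesgue_on:
  assumes "S \<in> sets lebesgue"
  shows "complete_measure (lebesgue_on S)"
proof
  fix A B :: "'a set"
  assume "B \<subseteq> A" "A \<in> null_sets (lebesgue_on S)"
  then have "A \<in> null_sets lebesgue" "A \<subseteq> S"
    using assms by (auto simp: null_sets_restrict_space)
  then show "B \<in> sets (lebesgue_on S)"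
    using \<open>B \<subseteq> A\<close> assms completion.complete[of B A lborel] by (auto simp: sets_restrict_space_iff)
qed

lemma integrable_norm_sq_add:
  fixes u v :: "'a \<Rightarrow> 'b::{real_inner,banach,second_countable_topology}"
  assumes [measurable]: "u \<in> borel_measurable M" "v \<in> borel_measurable M"
    and i: "integrable M (\<lambda>t. (norm (u t))\<^sup>2)" "integrable M (\<lambda>t. (norm (v t))\<^sup>2)"
  shows "integrable M (\<lambda>t. (norm (u t + v t))\<^sup>2)"
proof (rule Bochner_Integration.integrable_bound)
  show "integrable M (\<lambda>t. 2 * (norm (u t))\<^sup>2 + 2 * (norm (v t))\<^sup>2)" using i by simp
  have "(norm (a + b))\<^sup>2 \<le> 2 * (norm a)\<^sup>2 + 2 * (norm b)\<^sup>2" for a b :: 'b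
    using zero_le_power2[of "norm (a - b)"]
    by (simp add: power2_norm_eq_inner inner_add_left inner_add_right inner_diff_left inner_diff_right inner_commute)
  then show "AE t in M. norm ((norm (u t + v t))\<^sup>2) \<le> norm (2 * (norm (u t))\<^sup>2 + 2 * (norm (v t))\<^sup>2)"
    by simp
qed measurable

lemma abs_inner_le_sum_squares: "\<bar>inner a b\<bar> \<le> (norm a)\<^sup>2 + (norm b)\<^sup>2"
proof -
  have "2 * (norm a * norm b) \<le> (norm a)\<^sup>2 + (norm b)\<^sup>2"
    using sum_squares_bound[of "norm a" "norm b"] by simp
  moreover have "0 \<le> norm a * norm b" by simp
  ultimately show ?thesis using Cauchy_Schwarz_ineq2[of a b] by linarith
qed

lemma integrable_inner_of_norm_sq:
  fixes u v :: "'a \<Rightarrow> 'b::{real_inner,banach,second_countable_topology}"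
  assumes [measurable]: "u \<in> borel_measurable M" "v \<in> borel_measurable M"
    and i: "integrable M (\<lambda>t. (norm (u t))\<^sup>2)" "integrable M (\<lambda>t. (norm (v t))\<^sup>2)"
  shows "integrable M (\<lambda>t. inner (u t) (v t))"
proof (rule Bochner_Integration.integrable_bound)
  show "integrable M (\<lambda>t. (norm (u t))\<^sup>2 + (norm (v t))\<^sup>2)" using i by simp
qed (use abs_inner_le_sum_squares in auto)

text \<open>Riesz--Fischer: a subsequence with geometrically small steps converges almost everywhere,
  and Fatou's lemma identifies its limit as the mean-square limit of the whole sequence.\<close>

lemma L2_complete:
  fixes u :: "nat \<Rightarrow> 'a \<Rightarrow> 'b::{real_inner,banach,second_countable_topology}"
  assumes [measurable]: "\<And>n. u n \<in> borel_measurable M"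
    and i: "\<And>n. integrable M (\<lambda>t. (norm (u n t))\<^sup>2)"
    and C: "\<And>e. e > 0 \<Longrightarrow> \<exists>N. \<forall>m\<ge>N. \<forall>n\<ge>N. (\<integral>t. (norm (u m t - u n t))\<^sup>2 \<partial>M) < e"
  obtains F where "F \<in> borel_measurable M" "integrable M (\<lambda>t. (norm (F t))\<^sup>2)"
    "(\<lambda>n. \<integral>t. (norm (u n t - F t))\<^sup>2 \<partial>M) \<longlonglongrightarrow> 0"
proof -
  have idiff: "integrable M (\<lambda>t. (norm (u m t - u n t))\<^sup>2)" for m n
    using integrable_norm_sq_add[of "u m" M "\<lambda>t. - u n t"] i by simp
  \<comment> \<open>The rate 1/4 leaves room for the factor \<open>2 ^ k\<close> below: the weighted
    integrals are still at most \<open>(1/2) ^ k\<close>.\<close>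
  have "\<exists>N. \<forall>m\<ge>N. \<forall>n\<ge>N. (\<integral>t. (norm (u m t - u n t))\<^sup>2 \<partial>M) < (1/4) ^ k" for k by (rule C) simp
  then obtain N where N: "\<And>k m n. m \<ge> N k \<Longrightarrow> n \<ge> N k \<Longrightarrow> (\<integral>t. (norm (u m t - u n t))\<^sup>2 \<partial>M) < (1/4) ^ k"
    by metis
  \<comment> \<open>The maximum makes \<open>r\<close> strictly increasing and keeps it above
    \<open>N\<close>.\<close>
  define r where "r = rec_nat (N 0) (\<lambda>k x. max (N (Suc k)) (Suc x))"
  have rN: "r k \<ge> N k" for k by (cases k) (auto simp: r_def)
  have r: "strict_mono r" by (rule strict_mono_Suc_iff[THEN iffD2]) (simp add: r_def less_max_iff_disj)
  define h where "h k t = norm (u (r (Suc k)) t - u (r k) t)" for k t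
  have [measurable]: "h k \<in> borel_measurable M" for k unfolding h_def by measurable
  have hi: "integrable M (\<lambda>t. (h k t)\<^sup>2)" for k unfolding h_def by (rule idiff)
  have hle: "(\<integral>t. (h k t)\<^sup>2 \<partial>M) \<le> (1/4) ^ k" for k
    unfolding h_def using rN[of k] strict_mono_less_eq[OF r, of k "Suc k"]
    by (intro N[THEN less_imp_le]) auto
  have "(\<integral>\<^sup>+t. (\<Sum>k. ennreal (2 ^ k * (h k t)\<^sup>2)) \<partial>M) = (\<Sum>k. \<integral>\<^sup>+t. ennreal (2 ^ k * (h k t)\<^sup>2) \<partial>M)"
    by (rule nn_integral_suminf) simp
  also have "\<dots> = (\<Sum>k. ennreal (2 ^ k * (\<integral>t. (h k t)\<^sup>2 \<partial>M)))"
    using hi by (subst nn_integral_eq_integral) auto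
  also have "\<dots> \<le> (\<Sum>k. ennreal ((1/2) ^ k))"
  proof (intro suminf_le ennreal_leI)
    fix k :: nat
    have "2 ^ k * (\<integral>t. (h k t)\<^sup>2 \<partial>M) \<le> 2 ^ k * (1/4) ^ k" using hle by (intro mult_left_mono) auto
    also have "\<dots> = (1/2) ^ k" by (simp flip: power_mult_distrib)
    finally show "2 ^ k * (\<integral>t. (h k t)\<^sup>2 \<partial>M) \<le> (1/2) ^ k" .
  qed auto
  also have "\<dots> < \<infinity>"
    unfolding infinity_ennreal_def less_top[symmetric] by (rule ennreal_suminf_neq_top) (auto simp: summable_geometric)
  finally have "AE t in M. (\<Sum>k. ennreal (2 ^ k * (h k t)\<^sup>2)) \<noteq> \<infinity>"
    by (intro nn_integral_noteq_infinite) auto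
  then have AEconv: "AE t in M. convergent (\<lambda>k. u (r k) t)"
  proof eventually_elim
    case (elim t)
    then have s1: "summable (\<lambda>k. 2 ^ k * (h k t)\<^sup>2)" by (intro summable_suminf_not_top) auto
    have "summable (\<lambda>k. h k t)"
    proof (rule summable_comparison_test')
      show "summable (\<lambda>k. 2 ^ k * (h k t)\<^sup>2 + (1/2) ^ k)" by (intro summable_add s1 summable_geometric) simp
      fix k
      \<comment> \<open>The arithmetic-geometric inequality with weight \<open>2 ^ k\<close>: it
        passes from summability of the weighted squares to summability of the steps
        \<open>h k t\<close>.\<close>
      have "0 \<le> 2 ^ k * (h k t - (1/2) ^ k)\<^sup>2" by simp
      also have "\<dots> = 2 ^ k * (h k t)\<^sup>2 - 2 * h k t * (2 ^ k * (1/2) ^ k) + (2 ^ k * (1/2) ^ k) * (1/2) ^ k"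
        by (simp add: power2_eq_square algebra_simps)
      also have "(2::real) ^ k * (1/2) ^ k = 1" by (simp flip: power_mult_distrib)
      finally have "2 * h k t \<le> 2 ^ k * (h k t)\<^sup>2 + (1/2) ^ k" by simp
      moreover have "h k t \<ge> 0" by (simp add: h_def)
      ultimately show "norm (h k t) \<le> 2 ^ k * (h k t)\<^sup>2 + (1/2) ^ k" by simp
    qed
    then have "summable (\<lambda>k. u (r (Suc k)) t - u (r k) t)"
      unfolding h_def by (rule summable_norm_cancel)
    then have "convergent (\<lambda>n. u (r 0) t + (\<Sum>k<n. u (r (Suc k)) t - u (r k) t))"
      by (intro convergent_add convergent_const) (simp add: summable_iff_convergent)
    then show ?case by (simp add: sum_lessThan_telescope[of "\<lambda>k. u (r k) t"])
  qed
  define F where "F t = lim (\<lambda>k. u (r k) t)" for t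
  have Fm [measurable]: "F \<in> borel_measurable M" unfolding F_def by measurable
  have lim: "AE t in M. (\<lambda>k. u (r k) t) \<longlonglongrightarrow> F t"
    using AEconv by eventually_elim (simp add: F_def convergent_LIMSEQ_iff)
  \<comment> \<open>Fatou is applied along the subsequence with \<open>n\<close> fixed. As
    \<open>r k\<close> eventually exceeds \<open>n\<close>, a bound for the full sequence carries
    over to the limit, and integrability comes with it.\<close>
  have fatou: "integrable M (\<lambda>t. (norm (u n t - F t))\<^sup>2) \<and> (\<integral>t. (norm (u n t - F t))\<^sup>2 \<partial>M) \<le> e"
    if e: "\<And>m. m \<ge> n \<Longrightarrow> (\<integral>t. (norm (u n t - u m t))\<^sup>2 \<partial>M) \<le> e" for n e
  proof -
    have e0: "0 \<le> e" using e[of n] by simp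
    have "(\<integral>\<^sup>+t. ennreal ((norm (u n t - F t))\<^sup>2) \<partial>M)
        = (\<integral>\<^sup>+t. liminf (\<lambda>k. ennreal ((norm (u n t - u (r k) t))\<^sup>2)) \<partial>M)"
    proof (rule nn_integral_cong_AE)
      show "AE t in M. ennreal ((norm (u n t - F t))\<^sup>2) = liminf (\<lambda>k. ennreal ((norm (u n t - u (r k) t))\<^sup>2))"
        using lim
      proof eventually_elim
        case (elim t)
        have "(\<lambda>k. ennreal ((norm (u n t - u (r k) t))\<^sup>2)) \<longlonglongrightarrow> ennreal ((norm (u n t - F t))\<^sup>2)"
          by (intro tendsto_intros tendsto_ennrealI elim)
        then show ?case by (intro lim_imp_Liminf[symmetric]) auto
      qed
    qed
    also have "\<dots> \<le> liminf (\<lambda>k. \<integral>\<^sup>+t. ennreal ((norm (u n t - u (r k) t))\<^sup>2) \<partial>M)"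
      by (rule nn_integral_liminf) simp
    also have "\<dots> \<le> ennreal e"
    proof (rule Liminf_le)
      show "\<forall>\<^sub>F k in sequentially. (\<integral>\<^sup>+t. ennreal ((norm (u n t - u (r k) t))\<^sup>2) \<partial>M) \<le> ennreal e"
        using eventually_ge_at_top[of n]
      proof eventually_elim
        case (elim k)
        then have "r k \<ge> n" using seq_suble[OF r, of k] by linarith
        then show ?case using e by (subst nn_integral_eq_integral[OF idiff]) (auto intro: ennreal_leI)
      qed
    qed simp
    finally have le: "(\<integral>\<^sup>+t. ennreal ((norm (u n t - F t))\<^sup>2) \<partial>M) \<le> ennreal e" .
    then have "integrable M (\<lambda>t. (norm (u n t - F t))\<^sup>2)"
      by (intro integrableI_bounded) (auto intro: le_less_trans)
    with le e0 show ?thesis by (simp add: nn_integral_eq_integral)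
  qed
  have "\<exists>N. \<forall>n\<ge>N. (\<integral>t. (norm (u n t - F t))\<^sup>2 \<partial>M) \<le> e \<and> integrable M (\<lambda>t. (norm (u n t - F t))\<^sup>2)" if "e > 0" for e
  proof -
    obtain N where "\<forall>m\<ge>N. \<forall>n\<ge>N. (\<integral>t. (norm (u m t - u n t))\<^sup>2 \<partial>M) < e" using C[OF \<open>e > 0\<close>] by blast
    then show ?thesis using fatou[of _ e] by (intro exI[of _ N]) (meson less_imp_le order_trans)
  qed
  note * = this
  obtain n where n: "integrable M (\<lambda>t. (norm (u n t - F t))\<^sup>2)" using *[of 1] by auto
  have "integrable M (\<lambda>t. (norm (u n t + - (u n t - F t)))\<^sup>2)"
    by (rule integrable_norm_sq_add) (use n i in \<open>auto simp: norm_minus_commute\<close>)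
  then have "integrable M (\<lambda>t. (norm (F t))\<^sup>2)" by simp
  moreover have "(\<lambda>n. \<integral>t. (norm (u n t - F t))\<^sup>2 \<partial>M) \<longlonglongrightarrow> 0"
  proof (rule LIMSEQ_I)
    fix e :: real assume "e > 0"
    then obtain N where N: "\<forall>n\<ge>N. (\<integral>t. (norm (u n t - F t))\<^sup>2 \<partial>M) \<le> e / 2" using *[of "e/2"] by auto
    show "\<exists>N. \<forall>n\<ge>N. norm ((\<integral>t. (norm (u n t - F t))\<^sup>2 \<partial>M) - 0) < e"
      using N \<open>e > 0\<close> by (intro exI[of _ N]) (force simp: integral_nonneg_AE)
  qed
  ultimately show ?thesis using that Fm by blast
qed

lemma tendsto_norm_diff_iff:
  fixes f :: "'a \<Rightarrow> 'b::real_normed_vector"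
  shows "((\<lambda>x. norm (l - f x)) \<longlongrightarrow> 0) F \<longleftrightarrow> (f \<longlongrightarrow> l) F"
  unfolding tendsto_dist_iff[of f] by (simp add: dist_norm norm_minus_commute)

text \<open>The coordinate map \<open>J\<close> embeds \<open>(X, N)\<close> isometrically, so the notions for \<open>f\<close> with values in \<open>X\<close>
  become those of the library for \<open>J \<circ> f\<close>. The left inverse \<open>E\<close> is defined on the whole sequence
  space, which makes \<open>J \<circ> E\<close> a projection onto the (hence closed) image of \<open>J\<close>.\<close>

locale hilbert_carrier =
  fixes X :: "'b::real_vector set" and N :: "'b \<Rightarrow> real" and J :: "'b \<Rightarrow> ell2" and E :: "ell2 \<Rightarrow> 'b"
  assumes subspace: "subspace X"
    and J_add: "\<lbrakk>x \<in> X; y \<in> X\<rbrakk> \<Longrightarrow> J (x + y) = J x + J y"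
    and J_scale: "x \<in> X \<Longrightarrow> J (c *\<^sub>R x) = c *\<^sub>R J x"
    and E_mem: "E u \<in> X"
    and E_add: "E (u + v) = E u + E v"
    and E_scale: "E (c *\<^sub>R u) = c *\<^sub>R E u"
    and E_J: "x \<in> X \<Longrightarrow> E (J x) = x"
    and N_eq: "x \<in> X \<Longrightarrow> N x = norm (J x)"
    and J_E_le: "norm (J (E u)) \<le> norm u"
begin

lemma X_add: "\<lbrakk>x \<in> X; y \<in> X\<rbrakk> \<Longrightarrow> x + y \<in> X" by (rule subspace_add[OF subspace])
lemma X_scale: "x \<in> X \<Longrightarrow> c *\<^sub>R x \<in> X" by (rule subspace_scale[OF subspace])
lemma X_diff: "\<lbrakk>x \<in> X; y \<in> X\<rbrakk> \<Longrightarrow> x - y \<in> X" by (rule subspace_diff[OF subspace])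
lemma X_0: "0 \<in> X" by (rule subspace_0[OF subspace])
lemma X_sum: "(\<And>i. i \<in> I \<Longrightarrow> f i \<in> X) \<Longrightarrow> sum f I \<in> X" by (rule subspace_sum[OF subspace])

lemma J_0: "J 0 = 0" using J_scale[OF X_0, of 0] by simp

lemma J_diff: "\<lbrakk>x \<in> X; y \<in> X\<rbrakk> \<Longrightarrow> J (x - y) = J x - J y"
  using J_add[of "x - y" y] X_diff by (simp add: algebra_simps)

lemma J_sum: "(\<And>i. i \<in> I \<Longrightarrow> f i \<in> X) \<Longrightarrow> J (sum f I) = (\<Sum>i\<in>I. J (f i))"
  by (induction I rule: infinite_finite_induct) (auto simp: J_0 J_add X_sum)

lemma E_linear: "linear E" by (rule linearI) (auto simp: E_add E_scale)

lemma J_inj: "\<lbrakk>x \<in> X; y \<in> X; J x = J y\<rbrakk> \<Longrightarrow> x = y" using E_J by metis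

lemma bounded_linear_J_E: "bounded_linear (\<lambda>u. J (E u))"
  by (rule bounded_linear_intro[where K = 1]) (auto simp: E_add E_scale J_add J_scale E_mem J_E_le)

end

locale hilbert_carrier_measure = hilbert_carrier X N J E + complete_measure M
  for X :: "'b::real_vector set" and N J E and M :: "real measure"
begin

text \<open>Simple functions are transported by \<open>J\<close> in one direction and by
  \<open>E\<close> in the other. The second works because \<open>J (E u)\<close> is at most as long
  as \<open>u\<close>, so \<open>E (s n t)\<close> is at least as close to \<open>f t\<close> as
  \<open>s n t\<close> is to its coordinates.\<close>

lemma bochner_measurable_iff:
  "bochner_measurable X N M f \<longleftrightarrow> (AE t in M. f t \<in> X) \<and> (\<lambda>t. J (f t)) \<in> borel_measurable M"
proof (intro iffI conjI)
  assume f: "bochner_measurable X N M f"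
  then show AE: "AE t in M. f t \<in> X" by (simp add: bochner_measurable_def)
  obtain s where s: "\<And>n. simple_function M (s n)" "\<And>n. s n ` space M \<subseteq> X"
    "AE t in M. (\<lambda>n. N (f t - s n t)) \<longlonglongrightarrow> 0"
    using f unfolding bochner_measurable_def by blast
  have m: "(\<lambda>t. J (s n t)) \<in> borel_measurable M" for n
    by (rule borel_measurable_simple_function[OF simple_function_compose1[OF s(1), where g = J]])
  have "(\<lambda>t. lim (\<lambda>n. J (s n t))) \<in> borel_measurable M" using m by measurable
  moreover have "AE t in M. lim (\<lambda>n. J (s n t)) = J (f t)"
    using AE s(3) AE_space
  proof eventually_elim
    case (elim t)
    then have "(\<lambda>n. norm (J (f t) - J (s n t))) \<longlonglongrightarrow> 0"
      using s(2) by (simp add: N_eq J_diff X_diff image_subset_iff)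
    then have "(\<lambda>n. J (s n t)) \<longlonglongrightarrow> J (f t)"
      by (simp only: tendsto_norm_diff_iff)
    then show ?case by (rule limI)
  qed
  ultimately show "(\<lambda>t. J (f t)) \<in> borel_measurable M" by (rule borel_measurable_AE_eq)
next
  assume f: "(AE t in M. f t \<in> X) \<and> (\<lambda>t. J (f t)) \<in> borel_measurable M"
  then obtain s where s: "\<And>n. simple_function M (s n)" "\<And>t. t \<in> space M \<Longrightarrow> (\<lambda>n. s n t) \<longlonglongrightarrow> J (f t)"
    using borel_measurable_implies_sequence_metric[of "\<lambda>t. J (f t)" M 0] by blast
  have "AE t in M. (\<lambda>n. N (f t - E (s n t))) \<longlonglongrightarrow> 0"
    using conjunct1[OF f] AE_space
  proof eventually_elim
    case (elim t)
    have le: "norm (N (f t - E (s n t))) \<le> norm (J (f t) - s n t)" for n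
      using J_E_le[of "J (f t) - s n t"] elim(1)
      by (simp add: N_eq X_diff E_mem linear_diff[OF E_linear] E_J)
    have lim: "(\<lambda>n. norm (J (f t) - s n t)) \<longlonglongrightarrow> 0"
      using s(2)[OF elim(2)] by (simp only: tendsto_norm_diff_iff)
    show ?case by (rule Lim_null_comparison[OF always_eventually lim]) (use le in blast)
  qed
  moreover have "simple_function M (\<lambda>t. E (s n t))" for n
    by (rule simple_function_compose1[OF s(1), where g = E])
  ultimately show "bochner_measurable X N M f"
    unfolding bochner_measurable_def using f E_mem by (intro conjI exI[of _ "\<lambda>n t. E (s n t)"]) auto
qed

lemma integrable_N_iff:
  assumes "AE t in M. f t \<in> X" "(\<lambda>t. J (f t)) \<in> borel_measurable M"
  shows "integrable M (\<lambda>t. N (f t) ^ p) \<longleftrightarrow> integrable M (\<lambda>t. norm (J (f t)) ^ p)"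
proof (rule integrable_cong_AE)
  have AE: "AE t in M. norm (J (f t)) ^ p = N (f t) ^ p"
    using assms(1) by eventually_elim (simp add: N_eq)
  then show "AE t in M. N (f t) ^ p = norm (J (f t)) ^ p" by eventually_elim simp
  show m: "(\<lambda>t. norm (J (f t)) ^ p) \<in> borel_measurable M" using assms(2) by measurable
  show "(\<lambda>t. N (f t) ^ p) \<in> borel_measurable M" by (rule borel_measurable_AE_eq[OF m AE])
qed

lemma bochner_Lp_iff:
  "f \<in> bochner_Lp p X N M \<longleftrightarrow> (AE t in M. f t \<in> X) \<and> (\<lambda>t. J (f t)) \<in> borel_measurable M
     \<and> integrable M (\<lambda>t. norm (J (f t)) ^ p)"
  unfolding bochner_Lp_def mem_Collect_eq bochner_measurable_iff using integrable_N_iff[of f p] by blast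

lemma bochner_Linf_iff:
  "f \<in> bochner_Linf X N M \<longleftrightarrow> (AE t in M. f t \<in> X) \<and> (\<lambda>t. J (f t)) \<in> borel_measurable M
     \<and> (\<exists>c. AE t in M. norm (J (f t)) \<le> c)"
proof -
  have "(AE t in M. N (f t) \<le> c) \<longleftrightarrow> (AE t in M. norm (J (f t)) \<le> c)" if X: "AE t in M. f t \<in> X" for c
  proof
    show "AE t in M. norm (J (f t)) \<le> c" if "AE t in M. N (f t) \<le> c"
      using X that by eventually_elim (simp add: N_eq)
    show "AE t in M. N (f t) \<le> c" if "AE t in M. norm (J (f t)) \<le> c"
      using X that by eventually_elim (simp add: N_eq)
  qed
  then show ?thesis unfolding bochner_Linf_def mem_Collect_eq bochner_measurable_iff by blast
qed

lemma integral_N_eq: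
  assumes "f \<in> bochner_Lp p X N M"
  shows "(\<integral>t. N (f t) ^ p \<partial>M) = (\<integral>t. norm (J (f t)) ^ p \<partial>M)"
proof (rule integral_cong_AE)
  have f: "AE t in M. f t \<in> X" "(\<lambda>t. J (f t)) \<in> borel_measurable M" using assms by (auto simp: bochner_Lp_iff)
  have AE: "AE t in M. norm (J (f t)) ^ p = N (f t) ^ p"
    using f(1) by eventually_elim (simp add: N_eq)
  then show "AE t in M. N (f t) ^ p = norm (J (f t)) ^ p" by eventually_elim simp
  show m: "(\<lambda>t. norm (J (f t)) ^ p) \<in> borel_measurable M" using f(2) by measurable
  show "(\<lambda>t. N (f t) ^ p) \<in> borel_measurable M" by (rule borel_measurable_AE_eq[OF m AE])
qed

text \<open>\<open>J\<close> commutes with the integral of simple functions, so the approximation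
  for \<open>f\<close> is one for the coordinates of \<open>f\<close>. Together with the existence
  below this makes the definite description in \<open>bochner_int\<close> meaningful.\<close>

lemma has_bochner_int_imp_eq:
  assumes AE: "AE t in M. f t \<in> X" and i: "integrable M (\<lambda>t. J (f t))"
    and f: "has_bochner_int X N M f I"
  shows "I = E (\<integral>t. J (f t) \<partial>M)"
proof -
  obtain s where s: "\<And>n. Bochner_Integration.simple_bochner_integrable M (s n)" "\<And>n. s n ` space M \<subseteq> X"
    "(\<lambda>n. \<integral>\<^sup>+t. ennreal (N (f t - s n t)) \<partial>M) \<longlonglongrightarrow> 0"
    "(\<lambda>n. N (Bochner_Integration.simple_bochner_integral M (s n) - I)) \<longlonglongrightarrow> 0" and I: "I \<in> X"
    using f unfolding has_bochner_int_def by blast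
  have sf: "simple_function M (s n)" for n using s(1)[of n] by (simp add: Bochner_Integration.simple_bochner_integrable.simps)
  have sX: "Bochner_Integration.simple_bochner_integral M (s n) \<in> X" for n
    unfolding Bochner_Integration.simple_bochner_integral_def using s(2)[of n] by (intro X_sum X_scale) auto
  have sJ: "Bochner_Integration.simple_bochner_integrable M (\<lambda>t. J (s n t))" for n
    using Bochner_Integration.simple_bochner_integrable_compose2[where p = "\<lambda>x y. J x", OF _ s(1)[of n] s(1)[of n]] J_0 by simp
  have int: "Bochner_Integration.simple_bochner_integral M (\<lambda>t. J (s n t))
      = J (Bochner_Integration.simple_bochner_integral M (s n))" for n
  proof -
    have "Bochner_Integration.simple_bochner_integral M (\<lambda>t. J (s n t))
      = (\<Sum>y\<in>s n ` space M. measure M {x\<in>space M. s n x = y} *\<^sub>R J y)"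
      by (rule Bochner_Integration.simple_bochner_integral_partition[OF sJ sf]) auto
    also have "\<dots> = J (\<Sum>y\<in>s n ` space M. measure M {x\<in>space M. s n x = y} *\<^sub>R y)"
      using s(2)[of n] by (subst J_sum) (auto intro!: X_scale sum.cong simp: J_scale)
    finally show ?thesis unfolding Bochner_Integration.simple_bochner_integral_def .
  qed
  have "has_bochner_integral M (\<lambda>t. J (f t)) (J I)"
  proof (rule has_bochner_integral.intros[where s = "\<lambda>n t. J (s n t)"])
    show "(\<lambda>t. J (f t)) \<in> borel_measurable M" using i by measurable
    show "(\<lambda>n. \<integral>\<^sup>+t. ennreal (norm (J (f t) - J (s n t))) \<partial>M) \<longlonglongrightarrow> 0"
    proof (rule tendsto_cong[THEN iffD1, OF _ s(3)], rule always_eventually, rule allI, rule nn_integral_cong_AE)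
      show "AE t in M. ennreal (N (f t - s n t)) = ennreal (norm (J (f t) - J (s n t)))" for n
        using AE AE_space by eventually_elim (use s(2)[of n] in \<open>simp add: N_eq J_diff X_diff image_subset_iff\<close>)
    qed
    have "(\<lambda>n. norm (J (Bochner_Integration.simple_bochner_integral M (s n)) - J I)) \<longlonglongrightarrow> 0"
      using s(4) sX I by (simp add: N_eq J_diff X_diff)
    then show "(\<lambda>n. Bochner_Integration.simple_bochner_integral M (\<lambda>t. J (s n t))) \<longlonglongrightarrow> J I"
      unfolding int by (simp add: tendsto_norm_zero_iff LIM_zero_iff)
  qed (rule sJ)
  then show "I = E (\<integral>t. J (f t) \<partial>M)" using I by (simp add: has_bochner_integral_integral_eq E_J)
qed

text \<open>The library's approximating simple functions are pulled back by the contraction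
  \<open>E\<close>; their integrals commute with \<open>E\<close> by linearity.\<close>

lemma has_bochner_intI:
  assumes AE: "AE t in M. f t \<in> X" and i: "integrable M (\<lambda>t. J (f t))"
    and I: "I = E (\<integral>t. J (f t) \<partial>M)"
  shows "has_bochner_int X N M f I"
proof -
  obtain s where s: "\<And>n. Bochner_Integration.simple_bochner_integrable M (s n)"
    "(\<lambda>n. \<integral>\<^sup>+t. ennreal (norm (J (f t) - s n t)) \<partial>M) \<longlonglongrightarrow> 0"
    "(\<lambda>n. Bochner_Integration.simple_bochner_integral M (s n)) \<longlonglongrightarrow> (\<integral>t. J (f t) \<partial>M)"
    using has_bochner_integral_integrable[OF i] by (auto elim!: has_bochner_integral.cases)
  show ?thesis
    unfolding has_bochner_int_def bochner_measurable_iff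
  proof (intro conjI exI[of _ "\<lambda>n t. E (s n t)"] allI)
    show "AE t in M. f t \<in> X" by (rule AE)
    show "(\<lambda>t. J (f t)) \<in> borel_measurable M" using i by measurable
    show "I \<in> X" by (simp add: I E_mem)
    have E0: "E 0 = 0" by (rule linear_0[OF E_linear])
    show "Bochner_Integration.simple_bochner_integrable M (\<lambda>t. E (s n t))" for n
      using Bochner_Integration.simple_bochner_integrable_compose2[where p = "\<lambda>x y. E x", OF _ s(1)[of n] s(1)[of n]] E0 by simp
    show "(\<lambda>t. E (s n t)) ` space M \<subseteq> X" for n using E_mem by auto
    show "(\<lambda>n. \<integral>\<^sup>+t. ennreal (N (f t - E (s n t))) \<partial>M) \<longlonglongrightarrow> 0"
    proof (rule tendsto_sandwich[OF _ _ tendsto_const s(2)])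
      show "\<forall>\<^sub>F n in sequentially. (\<integral>\<^sup>+t. ennreal (N (f t - E (s n t))) \<partial>M)
          \<le> (\<integral>\<^sup>+t. ennreal (norm (J (f t) - s n t)) \<partial>M)"
      proof (rule always_eventually, rule allI, rule nn_integral_mono_AE)
        show "AE t in M. ennreal (N (f t - E (s n t))) \<le> ennreal (norm (J (f t) - s n t))" for n
          using AE
        proof eventually_elim
          case (elim t)
          then show ?case using J_E_le[of "J (f t) - s n t"]
            by (simp add: N_eq X_diff E_mem linear_diff[OF E_linear] E_J ennreal_leI)
        qed
      qed
    qed auto
    have lim: "(\<lambda>n. norm (Bochner_Integration.simple_bochner_integral M (s n) - (\<integral>t. J (f t) \<partial>M))) \<longlonglongrightarrow> 0"
      using s(3) by (simp add: tendsto_norm_zero_iff LIM_zero_iff)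
    have le: "norm (N (Bochner_Integration.simple_bochner_integral M (\<lambda>t. E (s n t)) - I))
        \<le> norm (Bochner_Integration.simple_bochner_integral M (s n) - (\<integral>t. J (f t) \<partial>M))" for n
      using J_E_le[of "Bochner_Integration.simple_bochner_integral M (s n) - (\<integral>t. J (f t) \<partial>M)"]
      by (simp add: I Bochner_Integration.simple_bochner_integral_linear[OF E_linear s(1)] N_eq E_mem
          flip: linear_diff[OF E_linear])
    show "(\<lambda>n. N (Bochner_Integration.simple_bochner_integral M (\<lambda>t. E (s n t)) - I)) \<longlonglongrightarrow> 0"
      by (rule Lim_null_comparison[OF always_eventually lim]) (use le in blast)
  qed
qed

text \<open>The integral cannot leave the image of \<open>J\<close>: the bounded projection onto
  that image commutes with integration and fixes the integrand almost everywhere.\<close>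

lemma J_integral_mem:
  assumes AE: "AE t in M. f t \<in> X" and i: "integrable M (\<lambda>t. J (f t))"
  shows "J (E (\<integral>t. J (f t) \<partial>M)) = (\<integral>t. J (f t) \<partial>M)"
proof -
  have "J (E (\<integral>t. J (f t) \<partial>M)) = (\<integral>t. J (E (J (f t))) \<partial>M)"
    using integral_bounded_linear[OF bounded_linear_J_E i] by simp
  also have "\<dots> = (\<integral>t. J (f t) \<partial>M)"
  proof (rule integral_cong_AE)
    show "(\<lambda>t. J (E (J (f t)))) \<in> borel_measurable M"
      by (rule borel_measurable_integrable[OF integrable_bounded_linear[OF bounded_linear_J_E i]])
    show "AE t in M. J (E (J (f t))) = J (f t)" using AE by eventually_elim (simp add: E_J)
  qed (use i in measurable)
  finally show ?thesis .
qed

lemma bochner_int_eq: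
  assumes "AE t in M. f t \<in> X" "integrable M (\<lambda>t. J (f t))"
  shows "bochner_int X N M f = E (\<integral>t. J (f t) \<partial>M)" "bochner_int X N M f \<in> X"
    "J (bochner_int X N M f) = (\<integral>t. J (f t) \<partial>M)"
proof -
  show 1: "bochner_int X N M f = E (\<integral>t. J (f t) \<partial>M)"
    unfolding bochner_int_def
    using has_bochner_intI[OF assms refl] has_bochner_int_imp_eq[OF assms] by (rule the_equality)
  show "bochner_int X N M f \<in> X" "J (bochner_int X N M f) = (\<integral>t. J (f t) \<partial>M)"
    by (simp_all add: 1 E_mem J_integral_mem[OF assms])
qed

lemma bochner_Lp_add:
  assumes f: "f \<in> bochner_Lp 2 X N M" and g: "g \<in> bochner_Lp 2 X N M"
  shows "(\<lambda>t. f t + g t) \<in> bochner_Lp 2 X N M" and "AE t in M. J (f t + g t) = J (f t) + J (g t)"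
proof -
  have fX: "AE t in M. f t \<in> X" and gX: "AE t in M. g t \<in> X"
    and [measurable]: "(\<lambda>t. J (f t)) \<in> borel_measurable M" "(\<lambda>t. J (g t)) \<in> borel_measurable M"
    and fi: "integrable M (\<lambda>t. norm (J (f t)) ^ 2)" and gi: "integrable M (\<lambda>t. norm (J (g t)) ^ 2)"
    using f g by (auto simp: bochner_Lp_iff)
  show AE: "AE t in M. J (f t + g t) = J (f t) + J (g t)" using fX gX by eventually_elim (rule J_add)
  then have AE': "AE t in M. J (f t) + J (g t) = J (f t + g t)" by eventually_elim simp
  have m: "(\<lambda>t. J (f t + g t)) \<in> borel_measurable M" by (rule borel_measurable_AE_eq[OF _ AE']) measurable
  have "integrable M (\<lambda>t. (norm (J (f t) + J (g t)))\<^sup>2)" by (rule integrable_norm_sq_add[OF _ _ fi gi]) measurable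
  moreover have "integrable M (\<lambda>t. (norm (J (f t + g t)))\<^sup>2) \<longleftrightarrow> integrable M (\<lambda>t. (norm (J (f t) + J (g t)))\<^sup>2)"
    using m AE by (intro integrable_cong_AE) (auto elim: AE_mp)
  moreover have "AE t in M. f t + g t \<in> X" using fX gX by eventually_elim (rule X_add)
  ultimately show "(\<lambda>t. f t + g t) \<in> bochner_Lp 2 X N M" using m by (simp add: bochner_Lp_iff)
qed

lemma bochner_Lp_scale:
  assumes f: "f \<in> bochner_Lp 2 X N M"
  shows "(\<lambda>t. c *\<^sub>R f t) \<in> bochner_Lp 2 X N M" and "AE t in M. J (c *\<^sub>R f t) = c *\<^sub>R J (f t)"
proof -
  have fX: "AE t in M. f t \<in> X"
    and [measurable]: "(\<lambda>t. J (f t)) \<in> borel_measurable M"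
    and fi: "integrable M (\<lambda>t. norm (J (f t)) ^ 2)"
    using f by (auto simp: bochner_Lp_iff)
  show AE: "AE t in M. J (c *\<^sub>R f t) = c *\<^sub>R J (f t)" using fX by eventually_elim (rule J_scale)
  then have AE': "AE t in M. c *\<^sub>R J (f t) = J (c *\<^sub>R f t)" by eventually_elim simp
  have m: "(\<lambda>t. J (c *\<^sub>R f t)) \<in> borel_measurable M" by (rule borel_measurable_AE_eq[OF _ AE']) measurable
  have "integrable M (\<lambda>t. (norm (c *\<^sub>R J (f t)))\<^sup>2)" using fi by (simp add: power_mult_distrib)
  moreover have "integrable M (\<lambda>t. (norm (J (c *\<^sub>R f t)))\<^sup>2) \<longleftrightarrow> integrable M (\<lambda>t. (norm (c *\<^sub>R J (f t)))\<^sup>2)"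
    using m AE by (intro integrable_cong_AE) (auto elim: AE_mp)
  moreover have "AE t in M. c *\<^sub>R f t \<in> X" using fX by eventually_elim (rule X_scale)
  ultimately show "(\<lambda>t. c *\<^sub>R f t) \<in> bochner_Lp 2 X N M" using m by (simp add: bochner_Lp_iff)
qed

definition L2_inner :: "(real \<Rightarrow> 'b) \<Rightarrow> (real \<Rightarrow> 'b) \<Rightarrow> real" where
  "L2_inner f g = (\<integral>t. inner (J (f t)) (J (g t)) \<partial>M)"

lemma L2_inner_self: "L2_inner f f = (\<integral>t. norm (J (f t)) ^ 2 \<partial>M)"
  by (simp add: L2_inner_def power2_norm_eq_inner)

text \<open>Completeness is inherited from functions with values in \<open>ell2\<close>. Their limit
  \<open>G\<close> may leave the image of \<open>J\<close>, but projecting it by \<open>E\<close>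
  does not increase its distance to the sequence.\<close>

lemma L2_semi_hilbert: "semi_hilbert (bochner_Lp 2 X N M) L2_inner"
proof
  let ?S = "bochner_Lp 2 X N M"
  have meas: "(\<lambda>t. J (f t)) \<in> borel_measurable M" if "f \<in> ?S" for f using that by (simp add: bochner_Lp_iff)
  have int: "integrable M (\<lambda>t. inner (J (f t)) (J (g t)))" if "f \<in> ?S" "g \<in> ?S" for f g
    using that by (intro integrable_inner_of_norm_sq) (auto simp: bochner_Lp_iff)
  have add: "f + g \<in> ?S" if "f \<in> ?S" "g \<in> ?S" for f g
    using bochner_Lp_add(1)[OF that] by (simp add: plus_fun_def)
  have scale: "c *\<^sub>R f \<in> ?S" if "f \<in> ?S" for f c
    using bochner_Lp_scale(1)[OF that] by (simp add: scaleR_fun_def)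
  show "subspace ?S"
  proof (rule subspaceI)
    show "0 \<in> ?S" by (auto simp: bochner_Lp_iff zero_fun_def X_0 J_0)
  qed (use add scale in auto)
  fix f g h :: "real \<Rightarrow> 'b" and c :: real
  assume f: "f \<in> ?S" and g: "g \<in> ?S"
  show "L2_inner f g = L2_inner g f" by (simp add: L2_inner_def inner_commute)
  show "L2_inner (c *\<^sub>R f) g = c * L2_inner f g"
  proof -
    have "L2_inner (c *\<^sub>R f) g = (\<integral>t. c * inner (J (f t)) (J (g t)) \<partial>M)"
      unfolding L2_inner_def
    proof (rule integral_cong_AE)
      show "AE t in M. inner (J ((c *\<^sub>R f) t)) (J (g t)) = c * inner (J (f t)) (J (g t))"
        using bochner_Lp_scale(2)[OF f, of c] by eventually_elim (simp add: scaleR_fun_def)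
    qed (use int[OF scale[OF f] g] int[OF f g] in measurable)
    then show ?thesis by (simp add: L2_inner_def)
  qed
  show "0 \<le> L2_inner f f" by (simp add: L2_inner_self)
  assume h: "h \<in> ?S"
  show "L2_inner (f + g) h = L2_inner f h + L2_inner g h"
  proof -
    have "L2_inner (f + g) h = (\<integral>t. inner (J (f t)) (J (h t)) + inner (J (g t)) (J (h t)) \<partial>M)"
      unfolding L2_inner_def
    proof (rule integral_cong_AE)
      show "AE t in M. inner (J ((f + g) t)) (J (h t)) = inner (J (f t)) (J (h t)) + inner (J (g t)) (J (h t))"
        using bochner_Lp_add(2)[OF f g] by eventually_elim (simp add: inner_add_left)
    qed (use int[OF add[OF f g] h] int[OF f h] int[OF g h] in measurable)
    then show ?thesis by (simp add: L2_inner_def int f g h)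
  qed
next
  let ?S = "bochner_Lp 2 X N M"
  fix F :: "nat \<Rightarrow> real \<Rightarrow> 'b"
  assume F: "\<And>n. F n \<in> ?S"
    and C: "\<And>e. e > 0 \<Longrightarrow> \<exists>N. \<forall>m\<ge>N. \<forall>n\<ge>N. L2_inner (F m - F n) (F m - F n) < e"
  have FX: "AE t in M. F n t \<in> X" and Fm [measurable]: "(\<lambda>t. J (F n t)) \<in> borel_measurable M"
    and Fi: "integrable M (\<lambda>t. (norm (J (F n t)))\<^sup>2)" for n
    using F[of n] by (auto simp: bochner_Lp_iff)
  have diff: "L2_inner (F m - g) (F m - g) = (\<integral>t. (norm (J (F m t) - J (g t)))\<^sup>2 \<partial>M)" if g: "g \<in> ?S" for m g
    unfolding L2_inner_self
  proof (rule integral_cong_AE)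
    have gX: "AE t in M. g t \<in> X" and [measurable]: "(\<lambda>t. J (g t)) \<in> borel_measurable M"
      using g by (auto simp: bochner_Lp_iff)
    have AE: "AE t in M. norm (J (F m t) - J (g t)) ^ 2 = norm (J ((F m - g) t)) ^ 2"
      using FX[of m] gX by eventually_elim (simp add: J_diff)
    then show "AE t in M. norm (J ((F m - g) t)) ^ 2 = norm (J (F m t) - J (g t)) ^ 2" by eventually_elim simp
    show m: "(\<lambda>t. norm (J (F m t) - J (g t)) ^ 2) \<in> borel_measurable M" by measurable
    show "(\<lambda>t. norm (J ((F m - g) t)) ^ 2) \<in> borel_measurable M" by (rule borel_measurable_AE_eq[OF m AE])
  qed
  have C': "\<exists>N. \<forall>m\<ge>N. \<forall>n\<ge>N. (\<integral>t. (norm (J (F m t) - J (F n t)))\<^sup>2 \<partial>M) < e" if "e > 0" for e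
    using C[OF that] by (simp only: diff[OF F])
  obtain G where G [measurable]: "G \<in> borel_measurable M" and Gi: "integrable M (\<lambda>t. (norm (G t))\<^sup>2)"
    and lim: "(\<lambda>n. \<integral>t. (norm (J (F n t) - G t))\<^sup>2 \<partial>M) \<longlonglongrightarrow> 0"
    using L2_complete[of "\<lambda>n t. J (F n t)", OF Fm Fi C'] by blast
  have JEm [measurable]: "(\<lambda>t. J (E (G t))) \<in> borel_measurable M"
    using measurable_compose[OF G borel_measurable_continuous_onI[OF linear_continuous_on[OF bounded_linear_J_E]]] .
  have "integrable M (\<lambda>t. norm (J (E (G t))) ^ 2)"
    by (rule Bochner_Integration.integrable_bound[OF Gi]) (auto intro!: power_mono J_E_le)
  then have EG: "(\<lambda>t. E (G t)) \<in> ?S" by (simp add: bochner_Lp_iff E_mem)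
  have "(\<lambda>n. L2_inner (F n - (\<lambda>t. E (G t))) (F n - (\<lambda>t. E (G t)))) \<longlonglongrightarrow> 0"
  proof (rule tendsto_sandwich[OF _ _ tendsto_const lim])
    have "(\<integral>t. (norm (J (F n t) - J (E (G t))))\<^sup>2 \<partial>M) \<le> (\<integral>t. (norm (J (F n t) - G t))\<^sup>2 \<partial>M)" for n
    proof (rule integral_mono_AE)
      show "integrable M (\<lambda>t. (norm (J (F n t) - J (E (G t))))\<^sup>2)"
        using integrable_norm_sq_add[of "\<lambda>t. J (F n t)" M "\<lambda>t. - J (E (G t))"] Fi EG by (simp add: bochner_Lp_iff)
      show "integrable M (\<lambda>t. (norm (J (F n t) - G t))\<^sup>2)"
        using integrable_norm_sq_add[of "\<lambda>t. J (F n t)" M "\<lambda>t. - G t"] Fi Gi by simp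
      show "AE t in M. (norm (J (F n t) - J (E (G t))))\<^sup>2 \<le> (norm (J (F n t) - G t))\<^sup>2"
        using FX[of n]
      proof eventually_elim
        case (elim t)
        then have "J (F n t) - J (E (G t)) = J (E (J (F n t) - G t))"
          by (simp add: linear_diff[OF E_linear] E_J J_diff E_mem)
        then show ?case by (simp add: J_E_le power_mono)
      qed
    qed
    then show "\<forall>\<^sub>F n in sequentially. L2_inner (F n - (\<lambda>t. E (G t))) (F n - (\<lambda>t. E (G t)))
        \<le> (\<integral>t. (norm (J (F n t) - G t))\<^sup>2 \<partial>M)"
      by (simp add: diff[OF EG])
  qed (simp add: L2_inner_self)
  with EG show "\<exists>x\<in>?S. (\<lambda>n. L2_inner (F n - x) (F n - x)) \<longlonglongrightarrow> 0" by blast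
qed

lemma Lp_dual_subset: "bochner_Lp_dual 2 X N M \<subseteq> semi_hilbert.dual (bochner_Lp 2 X N M) L2_inner"
proof -
  interpret semi_hilbert "bochner_Lp 2 X N M" L2_inner by (rule L2_semi_hilbert)
  have "bochner_Lp_norm 2 N M f = sqrt (L2_inner f f)" if "f \<in> bochner_Lp 2 X N M" for f
    using integral_N_eq[OF that] by (simp add: bochner_Lp_norm_def L2_inner_self sqrt_def)
  then show ?thesis
    unfolding dual_def bochner_Lp_dual_def plus_fun_def scaleR_fun_def by auto
qed

theorem bounded_imp_weakly_convergent_subseq:
  assumes F: "\<And>n. F n \<in> bochner_Lp 2 X N M" and K: "\<And>n. (\<integral>t. norm (J (F n t)) ^ 2 \<partial>M) \<le> K"
  obtains r f where "strict_mono (r :: nat \<Rightarrow> nat)" "weakly_converges_Lp 2 X N M (\<lambda>k. F (r k)) f"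
proof -
  interpret semi_hilbert "bochner_Lp 2 X N M" L2_inner by (rule L2_semi_hilbert)
  obtain r f where "strict_mono (r :: nat \<Rightarrow> nat)" "f \<in> bochner_Lp 2 X N M"
    "\<And>\<Phi>. \<Phi> \<in> dual \<Longrightarrow> (\<lambda>k. \<Phi> (F (r k))) \<longlonglongrightarrow> \<Phi> f"
    using weak_seq_compact[of F K] F K unfolding L2_inner_self by blast
  then show ?thesis using that[of r f] F Lp_dual_subset unfolding weakly_converges_Lp_def by blast
qed

end

lemma norm_add_scaleR_sq:
  fixes a b :: "'a::real_inner"
  shows "(norm (a + s *\<^sub>R b))\<^sup>2 = s\<^sup>2 * (norm b)\<^sup>2 + 2 * s * inner a b + (norm a)\<^sup>2"
  unfolding power2_norm_eq_inner
  by (simp add: inner_add_left inner_add_right inner_commute power2_eq_square algebra_simps)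

lemma integral_inner_cauchy_schwarz:
  fixes u v :: "'a \<Rightarrow> 'b::{real_inner,banach,second_countable_topology}"
  assumes [measurable]: "u \<in> borel_measurable M" "v \<in> borel_measurable M"
    and i: "integrable M (\<lambda>t. (norm (u t))\<^sup>2)" "integrable M (\<lambda>t. (norm (v t))\<^sup>2)"
  shows "\<bar>\<integral>t. inner (u t) (v t) \<partial>M\<bar> \<le> sqrt (\<integral>t. (norm (u t))\<^sup>2 \<partial>M) * sqrt (\<integral>t. (norm (v t))\<^sup>2 \<partial>M)"
proof -
  have uv: "integrable M (\<lambda>t. inner (u t) (v t))" by (rule integrable_inner_of_norm_sq) (use i in measurable)
  have "0 \<le> (\<integral>t. (norm (v t))\<^sup>2 \<partial>M) * s\<^sup>2 + 2 * (\<integral>t. inner (u t) (v t) \<partial>M) * s + (\<integral>t. (norm (u t))\<^sup>2 \<partial>M)" for s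
  proof -
    have "0 \<le> (\<integral>t. (norm (u t + s *\<^sub>R v t))\<^sup>2 \<partial>M)" by simp
    also have "\<dots> = (\<integral>t. s\<^sup>2 * (norm (v t))\<^sup>2 + 2 * s * inner (u t) (v t) + (norm (u t))\<^sup>2 \<partial>M)"
      by (simp only: norm_add_scaleR_sq)
    also have "\<dots> = s\<^sup>2 * (\<integral>t. (norm (v t))\<^sup>2 \<partial>M) + 2 * s * (\<integral>t. inner (u t) (v t) \<partial>M) + (\<integral>t. (norm (u t))\<^sup>2 \<partial>M)"
      using i uv by simp
    finally show ?thesis by (simp add: algebra_simps)
  qed
  from real_sqrt_le_mono[OF quadratic_nonneg_imp[OF this]] show ?thesis
    by (simp add: real_sqrt_mult mult.commute)
qed

lemma (in complete_measure) integral_AE_eq: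
  fixes f g :: "'a \<Rightarrow> 'b::{banach,second_countable_topology}"
  assumes "f \<in> borel_measurable M" "AE x in M. f x = g x"
  shows "integral\<^sup>L M g = integral\<^sup>L M f"
  by (rule integral_cong_AE) (use assms borel_measurable_AE_eq[OF assms] in \<open>auto elim: AE_mp\<close>)

section \<open>Testing weak limits\<close>

context hilbert_carrier_measure
begin

lemma Lp_norm_2: "f \<in> bochner_Lp 2 X N M \<Longrightarrow> bochner_Lp_norm 2 N M f = sqrt (\<integral>t. (norm (J (f t)))\<^sup>2 \<partial>M)"
  using integral_N_eq[of f 2] by (simp add: bochner_Lp_norm_def sqrt_def)

text \<open>The test function has values in \<open>ell2\<close> rather than in \<open>X\<close>, so
  truncated, normalized or scalar multiples of fixed vectors can be used without lifting them to
  \<open>X\<close>.\<close>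

lemma inner_functional_mem_dual:
  assumes g [measurable]: "g \<in> borel_measurable M" and gi: "integrable M (\<lambda>t. (norm (g t))\<^sup>2)"
  shows "(\<lambda>f. \<integral>t. inner (J (f t)) (g t) \<partial>M) \<in> bochner_Lp_dual 2 X N M"
proof -
  let ?S = "bochner_Lp 2 X N M"
  have fm [measurable]: "(\<lambda>t. J (f t)) \<in> borel_measurable M"
    and fi: "integrable M (\<lambda>t. (norm (J (f t)))\<^sup>2)" if "f \<in> ?S" for f using that by (auto simp: bochner_Lp_iff)
  have int: "integrable M (\<lambda>t. inner (J (f t)) (g t))" if "f \<in> ?S" for f
    by (rule integrable_inner_of_norm_sq[OF fm[OF that] g fi[OF that] gi])
  have "(\<integral>t. inner (J (f t + f' t)) (g t) \<partial>M) = (\<integral>t. inner (J (f t)) (g t) \<partial>M) + (\<integral>t. inner (J (f' t)) (g t) \<partial>M)"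
    if "f \<in> ?S" "f' \<in> ?S" for f f'
  proof -
    have "(\<integral>t. inner (J (f t + f' t)) (g t) \<partial>M) = (\<integral>t. inner (J (f t)) (g t) + inner (J (f' t)) (g t) \<partial>M)"
    proof (rule integral_AE_eq)
      show "AE t in M. inner (J (f t)) (g t) + inner (J (f' t)) (g t) = inner (J (f t + f' t)) (g t)"
        using bochner_Lp_add(2)[OF that] by eventually_elim (simp add: inner_add_left)
    qed (use int[OF that(1)] int[OF that(2)] in measurable)
    then show ?thesis using int that by simp
  qed
  moreover have "(\<integral>t. inner (J (c *\<^sub>R f t)) (g t) \<partial>M) = c * (\<integral>t. inner (J (f t)) (g t) \<partial>M)" if "f \<in> ?S" for f c
  proof -
    have "(\<integral>t. inner (J (c *\<^sub>R f t)) (g t) \<partial>M) = (\<integral>t. c * inner (J (f t)) (g t) \<partial>M)"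
    proof (rule integral_AE_eq)
      show "AE t in M. c * inner (J (f t)) (g t) = inner (J (c *\<^sub>R f t)) (g t)"
        using bochner_Lp_scale(2)[OF that, of c] by eventually_elim simp
    qed (use int[OF that] in measurable)
    then show ?thesis by simp
  qed
  moreover have "\<bar>\<integral>t. inner (J (f t)) (g t) \<partial>M\<bar> \<le> sqrt (\<integral>t. (norm (g t))\<^sup>2 \<partial>M) * bochner_Lp_norm 2 N M f" if "f \<in> ?S" for f
    using integral_inner_cauchy_schwarz[OF fm[OF that] g fi[OF that] gi] by (simp add: Lp_norm_2[OF that] mult.commute)
  ultimately show ?thesis unfolding bochner_Lp_dual_def by blast
qed

lemma weakly_converges_inner:
  assumes "weakly_converges_Lp 2 X N M F f"
    and "g \<in> borel_measurable M" "integrable M (\<lambda>t. (norm (g t))\<^sup>2)"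
  shows "(\<lambda>k. \<integral>t. inner (J (F k t)) (g t) \<partial>M) \<longlonglongrightarrow> (\<integral>t. inner (J (f t)) (g t) \<partial>M)"
  using assms(1)[unfolded weakly_converges_Lp_def, THEN conjunct2, THEN conjunct2, THEN bspec,
      OF inner_functional_mem_dual[OF assms(2,3)]] .

text \<open>Test with the unit field along the limit on the set where its norm exceeds
  \<open>c\<close>. In the limit, the integral of the norm over that set is at most that of
  \<open>c\<close>, so the excess \<open>h\<close> vanishes almost everywhere.\<close>

lemma weak_limit_norm_le:
  assumes fin: "finite_measure M" and w: "weakly_converges_Lp 2 X N M F f"
    and c: "\<And>k. AE t in M. norm (J (F k t)) \<le> c"
  shows "AE t in M. norm (J (f t)) \<le> c"
proof -
  interpret finite_measure M by fact
  have [measurable]: "(\<lambda>t. J (f t)) \<in> borel_measurable M"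
    and Fm [measurable]: "\<And>k. (\<lambda>t. J (F k t)) \<in> borel_measurable M"
    and fi: "integrable M (\<lambda>t. (norm (J (f t)))\<^sup>2)" and Fi: "\<And>k. integrable M (\<lambda>t. (norm (J (F k t)))\<^sup>2)"
    using w unfolding weakly_converges_Lp_def by (auto simp: bochner_Lp_iff)
  define g where "g t = (if norm (J (f t)) > c then (1 / norm (J (f t))) *\<^sub>R J (f t) else 0)" for t
  define h where "h t = (if norm (J (f t)) > c then norm (J (f t)) - c else 0)" for t
  define d where "d t = (if norm (J (f t)) > c then c else 0)" for t
  have [measurable]: "g \<in> borel_measurable M" "h \<in> borel_measurable M" "d \<in> borel_measurable M"
    unfolding g_def h_def d_def by measurable
  have g1: "norm (g t) \<le> 1" for t by (simp add: g_def)
  have gi: "integrable M (\<lambda>t. (norm (g t))\<^sup>2)"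
    by (rule integrable_const_bound[where B = 1]) (use g1 in \<open>auto simp: power_le_one_iff\<close>)
  have di: "integrable M d" by (rule integrable_const_bound[where B = "\<bar>c\<bar>"]) (auto simp: d_def)
  have ug: "inner (J (f t)) (g t) = h t + d t" for t
    by (simp add: g_def h_def d_def power2_norm_eq_inner[symmetric] power2_eq_square)
  have "integrable M (\<lambda>t. inner (J (f t)) (g t))" by (rule integrable_inner_of_norm_sq) (use fi gi in measurable)
  then have "integrable M (\<lambda>t. (h t + d t) - d t)" unfolding ug by (intro Bochner_Integration.integrable_diff di)
  then have hi: "integrable M h" by simp
  have "(\<integral>t. inner (J (f t)) (g t) \<partial>M) \<le> (\<integral>t. d t \<partial>M)"
  proof (rule LIMSEQ_le_const2[OF weakly_converges_inner[OF w _ gi]])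
    have "(\<integral>t. inner (J (F k t)) (g t) \<partial>M) \<le> (\<integral>t. d t \<partial>M)" for k
    proof (rule integral_mono_AE[OF _ di])
      show "integrable M (\<lambda>t. inner (J (F k t)) (g t))" by (rule integrable_inner_of_norm_sq) (use Fi gi in measurable)
      show "AE t in M. inner (J (F k t)) (g t) \<le> d t" using c[of k]
      proof eventually_elim
        case (elim t)
        have "inner (J (F k t)) (g t) \<le> norm (J (F k t)) * norm (g t)" by (rule norm_cauchy_schwarz)
        also have "\<dots> \<le> d t"
        proof (cases "norm (J (f t)) > c")
          case True
          have "norm (J (F k t)) * norm (g t) \<le> norm (J (F k t)) * 1" using g1 by (intro mult_left_mono) auto
          then show ?thesis using elim True by (simp add: d_def)
        qed (simp add: g_def d_def)
        finally show ?case .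
      qed
    qed
    then show "\<exists>N. \<forall>k\<ge>N. (\<integral>t. inner (J (F k t)) (g t) \<partial>M) \<le> (\<integral>t. d t \<partial>M)" by blast
  qed measurable
  then have "(\<integral>t. h t \<partial>M) \<le> 0" unfolding ug using hi di by simp
  moreover have h0: "h t \<ge> 0" for t by (simp add: h_def)
  ultimately have "(\<integral>t. h t \<partial>M) = 0" by (simp add: antisym)
  then have "AE t in M. h t = 0" using integral_nonneg_eq_0_iff_AE[OF hi] h0 by simp
  then show ?thesis by eventually_elim (auto simp: h_def split: if_splits)
qed

text \<open>An integrable test function is truncated at height \<open>m\<close> to become
  square-integrable. What is cut off contributes at most \<open>\<bar>c\<bar>\<close> times the
  integral of its norm, uniformly along the sequence, and that integral tends to zero.\<close>

lemma weakstar_from_weak: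
  assumes fin: "finite_measure M" and w: "weakly_converges_Lp 2 X N M F f"
    and c: "\<And>k. AE t in M. norm (J (F k t)) \<le> c"
    and ip: "\<And>x y. \<lbrakk>x \<in> X; y \<in> X\<rbrakk> \<Longrightarrow> ip x y = inner (J x) (J y)"
  shows "weakstar_converges_Linf X N ip M F f"
proof -
  interpret finite_measure M by fact
  have fm [measurable]: "(\<lambda>t. J (f t)) \<in> borel_measurable M"
    and Fm [measurable]: "\<And>k. (\<lambda>t. J (F k t)) \<in> borel_measurable M"
    and fX: "AE t in M. f t \<in> X" and FX: "\<And>k. AE t in M. F k t \<in> X"
    using w unfolding weakly_converges_Lp_def by (auto simp: bochner_Lp_iff)
  have fc: "AE t in M. norm (J (f t)) \<le> c" by (rule weak_limit_norm_le[OF fin w c])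
  have lim: "(\<lambda>k. \<integral>t. ip (F k t) (g t) \<partial>M) \<longlonglongrightarrow> (\<integral>t. ip (f t) (g t) \<partial>M)" if g: "g \<in> bochner_Lp 1 X N M" for g
  proof -
    define v where "v t = J (g t)" for t
    have gX: "AE t in M. g t \<in> X" and vm [measurable]: "v \<in> borel_measurable M" and vn: "integrable M (\<lambda>t. norm (v t))"
      using g by (auto simp: bochner_Lp_iff v_def[abs_def])
    have ipe: "(\<integral>t. ip (u t) (g t) \<partial>M) = (\<integral>t. inner (J (u t)) (v t) \<partial>M)"
      if "AE t in M. u t \<in> X" "(\<lambda>t. J (u t)) \<in> borel_measurable M" for u
    proof (rule integral_AE_eq)
      show "AE t in M. inner (J (u t)) (v t) = ip (u t) (g t)"
        using that(1) gX by eventually_elim (simp add: ip v_def)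
      show "(\<lambda>t. inner (J (u t)) (v t)) \<in> borel_measurable M" using that(2) by measurable
    qed
    define w where "w m t = (if norm (v t) \<le> real m then v t else 0)" for m t
    have wm [measurable]: "w m \<in> borel_measurable M" for m unfolding w_def by measurable
    have "(\<lambda>m. \<integral>t. norm (v t - w m t) \<partial>M) \<longlonglongrightarrow> (\<integral>t. 0 \<partial>M)"
    proof (rule integral_dominated_convergence[where w = "\<lambda>t. norm (v t)"])
      show "AE t in M. (\<lambda>m. norm (v t - w m t)) \<longlonglongrightarrow> 0"
      proof (rule AE_I2)
        fix t
        have "\<forall>\<^sub>F m in sequentially. norm (v t - w m t) = 0"
          using eventually_ge_at_top[of "nat \<lceil>norm (v t)\<rceil>"] by eventually_elim (simp add: w_def nat_ceiling_le_eq)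
        then show "(\<lambda>m. norm (v t - w m t)) \<longlonglongrightarrow> 0" by (rule tendsto_eventually)
      qed
    qed (use vn in \<open>auto simp: w_def\<close>)
    then have tail: "(\<lambda>m. \<integral>t. norm (v t - w m t) \<partial>M) \<longlonglongrightarrow> 0" by simp
    have wi: "integrable M (\<lambda>t. (norm (w m t))\<^sup>2)" for m
      by (rule integrable_const_bound[where B = "(real m)\<^sup>2"]) (auto simp: w_def intro!: power_mono)
    have rest: "integrable M (\<lambda>t. norm (v t - w m t))" for m
      by (rule Bochner_Integration.integrable_bound[OF vn]) (auto simp: w_def)
    \<comment> \<open>Stated for an arbitrary \<open>u\<close> so as to serve both for the members
      of the sequence and for the limit, whose bound is \<open>fc\<close>.\<close>
    have bnd: "integrable M (\<lambda>t. inner (J (u t)) (v t - w m t)) \<and>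
        \<bar>\<integral>t. inner (J (u t)) (v t - w m t) \<partial>M\<bar> \<le> \<bar>c\<bar> * (\<integral>t. norm (v t - w m t) \<partial>M)"
      if [measurable]: "(\<lambda>t. J (u t)) \<in> borel_measurable M" and uc: "AE t in M. norm (J (u t)) \<le> c" for u m
    proof -
      have le: "AE t in M. norm (inner (J (u t)) (v t - w m t)) \<le> \<bar>c\<bar> * norm (v t - w m t)" using uc
      proof eventually_elim
        case (elim t)
        have "norm (inner (J (u t)) (v t - w m t)) \<le> norm (J (u t)) * norm (v t - w m t)"
          unfolding real_norm_def by (rule Cauchy_Schwarz_ineq2)
        also have "\<dots> \<le> \<bar>c\<bar> * norm (v t - w m t)" using elim by (intro mult_right_mono) auto
        finally show ?case .
      qed
      have ci: "integrable M (\<lambda>t. \<bar>c\<bar> * norm (v t - w m t))" using rest by simp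
      have int: "integrable M (\<lambda>t. inner (J (u t)) (v t - w m t))"
        by (rule Bochner_Integration.integrable_bound[OF ci]) (use le in \<open>auto elim: AE_mp\<close>)
      have "norm (\<integral>t. inner (J (u t)) (v t - w m t) \<partial>M) \<le> (\<integral>t. norm (inner (J (u t)) (v t - w m t)) \<partial>M)"
        by (rule integral_norm_bound)
      also have "\<dots> \<le> (\<integral>t. \<bar>c\<bar> * norm (v t - w m t) \<partial>M)"
        by (rule integral_mono_AE[OF integrable_norm[OF int] ci le])
      finally have "norm (\<integral>t. inner (J (u t)) (v t - w m t) \<partial>M) \<le> (\<integral>t. \<bar>c\<bar> * norm (v t - w m t) \<partial>M)" .
      with int show ?thesis by simp
    qed
    have split: "(\<integral>t. inner (J (u t)) (v t) \<partial>M) = (\<integral>t. inner (J (u t)) (w m t) \<partial>M) + (\<integral>t. inner (J (u t)) (v t - w m t) \<partial>M)"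
      if u: "(\<lambda>t. J (u t)) \<in> borel_measurable M" "AE t in M. norm (J (u t)) \<le> c" "integrable M (\<lambda>t. (norm (J (u t)))\<^sup>2)" for u m
    proof -
      have "integrable M (\<lambda>t. inner (J (u t)) (w m t))" by (rule integrable_inner_of_norm_sq[OF u(1) wm u(3) wi])
      then have "(\<integral>t. inner (J (u t)) (w m t) + inner (J (u t)) (v t - w m t) \<partial>M)
        = (\<integral>t. inner (J (u t)) (w m t) \<partial>M) + (\<integral>t. inner (J (u t)) (v t - w m t) \<partial>M)"
        using bnd[OF u(1,2)] by (intro Bochner_Integration.integral_add) auto
      then show ?thesis by (simp add: inner_diff_right)
    qed
    have fi: "integrable M (\<lambda>t. (norm (J (f t)))\<^sup>2)" and Fi: "integrable M (\<lambda>t. (norm (J (F k t)))\<^sup>2)" for k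
      using w unfolding weakly_converges_Lp_def by (auto simp: bochner_Lp_iff)
    show ?thesis
      unfolding ipe[OF fX fm] ipe[OF FX Fm]
    proof (rule LIMSEQ_I)
      fix e :: real assume e: "e > 0"
      have "(\<lambda>m. \<bar>c\<bar> * (\<integral>t. norm (v t - w m t) \<partial>M)) \<longlonglongrightarrow> 0" using tendsto_mult_left[OF tail, of "\<bar>c\<bar>"] by simp
      then obtain m where m: "\<bar>c\<bar> * (\<integral>t. norm (v t - w m t) \<partial>M) < e / 3"
        using order_tendstoD(2)[of _ 0 sequentially "e/3"] e
        by (metis (no_types, lifting) eventually_happens' sequentially_bot zero_less_divide_iff zero_less_numeral)
      obtain K where K: "\<forall>k\<ge>K. norm ((\<integral>t. inner (J (F k t)) (w m t) \<partial>M) - (\<integral>t. inner (J (f t)) (w m t) \<partial>M)) < e / 3"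
        using LIMSEQ_D[OF weakly_converges_inner[OF w wm wi], of "e/3"] e by auto
      have "norm ((\<integral>t. inner (J (F k t)) (v t) \<partial>M) - (\<integral>t. inner (J (f t)) (v t) \<partial>M)) < e" if "k \<ge> K" for k
        using spec[OF K, of k] that m bnd[OF fm fc, of m] bnd[OF Fm c, of k m]
        unfolding split[OF fm fc fi, of m] split[OF Fm c Fi, of k m] real_norm_def by linarith
      then show "\<exists>K. \<forall>k\<ge>K. norm ((\<integral>t. inner (J (F k t)) (v t) \<partial>M) - (\<integral>t. inner (J (f t)) (v t) \<partial>M)) < e" by blast
    qed
  qed
  show ?thesis
    unfolding weakstar_converges_Linf_def bochner_Linf_iff using lim fX FX fm Fm fc c by blast
qed

end

text \<open>A continuous embedding of one carrier into another. It carries weak limits along,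
  because functionals on the larger space restrict to functionals on the smaller one.\<close>

locale hilbert_embedding =
  A: hilbert_carrier_measure X N J E M + B: hilbert_carrier_measure X' N' J' E' M
  for X :: "'b::real_vector set" and N J E and X' :: "'b set" and N' J' E' M +
  fixes c :: real
  assumes sub: "X \<subseteq> X'" and c: "x \<in> X \<Longrightarrow> N' x \<le> c * N x" and c0: "c \<ge> 0"
begin

text \<open>The same simple functions approximate in the weaker norm, so the two coordinate maps
  need not be compared.\<close>

lemma bochner_measurable_mono:
  assumes "bochner_measurable X N M f"
  shows "bochner_measurable X' N' M f"
proof -
  obtain s where s: "\<And>n. simple_function M (s n)" "\<And>n. s n ` space M \<subseteq> X"
    "AE t in M. (\<lambda>n. N (f t - s n t)) \<longlonglongrightarrow> 0" and AE: "AE t in M. f t \<in> X"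
    using assms unfolding bochner_measurable_def by blast
  have "AE t in M. (\<lambda>n. N' (f t - s n t)) \<longlonglongrightarrow> 0"
    using s(3) AE AE_space
  proof eventually_elim
    case (elim t)
    have d: "f t - s n t \<in> X" for n using elim s(2)[of n] by (intro A.X_diff) auto
    have lim: "(\<lambda>n. c * N (f t - s n t)) \<longlonglongrightarrow> 0" using tendsto_mult_left[OF elim(1), of c] by simp
    have "norm (N' (f t - s n t)) \<le> c * N (f t - s n t)" for n
      using c[OF d, of n] B.N_eq[of "f t - s n t"] subsetD[OF sub d, of n] by simp
    then show ?case by (intro Lim_null_comparison[OF always_eventually lim] allI)
  qed
  moreover have "AE t in M. f t \<in> X'" using AE sub by (auto elim: AE_mp)
  ultimately show ?thesis using s(1,2) sub unfolding bochner_measurable_def by blast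
qed

lemma norm_J'_le: "x \<in> X \<Longrightarrow> norm (J' x) \<le> c * norm (J x)"
  using c[of x] A.N_eq[of x] B.N_eq[of x] sub by auto

lemma bochner_L2_mono:
  assumes f: "f \<in> bochner_Lp 2 X N M"
  shows "f \<in> bochner_Lp 2 X' N' M" "(\<integral>t. (norm (J' (f t)))\<^sup>2 \<partial>M) \<le> c\<^sup>2 * (\<integral>t. (norm (J (f t)))\<^sup>2 \<partial>M)"
proof -
  have AE: "AE t in M. f t \<in> X" and i: "integrable M (\<lambda>t. (norm (J (f t)))\<^sup>2)"
    using f by (auto simp: A.bochner_Lp_iff)
  have m: "AE t in M. f t \<in> X'" "(\<lambda>t. J' (f t)) \<in> borel_measurable M"
    using bochner_measurable_mono[of f] f by (auto simp: B.bochner_measurable_iff bochner_Lp_def)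
  have le: "AE t in M. (norm (J' (f t)))\<^sup>2 \<le> c\<^sup>2 * (norm (J (f t)))\<^sup>2"
    using AE
  proof eventually_elim
    case (elim t)
    from power_mono[OF norm_J'_le[OF this], of 2] show ?case by (simp add: power_mult_distrib)
  qed
  have ci: "integrable M (\<lambda>t. c\<^sup>2 * (norm (J (f t)))\<^sup>2)" using i by simp
  have i': "integrable M (\<lambda>t. (norm (J' (f t)))\<^sup>2)"
    by (rule Bochner_Integration.integrable_bound[OF ci]) (use m le in \<open>auto elim: AE_mp\<close>)
  then show "f \<in> bochner_Lp 2 X' N' M" using m by (simp add: B.bochner_Lp_iff)
  from integral_mono_AE[OF i' ci le]
  show "(\<integral>t. (norm (J' (f t)))\<^sup>2 \<partial>M) \<le> c\<^sup>2 * (\<integral>t. (norm (J (f t)))\<^sup>2 \<partial>M)" by simp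
qed

lemma Lp_dual_mono: "bochner_Lp_dual 2 X' N' M \<subseteq> bochner_Lp_dual 2 X N M"
proof
  fix \<Phi> assume \<Phi>: "\<Phi> \<in> bochner_Lp_dual 2 X' N' M"
  then obtain B where B: "\<And>f. f \<in> bochner_Lp 2 X' N' M \<Longrightarrow> \<bar>\<Phi> f\<bar> \<le> B * bochner_Lp_norm 2 N' M f"
    unfolding bochner_Lp_dual_def by blast
  \<comment> \<open>The constant of a bounded functional may be negative, hence its absolute
    value.\<close>
  have "\<bar>\<Phi> f\<bar> \<le> (\<bar>B\<bar> * c) * bochner_Lp_norm 2 N M f" if f: "f \<in> bochner_Lp 2 X N M" for f
  proof -
    have n: "0 \<le> bochner_Lp_norm 2 N' M f" by (simp add: B.Lp_norm_2[OF bochner_L2_mono(1)[OF f]])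
    have "bochner_Lp_norm 2 N' M f \<le> c * bochner_Lp_norm 2 N M f"
      using real_sqrt_le_mono[OF bochner_L2_mono(2)[OF f]] c0
      by (simp add: B.Lp_norm_2[OF bochner_L2_mono(1)[OF f]] A.Lp_norm_2[OF f] real_sqrt_mult)
    then have "\<bar>B\<bar> * bochner_Lp_norm 2 N' M f \<le> \<bar>B\<bar> * (c * bochner_Lp_norm 2 N M f)" by (rule mult_left_mono) simp
    moreover have "B * bochner_Lp_norm 2 N' M f \<le> \<bar>B\<bar> * bochner_Lp_norm 2 N' M f"
      using n by (intro mult_right_mono) auto
    ultimately show ?thesis using B[OF bochner_L2_mono(1)[OF f]] by simp
  qed
  then show "\<Phi> \<in> bochner_Lp_dual 2 X N M"
    using \<Phi> bochner_L2_mono(1) unfolding bochner_Lp_dual_def by blast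
qed

lemma weakly_converges_mono:
  "weakly_converges_Lp 2 X N M F f \<Longrightarrow> weakly_converges_Lp 2 X' N' M F f"
  unfolding weakly_converges_Lp_def using Lp_dual_mono bochner_L2_mono(1) by blast

end

section \<open>A basis orthogonal in both spaces\<close>

text \<open>Pairing with \<open>h\<close> after \<open>j\<close> is a bounded functional, so its
  Riesz representative can be inserted in the expansion of \<open>z\<close>.\<close>

lemma blinfun_inner_sum_expansion:
  fixes j :: "'v::{real_inner,banach} \<Rightarrow>\<^sub>L 'h::real_inner"
  assumes z: "\<And>y. ((\<lambda>b. c b * inner y b) has_sum inner z y) M"
  shows "((\<lambda>b. c b * inner h (blinfun_apply j b)) has_sum inner h (blinfun_apply j z)) M"
proof -
  have "bounded_linear (\<lambda>x. inner h (blinfun_apply j x))" by (intro bounded_linear_intros)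
  then obtain k where k: "\<And>x. inner h (blinfun_apply j x) = inner k x" using riesz_representation by metis
  show ?thesis using z[of k] by (simp add: k inner_commute[of z])
qed

text \<open>A maximizing sequence in the unit ball is Cauchy by the parallelogram law, since its images
  under the compact map converge to a vector of maximal norm.\<close>

lemma compact_map_attains_norm:
  fixes j :: "'v::{real_inner,banach} \<Rightarrow>\<^sub>L 'h::real_inner"
  assumes compact: "compact (closure (blinfun_apply j ` cball 0 1))"
    and W: "subspace W" "closed W" and y: "y \<in> W" "blinfun_apply j y \<noteq> 0"
  obtains w where "w \<in> W" "norm w = 1" "blinfun_apply j w \<noteq> 0"
    "\<And>v. v \<in> W \<Longrightarrow> norm (blinfun_apply j v) \<le> norm (blinfun_apply j w) * norm v"
proof -
  define A where "A = (\<lambda>w. (norm (blinfun_apply j w))\<^sup>2) ` (W \<inter> cball 0 1)"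
  define s where "s = Sup A"
  have Wn: "(1 / norm v) *\<^sub>R v \<in> W \<inter> cball 0 1" if "v \<in> W" for v
    using that subspace_scale[OF W(1)] by auto
  have bdd: "bdd_above A"
  proof (rule bdd_aboveI)
    fix x assume "x \<in> A"
    then obtain w where w: "x = (norm (blinfun_apply j w))\<^sup>2" "norm w \<le> 1" by (auto simp: A_def)
    have "norm (blinfun_apply j w) \<le> norm j * norm w" by (rule norm_blinfun)
    also have "\<dots> \<le> norm j * 1" using w by (intro mult_left_mono) auto
    finally show "x \<le> (norm j)\<^sup>2" unfolding w by (intro power_mono) auto
  qed
  have le_s: "(norm (blinfun_apply j w))\<^sup>2 \<le> s" if "w \<in> W" "norm w \<le> 1" for w
    unfolding s_def using that by (intro cSup_upper[OF _ bdd]) (auto simp: A_def)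
  have y0: "y \<noteq> 0" using y(2) by auto
  have "0 < (norm (blinfun_apply j ((1 / norm y) *\<^sub>R y)))\<^sup>2" using y(2) y0 by (simp add: blinfun.scaleR_right)
  also have "\<dots> \<le> s" using Wn[OF y(1)] by (intro le_s) auto
  finally have s0: "s > 0" .
  have bound: "(norm (blinfun_apply j v))\<^sup>2 \<le> s * (norm v)\<^sup>2" if v: "v \<in> W" for v
  proof (cases "v = 0")
    case False
    have "(norm (blinfun_apply j ((1 / norm v) *\<^sub>R v)))\<^sup>2 \<le> s" using Wn[OF v] by (intro le_s) auto
    then show ?thesis using False by (simp add: blinfun.scaleR_right power_mult_distrib field_simps)
  qed simp
  have "A \<noteq> {}" using Wn[OF y(1)] by (auto simp: A_def)
  have "\<exists>x. x \<in> W \<and> norm x \<le> 1 \<and> s - 1 / real (Suc n) < (norm (blinfun_apply j x))\<^sup>2" for n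
    using less_cSupD[OF \<open>A \<noteq> {}\<close>, of "s - 1 / real (Suc n)"] by (auto simp: A_def s_def)
  then obtain x where x: "\<And>n. x n \<in> W" "\<And>n. norm (x n) \<le> 1"
    "\<And>n. s - 1 / real (Suc n) < (norm (blinfun_apply j (x n)))\<^sup>2" by metis
  have "blinfun_apply j (x n) \<in> closure (blinfun_apply j ` cball 0 1)" for n
    using x(2)[of n] by (intro subsetD[OF closure_subset]) auto
  then obtain h r where r: "strict_mono r" "((\<lambda>n. blinfun_apply j (x n)) \<circ> r) \<longlonglongrightarrow> h"
    using compact[unfolded compact_def] by meson
  define u where "u n = x (r n)" for n
  have u: "u n \<in> W" "norm (u n) \<le> 1" for n using x by (auto simp: u_def)
  have us: "s - 1 / real (Suc n) < (norm (blinfun_apply j (u n)))\<^sup>2" for n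
  proof -
    have "1 / real (Suc (r n)) \<le> 1 / real (Suc n)" using seq_suble[OF r(1), of n] by (intro divide_left_mono) auto
    then show ?thesis using x(3)[of "r n"] by (simp add: u_def)
  qed
  have conv: "(\<lambda>n. blinfun_apply j (u n)) \<longlonglongrightarrow> h" using r(2) by (simp add: o_def u_def)
  have par: "(norm (a - b))\<^sup>2 = 2 * (norm a)\<^sup>2 + 2 * (norm b)\<^sup>2 - (norm (a + b))\<^sup>2" for a b :: "'z::real_inner"
    by (simp add: power2_norm_eq_inner inner_add_left inner_add_right inner_diff_left inner_diff_right)
  \<comment> \<open>The parallelogram identity in both spaces. The images of \<open>u m\<close> and
    \<open>u n\<close> have squared norm close to \<open>s\<close>, while the sum obeys
    \<open>bound\<close>, so only the two defects and the distance of the images remain.\<close>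
  have close: "s * (norm (u m - u n))\<^sup>2 \<le> 2 / real (Suc m) + 2 / real (Suc n)
      + (norm (blinfun_apply j (u m) - blinfun_apply j (u n)))\<^sup>2" for m n
  proof -
    have "(norm (blinfun_apply j (u m) + blinfun_apply j (u n)))\<^sup>2 \<le> s * (norm (u m + u n))\<^sup>2"
      using bound[OF subspace_add[OF W(1) u(1) u(1)], of m n] by (simp add: blinfun.add_right)
    moreover have "s * (norm (u k))\<^sup>2 \<le> s" for k
      using u(2)[of k] s0 by (simp add: power_le_one)
    then have "s * (norm (u m))\<^sup>2 \<le> s" "s * (norm (u n))\<^sup>2 \<le> s" by blast+
    ultimately show ?thesis
      using us[of m] us[of n] unfolding par[of "u m"] par[of "blinfun_apply j (u m)"]
      by (simp add: algebra_simps)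
  qed
  have "Cauchy u"
  proof (rule CauchyI)
    fix e :: real assume e: "e > 0"
    \<comment> \<open>The two defects contribute less than \<open>4 * d\<close> and the distance of
      the images less than \<open>d\<close>, in total less than \<open>8 * d\<close>.\<close>
    define d where "d = s * e\<^sup>2 / 8"
    have d: "d > 0" using e s0 by (simp add: d_def)
    obtain N1 where N1: "1 / real (Suc N1) < d" using nat_approx_posE[OF d] by auto
    have "Cauchy (\<lambda>n. blinfun_apply j (u n))" using conv by (rule LIMSEQ_imp_Cauchy)
    then obtain N2 where N2: "\<forall>m\<ge>N2. \<forall>n\<ge>N2. norm (blinfun_apply j (u m) - blinfun_apply j (u n)) < sqrt d"
      using CauchyD d by (metis real_sqrt_gt_zero)
    have "norm (u m - u n) < e" if mn: "m \<ge> max N1 N2" "n \<ge> max N1 N2" for m n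
    proof -
      have "1 / real (Suc m) \<le> 1 / real (Suc N1)" "1 / real (Suc n) \<le> 1 / real (Suc N1)"
        using mn by (auto intro!: divide_left_mono)
      moreover have "(norm (blinfun_apply j (u m) - blinfun_apply j (u n)))\<^sup>2 < (sqrt d)\<^sup>2"
        using N2 mn by (intro power_strict_mono) auto
      ultimately have "s * (norm (u m - u n))\<^sup>2 < 5 * d" using close[of m n] N1 d by simp
      also have "\<dots> < s * e\<^sup>2" using d by (simp add: d_def)
      finally have "(norm (u m - u n))\<^sup>2 < e\<^sup>2" using s0 by simp
      then show ?thesis by (rule power2_less_imp_less) (use e in simp)
    qed
    then show "\<exists>N. \<forall>m\<ge>N. \<forall>n\<ge>N. norm (u m - u n) < e" by blast
  qed
  then obtain w where w: "u \<longlonglongrightarrow> w" by (auto simp: Cauchy_convergent_iff convergent_def)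
  have wW: "w \<in> W" using closed_sequentially[OF W(2)] u(1) w by blast
  have w1: "norm w \<le> 1" by (rule LIMSEQ_le_const2[OF tendsto_norm[OF w]]) (use u in blast)
  have jw: "(\<lambda>n. (norm (blinfun_apply j (u n)))\<^sup>2) \<longlonglongrightarrow> (norm (blinfun_apply j w))\<^sup>2" by (intro tendsto_intros w)
  have "(\<lambda>n. s - 1 / real (Suc n)) \<longlonglongrightarrow> s"
    using tendsto_diff[OF tendsto_const[of s] LIMSEQ_inverse_real_of_nat] by (simp add: inverse_eq_divide)
  then have "s \<le> (norm (blinfun_apply j w))\<^sup>2"
    by (rule LIMSEQ_le[OF _ jw]) (use us in \<open>auto intro: less_imp_le\<close>)
  with le_s[OF wW w1] have sw: "(norm (blinfun_apply j w))\<^sup>2 = s" by simp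
  have "norm w = 1"
  proof (rule antisym[OF w1])
    have "s * 1 \<le> s * (norm w)\<^sup>2" using bound[OF wW] sw by simp
    then have "1\<^sup>2 \<le> (norm w)\<^sup>2" using s0 by simp
    then show "1 \<le> norm w" by (rule power2_le_imp_le) simp
  qed
  moreover have "norm (blinfun_apply j v) \<le> norm (blinfun_apply j w) * norm v" if "v \<in> W" for v
    by (rule power2_le_imp_le) (use bound[OF that] sw in \<open>auto simp: power_mult_distrib\<close>)
  moreover have "blinfun_apply j w \<noteq> 0" using sw s0 by auto
  ultimately show ?thesis using that wW by blast
qed

text \<open>A spectral theorem for the compact operator given by \<open>j\<close> followed by its
  adjoint. Zorn's lemma yields a maximal orthonormal set of eigenvectors; were its complement
  nonzero, a unit vector there maximizing the norm of the image would be one more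
  eigenvector.\<close>

lemma spectral_basis:
  fixes j :: "'v::{real_inner,banach} \<Rightarrow>\<^sub>L 'h::real_inner"
  assumes inj: "inj (blinfun_apply j)" and compact: "compact (closure (blinfun_apply j ` cball 0 1))"
  obtains B where "onb B"
    "\<And>b w. b \<in> B \<Longrightarrow> inner (blinfun_apply j b) (blinfun_apply j w) = (norm (blinfun_apply j b))\<^sup>2 * inner b w"
proof -
  define \<A> where "\<A> = {B. orthonormal B \<and>
    (\<forall>b\<in>B. \<forall>w. inner (blinfun_apply j b) (blinfun_apply j w) = (norm (blinfun_apply j b))\<^sup>2 * inner b w)}"
  have "\<exists>M\<in>\<A>. \<forall>X\<in>\<A>. M \<subseteq> X \<longrightarrow> X = M"
  proof (rule subset_Zorn')
    fix \<C> assume \<C>: "subset.chain \<A> \<C>"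
    have "inner x y = (if x = y then 1 else 0)" if xy: "x \<in> \<Union>\<C>" "y \<in> \<Union>\<C>" for x y
    proof -
      obtain X Y where X: "X \<in> \<C>" "x \<in> X" "Y \<in> \<C>" "y \<in> Y" using xy by blast
      then have "X \<subseteq> Y \<or> Y \<subseteq> X" using \<C> by (auto simp: subset.chain_def)
      then obtain Z where Z: "Z \<in> \<C>" "x \<in> Z" "y \<in> Z" using X by blast
      then have "orthonormal Z" using \<C> by (auto simp: subset.chain_def \<A>_def)
      then show ?thesis using Z(2,3) by (rule orthonormal_inner)
    qed
    then have "orthonormal (\<Union>\<C>)" by (simp add: orthonormal_def)
    moreover have "\<forall>b\<in>\<Union>\<C>. \<forall>w. inner (blinfun_apply j b) (blinfun_apply j w) = (norm (blinfun_apply j b))\<^sup>2 * inner b w"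
      using \<C> by (auto simp: subset.chain_def \<A>_def)
    ultimately show "\<Union>\<C> \<in> \<A>" by (simp add: \<A>_def)
  qed
  then obtain M where M: "M \<in> \<A>" "\<And>X. X \<in> \<A> \<Longrightarrow> M \<subseteq> X \<Longrightarrow> X = M" by blast
  have oM: "orthonormal M"
    and eM: "\<And>b w. b \<in> M \<Longrightarrow> inner (blinfun_apply j b) (blinfun_apply j w) = (norm (blinfun_apply j b))\<^sup>2 * inner b w"
    using M(1) by (auto simp: \<A>_def)
  have "y = 0" if y: "\<forall>b\<in>M. inner y b = 0" for y
  proof (rule ccontr)
    assume "y \<noteq> 0"
    then have jy: "blinfun_apply j y \<noteq> 0" using inj by (metis blinfun.zero_right injD)
    define W where "W = {w. \<forall>b\<in>M. inner w b = 0}"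
    have W: "subspace W" by (auto simp: W_def subspace_def inner_add_left)
    have "W = (\<Inter>b\<in>M. {w. inner w b = 0})" by (auto simp: W_def)
    moreover have "closed {w. inner w b = 0}" for b :: 'v by (intro closed_Collect_eq continuous_intros)
    ultimately have cW: "closed W" by auto
    have yW: "y \<in> W" using y by (simp add: W_def)
    obtain w where w: "w \<in> W" "norm w = 1" "blinfun_apply j w \<noteq> 0"
      "\<And>v. v \<in> W \<Longrightarrow> norm (blinfun_apply j v) \<le> norm (blinfun_apply j w) * norm v"
      using compact_map_attains_norm[OF compact W cW yW jy] by blast
    define s where "s = (norm (blinfun_apply j w))\<^sup>2"
    \<comment> \<open>The difference \<open>s * norm^2 - norm (j _)^2\<close> is nonnegative on
      \<open>W\<close> and zero at \<open>w\<close>, so its first variation at \<open>w\<close>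
      vanishes.\<close>
    have eW: "inner (blinfun_apply j w) (blinfun_apply j v) = s * inner w v" if v: "v \<in> W" for v
    proof -
      have "0 \<le> (s * (norm v)\<^sup>2 - (norm (blinfun_apply j v))\<^sup>2) * t\<^sup>2
          + 2 * (s * inner w v - inner (blinfun_apply j w) (blinfun_apply j v)) * t + 0" for t
      proof -
        have "w + t *\<^sub>R v \<in> W" using w(1) v W by (intro subspace_add subspace_scale)
        from power_mono[OF w(4)[OF this], of 2]
        have "(norm (blinfun_apply j w + t *\<^sub>R blinfun_apply j v))\<^sup>2 \<le> s * (norm (w + t *\<^sub>R v))\<^sup>2"
          by (simp add: power_mult_distrib s_def blinfun.add_right blinfun.scaleR_right)
        then show ?thesis unfolding norm_add_scaleR_sq w(2) s_def[symmetric] by (simp add: algebra_simps)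
      qed
      from quadratic_nonneg_imp[OF this] show ?thesis by simp
    qed
    \<comment> \<open>A general \<open>v\<close> is split into \<open>z\<close>, with the
      coefficients of \<open>v\<close> along \<open>M\<close>, and a rest in \<open>W\<close>. Both
      pairings of \<open>w\<close> with \<open>z\<close> vanish term by term, as the members of
      \<open>M\<close> are eigenvectors orthogonal to \<open>w\<close>.\<close>
    have ew: "inner (blinfun_apply j w) (blinfun_apply j v) = s * inner w v" for v
    proof -
      obtain z where z: "\<And>y. ((\<lambda>b. inner v b * inner y b) has_sum inner z y) M" "\<And>b. b \<in> M \<Longrightarrow> inner z b = inner v b"
        using exists_with_coefficients[OF oM bessel_summable[OF oM, of v]] by blast
      have wb: "inner w b = 0" if "b \<in> M" for b using w(1) that by (simp add: W_def)
      have "((\<lambda>b. inner v b * inner w b) has_sum 0) M" by (rule has_sum_0) (simp add: wb)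
      then have zw: "inner w z = 0" using has_sum_unique[OF z(1)[of w]] by (simp add: inner_commute)
      have "((\<lambda>b. inner v b * inner (blinfun_apply j w) (blinfun_apply j b)) has_sum 0) M"
        by (rule has_sum_0) (simp add: inner_commute[of "blinfun_apply j w"] eM inner_commute[of _ w] wb)
      then have jz: "inner (blinfun_apply j w) (blinfun_apply j z) = 0"
        using has_sum_unique[OF blinfun_inner_sum_expansion[OF z(1)]] by blast
      have "v - z \<in> W" using z(2) by (simp add: W_def inner_diff_left)
      from eW[OF this] show ?thesis by (simp add: blinfun.diff_right inner_diff_right zw jz)
    qed
    have "orthonormal (insert w M)"
    proof -
      have "inner w w = 1" using w(2) by (simp add: norm_eq_1)
      moreover have "inner w b = 0" "inner b w = 0" if "b \<in> M" for b using w(1) that by (auto simp: W_def inner_commute)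
      ultimately show ?thesis using oM unfolding orthonormal_def by (metis insert_iff zero_neq_one)
    qed
    then have "insert w M \<in> \<A>" using eM ew by (auto simp: \<A>_def s_def)
    then have "w \<in> M" using M(2) by blast
    then have "inner w w = 0" using w(1) by (simp add: W_def)
    then show False using w(2) by simp
  qed
  then have "onb M" using oM unfolding onb_def by (intro conjI allI impI)
  then show ?thesis using that eM by blast
qed

section \<open>Coordinates of operators\<close>

text \<open>Bases indexed by another set: the basis of V and the normalized images in H can both be
  indexed by \<open>B\<close>, so that all matrices are functions on
  \<open>B \<times> B\<close>.\<close>

definition onb_family :: "('i \<Rightarrow> 'a::real_inner) \<Rightarrow> 'i set \<Rightarrow> bool" where
  "onb_family f I \<longleftrightarrow> inj_on f I \<and> onb (f ` I)"

lemma onb_familyD: "onb_family f I \<Longrightarrow> inj_on f I" "onb_family f I \<Longrightarrow> onb (f ` I)"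
  by (simp_all add: onb_family_def)

lemma onb_family_id: "onb B \<Longrightarrow> onb_family (\<lambda>b. b) B"
  by (simp add: onb_family_def)

lemma has_sum_Times_image:
  assumes "inj_on f A" "inj_on g B"
  shows "(F has_sum S) (f ` A \<times> g ` B) \<longleftrightarrow> ((\<lambda>(a, b). F (f a, g b)) has_sum S) (A \<times> B)"
proof -
  have i: "inj_on (map_prod f g) (A \<times> B)" using assms by (rule map_prod_inj_on)
  have "f ` A \<times> g ` B = map_prod f g ` (A \<times> B)" by auto
  then show ?thesis using has_sum_reindex[OF i, of F S] by (simp add: o_def case_prod_unfold map_prod_def)
qed

lemma summable_on_Times_image:
  assumes "inj_on f A" "inj_on g B"
  shows "F summable_on (f ` A \<times> g ` B) \<longleftrightarrow> (\<lambda>(a, b). F (f a, g b)) summable_on (A \<times> B)"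
  unfolding summable_on_def using has_sum_Times_image[OF assms] by blast

lemma parseval_family:
  fixes f :: "'i \<Rightarrow> 'a::{real_inner,banach}"
  assumes "onb_family f I"
  shows "((\<lambda>i. (inner x (f i))\<^sup>2) has_sum (norm x)\<^sup>2) I"
  using parseval[OF onb_familyD(2)[OF assms], of x]
  unfolding has_sum_reindex[OF onb_familyD(1)[OF assms]] o_def .

lemma expansion_family:
  fixes f :: "'i \<Rightarrow> 'a::{real_inner,banach}"
  assumes "onb_family f I"
  shows "((\<lambda>i. inner x (f i) * inner y (f i)) has_sum inner x y) I"
  using onb_expansion[OF onb_familyD(2)[OF assms], of x y]
  unfolding has_sum_reindex[OF onb_familyD(1)[OF assms]] o_def .

context
  fixes f :: "'i \<Rightarrow> 'a::{real_inner,banach}" and g :: "'k \<Rightarrow> 'b::{real_inner,banach}" and I :: "'i set" and K :: "'k set"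
  assumes f: "onb_family f I" and g: "onb_family g K"
begin

lemma hilbert_schmidt_iff_families:
  fixes T :: "'a \<Rightarrow>\<^sub>L 'b"
  shows "hilbert_schmidt T \<longleftrightarrow> (\<lambda>(i, k). (inner (blinfun_apply T (f i)) (g k))\<^sup>2) summable_on I \<times> K"
  unfolding hilbert_schmidt_iff_matrix[OF onb_familyD(2)[OF f] onb_familyD(2)[OF g]]
    summable_on_Times_image[OF onb_familyD(1)[OF f] onb_familyD(1)[OF g]] by simp

lemma hs_inner_families:
  fixes T S :: "'a \<Rightarrow>\<^sub>L 'b"
  assumes "hilbert_schmidt T" "hilbert_schmidt S"
  shows "((\<lambda>(i, k). inner (blinfun_apply T (f i)) (g k) * inner (blinfun_apply S (f i)) (g k)) has_sum hs_inner T S) (I \<times> K)"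
  using hs_inner_matrix_has_sum[OF onb_familyD(2)[OF f] onb_familyD(2)[OF g] assms]
  unfolding has_sum_Times_image[OF onb_familyD(1)[OF f] onb_familyD(1)[OF g]] by simp

lemma blinfun_with_matrix_families:
  assumes m: "(\<lambda>(i, k). (m i k)\<^sup>2) summable_on I \<times> K"
  obtains T :: "'a \<Rightarrow>\<^sub>L 'b" where "\<And>i k. \<lbrakk>i \<in> I; k \<in> K\<rbrakk> \<Longrightarrow> inner (blinfun_apply T (f i)) (g k) = m i k"
    "hilbert_schmidt T"
proof -
  define m' where "m' a b = m (inv_into I f a) (inv_into K g b)" for a b
  have m': "m' (f i) (g k) = m i k" if "i \<in> I" "k \<in> K" for i k
    using that onb_familyD(1)[OF f] onb_familyD(1)[OF g] by (simp add: m'_def)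
  have "(\<lambda>(i, k). (m' (f i) (g k))\<^sup>2) summable_on I \<times> K"
    using m by (rule summable_on_cong[THEN iffD1, rotated]) (auto simp: m')
  then have "(\<lambda>(a, b). (m' a b)\<^sup>2) summable_on f ` I \<times> g ` K"
    unfolding summable_on_Times_image[OF onb_familyD(1)[OF f] onb_familyD(1)[OF g]] by simp
  then obtain T :: "'a \<Rightarrow>\<^sub>L 'b" where
    T: "\<And>a b. \<lbrakk>a \<in> f ` I; b \<in> g ` K\<rbrakk> \<Longrightarrow> inner (blinfun_apply T a) b = m' a b"
    using blinfun_with_matrix[OF onb_familyD(2)[OF f] onb_familyD(2)[OF g]] by blast
  have T': "inner (blinfun_apply T (f i)) (g k) = m i k" if "i \<in> I" "k \<in> K" for i k
    using T[of "f i" "g k"] that by (simp add: m')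
  have "hilbert_schmidt T" unfolding hilbert_schmidt_iff_families
    using m by (rule summable_on_cong[THEN iffD1, rotated]) (auto simp: T')
  with T' show ?thesis using that by blast
qed

lemma blinfun_eq_families:
  fixes T S :: "'a \<Rightarrow>\<^sub>L 'b"
  assumes "\<And>i k. \<lbrakk>i \<in> I; k \<in> K\<rbrakk> \<Longrightarrow> inner (blinfun_apply T (f i)) (g k) = inner (blinfun_apply S (f i)) (g k)"
  shows "T = S"
  by (rule blinfun_eq_on_onb[OF onb_familyD(2)[OF f]], rule eq_if_onb_coefficients[OF onb_familyD(2)[OF g]])
     (use assms in auto)

end

text \<open>\<open>eigen\<close> says that \<open>b\<close> is an eigenvector of \<open>j\<close>
  followed by its adjoint. Thus \<open>B\<close> diagonalizes the embedding, and passing between the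
  three spaces only rescales matrix entries.\<close>

locale gelfand_triple =
  fixes j :: "'v::{real_inner,banach,second_countable_topology} \<Rightarrow>\<^sub>L 'h::{real_inner,banach,second_countable_topology}"
    and B :: "'v set"
  assumes inj_j: "inj (blinfun_apply j)"
    and dense_j: "closure (range (blinfun_apply j)) = UNIV"
    and onb_B: "onb B"
    and eigen: "b \<in> B \<Longrightarrow> inner (blinfun_apply j b) (blinfun_apply j w) = (norm (blinfun_apply j b))\<^sup>2 * inner b w"
begin

text \<open>The elements of B are eigenvectors: their images in H, divided by their norms \<open>\<nu>\<close>, form an
  orthonormal basis of H.\<close>

definition \<nu> :: "'v \<Rightarrow> real" where "\<nu> b = norm (blinfun_apply j b)"

definition hb :: "'v \<Rightarrow> 'h" where "hb b = (1 / \<nu> b) *\<^sub>R blinfun_apply j b"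

lemma \<nu>_pos: "b \<in> B \<Longrightarrow> 0 < \<nu> b"
proof -
  assume b: "b \<in> B"
  have "inner b b = 1" using orthonormal_inner[OF onb_orthonormal[OF onb_B] b b] by simp
  then have "b \<noteq> 0" by auto
  then have "blinfun_apply j b \<noteq> 0" using inj_j by (metis blinfun.zero_right injD)
  then show ?thesis by (simp add: \<nu>_def)
qed

lemma \<nu>_le: "b \<in> B \<Longrightarrow> \<nu> b \<le> norm j"
  using norm_blinfun[of j b] orthonormal_inner[OF onb_orthonormal[OF onb_B], of b b]
  by (simp add: \<nu>_def norm_eq_sqrt_inner)

lemma j_eq_hb: "b \<in> B \<Longrightarrow> blinfun_apply j b = \<nu> b *\<^sub>R hb b"
  using \<nu>_pos[of b] by (simp add: hb_def)

lemma inner_j_eq: "b \<in> B \<Longrightarrow> inner (blinfun_apply j b) (blinfun_apply j w) = (\<nu> b)\<^sup>2 * inner b w"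
  by (simp add: \<nu>_def eigen)

lemma inner_j_eq': "b \<in> B \<Longrightarrow> inner (blinfun_apply j w) (blinfun_apply j b) = (\<nu> b)\<^sup>2 * inner w b"
  using inner_j_eq[of b w] by (simp add: inner_commute)

lemma famB: "onb_family (\<lambda>b. b) B"
  by (rule onb_family_id[OF onb_B])

text \<open>The eigenvector relation makes the images orthogonal. A vector orthogonal to all of them
  is orthogonal to the range of \<open>j\<close>, hence zero by density.\<close>

lemma famH: "onb_family hb B"
proof -
  have o: "inner (hb b) (hb c) = (if b = c then 1 else 0)" if "b \<in> B" "c \<in> B" for b c
    using that \<nu>_pos[of b] \<nu>_pos[of c] orthonormal_inner[OF onb_orthonormal[OF onb_B], of b c]
    by (auto simp: hb_def inner_j_eq power2_eq_square)
  have inj: "inj_on hb B"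
    by (rule inj_onI) (metis o zero_neq_one)
  moreover have "orthonormal (hb ` B)" unfolding orthonormal_def
    using o inj by (auto simp: inj_on_eq_iff)
  moreover have "y = 0" if y: "\<forall>b\<in>hb ` B. inner y b = 0" for y
  proof -
    have "blinfun_inner_left y o\<^sub>L j = 0"
    proof (rule blinfun_eq_on_onb[OF onb_B])
      show "blinfun_apply (blinfun_inner_left y o\<^sub>L j) b = blinfun_apply 0 b" if "b \<in> B" for b
        using y that by (simp add: j_eq_hb inner_commute)
    qed
    then have "inner y (blinfun_apply j v) = 0" for v
      by (metis blinfun_apply_blinfun_compose blinfun_inner_left.rep_eq inner_commute zero_blinfun.rep_eq)
    then have "range (blinfun_apply j) \<subseteq> {x. inner y x = 0}" by auto
    moreover have "closed {x. inner y x = 0}" by (intro closed_Collect_eq continuous_intros)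
    ultimately have "closure (range (blinfun_apply j)) \<subseteq> {x. inner y x = 0}" by (rule closure_minimal)
    moreover have "y \<in> closure (range (blinfun_apply j))" by (simp add: dense_j)
    ultimately have "y \<in> {x. inner y x = 0}" by (rule subsetD)
    then show ?thesis by simp
  qed
  ultimately show ?thesis unfolding onb_family_def onb_def by blast
qed

lemma countable_B: "countable B"
  by (rule orthonormal_countable[OF onb_orthonormal[OF onb_B]])

text \<open>The matrix of an operator from V to its dual. As every space of operators is a subset of
  this type, one matrix serves for all of them.\<close>

definition coef :: "'v oper \<Rightarrow> 'v \<Rightarrow> 'v \<Rightarrow> real" where
  "coef R b c = blinfun_apply (blinfun_apply R b) c"

lemma oper_eqI:
  assumes "\<And>b c. \<lbrakk>b \<in> B; c \<in> B\<rbrakk> \<Longrightarrow> coef R b c = coef S b c"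
  shows "R = S"
  by (rule blinfun_eq_on_onb[OF onb_B], rule blinfun_eq_on_onb[OF onb_B]) (use assms in \<open>simp add: coef_def\<close>)

lemma coef_add: "coef (R + S) b c = coef R b c + coef S b c"
  and coef_scale: "coef (r *\<^sub>R R) b c = r * coef R b c"
  by (simp_all add: coef_def blinfun.add_left blinfun.scaleR_left)

section \<open>Matrix entries of operators between the spaces of the triple\<close>

lemma coef_from_HH: "\<lbrakk>b \<in> B; c \<in> B\<rbrakk> \<Longrightarrow> coef (from_HH j T) b c = \<nu> b * \<nu> c * inner (blinfun_apply T (hb b)) (hb c)"
  by (simp add: coef_def from_HH_def dual_emb_apply j_eq_hb blinfun.scaleR_right blinfun.scaleR_left)

lemma coef_from_HV: "\<lbrakk>b \<in> B; c \<in> B\<rbrakk> \<Longrightarrow> coef (from_HV j T) b c = \<nu> b * (\<nu> c)\<^sup>2 * inner (blinfun_apply T (hb b)) c"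
  by (simp add: coef_def from_HV_def dual_emb_apply inner_j_eq') (simp add: j_eq_hb blinfun.scaleR_right)

text \<open>Embedding V into its dual through H is, on the basis, the Riesz map of V up to the
  eigenvalue. This is the origin of the squares of \<open>\<nu>\<close> for operators that use the
  dual of V as domain or V as range.\<close>

lemma dual_emb_j: "b \<in> B \<Longrightarrow> blinfun_apply (dual_emb j) (blinfun_apply j b) = (\<nu> b)\<^sup>2 *\<^sub>R blinfun_inner_left b"
  by (rule blinfun_eqI) (simp add: dual_emb_apply inner_j_eq blinfun.scaleR_left inner_commute[of b])

lemma coef_from_DH: "\<lbrakk>b \<in> B; c \<in> B\<rbrakk> \<Longrightarrow>
    coef (from_DH j T) b c = (\<nu> b)\<^sup>2 * \<nu> c * inner (blinfun_apply (T o\<^sub>L riesz_map) b) (hb c)"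
  by (simp add: coef_def from_DH_def dual_emb_apply dual_emb_j blinfun.scaleR_right blinfun.scaleR_left riesz_map_apply)
     (simp add: j_eq_hb)

lemma coef_from_VH: "\<lbrakk>b \<in> B; c \<in> B\<rbrakk> \<Longrightarrow> coef (from_VH j T) b c = \<nu> c * inner (blinfun_apply T b) (hb c)"
  by (simp add: coef_def from_VH_def dual_emb_apply j_eq_hb)

lemma coef_from_HD: "\<lbrakk>b \<in> B; c \<in> B\<rbrakk> \<Longrightarrow>
    coef (from_HD j T) b c = \<nu> b * inner (blinfun_apply (riesz_inv o\<^sub>L T) (hb b)) c"
  by (simp add: coef_def from_HD_def j_eq_hb blinfun.scaleR_right blinfun.scaleR_left)

lemma inj_from_HH: "inj (from_HH j)"
proof (rule injI)
  fix T S :: "'h \<Rightarrow>\<^sub>L 'h" assume eq: "from_HH j T = from_HH j S"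
  show "T = S"
  proof (rule blinfun_eq_families[OF famH famH])
    fix b c assume bc: "b \<in> B" "c \<in> B"
    show "inner (blinfun_apply T (hb b)) (hb c) = inner (blinfun_apply S (hb b)) (hb c)"
      using arg_cong[OF eq, of "\<lambda>R. coef R b c"] \<nu>_pos[OF bc(1)] \<nu>_pos[OF bc(2)] by (simp add: coef_from_HH bc)
  qed
qed

lemma inj_from_HV: "inj (from_HV j)"
proof (rule injI)
  fix T S :: "'h \<Rightarrow>\<^sub>L 'v" assume eq: "from_HV j T = from_HV j S"
  show "T = S"
  proof (rule blinfun_eq_families[OF famH famB])
    fix b c assume bc: "b \<in> B" "c \<in> B"
    show "inner (blinfun_apply T (hb b)) c = inner (blinfun_apply S (hb b)) c"
      using arg_cong[OF eq, of "\<lambda>R. coef R b c"] \<nu>_pos[OF bc(1)] \<nu>_pos[OF bc(2)] by (simp add: coef_from_HV bc)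
  qed
qed

lemma comp_riesz_inj:
  fixes T S :: "'v dual \<Rightarrow>\<^sub>L 'b::real_normed_vector"
  assumes "T o\<^sub>L riesz_map = S o\<^sub>L riesz_map"
  shows "T = S"
proof (rule blinfun_eqI)
  fix f :: "'v dual"
  have "blinfun_apply (T o\<^sub>L riesz_map) (blinfun_apply riesz_inv f) = blinfun_apply (S o\<^sub>L riesz_map) (blinfun_apply riesz_inv f)"
    by (simp only: assms)
  then show "blinfun_apply T f = blinfun_apply S f" by (simp add: riesz_map_apply)
qed

lemma inj_from_DH: "inj (from_DH j)"
proof (rule injI)
  fix T S :: "'v dual \<Rightarrow>\<^sub>L 'h" assume eq: "from_DH j T = from_DH j S"
  have "T o\<^sub>L riesz_map = S o\<^sub>L riesz_map"
  proof (rule blinfun_eq_families[OF famB famH])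
    fix b c assume bc: "b \<in> B" "c \<in> B"
    show "inner (blinfun_apply (T o\<^sub>L riesz_map) b) (hb c) = inner (blinfun_apply (S o\<^sub>L riesz_map) b) (hb c)"
      using arg_cong[OF eq, of "\<lambda>R. coef R b c"] \<nu>_pos[OF bc(1)] \<nu>_pos[OF bc(2)] by (simp add: coef_from_DH bc)
  qed
  then show "T = S" by (rule comp_riesz_inj)
qed

lemmas as_HH_from_HH = the_inv_f_f[OF inj_from_HH]
lemmas as_HV_from_HV = the_inv_f_f[OF inj_from_HV]
lemmas as_DH_from_DH = the_inv_f_f[OF inj_from_DH]

section \<open>The operator spaces as weighted sequence spaces\<close>

definition weighted :: "('v \<Rightarrow> 'v \<Rightarrow> real) \<Rightarrow> 'v oper set" where
  "weighted w = {R. (\<lambda>(b, c). w b c * (coef R b c)\<^sup>2) summable_on B \<times> B}"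

text \<open>The weights undo the factors of \<open>\<nu>\<close> in \<open>coef\<close>:
  \<open>wH\<close> is the one for HS(H,H), and \<open>wV\<close> adds those of HS(V*,H) and
  HS(H,V). \<open>wD\<close> is \<open>wH\<close> squared over \<open>wV\<close>, as duality with
  respect to the pairing of H demands.\<close>

definition wH :: "'v \<Rightarrow> 'v \<Rightarrow> real" where "wH b c = 1 / ((\<nu> b)\<^sup>2 * (\<nu> c)\<^sup>2)"
definition wV :: "'v \<Rightarrow> 'v \<Rightarrow> real" where "wV b c = wH b c * (1 / (\<nu> b)\<^sup>2 + 1 / (\<nu> c)\<^sup>2)"
definition wD :: "'v \<Rightarrow> 'v \<Rightarrow> real" where "wD b c = 1 / ((\<nu> b)\<^sup>2 + (\<nu> c)\<^sup>2)"

lemma summable_on_Times_cong: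
  assumes "\<And>b c. \<lbrakk>b \<in> B; c \<in> B\<rbrakk> \<Longrightarrow> f b c = g b c"
  shows "(\<lambda>(b, c). f b c :: real) summable_on B \<times> B \<longleftrightarrow> (\<lambda>(b, c). g b c) summable_on B \<times> B"
  by (rule summable_on_cong) (use assms in auto)

lemma hs_HH_iff: "hilbert_schmidt T \<longleftrightarrow> from_HH j T \<in> weighted wH"
  unfolding weighted_def mem_Collect_eq hilbert_schmidt_iff_families[OF famH famH]
  by (rule summable_on_Times_cong) (use \<nu>_pos in \<open>fastforce simp: coef_from_HH wH_def power_mult_distrib\<close>)

lemma hs_HV_iff: "hilbert_schmidt T \<longleftrightarrow> from_HV j T \<in> weighted (\<lambda>b c. wH b c / (\<nu> c)\<^sup>2)"
  unfolding weighted_def mem_Collect_eq hilbert_schmidt_iff_families[OF famH famB]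
  by (rule summable_on_Times_cong) (use \<nu>_pos in \<open>fastforce simp: coef_from_HV wH_def power_mult_distrib power2_eq_square\<close>)

lemma hs_DH_iff: "hilbert_schmidt T \<longleftrightarrow> from_DH j T \<in> weighted (\<lambda>b c. wH b c / (\<nu> b)\<^sup>2)"
  unfolding weighted_def mem_Collect_eq hilbert_schmidt_dual_domain[OF onb_B onb_familyD(2)[OF famH]] hilbert_schmidt_iff_families[OF famB famH]
  by (rule summable_on_Times_cong) (use \<nu>_pos in \<open>fastforce simp: coef_from_DH wH_def power_mult_distrib power2_eq_square\<close>)

lemma hs_VH_iff: "hilbert_schmidt T \<longleftrightarrow> from_VH j T \<in> weighted (\<lambda>b c. 1 / (\<nu> c)\<^sup>2)"
  unfolding weighted_def mem_Collect_eq hilbert_schmidt_iff_families[OF famB famH]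
  by (rule summable_on_Times_cong) (use \<nu>_pos in \<open>fastforce simp: coef_from_VH power_mult_distrib\<close>)

lemma hs_HD_iff: "hilbert_schmidt T \<longleftrightarrow> from_HD j T \<in> weighted (\<lambda>b c. 1 / (\<nu> b)\<^sup>2)"
  unfolding weighted_def mem_Collect_eq hilbert_schmidt_dual_range[of T] hilbert_schmidt_iff_families[OF famH famB]
  by (rule summable_on_Times_cong) (use \<nu>_pos in \<open>fastforce simp: coef_from_HD power_mult_distrib simp del: blinfun_apply_blinfun_compose\<close>)

lemma from_HH_surj:
  assumes "R \<in> weighted wH" obtains T where "R = from_HH j T" "hilbert_schmidt T"
proof -
  have "(\<lambda>(b, c). (coef R b c / (\<nu> b * \<nu> c))\<^sup>2) summable_on B \<times> B"
    using assms unfolding weighted_def mem_Collect_eq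
    by (rule summable_on_Times_cong[THEN iffD1, rotated]) (simp add: wH_def power_divide power_mult_distrib)
  then obtain T :: "'h \<Rightarrow>\<^sub>L 'h" where
    T: "\<And>b c. \<lbrakk>b \<in> B; c \<in> B\<rbrakk> \<Longrightarrow> inner (blinfun_apply T (hb b)) (hb c) = coef R b c / (\<nu> b * \<nu> c)" and hs: "hilbert_schmidt T"
    by (rule blinfun_with_matrix_families[OF famH famH]) blast
  have "R = from_HH j T"
    by (rule oper_eqI) (use \<nu>_pos in \<open>force simp: coef_from_HH T\<close>)
  with hs show ?thesis using that by blast
qed

lemma from_HV_surj:
  assumes "R \<in> weighted (\<lambda>b c. wH b c / (\<nu> c)\<^sup>2)" obtains T where "R = from_HV j T" "hilbert_schmidt T"
proof -
  have "(\<lambda>(b, c). (coef R b c / (\<nu> b * (\<nu> c)\<^sup>2))\<^sup>2) summable_on B \<times> B"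
    using assms unfolding weighted_def mem_Collect_eq
    by (rule summable_on_Times_cong[THEN iffD1, rotated]) (simp add: wH_def power_divide power_mult_distrib power2_eq_square)
  then obtain T :: "'h \<Rightarrow>\<^sub>L 'v" where
    T: "\<And>b c. \<lbrakk>b \<in> B; c \<in> B\<rbrakk> \<Longrightarrow> inner (blinfun_apply T (hb b)) c = coef R b c / (\<nu> b * (\<nu> c)\<^sup>2)" and hs: "hilbert_schmidt T"
    by (rule blinfun_with_matrix_families[OF famH famB]) blast
  have "R = from_HV j T"
    by (rule oper_eqI) (use \<nu>_pos in \<open>force simp: coef_from_HV T\<close>)
  with hs show ?thesis using that by blast
qed

lemma from_DH_surj:
  assumes R: "R \<in> weighted (\<lambda>b c. wH b c / (\<nu> b)\<^sup>2)" obtains T where "R = from_DH j T" "hilbert_schmidt T"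
proof -
  have "(\<lambda>(b, c). (coef R b c / ((\<nu> b)\<^sup>2 * \<nu> c))\<^sup>2) summable_on B \<times> B"
    using R unfolding weighted_def mem_Collect_eq
    by (rule summable_on_Times_cong[THEN iffD1, rotated]) (simp add: wH_def power_divide power_mult_distrib power2_eq_square)
  then obtain T :: "'v \<Rightarrow>\<^sub>L 'h" where
    T: "\<And>b c. \<lbrakk>b \<in> B; c \<in> B\<rbrakk> \<Longrightarrow> inner (blinfun_apply T b) (hb c) = coef R b c / ((\<nu> b)\<^sup>2 * \<nu> c)"
    by (rule blinfun_with_matrix_families[OF famB famH]) blast
  have eq: "R = from_DH j (T o\<^sub>L riesz_inv)"
    by (rule oper_eqI) (use \<nu>_pos in \<open>force simp: coef_from_DH T riesz_map_apply\<close>)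
  have "hilbert_schmidt (T o\<^sub>L riesz_inv)" using R unfolding hs_DH_iff eq[symmetric] .
  with eq show ?thesis using that by blast
qed

lemma from_VH_surj:
  assumes R: "R \<in> weighted (\<lambda>b c. 1 / (\<nu> c)\<^sup>2)" obtains T where "R = from_VH j T" "hilbert_schmidt T"
proof -
  have "(\<lambda>(b, c). (coef R b c / \<nu> c)\<^sup>2) summable_on B \<times> B"
    using R unfolding weighted_def mem_Collect_eq
    by (rule summable_on_Times_cong[THEN iffD1, rotated]) (simp add: power_divide)
  then obtain T :: "'v \<Rightarrow>\<^sub>L 'h" where
    T: "\<And>b c. \<lbrakk>b \<in> B; c \<in> B\<rbrakk> \<Longrightarrow> inner (blinfun_apply T b) (hb c) = coef R b c / \<nu> c" and hs: "hilbert_schmidt T"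
    by (rule blinfun_with_matrix_families[OF famB famH]) blast
  have "R = from_VH j T"
    by (rule oper_eqI) (use \<nu>_pos in \<open>force simp: coef_from_VH T\<close>)
  with hs show ?thesis using that by blast
qed

lemma from_HD_surj:
  assumes R: "R \<in> weighted (\<lambda>b c. 1 / (\<nu> b)\<^sup>2)" obtains T where "R = from_HD j T" "hilbert_schmidt T"
proof -
  have "(\<lambda>(b, c). (coef R b c / \<nu> b)\<^sup>2) summable_on B \<times> B"
    using R unfolding weighted_def mem_Collect_eq
    by (rule summable_on_Times_cong[THEN iffD1, rotated]) (simp add: power_divide)
  then obtain T :: "'h \<Rightarrow>\<^sub>L 'v" where
    T: "\<And>b c. \<lbrakk>b \<in> B; c \<in> B\<rbrakk> \<Longrightarrow> inner (blinfun_apply T (hb b)) c = coef R b c / \<nu> b"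
    by (rule blinfun_with_matrix_families[OF famH famB]) blast
  have eq: "R = from_HD j (riesz_map o\<^sub>L T)"
    by (rule oper_eqI) (use \<nu>_pos in \<open>force simp: coef_from_HD T riesz_map_apply inner_commute[of _ "blinfun_apply T _"]\<close>)
  have "hilbert_schmidt (riesz_map o\<^sub>L T)" using R unfolding hs_HD_iff eq[symmetric] .
  with eq show ?thesis using that by blast
qed

text \<open>Numbers the matrix positions by coordinates of \<open>ell2\<close>. When
  \<open>B\<close> is finite, coordinates are left over; they are set to zero.\<close>

definition \<kappa> :: "'v \<times> 'v \<Rightarrow> nat" where "\<kappa> = to_nat_on (B \<times> B)"

lemma inj_\<kappa>: "inj_on \<kappa> (B \<times> B)"
  unfolding \<kappa>_def by (intro inj_on_to_nat_on countable_SIGMA countable_B)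

lemma inv_\<kappa>: "\<lbrakk>b \<in> B; c \<in> B\<rbrakk> \<Longrightarrow> inv_into (B \<times> B) \<kappa> (\<kappa> (b, c)) = (b, c)"
  by (rule inv_into_f_f[OF inj_\<kappa>]) simp

lemma coord_has_sum:
  assumes "\<And>n. n \<notin> \<kappa> ` (B \<times> B) \<Longrightarrow> coord x n = 0"
  shows "((\<lambda>p. coord x (\<kappa> p) * coord y (\<kappa> p)) has_sum inner x y) (B \<times> B)"
proof -
  have "(\<lambda>n. coord x n * coord y n) summable_on UNIV"
    by (rule summable_on_prod_of_squares[OF coord_summable coord_summable])
  then have "((\<lambda>n. coord x n * coord y n) has_sum inner x y) UNIV" by (simp add: inner_ell2_def)
  then have "((\<lambda>n. coord x n * coord y n) has_sum inner x y) (\<kappa> ` (B \<times> B))"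
    by (rule has_sum_cong_neutral[THEN iffD1, rotated 3]) (use assms in auto)
  then show ?thesis unfolding has_sum_reindex[OF inj_\<kappa>] o_def .
qed

lemma coord_\<kappa>_summable: "(\<lambda>p. (coord x (\<kappa> p))\<^sup>2) summable_on B \<times> B"
proof -
  have "(\<lambda>n. (coord x n)\<^sup>2) summable_on \<kappa> ` (B \<times> B)"
    by (rule summable_on_subset_banach[OF coord_summable]) simp
  then show ?thesis unfolding summable_on_reindex[OF inj_\<kappa>] o_def .
qed

text \<open>The square root of the weight makes the map isometric for the weighted norm.\<close>

definition Jw :: "('v \<Rightarrow> 'v \<Rightarrow> real) \<Rightarrow> 'v oper \<Rightarrow> ell2" where
  "Jw w R = Abs_ell2 (\<lambda>n. if n \<in> \<kappa> ` (B \<times> B)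
     then case inv_into (B \<times> B) \<kappa> n of (b, c) \<Rightarrow> sqrt (w b c) * coef R b c else 0)"

text \<open>The operator with the matrix read off from \<open>x\<close>. Existence is part of
  \<open>coef_Ew\<close>, uniqueness is \<open>oper_eqI\<close>. Coordinates outside the range of
  \<open>\<kappa>\<close> are ignored, so this is a left inverse of \<open>Jw w\<close> defined on
  all of \<open>ell2\<close>.\<close>

definition Ew :: "('v \<Rightarrow> 'v \<Rightarrow> real) \<Rightarrow> ell2 \<Rightarrow> 'v oper" where
  "Ew w x = (SOME R. \<forall>b\<in>B. \<forall>c\<in>B. coef R b c = coord x (\<kappa> (b, c)) / sqrt (w b c))"

lemma coef_diff: "coef (R - S) b c = coef R b c - coef S b c"
  by (simp add: coef_def blinfun.diff_left)

text \<open>The positive lower bound ensures that a sequence in \<open>ell2\<close>, divided by the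
  square roots of the weights, is still the matrix of a bounded operator.\<close>

definition weight :: "('v \<Rightarrow> 'v \<Rightarrow> real) \<Rightarrow> bool" where
  "weight w \<longleftrightarrow> (\<exists>\<delta>>0. \<forall>b\<in>B. \<forall>c\<in>B. \<delta> \<le> w b c)"

lemma weight_pos: "\<lbrakk>weight w; b \<in> B; c \<in> B\<rbrakk> \<Longrightarrow> 0 < w b c"
  unfolding weight_def by (meson less_le_trans)

lemma coord_Jw:
  assumes w: "weight w" and R: "R \<in> weighted w"
  shows "coord (Jw w R) = (\<lambda>n. if n \<in> \<kappa> ` (B \<times> B)
     then case inv_into (B \<times> B) \<kappa> n of (b, c) \<Rightarrow> sqrt (w b c) * coef R b c else 0)" (is "_ = ?f")
proof -
  have "(\<lambda>n. (?f n)\<^sup>2) summable_on \<kappa> ` (B \<times> B)"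
    unfolding summable_on_reindex[OF inj_\<kappa>]
  proof (rule summable_on_cong[THEN iffD1])
    show "(\<lambda>(b, c). w b c * (coef R b c)\<^sup>2) summable_on B \<times> B" using R by (simp add: weighted_def)
    show "(case p of (b, c) \<Rightarrow> w b c * (coef R b c)\<^sup>2) = ((\<lambda>n. (?f n)\<^sup>2) \<circ> \<kappa>) p" if "p \<in> B \<times> B" for p
      using that less_imp_le[OF weight_pos[OF w, of "fst p" "snd p"]] by (auto simp: inv_\<kappa> power_mult_distrib)
  qed
  then have "(\<lambda>n. (?f n)\<^sup>2) summable_on UNIV"
    by (rule summable_on_cong_neutral[THEN iffD1, rotated 3]) auto
  then show ?thesis unfolding Jw_def by (intro Abs_ell2_inverse) simp
qed

lemma coord_Jw_\<kappa>:
  assumes "weight w" "R \<in> weighted w" "b \<in> B" "c \<in> B"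
  shows "coord (Jw w R) (\<kappa> (b, c)) = sqrt (w b c) * coef R b c"
  using assms(3,4) by (simp add: coord_Jw[OF assms(1,2)] inv_\<kappa>)

lemma coord_Jw_0:
  assumes "weight w" "R \<in> weighted w" "n \<notin> \<kappa> ` (B \<times> B)"
  shows "coord (Jw w R) n = 0"
  using assms(3) by (simp add: coord_Jw[OF assms(1,2)])

lemma inner_Jw_has_sum:
  assumes w: "weight w" and R: "R \<in> weighted w" and w': "weight w'" and S: "S \<in> weighted w'"
  shows "((\<lambda>(b, c). (sqrt (w b c) * sqrt (w' b c)) * (coef R b c * coef S b c)) has_sum inner (Jw w R) (Jw w' S)) (B \<times> B)"
  using coord_has_sum[OF coord_Jw_0[OF w R], of "Jw w' S"]
  by (rule has_sum_cong[THEN iffD1, rotated]) (auto simp: coord_Jw_\<kappa>[OF w R] coord_Jw_\<kappa>[OF w' S])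

lemma norm_Jw_has_sum:
  assumes w: "weight w" and R: "R \<in> weighted w"
  shows "((\<lambda>(b, c). w b c * (coef R b c)\<^sup>2) has_sum (norm (Jw w R))\<^sup>2) (B \<times> B)"
  using inner_Jw_has_sum[OF w R w R] unfolding power2_norm_eq_inner
  by (rule has_sum_cong[THEN iffD1, rotated])
     (use weight_pos[OF w] in \<open>auto simp: power2_eq_square less_imp_le\<close>)

text \<open>The required entries are square-summable over \<open>B \<times> B\<close>, so they
  belong to a Hilbert--Schmidt operator of V into itself; the Riesz map turns it into an operator
  into the dual.\<close>

lemma coef_Ew:
  assumes w: "weight w" and bc: "b \<in> B" "c \<in> B"
  shows "coef (Ew w x) b c = coord x (\<kappa> (b, c)) / sqrt (w b c)"
proof -
  obtain \<delta> where \<delta>: "\<delta> > 0" "\<And>b c. \<lbrakk>b \<in> B; c \<in> B\<rbrakk> \<Longrightarrow> \<delta> \<le> w b c" using w by (auto simp: weight_def)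
  have "(\<lambda>(b, c). (coord x (\<kappa> (b, c)) / sqrt (w b c))\<^sup>2) summable_on B \<times> B"
  proof (rule summable_on_nonneg_comparison[OF summable_on_cmult_right[OF coord_\<kappa>_summable[of x], of "1 / \<delta>"]])
    fix p assume p: "p \<in> B \<times> B"
    obtain b c where bc: "p = (b, c)" by (cases p)
    have b: "b \<in> B" "c \<in> B" using p bc by auto
    have "(coord x (\<kappa> (b, c)) / sqrt (w b c))\<^sup>2 = 1 / w b c * (coord x (\<kappa> (b, c)))\<^sup>2"
      using weight_pos[OF w b] by (simp add: power_divide)
    also have "\<dots> \<le> 1 / \<delta> * (coord x (\<kappa> (b, c)))\<^sup>2"
      using \<delta>(1) \<delta>(2)[OF b] by (intro mult_right_mono divide_left_mono) auto
    finally show "(case p of (b, c) \<Rightarrow> (coord x (\<kappa> (b, c)) / sqrt (w b c))\<^sup>2) \<le> 1 / \<delta> * (coord x (\<kappa> p))\<^sup>2"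
      by (simp add: bc)
  qed auto
  then obtain T :: "'v \<Rightarrow>\<^sub>L 'v" where
    T: "\<And>b c. \<lbrakk>b \<in> B; c \<in> B\<rbrakk> \<Longrightarrow> inner (blinfun_apply T b) c = coord x (\<kappa> (b, c)) / sqrt (w b c)"
    by (rule blinfun_with_matrix_families[OF famB famB]) blast
  have "\<forall>b\<in>B. \<forall>c\<in>B. coef (riesz_map o\<^sub>L T) b c = coord x (\<kappa> (b, c)) / sqrt (w b c)"
    using T by (simp add: coef_def riesz_map_apply inner_commute[of _ "blinfun_apply T _"])
  then have "\<forall>b\<in>B. \<forall>c\<in>B. coef (Ew w x) b c = coord x (\<kappa> (b, c)) / sqrt (w b c)"
    unfolding Ew_def by (rule someI[of "\<lambda>R. \<forall>b\<in>B. \<forall>c\<in>B. coef R b c = coord x (\<kappa> (b, c)) / sqrt (w b c)"])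
  then show ?thesis using bc by blast
qed

lemma Ew_mem:
  assumes w: "weight w"
  shows "Ew w x \<in> weighted w"
  unfolding weighted_def mem_Collect_eq
  using coord_\<kappa>_summable[of x]
proof (rule summable_on_cong[THEN iffD1, rotated])
  fix p assume "p \<in> B \<times> B"
  then obtain b c where bc: "p = (b, c)" "b \<in> B" "c \<in> B" by auto
  show "(coord x (\<kappa> p))\<^sup>2 = (case p of (b, c) \<Rightarrow> w b c * (coef (Ew w x) b c)\<^sup>2)"
    using weight_pos[OF w bc(2,3)] by (simp add: bc coef_Ew[OF w] power_divide)
qed

text \<open>The norm is a parameter so that \<open>normV\<close>, \<open>normH\<close> and
  \<open>normD\<close>, each defined in its own way, can be used once shown equal to the coordinate
  norm.\<close>

lemma hilbert_carrier_weighted: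
  assumes w: "weight w" and N: "\<And>R. R \<in> weighted w \<Longrightarrow> N R = norm (Jw w R)"
  shows "hilbert_carrier (weighted w) N (Jw w) (Ew w)"
proof
  have sq: "(\<lambda>p. (sqrt (w (fst p) (snd p)) * coef R (fst p) (snd p))\<^sup>2) summable_on B \<times> B \<longleftrightarrow> R \<in> weighted w" for R
    unfolding weighted_def mem_Collect_eq
    by (rule summable_on_cong) (use weight_pos[OF w] in \<open>auto simp: power_mult_distrib less_imp_le\<close>)
  have add: "R + S \<in> weighted w" if "R \<in> weighted w" "S \<in> weighted w" for R S
    using summable_on_squares_add[OF sq[THEN iffD2, OF that(1)] sq[THEN iffD2, OF that(2)]]
    unfolding sq[symmetric] by (simp add: coef_add distrib_left)
  have scale: "r *\<^sub>R R \<in> weighted w" if "R \<in> weighted w" for R r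
    using summable_on_squares_cmult[OF sq[THEN iffD2, OF that], of r]
    unfolding sq[symmetric] by (simp add: coef_scale mult.left_commute)
  show "subspace (weighted w)"
  proof (rule subspaceI)
    show "0 \<in> weighted w" by (simp add: weighted_def coef_def case_prod_unfold)
  qed (use add scale in auto)
  show "Ew w u \<in> weighted w" for u by (rule Ew_mem[OF w])
  show "Ew w (u + v) = Ew w u + Ew w v" for u v
    by (rule oper_eqI) (simp add: coef_Ew[OF w] coef_add plus_ell2.rep_eq add_divide_distrib)
  show "Ew w (c *\<^sub>R u) = c *\<^sub>R Ew w u" for c u
    by (rule oper_eqI) (simp add: coef_Ew[OF w] coef_scale scaleR_ell2.rep_eq)
  have J_eqI: "Jw w R = x" if R: "R \<in> weighted w" and 1: "\<And>b c. \<lbrakk>b \<in> B; c \<in> B\<rbrakk> \<Longrightarrow> coord x (\<kappa> (b, c)) = sqrt (w b c) * coef R b c"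
    and 2: "\<And>n. n \<notin> \<kappa> ` (B \<times> B) \<Longrightarrow> coord x n = 0" for R x
  proof (rule coord_inject[THEN iffD1], rule ext)
    fix n show "coord (Jw w R) n = coord x n"
    proof (cases "n \<in> \<kappa> ` (B \<times> B)")
      case True
      then obtain b c where bc: "n = \<kappa> (b, c)" "b \<in> B" "c \<in> B" by auto
      then show ?thesis by (simp add: 1 coord_Jw_\<kappa>[OF w R])
    qed (simp add: 2 coord_Jw_0[OF w R])
  qed
  show "Jw w (R + S) = Jw w R + Jw w S" if "R \<in> weighted w" "S \<in> weighted w" for R S
    using that by (intro J_eqI add) (auto simp: plus_ell2.rep_eq coord_Jw_0[OF w] coord_Jw_\<kappa>[OF w] coef_add distrib_left)
  show "Jw w (c *\<^sub>R R) = c *\<^sub>R Jw w R" if "R \<in> weighted w" for c R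
    using that by (intro J_eqI scale) (auto simp: scaleR_ell2.rep_eq coord_Jw_0[OF w] coord_Jw_\<kappa>[OF w] coef_scale)
  show "Ew w (Jw w R) = R" if R: "R \<in> weighted w" for R
  proof (rule oper_eqI)
    fix b c assume bc: "b \<in> B" "c \<in> B"
    show "coef (Ew w (Jw w R)) b c = coef R b c"
      using weight_pos[OF w bc] by (simp add: coef_Ew[OF w bc] coord_Jw_\<kappa>[OF w R bc])
  qed
  show "N R = norm (Jw w R)" if "R \<in> weighted w" for R by (rule N[OF that])
  show "norm (Jw w (Ew w u)) \<le> norm u" for u
  proof (rule norm_le_of_finite_sums)
    fix F :: "nat set" assume F: "finite F"
    have "(coord (Jw w (Ew w u)) n)\<^sup>2 \<le> (coord u n)\<^sup>2" for n
    proof (cases "n \<in> \<kappa> ` (B \<times> B)")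
      case True
      then obtain b c where bc: "n = \<kappa> (b, c)" "b \<in> B" "c \<in> B" by auto
      show ?thesis using weight_pos[OF w bc(2,3)]
        by (simp add: bc coord_Jw_\<kappa>[OF w Ew_mem[OF w]] coef_Ew[OF w])
    qed (simp add: coord_Jw_0[OF w Ew_mem[OF w]])
    then have "(\<Sum>n\<in>F. (coord (Jw w (Ew w u)) n)\<^sup>2) \<le> (\<Sum>n\<in>F. (coord u n)\<^sup>2)" by (intro sum_mono)
    also have "\<dots> \<le> (norm u)\<^sup>2" using F by (rule sum_coord_le_norm)
    finally show "(\<Sum>n\<in>F. (coord (Jw w (Ew w u)) n)\<^sup>2) \<le> (norm u)\<^sup>2" .
  qed simp
qed

text \<open>The projection only deletes coordinates outside the range of \<open>\<kappa>\<close>. In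
  particular it fixes vectors produced by \<open>Jw\<close> with a different weight.\<close>

lemma J_E_supported:
  assumes w: "weight w" and x: "\<And>n. n \<notin> \<kappa> ` (B \<times> B) \<Longrightarrow> coord x n = 0"
  shows "Jw w (Ew w x) = x"
proof (rule coord_inject[THEN iffD1], rule ext)
  fix n show "coord (Jw w (Ew w x)) n = coord x n"
  proof (cases "n \<in> \<kappa> ` (B \<times> B)")
    case True
    then obtain b c where bc: "n = \<kappa> (b, c)" "b \<in> B" "c \<in> B" by auto
    show ?thesis using weight_pos[OF w bc(2,3)]
      by (simp add: bc coord_Jw_\<kappa>[OF w Ew_mem[OF w]] coef_Ew[OF w])
  qed (simp add: coord_Jw_0[OF w Ew_mem[OF w]] x)
qed

lemma weight_mono:
  assumes "weight w" "k > 0" "\<And>b c. \<lbrakk>b \<in> B; c \<in> B\<rbrakk> \<Longrightarrow> k * w b c \<le> w' b c"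
  shows "weight w'"
proof -
  obtain \<delta> where \<delta>: "\<delta> > 0" "\<And>b c. \<lbrakk>b \<in> B; c \<in> B\<rbrakk> \<Longrightarrow> \<delta> \<le> w b c" using assms(1) by (auto simp: weight_def)
  have "k * \<delta> \<le> w' b c" if "b \<in> B" "c \<in> B" for b c
    using mult_left_mono[OF \<delta>(2)[OF that], of k] assms(2) assms(3)[OF that] by linarith
  then show ?thesis unfolding weight_def using \<delta>(1) assms(2) by (intro exI[of _ "k * \<delta>"]) auto
qed

text \<open>The added 1 keeps the bound positive even if V is trivial and the norm of
  \<open>j\<close> is zero; it reappears in the constants of the final estimates.\<close>

lemma \<nu>_sq: "b \<in> B \<Longrightarrow> 0 < (\<nu> b)\<^sup>2" "b \<in> B \<Longrightarrow> (\<nu> b)\<^sup>2 \<le> (norm j)\<^sup>2 + 1"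
proof -
  show "b \<in> B \<Longrightarrow> 0 < (\<nu> b)\<^sup>2" using \<nu>_pos[of b] by simp
  assume b: "b \<in> B"
  have "(\<nu> b)\<^sup>2 \<le> (norm j)\<^sup>2" using \<nu>_le[OF b] \<nu>_pos[OF b] by (intro power_mono) auto
  then show "(\<nu> b)\<^sup>2 \<le> (norm j)\<^sup>2 + 1" by simp
qed

lemma weight_D: "weight wD"
  unfolding weight_def
proof (intro exI[of _ "1 / (2 * ((norm j)\<^sup>2 + 1))"] conjI ballI)
  show "0 < 1 / (2 * ((norm j)\<^sup>2 + 1))" by (intro divide_pos_pos mult_pos_pos add_nonneg_pos) auto
  show "1 / (2 * ((norm j)\<^sup>2 + 1)) \<le> wD b c" if "b \<in> B" "c \<in> B" for b c
  proof -
    have "0 < (\<nu> b)\<^sup>2 + (\<nu> c)\<^sup>2" using \<nu>_sq(1)[OF that(1)] \<nu>_sq(1)[OF that(2)] by (rule add_pos_pos)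
    moreover have "(\<nu> b)\<^sup>2 + (\<nu> c)\<^sup>2 \<le> 2 * ((norm j)\<^sup>2 + 1)" using \<nu>_sq(2)[OF that(1)] \<nu>_sq(2)[OF that(2)] by simp
    ultimately show ?thesis unfolding wD_def by (intro frac_le) auto
  qed
qed

lemma inverse_sum_le:
  fixes x y K :: real
  assumes "0 < x" "0 < y" "x * y \<le> K * (x + y)"
  shows "1 / (x + y) \<le> K * (1 / (x * y))"
proof -
  have "1 \<le> K * (x + y) / (x * y)" using assms by (simp add: pos_le_divide_eq)
  then show ?thesis using assms by (simp add: pos_divide_le_eq)
qed

lemma wD_le_wH: "\<lbrakk>b \<in> B; c \<in> B\<rbrakk> \<Longrightarrow> wD b c \<le> ((norm j)\<^sup>2 + 1) * wH b c"
proof -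
  assume bc: "b \<in> B" "c \<in> B"
  note n = \<nu>_sq[OF bc(1)] \<nu>_sq[OF bc(2)]
  have "(\<nu> b)\<^sup>2 * (\<nu> c)\<^sup>2 \<le> ((norm j)\<^sup>2 + 1) * ((\<nu> b)\<^sup>2 + (\<nu> c)\<^sup>2)"
    using n by (intro mult_mono) auto
  then show ?thesis using n unfolding wD_def wH_def by (intro inverse_sum_le) auto
qed

lemma wH_le_wV: "\<lbrakk>b \<in> B; c \<in> B\<rbrakk> \<Longrightarrow> wH b c \<le> (((norm j)\<^sup>2 + 1) / 2) * wV b c"
proof -
  assume bc: "b \<in> B" "c \<in> B"
  have n: "0 < (\<nu> b)\<^sup>2" "0 < (\<nu> c)\<^sup>2" "(\<nu> b)\<^sup>2 \<le> (norm j)\<^sup>2 + 1" "(\<nu> c)\<^sup>2 \<le> (norm j)\<^sup>2 + 1"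
    using \<nu>_sq[OF bc(1)] \<nu>_sq[OF bc(2)] by auto
  have "1 \<le> ((norm j)\<^sup>2 + 1) / (\<nu> b)\<^sup>2" "1 \<le> ((norm j)\<^sup>2 + 1) / (\<nu> c)\<^sup>2"
    using n by simp_all
  then have "1 \<le> (((norm j)\<^sup>2 + 1) / 2) * (1 / (\<nu> b)\<^sup>2 + 1 / (\<nu> c)\<^sup>2)" by (simp add: field_simps)
  moreover have "0 \<le> wH b c" by (simp add: wH_def)
  ultimately have "1 * wH b c \<le> ((((norm j)\<^sup>2 + 1) / 2) * (1 / (\<nu> b)\<^sup>2 + 1 / (\<nu> c)\<^sup>2)) * wH b c"
    by (rule mult_right_mono)
  then show ?thesis by (simp add: wV_def mult_ac)
qed

lemma weight_H: "weight wH"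
proof (rule weight_mono[OF weight_D, of "1 / ((norm j)\<^sup>2 + 1)"])
  have k: "0 < (norm j)\<^sup>2 + 1" by (intro add_nonneg_pos) auto
  then show "0 < 1 / ((norm j)\<^sup>2 + 1)" by simp
  show "1 / ((norm j)\<^sup>2 + 1) * wD b c \<le> wH b c" if "b \<in> B" "c \<in> B" for b c
    using wD_le_wH[OF that] k by (simp add: field_simps)
qed

lemma weight_V: "weight wV"
proof (rule weight_mono[OF weight_H, of "2 / ((norm j)\<^sup>2 + 1)"])
  have k: "0 < (norm j)\<^sup>2 + 1" by (intro add_nonneg_pos) auto
  then show "0 < 2 / ((norm j)\<^sup>2 + 1)" by simp
  show "2 / ((norm j)\<^sup>2 + 1) * wH b c \<le> wV b c" if "b \<in> B" "c \<in> B" for b c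
    using wH_le_wV[OF that] k by (simp add: field_simps)
qed

lemma weighted_mono:
  assumes "weight w" "weight w'" "k \<ge> 0" and le: "\<And>b c. \<lbrakk>b \<in> B; c \<in> B\<rbrakk> \<Longrightarrow> w' b c \<le> k * w b c" and R: "R \<in> weighted w"
  shows "R \<in> weighted w'" "(norm (Jw w' R))\<^sup>2 \<le> k * (norm (Jw w R))\<^sup>2"
proof -
  have hs: "((\<lambda>(b, c). k * (w b c * (coef R b c)\<^sup>2)) has_sum k * (norm (Jw w R))\<^sup>2) (B \<times> B)"
    using has_sum_cmult_right[OF norm_Jw_has_sum[OF assms(1) R], of k] by (simp add: case_prod_unfold)
  have le': "w' b c * (coef R b c)\<^sup>2 \<le> k * (w b c * (coef R b c)\<^sup>2)" if "b \<in> B" "c \<in> B" for b c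
    using mult_right_mono[OF le[OF that], of "(coef R b c)\<^sup>2"] by (simp add: mult.assoc)
  have "(\<lambda>(b, c). w' b c * (coef R b c)\<^sup>2) summable_on B \<times> B"
    by (rule summable_on_nonneg_comparison[OF has_sum_imp_summable[OF hs]])
       (use le' weight_pos[OF assms(2)] in \<open>auto simp: less_imp_le\<close>)
  then show R': "R \<in> weighted w'" by (simp add: weighted_def)
  show "(norm (Jw w' R))\<^sup>2 \<le> k * (norm (Jw w R))\<^sup>2"
    by (rule has_sum_mono[OF norm_Jw_has_sum[OF assms(2) R'] hs]) (use le' in auto)
qed

lemma opH_eq: "opH j = weighted wH"
  unfolding opH_def using hs_HH_iff from_HH_surj by (auto elim!: from_HH_surj)

lemma weighted_add_iff:
  assumes "\<And>b c. \<lbrakk>b \<in> B; c \<in> B\<rbrakk> \<Longrightarrow> 0 \<le> w b c" "\<And>b c. \<lbrakk>b \<in> B; c \<in> B\<rbrakk> \<Longrightarrow> 0 \<le> w' b c"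
  shows "R \<in> weighted (\<lambda>b c. w b c + w' b c) \<longleftrightarrow> R \<in> weighted w \<and> R \<in> weighted w'"
proof (intro iffI conjI)
  assume R: "R \<in> weighted w \<and> R \<in> weighted w'"
  then show "R \<in> weighted (\<lambda>b c. w b c + w' b c)"
    using summable_on_add[of "\<lambda>(b, c). w b c * (coef R b c)\<^sup>2" "B \<times> B" "\<lambda>(b, c). w' b c * (coef R b c)\<^sup>2"]
    by (simp add: weighted_def case_prod_unfold distrib_right)
next
  assume R: "R \<in> weighted (\<lambda>b c. w b c + w' b c)"
  show "R \<in> weighted w" "R \<in> weighted w'"
    unfolding weighted_def mem_Collect_eq
    by (rule summable_on_nonneg_comparison[OF R[unfolded weighted_def mem_Collect_eq]];
        use assms in \<open>auto intro: mult_right_mono\<close>)+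
qed

lemma wV_eq: "wV = (\<lambda>b c. wH b c / (\<nu> b)\<^sup>2 + wH b c / (\<nu> c)\<^sup>2)"
  by (intro ext) (simp add: wV_def algebra_simps)

lemma opV_iff: "R \<in> opV j \<longleftrightarrow> R \<in> weighted (\<lambda>b c. wH b c / (\<nu> b)\<^sup>2) \<and> R \<in> weighted (\<lambda>b c. wH b c / (\<nu> c)\<^sup>2)"
  unfolding opV_def using hs_DH_iff hs_HV_iff by (auto elim!: from_DH_surj from_HV_surj)

lemma opV_eq: "opV j = weighted wV"
proof (rule set_eqI)
  fix R
  have "R \<in> weighted wV \<longleftrightarrow> R \<in> weighted (\<lambda>b c. wH b c / (\<nu> b)\<^sup>2) \<and> R \<in> weighted (\<lambda>b c. wH b c / (\<nu> c)\<^sup>2)"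
    unfolding wV_eq by (rule weighted_add_iff) (simp_all add: wH_def)
  then show "R \<in> opV j \<longleftrightarrow> R \<in> weighted wV" by (simp only: opV_iff)
qed

lemma opH_cases:
  assumes "R \<in> opH j" obtains T where "R = from_HH j T" "hilbert_schmidt T" "as_HH j R = T"
  using assms by (auto simp: opH_def as_HH_from_HH)

lemma opV_cases:
  assumes "R \<in> opV j"
  obtains T U where "R = from_HV j T" "hilbert_schmidt T" "as_HV j R = T"
    "R = from_DH j U" "hilbert_schmidt U" "as_DH j R = U"
proof -
  obtain T where T: "R = from_HV j T" "hilbert_schmidt T" using assms by (auto simp: opV_def)
  obtain U where U: "R = from_DH j U" "hilbert_schmidt U" using assms by (auto simp: opV_def)
  have "as_HV j R = T" "as_DH j R = U"
    unfolding T(1) as_HV_from_HV using U(1) as_DH_from_DH by (simp_all only: T(1)[symmetric])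
  with T U show ?thesis using that by blast
qed

lemma innerH_eq:
  assumes R: "R \<in> opH j" and S: "S \<in> opH j"
  shows "innerH j R S = inner (Jw wH R) (Jw wH S)"
proof -
  obtain T where T: "R = from_HH j T" "hilbert_schmidt T" "as_HH j R = T" using R by (rule opH_cases)
  obtain U where U: "S = from_HH j U" "hilbert_schmidt U" "as_HH j S = U" using S by (rule opH_cases)
  have 1: "((\<lambda>(b, c). inner (blinfun_apply T (hb b)) (hb c) * inner (blinfun_apply U (hb b)) (hb c)) has_sum hs_inner T U) (B \<times> B)"
    by (rule hs_inner_families[OF famH famH T(2) U(2)])
  have "((\<lambda>(b, c). (sqrt (wH b c) * sqrt (wH b c)) * (coef R b c * coef S b c)) has_sum inner (Jw wH R) (Jw wH S)) (B \<times> B)"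
    using R S unfolding opH_eq by (intro inner_Jw_has_sum weight_H)
  then have "((\<lambda>(b, c). inner (blinfun_apply T (hb b)) (hb c) * inner (blinfun_apply U (hb b)) (hb c)) has_sum inner (Jw wH R) (Jw wH S)) (B \<times> B)"
  proof (rule has_sum_cong[THEN iffD1, rotated])
    fix p assume "p \<in> B \<times> B"
    then obtain b c where bc: "p = (b, c)" "b \<in> B" "c \<in> B" by auto
    show "(case p of (b, c) \<Rightarrow> sqrt (wH b c) * sqrt (wH b c) * (coef R b c * coef S b c)) =
        (case p of (b, c) \<Rightarrow> inner (blinfun_apply T (hb b)) (hb c) * inner (blinfun_apply U (hb b)) (hb c))"
      using \<nu>_pos[OF bc(2)] \<nu>_pos[OF bc(3)]
      by (simp add: bc T(1) U(1) coef_from_HH wH_def power2_eq_square)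
  qed
  with 1 show ?thesis unfolding innerH_def T(3) U(3) by (rule has_sum_unique)
qed

lemma normH_eq: "R \<in> opH j \<Longrightarrow> normH j R = norm (Jw wH R)"
  by (simp add: normH_def innerH_eq norm_eq_sqrt_inner)

lemma hs_HV_has_sum:
  assumes "hilbert_schmidt T"
  shows "((\<lambda>(b, c). wH b c / (\<nu> c)\<^sup>2 * (coef (from_HV j T) b c)\<^sup>2) has_sum hs_inner T T) (B \<times> B)"
  using hs_inner_families[OF famH famB assms assms]
proof (rule has_sum_cong[THEN iffD1, rotated])
  fix p assume "p \<in> B \<times> B"
  then obtain b c where bc: "p = (b, c)" "b \<in> B" "c \<in> B" by auto
  show "(case p of (b, c) \<Rightarrow> inner (blinfun_apply T (hb b)) c * inner (blinfun_apply T (hb b)) c) =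
      (case p of (b, c) \<Rightarrow> wH b c / (\<nu> c)\<^sup>2 * (coef (from_HV j T) b c)\<^sup>2)"
    using \<nu>_pos[OF bc(2)] \<nu>_pos[OF bc(3)] by (simp add: bc coef_from_HV wH_def power2_eq_square)
qed

lemma hs_DH_has_sum:
  assumes "hilbert_schmidt T"
  shows "((\<lambda>(b, c). wH b c / (\<nu> b)\<^sup>2 * (coef (from_DH j T) b c)\<^sup>2) has_sum hs_inner T T) (B \<times> B)"
proof -
  have r: "hilbert_schmidt (T o\<^sub>L riesz_map)"
    using assms by (simp add: hilbert_schmidt_dual_domain[OF onb_B onb_familyD(2)[OF famH]])
  show ?thesis
    using hs_inner_families[OF famB famH r r]
    unfolding hs_inner_dual_domain[OF onb_B onb_familyD(2)[OF famH] assms assms, symmetric]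
  proof (rule has_sum_cong[THEN iffD1, rotated])
    fix p assume "p \<in> B \<times> B"
    then obtain b c where bc: "p = (b, c)" "b \<in> B" "c \<in> B" by auto
    show "(case p of (b, c) \<Rightarrow> inner (blinfun_apply (T o\<^sub>L riesz_map) b) (hb c) * inner (blinfun_apply (T o\<^sub>L riesz_map) b) (hb c)) =
        (case p of (b, c) \<Rightarrow> wH b c / (\<nu> b)\<^sup>2 * (coef (from_DH j T) b c)\<^sup>2)"
      using \<nu>_pos[OF bc(2)] \<nu>_pos[OF bc(3)]
      by (simp add: bc coef_from_DH wH_def power2_eq_square del: blinfun_apply_blinfun_compose)
  qed
qed

lemma normV_eq:
  assumes R: "R \<in> opV j"
  shows "normV j R = norm (Jw wV R)"
proof -
  obtain T U where T: "R = from_HV j T" "hilbert_schmidt T" "as_HV j R = T"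
    and U: "R = from_DH j U" "hilbert_schmidt U" "as_DH j R = U" using R by (rule opV_cases)
  have "((\<lambda>(b, c). wH b c / (\<nu> b)\<^sup>2 * (coef R b c)\<^sup>2 + wH b c / (\<nu> c)\<^sup>2 * (coef R b c)\<^sup>2)
      has_sum hs_inner U U + hs_inner T T) (B \<times> B)"
    using has_sum_add[OF hs_DH_has_sum[OF U(2)] hs_HV_has_sum[OF T(2)]]
    by (simp add: case_prod_unfold T(1)[symmetric] U(1)[symmetric])
  then have "((\<lambda>(b, c). wV b c * (coef R b c)\<^sup>2) has_sum hs_inner U U + hs_inner T T) (B \<times> B)"
    by (simp add: wV_eq distrib_right)
  moreover have "((\<lambda>(b, c). wV b c * (coef R b c)\<^sup>2) has_sum (norm (Jw wV R))\<^sup>2) (B \<times> B)"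
    using R by (intro norm_Jw_has_sum weight_V) (simp add: opV_eq)
  ultimately have "hs_inner U U + hs_inner T T = (norm (Jw wV R))\<^sup>2" by (rule has_sum_unique)
  then show ?thesis by (simp add: normV_def innerV_def T(3) U(3))
qed

lemma weighted_mono_set:
  assumes "\<And>b c. \<lbrakk>b \<in> B; c \<in> B\<rbrakk> \<Longrightarrow> 0 \<le> w' b c" "\<And>b c. \<lbrakk>b \<in> B; c \<in> B\<rbrakk> \<Longrightarrow> w' b c * (coef S b c)\<^sup>2 \<le> w b c * (coef R b c)\<^sup>2"
    and R: "R \<in> weighted w"
  shows "S \<in> weighted w'"
  unfolding weighted_def mem_Collect_eq
  by (rule summable_on_nonneg_comparison[OF R[unfolded weighted_def mem_Collect_eq]]) (use assms in auto)

lemma wD_le: "\<lbrakk>b \<in> B; c \<in> B\<rbrakk> \<Longrightarrow> wD b c \<le> 1 / (\<nu> b)\<^sup>2" "\<lbrakk>b \<in> B; c \<in> B\<rbrakk> \<Longrightarrow> wD b c \<le> 1 / (\<nu> c)\<^sup>2"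
  "0 \<le> wD b c"
  unfolding wD_def using \<nu>_sq(1) by (auto intro!: frac_le)

lemma opD_eq: "opD j = weighted wD"
proof (intro equalityI subsetI)
  fix R assume "R \<in> opD j"
  then obtain K L where KL: "R = from_VH j K + from_HD j L" "hilbert_schmidt K" "hilbert_schmidt L"
    by (auto simp: opD_def)
  have 1: "from_VH j K \<in> weighted wD"
    by (rule weighted_mono_set[OF _ _ KL(2)[unfolded hs_VH_iff]])
       (rule wD_le(3), rule mult_right_mono[OF wD_le(2)], simp_all)
  have 2: "from_HD j L \<in> weighted wD"
    by (rule weighted_mono_set[OF _ _ KL(3)[unfolded hs_HD_iff]])
       (rule wD_le(3), rule mult_right_mono[OF wD_le(1)], simp_all)
  interpret hilbert_carrier "weighted wD" "\<lambda>R. norm (Jw wD R)" "Jw wD" "Ew wD"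
    by (rule hilbert_carrier_weighted[OF weight_D]) simp
  show "R \<in> weighted wD" unfolding KL(1) by (rule X_add[OF 1 2])
next
  fix R assume R: "R \<in> weighted wD"
  \<comment> \<open>The fraction of the squared \<open>\<nu>\<close> of the column in the sum of
    both squares.\<close>
  define t where "t b c = (\<nu> c)\<^sup>2 * wD b c" for b c
  have wt: "weight wD" by (rule weight_D)
  have pos: "0 < wD b c" "0 < (\<nu> b)\<^sup>2" "0 < (\<nu> c)\<^sup>2" if "b \<in> B" "c \<in> B" for b c
    using weight_pos[OF wt that] \<nu>_sq that by auto
  define x where "x = Abs_ell2 (\<lambda>n. if n \<in> \<kappa> ` (B \<times> B) then case inv_into (B \<times> B) \<kappa> n of (b, c) \<Rightarrow> t b c * coord (Jw wD R) n else 0)"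
  have t01: "0 \<le> t b c" "t b c \<le> 1" if "b \<in> B" "c \<in> B" for b c
    using pos[OF that] add_pos_pos[OF pos(2,3)[OF that]] unfolding t_def wD_def
    by (simp_all only: times_divide_eq_right mult_1_right pos_divide_le_eq) (auto intro: divide_nonneg_pos)
  have "(\<lambda>n. (if n \<in> \<kappa> ` (B \<times> B) then case inv_into (B \<times> B) \<kappa> n of (b, c) \<Rightarrow> t b c * coord (Jw wD R) n else 0)\<^sup>2) summable_on UNIV"
  proof (rule summable_on_nonneg_comparison[OF coord_summable[of "Jw wD R"]])
    fix n
    show "(if n \<in> \<kappa> ` (B \<times> B) then case inv_into (B \<times> B) \<kappa> n of (b, c) \<Rightarrow> t b c * coord (Jw wD R) n else 0)\<^sup>2
        \<le> (coord (Jw wD R) n)\<^sup>2"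
    proof (cases "n \<in> \<kappa> ` (B \<times> B)")
      case True
      then obtain b c where bc: "n = \<kappa> (b, c)" "b \<in> B" "c \<in> B" by auto
      have "(t b c)\<^sup>2 \<le> 1" using t01[OF bc(2,3)] by (intro power_le_one) auto
      then show ?thesis using bc mult_right_mono[of "(t b c)\<^sup>2" 1 "(coord (Jw wD R) n)\<^sup>2"]
        by (simp add: inv_\<kappa> power_mult_distrib)
    qed simp
  qed simp
  then have cx: "coord x = (\<lambda>n. if n \<in> \<kappa> ` (B \<times> B) then case inv_into (B \<times> B) \<kappa> n of (b, c) \<Rightarrow> t b c * coord (Jw wD R) n else 0)"
    unfolding x_def by (intro Abs_ell2_inverse) simp
  define S where "S = Ew wD x"
  have cS: "coef S b c = t b c * coef R b c" if "b \<in> B" "c \<in> B" for b c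
    using that pos[OF that] by (simp add: S_def coef_Ew[OF wt] cx inv_\<kappa> coord_Jw_\<kappa>[OF wt R])
  have "S \<in> weighted (\<lambda>b c. 1 / (\<nu> c)\<^sup>2)"
  proof (rule weighted_mono_set[OF _ _ R])
    fix b c assume bc: "b \<in> B" "c \<in> B"
    have "1 / (\<nu> c)\<^sup>2 * (t b c)\<^sup>2 = wD b c * t b c" using pos[OF bc] by (simp add: t_def power2_eq_square)
    also have "\<dots> \<le> wD b c * 1" using t01[OF bc] pos[OF bc] by (intro mult_left_mono) auto
    finally show "1 / (\<nu> c)\<^sup>2 * (coef S b c)\<^sup>2 \<le> wD b c * (coef R b c)\<^sup>2"
      using mult_right_mono[of "1 / (\<nu> c)\<^sup>2 * (t b c)\<^sup>2" "wD b c" "(coef R b c)\<^sup>2"] by (simp add: cS[OF bc] power_mult_distrib mult.assoc)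
  qed simp
  then obtain K where K: "S = from_VH j K" "hilbert_schmidt K" by (rule from_VH_surj)
  have "R - S \<in> weighted (\<lambda>b c. 1 / (\<nu> b)\<^sup>2)"
  proof (rule weighted_mono_set[OF _ _ R])
    fix b c assume bc: "b \<in> B" "c \<in> B"
    have u: "1 - t b c = (\<nu> b)\<^sup>2 * wD b c"
      using pos[OF bc] by (simp add: t_def wD_def field_simps)
    have c: "coef (R - S) b c = ((\<nu> b)\<^sup>2 * wD b c) * coef R b c"
      unfolding u[symmetric] by (simp add: coef_diff cS[OF bc] left_diff_distrib)
    have "1 / (\<nu> b)\<^sup>2 * ((\<nu> b)\<^sup>2 * wD b c)\<^sup>2 = wD b c * (1 - t b c)"
      using pos[OF bc] by (simp add: u power2_eq_square)
    also have "\<dots> \<le> wD b c * 1" using t01[OF bc] pos[OF bc] by (intro mult_left_mono) auto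
    finally show "1 / (\<nu> b)\<^sup>2 * (coef (R - S) b c)\<^sup>2 \<le> wD b c * (coef R b c)\<^sup>2"
      using mult_right_mono[of "1 / (\<nu> b)\<^sup>2 * ((\<nu> b)\<^sup>2 * wD b c)\<^sup>2" "wD b c" "(coef R b c)\<^sup>2"]
      unfolding c by (simp add: power_mult_distrib mult.assoc)
  qed simp
  then obtain L where L: "R - S = from_HD j L" "hilbert_schmidt L" by (rule from_HD_surj)
  have "R = from_VH j K + from_HD j L" using K(1) L(1) by (simp add: algebra_simps)
  then show "R \<in> opD j" using K(2) L(2) unfolding opD_def by blast
qed

text \<open>The value does not depend on the decomposition of \<open>R\<close>: each summand contributes its own
  coefficients, weighted by \<open>wH\<close>.\<close>

lemma pairing_has_sum:
  assumes R: "R \<in> opD j" and S: "S \<in> opV j"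
  shows "((\<lambda>(b, c). wH b c * (coef R b c * coef S b c)) has_sum pairing j R S) (B \<times> B)"
proof -
  obtain T U where T: "S = from_HV j T" "hilbert_schmidt T" "as_HV j S = T"
    and U: "S = from_DH j U" "hilbert_schmidt U" "as_DH j S = U" using S by (rule opV_cases)
  define val where "val K L = (\<Sum>\<^sub>\<infinity>e\<in>some_basis. inner (blinfun_apply K e) (blinfun_apply (as_DH j S) (blinfun_inner_left e)))
       + (\<Sum>\<^sub>\<infinity>e\<in>some_basis. blinfun_apply (blinfun_apply L e) (blinfun_apply (as_HV j S) e))" for K L
  have val: "((\<lambda>(b, c). wH b c * (coef R b c * coef S b c)) has_sum val K L) (B \<times> B)"
    if KL: "hilbert_schmidt K" "hilbert_schmidt L" "R = from_VH j K + from_HD j L" for K L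
  proof -
    have U': "hilbert_schmidt (U o\<^sub>L riesz_map)"
      using U(2) by (simp add: hilbert_schmidt_dual_domain[OF onb_B onb_familyD(2)[OF famH]])
    have L': "hilbert_schmidt (riesz_inv o\<^sub>L L)" using KL(2) by (simp flip: hilbert_schmidt_dual_range)
    have v: "val K L = hs_inner K (U o\<^sub>L riesz_map) + hs_inner (riesz_inv o\<^sub>L L) T"
      by (simp add: val_def hs_inner_def U(3) T(3) riesz_map_apply)
    have "((\<lambda>(b, c). inner (blinfun_apply K b) (hb c) * inner (blinfun_apply (U o\<^sub>L riesz_map) b) (hb c)
        + inner (blinfun_apply (riesz_inv o\<^sub>L L) (hb b)) c * inner (blinfun_apply T (hb b)) c) has_sum val K L) (B \<times> B)"
      unfolding v
      using has_sum_add[OF hs_inner_families[OF famB famH KL(1) U'] hs_inner_families[OF famH famB L' T(2)]]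
      by (simp add: case_prod_unfold)
    then show ?thesis
    proof (rule has_sum_cong[THEN iffD1, rotated])
      fix p assume "p \<in> B \<times> B"
      then obtain b c where bc: "p = (b, c)" "b \<in> B" "c \<in> B" by auto
      have n: "\<nu> b \<noteq> 0" "\<nu> c \<noteq> 0" using \<nu>_pos bc(2,3) by force+
      have k: "inner (blinfun_apply K b) (hb c) = coef (from_VH j K) b c / \<nu> c"
        using n by (simp add: coef_from_VH bc)
      have l: "inner (blinfun_apply (riesz_inv o\<^sub>L L) (hb b)) c = coef (from_HD j L) b c / \<nu> b"
        using n by (simp add: coef_from_HD bc del: blinfun_apply_blinfun_compose)
      have u: "inner (blinfun_apply (U o\<^sub>L riesz_map) b) (hb c) = coef S b c / ((\<nu> b)\<^sup>2 * \<nu> c)"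
        using n by (simp add: U(1) coef_from_DH bc del: blinfun_apply_blinfun_compose)
      have t: "inner (blinfun_apply T (hb b)) c = coef S b c / (\<nu> b * (\<nu> c)\<^sup>2)"
        using n by (simp add: T(1) coef_from_HV bc)
      show "(case p of (b, c) \<Rightarrow> inner (blinfun_apply K b) (hb c) * inner (blinfun_apply (U o\<^sub>L riesz_map) b) (hb c)
          + inner (blinfun_apply (riesz_inv o\<^sub>L L) (hb b)) c * inner (blinfun_apply T (hb b)) c)
        = (case p of (b, c) \<Rightarrow> wH b c * (coef R b c * coef S b c))"
        unfolding bc(1) prod.case k l u t KL(3) coef_add using n
        by (simp add: wH_def power2_eq_square field_simps)
    qed
  qed
  obtain K L where KL: "hilbert_schmidt K" "hilbert_schmidt L" "R = from_VH j K + from_HD j L"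
    using R by (auto simp: opD_def)
  have "pairing j R S = val K L"
    unfolding pairing_def val_def[symmetric]
    by (rule the_equality) (use KL val has_sum_unique in blast)+
  with val[OF KL] show ?thesis by simp
qed

text \<open>The identity behind the duality: the pairing becomes the plain inner product in
  \<open>ell2\<close> of the D-coordinates of one operator with the V-coordinates of the
  other.\<close>

lemma sqrt_wD_wV: "\<lbrakk>b \<in> B; c \<in> B\<rbrakk> \<Longrightarrow> sqrt (wD b c) * sqrt (wV b c) = wH b c"
proof -
  assume bc: "b \<in> B" "c \<in> B"
  have n: "0 < (\<nu> b)\<^sup>2" "0 < (\<nu> c)\<^sup>2" using \<nu>_sq bc by auto
  have e: "1 / (\<nu> b)\<^sup>2 + 1 / (\<nu> c)\<^sup>2 = ((\<nu> b)\<^sup>2 + (\<nu> c)\<^sup>2) * wH b c"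
    using n by (simp add: wH_def field_simps)
  have "wD b c * wV b c = (wH b c)\<^sup>2"
  proof -
    obtain x where x: "x = (\<nu> b)\<^sup>2 + (\<nu> c)\<^sup>2" "x > 0" using add_pos_pos[OF n] by blast
    then show ?thesis unfolding wV_def e wD_def x(1)[symmetric] by (simp add: power2_eq_square)
  qed
  moreover have "0 \<le> wH b c" by (simp add: wH_def)
  ultimately show ?thesis by (simp flip: real_sqrt_mult)
qed

lemma inner_JD_JV_has_sum:
  assumes "R \<in> opD j" "S \<in> opV j"
  shows "((\<lambda>(b, c). wH b c * (coef R b c * coef S b c)) has_sum inner (Jw wD R) (Jw wV S)) (B \<times> B)"
  using inner_Jw_has_sum[OF weight_D assms(1)[unfolded opD_eq] weight_V assms(2)[unfolded opV_eq]]
  by (rule has_sum_cong[THEN iffD1, rotated]) (auto simp: sqrt_wD_wV)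

lemma pairing_eq:
  assumes "R \<in> opD j" "S \<in> opV j"
  shows "pairing j R S = inner (Jw wD R) (Jw wV S)"
  using pairing_has_sum[OF assms] inner_JD_JV_has_sum[OF assms] by (rule has_sum_unique)

text \<open>The supremum is attained: the normalized D-coordinates of \<open>R\<close>, read as
  V-coordinates, belong to an operator of norm at most 1 for which Cauchy--Schwarz is an
  equality.\<close>

lemma normD_eq:
  assumes R: "R \<in> opD j"
  shows "normD j R = norm (Jw wD R)"
  unfolding normD_def
proof (rule cSup_eq_maximum)
  let ?x = "Jw wD R"
  \<comment> \<open>For \<open>R\<close> of norm zero the division gives 0, so \<open>S\<close> has
    norm 0 and the equality still holds.\<close>
  define S where "S = Ew wV ((1 / norm ?x) *\<^sub>R ?x)"
  have S: "S \<in> opV j" unfolding S_def opV_eq by (rule Ew_mem[OF weight_V])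
  have JS: "Jw wV S = (1 / norm ?x) *\<^sub>R ?x"
    unfolding S_def using R by (intro J_E_supported[OF weight_V]) (simp add: scaleR_ell2.rep_eq coord_Jw_0[OF weight_D] opD_eq)
  have "inner ?x ((1 / norm ?x) *\<^sub>R ?x) = norm ?x"
    by (simp add: power2_norm_eq_inner[symmetric] power2_eq_square)
  then have "norm ?x = \<bar>pairing j R S\<bar>" by (simp add: pairing_eq[OF R S] JS)
  moreover have "normV j S \<le> 1" by (simp add: normV_eq[OF S] JS)
  ultimately show "norm ?x \<in> (\<lambda>S. \<bar>pairing j R S\<bar>) ` {S \<in> opV j. normV j S \<le> 1}" using S by blast
next
  fix y assume "y \<in> (\<lambda>S. \<bar>pairing j R S\<bar>) ` {S \<in> opV j. normV j S \<le> 1}"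
  then obtain S where S: "S \<in> opV j" "normV j S \<le> 1" "y = \<bar>pairing j R S\<bar>" by auto
  have "\<bar>inner (Jw wD R) (Jw wV S)\<bar> \<le> norm (Jw wD R) * norm (Jw wV S)" by (rule Cauchy_Schwarz_ineq2)
  also have "\<dots> \<le> norm (Jw wD R) * 1" using S(2) by (intro mult_left_mono) (auto simp: normV_eq[OF S(1)])
  finally show "y \<le> norm (Jw wD R)" by (simp add: S(3) pairing_eq[OF R S(1)])
qed

section \<open>The embeddings between the three spaces, and self-adjoint operators\<close>

abbreviation "JV \<equiv> Jw wV"
abbreviation "JH \<equiv> Jw wH"
abbreviation "JD \<equiv> Jw wD"

lemma carrier_V: "hilbert_carrier (opV j) (normV j) JV (Ew wV)"
  unfolding opV_eq by (rule hilbert_carrier_weighted[OF weight_V]) (simp add: normV_eq flip: opV_eq)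
lemma carrier_H: "hilbert_carrier (opH j) (normH j) JH (Ew wH)"
  unfolding opH_eq by (rule hilbert_carrier_weighted[OF weight_H]) (simp add: normH_eq flip: opH_eq)
lemma carrier_D: "hilbert_carrier (opD j) (normD j) JD (Ew wD)"
  unfolding opD_eq by (rule hilbert_carrier_weighted[OF weight_D]) (simp add: normD_eq flip: opD_eq)

lemma norm_j_sq1: "0 < (norm j)\<^sup>2 + 1"
  by (intro add_nonneg_pos) auto

lemma opV_subset_opH: "opV j \<subseteq> opH j"
  and opH_subset_opD: "opH j \<subseteq> opD j"
  and norm_JD_le_JH: "R \<in> opH j \<Longrightarrow> norm (JD R) \<le> sqrt ((norm j)\<^sup>2 + 1) * norm (JH R)"
proof -
  show "opV j \<subseteq> opH j" unfolding opV_eq opH_eq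
    using weighted_mono(1)[OF weight_V weight_H _ wH_le_wV] norm_j_sq1 by auto
  show "opH j \<subseteq> opD j" unfolding opD_eq opH_eq
    using weighted_mono(1)[OF weight_H weight_D _ wD_le_wH] norm_j_sq1 by auto
  assume "R \<in> opH j"
  then have "(norm (JD R))\<^sup>2 \<le> ((norm j)\<^sup>2 + 1) * (norm (JH R))\<^sup>2"
    unfolding opH_eq using weighted_mono(2)[OF weight_H weight_D _ wD_le_wH] norm_j_sq1 by auto
  from real_sqrt_le_mono[OF this] show "norm (JD R) \<le> sqrt ((norm j)\<^sup>2 + 1) * norm (JH R)"
    by (simp add: real_sqrt_mult)
qed

text \<open>The factor 1/2 arises because \<open>wV\<close> has two summands, each at least
  \<open>wH\<close> divided by \<open>C^2\<close>.\<close>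

lemma norm_JH_le_JV:
  assumes C: "\<And>v. norm (blinfun_apply j v) \<le> C * norm v" and R: "R \<in> opV j"
  shows "(norm (JH R))\<^sup>2 \<le> (C\<^sup>2 / 2) * (norm (JV R))\<^sup>2"
proof (rule weighted_mono(2)[OF weight_V weight_H _ _ R[unfolded opV_eq]])
  have le: "(\<nu> b)\<^sup>2 \<le> C\<^sup>2" if "b \<in> B" for b
    using C[of b] \<nu>_pos[OF that] orthonormal_inner[OF onb_orthonormal[OF onb_B] that that]
    by (intro power_mono) (auto simp: \<nu>_def norm_eq_sqrt_inner)
  show "wH b c \<le> C\<^sup>2 / 2 * wV b c" if bc: "b \<in> B" "c \<in> B" for b c
  proof -
    have "1 \<le> C\<^sup>2 / (\<nu> b)\<^sup>2" "1 \<le> C\<^sup>2 / (\<nu> c)\<^sup>2"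
      using le \<nu>_sq(1) bc by simp_all
    then have "1 \<le> C\<^sup>2 / 2 * (1 / (\<nu> b)\<^sup>2 + 1 / (\<nu> c)\<^sup>2)" by (simp add: field_simps)
    moreover have "0 \<le> wH b c" by (simp add: wH_def)
    ultimately have "1 * wH b c \<le> (C\<^sup>2 / 2 * (1 / (\<nu> b)\<^sup>2 + 1 / (\<nu> c)\<^sup>2)) * wH b c"
      by (rule mult_right_mono)
    then show ?thesis by (simp add: wV_def mult_ac)
  qed
qed simp

lemma inner_JD_JV_eq_JH:
  assumes "R \<in> opH j" "S \<in> opV j"
  shows "inner (JD R) (JV S) = inner (JH R) (JH S)"
proof (rule has_sum_unique[OF inner_JD_JV_has_sum])
  show "R \<in> opD j" using assms(1) opH_subset_opD by blast
  have S: "S \<in> weighted wH" using assms(2) opV_subset_opH by (auto simp: opH_eq)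
  show "((\<lambda>(b, c). wH b c * (coef R b c * coef S b c)) has_sum inner (JH R) (JH S)) (B \<times> B)"
    using inner_Jw_has_sum[OF weight_H assms(1)[unfolded opH_eq] weight_H S]
    by (rule has_sum_cong[THEN iffD1, rotated]) (auto simp: wH_def)
qed (rule assms(2))

lemma coef_sym:
  assumes R: "R \<in> opH j" "self_adjoint_op j R" and bc: "b \<in> B" "c \<in> B"
  shows "coef R b c = coef R c b"
proof -
  obtain T where T: "R = from_HH j T" "hilbert_schmidt T" "as_HH j R = T" using R(1) by (rule opH_cases)
  have "inner (blinfun_apply T (hb b)) (hb c) = inner (hb b) (blinfun_apply T (hb c))"
    using R(2) by (simp add: self_adjoint_op_def T(3))
  then show ?thesis by (simp add: T(1) coef_from_HH bc inner_commute)
qed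

text \<open>For self-adjoint \<open>R\<close> the operator from the dual to H is the adjoint of the
  one from H to V; on the basis this is the symmetry of the matrix. It moves the second half of the
  elliptic term to the same vectors as the first.\<close>

lemma as_DH_adjoint:
  assumes R: "R \<in> opV j" "self_adjoint_op j R" and c: "c \<in> B"
  shows "inner (blinfun_apply (as_DH j R) f) (blinfun_apply j c) = blinfun_apply f (blinfun_apply (as_HV j R) (blinfun_apply j c))"
proof -
  obtain T U where T: "R = from_HV j T" "as_HV j R = T" and U: "R = from_DH j U" "as_DH j R = U"
    using R(1) by (rule opV_cases)
  have RH: "R \<in> opH j" using R(1) opV_subset_opH by blast
  have "blinfun_inner_left (blinfun_apply j c) o\<^sub>L U o\<^sub>L riesz_map = blinfun_inner_left (blinfun_apply T (blinfun_apply j c))"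
  proof (rule blinfun_eq_on_onb[OF onb_B])
    fix d assume d: "d \<in> B"
    have n: "\<nu> d \<noteq> 0" "\<nu> c \<noteq> 0" using \<nu>_pos c d by force+
    have "inner (blinfun_apply (U o\<^sub>L riesz_map) d) (blinfun_apply j c) = coef R d c / (\<nu> d)\<^sup>2"
      using n by (simp add: U(1) coef_from_DH d c j_eq_hb del: blinfun_apply_blinfun_compose)
    also have "\<dots> = coef R c d / (\<nu> d)\<^sup>2" by (simp add: coef_sym[OF RH R(2) d c])
    also have "\<dots> = inner d (blinfun_apply T (blinfun_apply j c))"
      using n by (simp add: T(1) coef_from_HV d c j_eq_hb blinfun.scaleR_right inner_commute)
    finally show "blinfun_apply (blinfun_inner_left (blinfun_apply j c) o\<^sub>L U o\<^sub>L riesz_map) d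
        = blinfun_apply (blinfun_inner_left (blinfun_apply T (blinfun_apply j c))) d"
      by simp
  qed
  then have "blinfun_apply (blinfun_inner_left (blinfun_apply j c) o\<^sub>L U o\<^sub>L riesz_map) (blinfun_apply riesz_inv f)
      = inner (blinfun_apply riesz_inv f) (blinfun_apply T (blinfun_apply j c))" by simp
  then show ?thesis by (simp add: T(2) U(2) riesz_map_apply)
qed

text \<open>By symmetry of the matrix the two Hilbert--Schmidt parts of the norm are transposes of
  each other and equal, so the H-to-V part is half of the total.\<close>

lemma norm_JV_sq_self_adjoint:
  assumes R: "R \<in> opV j" "self_adjoint_op j R"
  shows "((\<lambda>b. (norm (blinfun_apply (as_HV j R) (hb b)))\<^sup>2) has_sum (norm (JV R))\<^sup>2 / 2) B"
proof -
  obtain T U where T: "R = from_HV j T" "hilbert_schmidt T" "as_HV j R = T" using R(1) by (rule opV_cases)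
  have RH: "R \<in> opH j" using R(1) opV_subset_opH by blast
  define s where "s = hs_inner T T"
  have 1: "((\<lambda>(b, c). (inner (blinfun_apply T (hb b)) c)\<^sup>2) has_sum s) (B \<times> B)"
    using hs_inner_families[OF famH famB T(2) T(2)] by (simp add: s_def power2_eq_square)
  then have 2: "((\<lambda>(b, c). (inner (blinfun_apply T (hb c)) b)\<^sup>2) has_sum s) (B \<times> B)"
    by (subst has_sum_swap_iff) simp
  have "((\<lambda>(b, c). wV b c * (coef R b c)\<^sup>2) has_sum s + s) (B \<times> B)"
    using has_sum_add[OF 1 2]
  proof (rule has_sum_cong[THEN iffD1, rotated])
    fix p assume "p \<in> B \<times> B"
    then obtain b c where bc: "p = (b, c)" "b \<in> B" "c \<in> B" by auto
    have n: "\<nu> b \<noteq> 0" "\<nu> c \<noteq> 0" using \<nu>_pos bc(2,3) by force+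
    have x: "inner (blinfun_apply T (hb b)) c = coef R b c / (\<nu> b * (\<nu> c)\<^sup>2)"
      using n by (simp add: T(1) coef_from_HV bc)
    have y: "inner (blinfun_apply T (hb c)) b = coef R b c / (\<nu> c * (\<nu> b)\<^sup>2)"
      using n by (simp add: coef_sym[OF RH R(2) bc(2,3)]) (simp add: T(1) coef_from_HV bc)
    show "(case p of (b, c) \<Rightarrow> (inner (blinfun_apply T (hb b)) c)\<^sup>2) + (case p of (b, c) \<Rightarrow> (inner (blinfun_apply T (hb c)) b)\<^sup>2)
        = (case p of (b, c) \<Rightarrow> wV b c * (coef R b c)\<^sup>2)"
      unfolding bc(1) prod.case x y using n by (simp add: wV_def wH_def field_simps power2_eq_square)
  qed
  then have "s + s = (norm (JV R))\<^sup>2"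
    using norm_Jw_has_sum[OF weight_V R(1)[unfolded opV_eq]] by (rule has_sum_unique)
  then have s: "s = (norm (JV R))\<^sup>2 / 2" by simp
  have "((\<lambda>b. (norm (blinfun_apply T (hb b)))\<^sup>2) has_sum s) B"
    using 1 by (rule has_sum_Times_nonneg_iff[THEN iffD1, rotated 2]) (use parseval_family[OF famB] in auto)
  then show ?thesis by (simp add: T(3) s)
qed

section \<open>Estimates for one step of the scheme\<close>

text \<open>The Lyapunov operator, the linear elliptic part of the Riccati equation.\<close>

definition lyapunov :: "'v oper \<Rightarrow> 'v oper \<Rightarrow> 'v oper" where
  "lyapunov A R = (dual_op A o\<^sub>L as_HV j R o\<^sub>L j) + (dual_emb j o\<^sub>L as_DH j R o\<^sub>L A)"

lemma dual_op_apply: "blinfun_apply (blinfun_apply (dual_op A) u) v = blinfun_apply (blinfun_apply A v) u"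
  unfolding dual_op_def
proof (rule op_of_form_apply)
  have 1: "bounded_bilinear (\<lambda>u v. blinfun_apply (blinfun_apply A v) u)"
    by (intro bounded_bilinear.flip[OF bounded_bilinear.comp1[OF bounded_bilinear_blinfun_apply blinfun.bounded_linear_right]])
  then show "bounded_bilinear (\<lambda>u v. blinfun_apply (blinfun_apply A v) u)" .
qed

lemma coef_lyapunov:
  assumes R: "R \<in> opV j" "self_adjoint_op j R" and bc: "b \<in> B" "c \<in> B"
  shows "coef (lyapunov A R) b c
    = \<nu> b * blinfun_apply (blinfun_apply A c) (blinfun_apply (as_HV j R) (hb b))
    + \<nu> c * blinfun_apply (blinfun_apply A b) (blinfun_apply (as_HV j R) (hb c))"
  using bc by (simp add: coef_def lyapunov_def blinfun.add_left dual_op_apply dual_emb_apply as_DH_adjoint[OF R bc(2)])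
     (simp add: j_eq_hb blinfun.scaleR_right)

text \<open>Put \<open>x\<^sub>b = R (hb b)\<close>. As the sum of \<open>(x\<^sub>b, c) c\<close> over \<open>c\<close> is \<open>x\<^sub>b\<close>, pairing
  with \<open>R\<close> turns the coefficients above into twice the sum of \<open>A(x\<^sub>b, x\<^sub>b)\<close>.\<close>

lemma lyapunov_estimates:
  assumes R: "R \<in> opV j" "self_adjoint_op j R"
    and bound: "\<And>u v. \<bar>blinfun_apply (blinfun_apply A u) v\<bar> \<le> \<eta> * norm u * norm v"
    and coercive: "\<And>u. \<mu> * (norm u)\<^sup>2 \<le> blinfun_apply (blinfun_apply A u) u"
    and \<eta>: "\<eta> \<ge> 0"
  shows "lyapunov A R \<in> opD j" "(norm (JD (lyapunov A R)))\<^sup>2 \<le> 2 * \<eta>\<^sup>2 * (norm (JV R))\<^sup>2"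
    "\<mu> * (norm (JV R))\<^sup>2 \<le> inner (JD (lyapunov A R)) (JV R)"
proof -
  obtain T U where T: "R = from_HV j T" "hilbert_schmidt T" "as_HV j R = T" using R(1) by (rule opV_cases)
  have RH: "R \<in> opH j" using R(1) opV_subset_opH by blast
  define x where "x b = blinfun_apply T (hb b)" for b
  define Z where "Z = lyapunov A R"
  define q where "q = (norm (JV R))\<^sup>2 / 2"
  have q: "((\<lambda>b. (norm (x b))\<^sup>2) has_sum q) B"
    using norm_JV_sq_self_adjoint[OF R] by (simp add: T(3) x_def q_def)
  have "\<exists>y. \<forall>v. blinfun_apply (blinfun_apply A v) (x b) = inner y v" for b
  proof -
    have "bounded_linear (\<lambda>v. blinfun_apply (blinfun_apply A v) (x b))" by (intro bounded_linear_intros)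
    then show ?thesis by (metis riesz_representation)
  qed
  \<comment> \<open>\<open>y b\<close> represents, in V, the functional sending \<open>v\<close> to
    the form at \<open>(v, x b)\<close>. Testing with \<open>y b\<close> itself bounds it by
    \<open>\<eta>\<close> times the norm of \<open>x b\<close>.\<close>
  then obtain y where y: "\<And>b v. blinfun_apply (blinfun_apply A v) (x b) = inner (y b) v" by metis
  have ny: "(norm (y b))\<^sup>2 \<le> \<eta>\<^sup>2 * (norm (x b))\<^sup>2" for b
  proof -
    have "norm (y b) * norm (y b) \<le> (\<eta> * norm (x b)) * norm (y b)"
      using bound[of "y b" "x b"] by (simp add: y power2_norm_eq_inner[symmetric] power2_eq_square mult_ac)
    then have "norm (y b) \<le> \<eta> * norm (x b)"
      by (cases "norm (y b) = 0") (use \<eta> in \<open>auto simp: mult_le_cancel_right\<close>)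
    from power_mono[OF this, of 2] show ?thesis by (simp add: power_mult_distrib)
  qed
  have coefZ: "coef Z b c = \<nu> b * inner (y b) c + \<nu> c * inner (y c) b" if "b \<in> B" "c \<in> B" for b c
    using coef_lyapunov[OF R that, of A] by (simp add: Z_def T(3) y flip: x_def)
  have coefR: "coef R b c = \<nu> b * (\<nu> c)\<^sup>2 * inner (x b) c" if "b \<in> B" "c \<in> B" for b c
    using that by (simp add: T(1) coef_from_HV x_def)
  have ysum: "(\<lambda>b. (norm (y b))\<^sup>2) summable_on B"
    by (rule summable_on_nonneg_comparison[OF has_sum_imp_summable[OF has_sum_cmult_right[OF q, of "\<eta>\<^sup>2"]]])
       (use ny in auto)
  define r where "r = (\<Sum>\<^sub>\<infinity>b\<in>B. (norm (y b))\<^sup>2)"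
  have r: "((\<lambda>b. (norm (y b))\<^sup>2) has_sum r) B" unfolding r_def using ysum by simp
  have r_le: "r \<le> \<eta>\<^sup>2 * q" by (rule has_sum_mono[OF r has_sum_cmult_right[OF q]]) (rule ny)
  have yy: "((\<lambda>(b, c). (inner (y b) c)\<^sup>2) has_sum r) (B \<times> B)"
    using r by (rule has_sum_Times_nonneg_iff[THEN iffD2, rotated 2]) (use parseval_family[OF famB] in auto)
  have xx: "((\<lambda>(b, c). (inner (x b) c)\<^sup>2) has_sum q) (B \<times> B)"
    using q by (rule has_sum_Times_nonneg_iff[THEN iffD2, rotated 2]) (use parseval_family[OF famB] in auto)
  have yy': "((\<lambda>(b, c). (inner (y c) b)\<^sup>2) has_sum r) (B \<times> B)"
    using yy by (subst has_sum_swap_iff) simp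
  have maj: "((\<lambda>p. 2 * ((case p of (b, c) \<Rightarrow> (inner (y b) c)\<^sup>2) + (case p of (b, c) \<Rightarrow> (inner (y c) b)\<^sup>2))) has_sum 2 * (r + r)) (B \<times> B)"
    by (intro has_sum_cmult_right has_sum_add yy yy')
  \<comment> \<open>The square of a sum of two terms costs a factor 2; \<open>wD\<close> then
    cancels the squares of \<open>\<nu>\<close>.\<close>
  have Zle: "wD b c * (coef Z b c)\<^sup>2 \<le> 2 * ((inner (y b) c)\<^sup>2 + (inner (y c) b)\<^sup>2)" if bc: "b \<in> B" "c \<in> B" for b c
  proof -
    have n: "0 < (\<nu> b)\<^sup>2" "0 < (\<nu> c)\<^sup>2" using \<nu>_sq bc by auto
    have "(coef Z b c)\<^sup>2 \<le> 2 * ((\<nu> b)\<^sup>2 * (inner (y b) c)\<^sup>2) + 2 * ((\<nu> c)\<^sup>2 * (inner (y c) b)\<^sup>2)"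
      unfolding coefZ[OF bc] power_mult_distrib[symmetric]
      using sum_squares_bound[of "\<nu> b * inner (y b) c" "\<nu> c * inner (y c) b"] by (simp add: power2_sum)
    then have "wD b c * (coef Z b c)\<^sup>2 \<le> wD b c * (2 * ((\<nu> b)\<^sup>2 * (inner (y b) c)\<^sup>2) + 2 * ((\<nu> c)\<^sup>2 * (inner (y c) b)\<^sup>2))"
      using wD_le(3) by (rule mult_left_mono)
    also have "\<dots> = 2 * ((wD b c * (\<nu> b)\<^sup>2) * (inner (y b) c)\<^sup>2) + 2 * ((wD b c * (\<nu> c)\<^sup>2) * (inner (y c) b)\<^sup>2)"
      by (simp add: algebra_simps)
    also have "\<dots> \<le> 2 * (1 * (inner (y b) c)\<^sup>2) + 2 * (1 * (inner (y c) b)\<^sup>2)"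
      using wD_le(1)[OF bc] wD_le(2)[OF bc] n
      by (intro add_mono mult_left_mono mult_right_mono) (auto simp: pos_le_divide_eq)
    finally show ?thesis by simp
  qed
  have "(\<lambda>(b, c). wD b c * (coef Z b c)\<^sup>2) summable_on B \<times> B"
    by (rule summable_on_nonneg_comparison[OF has_sum_imp_summable[OF maj]]) (use Zle wD_le(3) in auto)
  then have ZD: "Z \<in> weighted wD" by (simp add: weighted_def)
  then show "lyapunov A R \<in> opD j" by (simp add: opD_eq Z_def)
  have "(norm (JD Z))\<^sup>2 \<le> 2 * (r + r)"
    by (rule has_sum_mono[OF norm_Jw_has_sum[OF weight_D ZD] maj]) (use Zle in auto)
  then show "(norm (JD (lyapunov A R)))\<^sup>2 \<le> 2 * \<eta>\<^sup>2 * (norm (JV R))\<^sup>2"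
    using r_le by (simp add: Z_def q_def)
  have "(\<lambda>p. inner (x (fst p)) (snd p) * inner (y (fst p)) (snd p)) summable_on B \<times> B"
    by (rule summable_on_prod_of_squares) (use xx yy in \<open>auto simp: case_prod_unfold intro: has_sum_imp_summable\<close>)
  then have Fs: "(\<lambda>(b, c). inner (x b) c * inner (y b) c) summable_on B \<times> B" by (simp add: case_prod_unfold)
  define f where "f = (\<Sum>\<^sub>\<infinity>(b, c)\<in>B \<times> B. inner (x b) c * inner (y b) c)"
  have F: "((\<lambda>(b, c). inner (x b) c * inner (y b) c) has_sum f) (B \<times> B)" unfolding f_def using Fs by simp
  then have F': "((\<lambda>(b, c). inner (x c) b * inner (y c) b) has_sum f) (B \<times> B)"
    by (subst has_sum_swap_iff) simp
  have xy: "((\<lambda>b. inner (x b) (y b)) has_sum f) B"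
    by (rule has_sum_SigmaD[OF F]) (use expansion_family[OF famB] in simp)
  have f_ge: "\<mu> * q \<le> f"
    by (rule has_sum_mono[OF has_sum_cmult_right[OF q] xy])
       (use coercive[of "x _"] in \<open>simp add: y inner_commute[of "y _"]\<close>)
  \<comment> \<open>Each of the two terms of \<open>coef Z\<close> combines with the symmetric
    \<open>coef R\<close> to one of the two transposed double sums, so the pairing is
    \<open>f\<close> twice.\<close>
  have "((\<lambda>(b, c). wH b c * (coef Z b c * coef R b c)) has_sum f + f) (B \<times> B)"
    using has_sum_add[OF F F']
  proof (rule has_sum_cong[THEN iffD1, rotated])
    fix p assume "p \<in> B \<times> B"
    then obtain b c where bc: "p = (b, c)" "b \<in> B" "c \<in> B" by auto
    have n: "\<nu> b \<noteq> 0" "\<nu> c \<noteq> 0" using \<nu>_pos bc(2,3) by force+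
    have 1: "inner (x b) c = coef R b c / (\<nu> b * (\<nu> c)\<^sup>2)" using n by (simp add: coefR bc)
    have 2: "inner (x c) b = coef R b c / (\<nu> c * (\<nu> b)\<^sup>2)"
      using n by (simp add: coef_sym[OF RH R(2) bc(2,3)]) (simp add: coefR bc)
    show "(case p of (b, c) \<Rightarrow> inner (x b) c * inner (y b) c) + (case p of (b, c) \<Rightarrow> inner (x c) b * inner (y c) b)
        = (case p of (b, c) \<Rightarrow> wH b c * (coef Z b c * coef R b c))"
      unfolding bc(1) prod.case 1 2 coefZ[OF bc(2,3)] using n by (simp add: wH_def field_simps power2_eq_square)
  qed
  moreover have "((\<lambda>(b, c). wH b c * (coef Z b c * coef R b c)) has_sum inner (JD Z) (JV R)) (B \<times> B)"
    using ZD R(1) by (intro inner_JD_JV_has_sum) (auto simp: opD_eq)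
  ultimately have "f + f = inner (JD Z) (JV R)" by (rule has_sum_unique)
  then show "\<mu> * (norm (JV R))\<^sup>2 \<le> inner (JD (lyapunov A R)) (JV R)"
    using f_ge by (simp add: Z_def q_def)
qed

definition square_op :: "'v oper \<Rightarrow> 'v oper" where
  "square_op R = from_HH j (as_HH j R o\<^sub>L as_HH j R)"

text \<open>The Hilbert--Schmidt norm dominates the operator norm, which gives the upper bound. For
  the lower one, the inequality for \<open>R\<close> is applied to the vectors
  \<open>S (hb b)\<close> and summed.\<close>

lemma square_estimates:
  assumes R: "op_ge j R (- \<gamma>)"
  shows "square_op R \<in> opH j" "norm (JH (square_op R)) \<le> (norm (JH R))\<^sup>2"
    "- \<gamma> * (norm (JH R))\<^sup>2 \<le> inner (JH (square_op R)) (JH R)"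
proof -
  have RH: "R \<in> opH j" and sa: "self_adjoint_op j R"
    and ge: "\<And>u. inner (blinfun_apply (as_HH j R) u - (- \<gamma>) *\<^sub>R u) u \<ge> 0"
    using R by (auto simp: op_ge_def)
  obtain S where S: "R = from_HH j S" "hilbert_schmidt S" "as_HH j R = S" using RH by (rule opH_cases)
  have nR: "(norm (JH R))\<^sup>2 = hs_inner S S"
    using innerH_eq[OF RH RH] by (simp add: innerH_def S(3) power2_norm_eq_inner)
  have prod: "((\<lambda>b. inner (blinfun_apply X (hb b)) (blinfun_apply Y (hb b))) has_sum hs_inner X Y) B"
    if "hilbert_schmidt X" "hilbert_schmidt Y" for X Y :: "'h \<Rightarrow>\<^sub>L 'h"
    using hs_inner_product_has_sum[OF onb_familyD(2)[OF famH] onb_familyD(2)[OF famH] that]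
    unfolding has_sum_reindex[OF onb_familyD(1)[OF famH]] o_def .
  have hS: "((\<lambda>b. (norm (blinfun_apply S (hb b)))\<^sup>2) has_sum (norm (JH R))\<^sup>2) B"
    using prod[OF S(2) S(2)] unfolding nR by (simp add: power2_norm_eq_inner)
  \<comment> \<open>By self-adjointness the coefficients of \<open>S u\<close> are the pairings of
    \<open>u\<close> with the \<open>S (hb b)\<close>.\<close>
  have op: "(norm (blinfun_apply S u))\<^sup>2 \<le> (norm (JH R))\<^sup>2 * (norm u)\<^sup>2" for u
  proof (rule has_sum_mono[OF parseval_family[OF famH] has_sum_cmult_left[OF hS]])
    fix b assume "b \<in> B"
    have "inner (blinfun_apply S u) (hb b) = inner u (blinfun_apply S (hb b))"
      using sa by (simp add: self_adjoint_op_def S(3))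
    then have "\<bar>inner (blinfun_apply S u) (hb b)\<bar> \<le> norm (blinfun_apply S (hb b)) * norm u"
      using Cauchy_Schwarz_ineq2[of u "blinfun_apply S (hb b)"] by (simp add: mult.commute)
    from power_mono[OF this, of 2]
    show "(inner (blinfun_apply S u) (hb b))\<^sup>2 \<le> (norm (blinfun_apply S (hb b)))\<^sup>2 * (norm u)\<^sup>2"
      by (simp add: power_mult_distrib)
  qed
  have maj: "((\<lambda>b. (norm (JH R))\<^sup>2 * (norm (blinfun_apply S (hb b)))\<^sup>2) has_sum (norm (JH R))\<^sup>2 * (norm (JH R))\<^sup>2) B"
    by (rule has_sum_cmult_right[OF hS])
  have SS: "hilbert_schmidt (S o\<^sub>L S)"
  proof -
    have "(\<lambda>b. (norm (blinfun_apply (S o\<^sub>L S) (hb b)))\<^sup>2) summable_on B"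
      by (rule summable_on_nonneg_comparison[OF has_sum_imp_summable[OF maj]]) (use op in auto)
    then have "(\<lambda>b. (norm (blinfun_apply (S o\<^sub>L S) b))\<^sup>2) summable_on hb ` B"
      unfolding summable_on_reindex[OF onb_familyD(1)[OF famH]] o_def .
    then show ?thesis unfolding hilbert_schmidt_iff_onb[OF onb_familyD(2)[OF famH] onb_familyD(2)[OF famH]] .
  qed
  have W: "square_op R = from_HH j (S o\<^sub>L S)" by (simp add: square_op_def S(3))
  show WH: "square_op R \<in> opH j" unfolding W opH_def using SS by blast
  have asW: "as_HH j (square_op R) = S o\<^sub>L S" unfolding W by (rule as_HH_from_HH)
  have nW: "(norm (JH (square_op R)))\<^sup>2 = hs_inner (S o\<^sub>L S) (S o\<^sub>L S)"
    using innerH_eq[OF WH WH] by (simp add: innerH_def asW power2_norm_eq_inner)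
  have "hs_inner (S o\<^sub>L S) (S o\<^sub>L S) \<le> (norm (JH R))\<^sup>2 * (norm (JH R))\<^sup>2"
    by (rule has_sum_mono[OF prod[OF SS SS] maj]) (use op in \<open>auto simp: power2_norm_eq_inner[symmetric]\<close>)
  then have "(norm (JH (square_op R)))\<^sup>2 \<le> ((norm (JH R))\<^sup>2)\<^sup>2" 
    unfolding nW by (simp add: power2_eq_square[of "(norm (JH R))\<^sup>2"])
  then show "norm (JH (square_op R)) \<le> (norm (JH R))\<^sup>2" by (rule power2_le_imp_le) simp
  have "- \<gamma> * (norm (JH R))\<^sup>2 \<le> hs_inner (S o\<^sub>L S) S"
  proof (rule has_sum_mono[OF has_sum_cmult_right[OF hS] prod[OF SS S(2)]])
    fix b assume "b \<in> B"
    show "- \<gamma> * (norm (blinfun_apply S (hb b)))\<^sup>2 \<le> inner (blinfun_apply (S o\<^sub>L S) (hb b)) (blinfun_apply S (hb b))"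
      using ge[of "blinfun_apply S (hb b)"] by (simp add: S(3) inner_add_left power2_norm_eq_inner)
  qed
  then show "- \<gamma> * (norm (JH R))\<^sup>2 \<le> inner (JH (square_op R)) (JH R)"
    using innerH_eq[OF WH RH] by (simp add: innerH_def asW S(3))
qed

text \<open>The first estimate pairs the equation with \<open>P\<close>; twice the pairing of
  \<open>P - P'\<close> with \<open>P\<close> is the difference of squared norms plus the squared
  norm of the jump. The second solves the equation for the difference quotient, using the triangle
  inequality in \<open>opD\<close>; the quartic term is the contribution of the square.\<close>

lemma euler_step_estimates:
  assumes P: "P \<in> opV j" "op_ge j P (- \<gamma>)" and P': "P' \<in> opH j" and Q: "Q \<in> opH j"
    and eq: "(1 / \<tau>) *\<^sub>R (P - P') + lyapunov A P + square_op P = Q"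
    and C: "\<And>v. norm (blinfun_apply j v) \<le> C * norm v"
    and A_bound: "\<And>u v. \<bar>blinfun_apply (blinfun_apply A u) v\<bar> \<le> \<eta> * norm u * norm v"
    and A_coercive: "\<And>u. \<mu> * (norm u)\<^sup>2 \<le> blinfun_apply (blinfun_apply A u) u"
    and const: "\<eta> \<ge> 0" "\<mu> > 0" "\<tau> > 0" "0 \<le> \<gamma>" "\<gamma> * C\<^sup>2 \<le> \<mu>"
  shows "(norm (JH P))\<^sup>2 - (norm (JH P'))\<^sup>2 + (norm (JH (P - P')))\<^sup>2 + \<mu> / 2 * \<tau> * (norm (JV P))\<^sup>2
      \<le> C\<^sup>2 / \<mu> * \<tau> * (norm (JH Q))\<^sup>2"
    and "(norm (JD ((1 / \<tau>) *\<^sub>R (P - P'))))\<^sup>2 \<le> 3 * (((norm j)\<^sup>2 + 1) * (norm (JH Q))\<^sup>2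
      + 2 * \<eta>\<^sup>2 * (norm (JV P))\<^sup>2 + ((norm j)\<^sup>2 + 1) * ((norm (JH P))\<^sup>2)\<^sup>2)"
proof -
  interpret H: hilbert_carrier "opH j" "normH j" JH "Ew wH" by (rule carrier_H)
  interpret D: hilbert_carrier "opD j" "normD j" JD "Ew wD" by (rule carrier_D)
  have PH: "P \<in> opH j" using P(1) opV_subset_opH by blast
  have sa: "self_adjoint_op j P" using P(2) by (simp add: op_ge_def)
  define k where "k = sqrt ((norm j)\<^sup>2 + 1)"
  have k: "k \<ge> 0" "k\<^sup>2 = (norm j)\<^sup>2 + 1" using norm_j_sq1 by (simp_all add: k_def)
  define Z where "Z = lyapunov A P"
  define W where "W = square_op P"
  have Z: "Z \<in> opD j" "(norm (JD Z))\<^sup>2 \<le> 2 * \<eta>\<^sup>2 * (norm (JV P))\<^sup>2" "\<mu> * (norm (JV P))\<^sup>2 \<le> inner (JD Z) (JV P)"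
    unfolding Z_def by (rule lyapunov_estimates[OF P(1) sa A_bound A_coercive const(1)])+
  have W: "W \<in> opH j" "norm (JH W) \<le> (norm (JH P))\<^sup>2" "- \<gamma> * (norm (JH P))\<^sup>2 \<le> inner (JH W) (JH P)"
    unfolding W_def by (rule square_estimates[OF P(2)])+
  define X where "X = (1 / \<tau>) *\<^sub>R (P - P')"
  have X: "X \<in> opH j" unfolding X_def by (intro H.X_scale H.X_diff PH P')
  note D = subsetD[OF opH_subset_opD]
  have eq': "X + Z + W = Q" using eq by (simp add: X_def Z_def W_def)
  have Jsum: "JD Q = JD X + JD Z + JD W"
    unfolding eq'[symmetric] using D[OF X] Z(1) D[OF W(1)] by (simp add: D.J_add D.X_add)
  have "inner (JD Q) (JV P) = inner (JD X) (JV P) + inner (JD Z) (JV P) + inner (JD W) (JV P)"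
    unfolding Jsum by (simp add: inner_add_left)
  then have en: "inner (JH Q) (JH P) = inner (JH X) (JH P) + inner (JD Z) (JV P) + inner (JH W) (JH P)"
    by (simp add: inner_JD_JV_eq_JH Q X W(1) P(1))
  define p where "p = norm (JV P)"
  define h where "h = norm (JH P)"
  have hp: "h\<^sup>2 \<le> (C\<^sup>2 / 2) * p\<^sup>2" unfolding h_def p_def by (rule norm_JH_le_JV[OF C P(1)])
  have "\<gamma> * h\<^sup>2 \<le> \<gamma> * ((C\<^sup>2 / 2) * p\<^sup>2)" using hp const(4) by (rule mult_left_mono)
  also have "\<dots> = (\<gamma> * C\<^sup>2) * p\<^sup>2 / 2" by simp
  also have "\<dots> \<le> \<mu> * p\<^sup>2 / 2" using const(5) by (intro divide_right_mono mult_right_mono) auto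
  finally have gh: "\<gamma> * h\<^sup>2 \<le> \<mu> * p\<^sup>2 / 2" .
  \<comment> \<open>Young's inequality, with the weight for which the embedding inequality turns the
    first term into \<open>\<mu> / 2\<close> times \<open>p\<close> squared.\<close>
  have c1: "2 * (norm (JH Q) * h) \<le> \<mu> / C\<^sup>2 * h\<^sup>2 + C\<^sup>2 / \<mu> * (norm (JH Q))\<^sup>2" if "C \<noteq> 0"
  proof -
    have "0 \<le> (\<mu> / C\<^sup>2) * (h - C\<^sup>2 / \<mu> * norm (JH Q))\<^sup>2" using const(2) by simp
    also have "\<dots> = \<mu> / C\<^sup>2 * h\<^sup>2 - 2 * (norm (JH Q) * h) + C\<^sup>2 / \<mu> * (norm (JH Q))\<^sup>2"
      using that const(2) by (simp add: power2_diff field_simps power2_eq_square)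
    finally show ?thesis by simp
  qed
  have c2: "\<mu> / C\<^sup>2 * h\<^sup>2 \<le> \<mu> / 2 * p\<^sup>2" if "C \<noteq> 0"
    using hp that const(2) by (simp add: field_simps)
  have c3: "h = 0" if "C = 0" using hp that by simp
  have qh: "2 * (norm (JH Q) * h) \<le> \<mu> / 2 * p\<^sup>2 + C\<^sup>2 / \<mu> * (norm (JH Q))\<^sup>2"
  proof (cases "C = 0")
    case True
    then show ?thesis using c3 const(2) by simp
  next
    case False
    then show ?thesis using c1 c2 by linarith
  qed
  have "inner (JH Q) (JH P) \<le> norm (JH Q) * h" unfolding h_def by (rule norm_cauchy_schwarz)
  \<comment> \<open>In multiples of \<open>\<mu> * p^2\<close>, after doubling: the elliptic part
    gives 2, the square costs at most 1 and the right-hand side 1/2, leaving 1/2.\<close>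
  then have main: "2 * inner (JH X) (JH P) + \<mu> / 2 * p\<^sup>2 \<le> C\<^sup>2 / \<mu> * (norm (JH Q))\<^sup>2"
    using en Z(3) W(3) gh qh by (simp add: p_def h_def)
  have JX: "JH X = (1 / \<tau>) *\<^sub>R (JH P - JH P')" unfolding X_def by (simp add: H.J_scale H.J_diff H.X_diff PH P')
  have "2 * inner (JH P - JH P') (JH P) = h\<^sup>2 - (norm (JH P'))\<^sup>2 + (norm (JH (P - P')))\<^sup>2"
    by (simp add: H.J_diff PH P' h_def power2_norm_eq_inner inner_diff_left inner_diff_right inner_commute)
  then have "2 * inner (JH X) (JH P) = (h\<^sup>2 - (norm (JH P'))\<^sup>2 + (norm (JH (P - P')))\<^sup>2) / \<tau>"
    by (simp add: JX)
  have d: "\<tau> * (x / \<tau> + y) = x + y * \<tau>" for x y using const(3) by (simp add: field_simps)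
  from \<open>2 * inner (JH X) (JH P) = _\<close> have "\<tau> * ((h\<^sup>2 - (norm (JH P'))\<^sup>2 + (norm (JH (P - P')))\<^sup>2) / \<tau> + \<mu> / 2 * p\<^sup>2) \<le> \<tau> * (C\<^sup>2 / \<mu> * (norm (JH Q))\<^sup>2)"
    using main const(3) by (intro mult_left_mono) auto
  then show "(norm (JH P))\<^sup>2 - (norm (JH P'))\<^sup>2 + (norm (JH (P - P')))\<^sup>2 + \<mu> / 2 * \<tau> * (norm (JV P))\<^sup>2
      \<le> C\<^sup>2 / \<mu> * \<tau> * (norm (JH Q))\<^sup>2"
    unfolding d h_def p_def by (simp add: mult_ac)
  have JX': "JD X = JD Q - JD Z - JD W" unfolding Jsum by simp
  have "norm (JD Q) \<le> k * norm (JH Q)" "norm (JD W) \<le> k * norm (JH W)"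
    unfolding k_def by (intro norm_JD_le_JH Q W(1))+
  moreover have "k * norm (JH W) \<le> k * (norm (JH P))\<^sup>2" using W(2) k(1) by (rule mult_left_mono)
  ultimately have JQ: "(norm (JD Q))\<^sup>2 \<le> (k * norm (JH Q))\<^sup>2"
    and JW: "(norm (JD W))\<^sup>2 \<le> (k * (norm (JH P))\<^sup>2)\<^sup>2"
    by (auto intro!: power_mono)
  have "norm (JD X) \<le> norm (JD Q) + norm (JD Z) + norm (JD W)"
    unfolding JX' using norm_triangle_ineq4[of "JD Q - JD Z" "JD W"] norm_triangle_ineq4[of "JD Q" "JD Z"] by linarith
  then have 1: "(norm (JD X))\<^sup>2 \<le> (norm (JD Q) + norm (JD Z) + norm (JD W))\<^sup>2" by (rule power_mono) simp
  \<comment> \<open>The origin of the factor 3.\<close>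
  have 2: "(x + y + z)\<^sup>2 \<le> 3 * (x\<^sup>2 + y\<^sup>2 + z\<^sup>2)" for x y z :: real
    using sum_squares_bound[of x y] sum_squares_bound[of x z] sum_squares_bound[of y z]
    by (simp add: power2_eq_square algebra_simps)
  have 3: "x \<le> 3 * (q' + z' + w')" if "x \<le> s" "s \<le> 3 * (q + z + w)" "q \<le> q'" "z \<le> z'" "w \<le> w'"
    for x s q z w q' z' w' :: real
  proof -
    have "3 * (q + z + w) \<le> 3 * (q' + z' + w')" using that(3-5) by (intro mult_left_mono add_mono) auto
    with that(1,2) show ?thesis by (rule order_trans[OF order_trans])
  qed
  show "(norm (JD ((1 / \<tau>) *\<^sub>R (P - P'))))\<^sup>2 \<le> 3 * (((norm j)\<^sup>2 + 1) * (norm (JH Q))\<^sup>2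
      + 2 * \<eta>\<^sup>2 * (norm (JV P))\<^sup>2 + ((norm j)\<^sup>2 + 1) * ((norm (JH P))\<^sup>2)\<^sup>2)"
    unfolding X_def[symmetric] k(2)[symmetric] using 3[OF 1 2 JQ Z(2) JW] by (simp only: power_mult_distrib)
qed

end

lemma finite_measure_lebesgue_on_Icc: "finite_measure (lebesgue_on {x..y :: real})"
  by (rule finite_measureI) (simp add: emeasure_restrict_space emeasure_lborel_Icc_eq)

lemma measure_lebesgue_on_Icc: "x \<le> y \<Longrightarrow> measure (lebesgue_on {x..y :: real}) {x..y} = y - x"
  by (simp add: measure_restrict_space)

text \<open>Bound and coercivity survive averaging. Bounded bilinearity of the average must be shown
  first, since otherwise \<open>op_of_form\<close> would not return the form.\<close>

lemma avg_A_estimates: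
  fixes a :: "real \<Rightarrow> 'v::real_normed_vector \<Rightarrow> 'v \<Rightarrow> real"
  assumes bil: "\<And>t. t \<in> {0..T} \<Longrightarrow> bilinear (a t)"
    and meas: "\<And>u v. (\<lambda>t. a t u v) \<in> borel_measurable (lebesgue_on {0..T})"
    and coercive: "\<And>t u. t \<in> {0..T} \<Longrightarrow> a t u u \<ge> \<mu> * (norm u)\<^sup>2"
    and bound: "\<And>t u v. t \<in> {0..T} \<Longrightarrow> \<bar>a t u v\<bar> \<le> \<eta> * norm u * norm v"
    and \<tau>: "\<tau> > 0" and n: "1 \<le> n" "real n * \<tau> \<le> T"
  shows "\<bar>blinfun_apply (blinfun_apply (avg_A a \<tau> n) u) v\<bar> \<le> \<eta> * norm u * norm v"
    "\<mu> * (norm u)\<^sup>2 \<le> blinfun_apply (blinfun_apply (avg_A a \<tau> n) u) u"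
proof -
  let ?I = "{(real n - 1) * \<tau>..real n * \<tau>}"
  let ?M = "lebesgue_on ?I"
  interpret finite_measure ?M by (rule finite_measure_lebesgue_on_Icc)
  have sub: "?I \<subseteq> {0..T}" using \<tau> n by (auto intro: order_trans mult_nonneg_nonneg)
  have len: "measure ?M (space ?M) = \<tau>"
    using measure_lebesgue_on_Icc[of "(real n - 1) * \<tau>" "real n * \<tau>"] \<tau> by (simp add: algebra_simps)
  have [measurable]: "(\<lambda>t. a t u v) \<in> borel_measurable ?M" for u v
    by (rule measurable_restrict_mono[OF meas sub])
  have b: "AE t in ?M. norm (a t u v) \<le> \<eta> * norm u * norm v" for u v
    by (rule AE_I2) (use bound sub in auto)
  have i: "integrable ?M (\<lambda>t. a t u v)" for u v
    by (rule integrable_const_bound[OF b]) measurable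
  define \<alpha> where "\<alpha> u v = (1 / \<tau>) * (\<integral>t. a t u v \<partial>?M)" for u v
  have \<alpha>_le: "\<bar>\<alpha> u v\<bar> \<le> \<eta> * norm u * norm v" for u v
  proof -
    have "norm (\<integral>t. a t u v \<partial>?M) \<le> (\<integral>t. norm (a t u v) \<partial>?M)" by (rule integral_norm_bound)
    also have "\<dots> \<le> (\<integral>t. \<eta> * norm u * norm v \<partial>?M)"
      by (rule integral_mono_AE[OF integrable_norm[OF i] _ b]) simp
    also have "\<dots> = \<tau> * (\<eta> * norm u * norm v)" using len by simp
    finally show ?thesis using \<tau> by (simp add: \<alpha>_def abs_mult field_simps)
  qed
  have bl: "a t (u + u') v = a t u v + a t u' v" "a t u (v + v') = a t u v + a t u v'"
    "a t (r *\<^sub>R u) v = r * a t u v" "a t u (r *\<^sub>R v) = r * a t u v" if "t \<in> space ?M" for t u u' v v' r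
    using bil[of t] that sub by (auto simp: bilinear_ladd bilinear_radd bilinear_lmul bilinear_rmul)
  have "bounded_bilinear \<alpha>"
  proof (rule bounded_bilinear.intro)
    show "\<alpha> (u + u') v = \<alpha> u v + \<alpha> u' v" for u u' v
    proof -
      have "(\<integral>t. a t (u + u') v \<partial>?M) = (\<integral>t. a t u v + a t u' v \<partial>?M)"
        by (rule Bochner_Integration.integral_cong[OF refl bl(1)])
      then show ?thesis unfolding \<alpha>_def by (simp add: i distrib_left)
    qed
    show "\<alpha> u (v + v') = \<alpha> u v + \<alpha> u v'" for u v v'
    proof -
      have "(\<integral>t. a t u (v + v') \<partial>?M) = (\<integral>t. a t u v + a t u v' \<partial>?M)"
        by (rule Bochner_Integration.integral_cong[OF refl bl(2)])
      then show ?thesis unfolding \<alpha>_def by (simp add: i distrib_left)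
    qed
    show "\<alpha> (r *\<^sub>R u) v = r *\<^sub>R \<alpha> u v" for r u v
    proof -
      have "(\<integral>t. a t (r *\<^sub>R u) v \<partial>?M) = (\<integral>t. r * a t u v \<partial>?M)"
        by (rule Bochner_Integration.integral_cong[OF refl bl(3)])
      then show ?thesis unfolding \<alpha>_def by simp
    qed
    show "\<alpha> u (r *\<^sub>R v) = r *\<^sub>R \<alpha> u v" for r u v
    proof -
      have "(\<integral>t. a t u (r *\<^sub>R v) \<partial>?M) = (\<integral>t. r * a t u v \<partial>?M)"
        by (rule Bochner_Integration.integral_cong[OF refl bl(4)])
      then show ?thesis unfolding \<alpha>_def by simp
    qed
    show "\<exists>K. \<forall>u v. norm (\<alpha> u v) \<le> norm u * norm v * K"
      using \<alpha>_le by (intro exI[of _ \<eta>]) (simp add: mult_ac)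
  qed
  then have app: "blinfun_apply (blinfun_apply (avg_A a \<tau> n) u) v = \<alpha> u v" for u v
    unfolding avg_A_def \<alpha>_def by (rule op_of_form_apply)
  show "\<bar>blinfun_apply (blinfun_apply (avg_A a \<tau> n) u) v\<bar> \<le> \<eta> * norm u * norm v"
    unfolding app by (rule \<alpha>_le)
  have "\<tau> * (\<mu> * (norm u)\<^sup>2) = (\<integral>t. \<mu> * (norm u)\<^sup>2 \<partial>?M)" using len by simp
  also have "\<dots> \<le> (\<integral>t. a t u u \<partial>?M)"
    by (rule integral_mono[OF _ i]) (use coercive sub in auto)
  finally show "\<mu> * (norm u)\<^sup>2 \<le> blinfun_apply (blinfun_apply (avg_A a \<tau> n) u) u"
    unfolding app \<alpha>_def using \<tau> by (simp add: field_simps)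
qed

lemma AE_lebesgue_neq: "AE t in lebesgue. t \<noteq> (x :: real)"
  by (rule AE_completion) (rule AE_lborel_singleton)

text \<open>Half-open intervals make the sum exact; they differ from the closed ones of the averages
  by a null set.\<close>

lemma integral_consecutive_intervals:
  fixes F :: "real \<Rightarrow> real"
  assumes F: "integrable lebesgue F" and \<tau>: "\<tau> > 0"
  shows "(\<Sum>n=1..N. \<integral>t. indicator {(real n - 1) * \<tau><..real n * \<tau>} t * F t \<partial>lebesgue)
    = (\<integral>t. indicator {0<..real N * \<tau>} t * F t \<partial>lebesgue)"
proof (induction N)
  case (Suc N)
  have i: "integrable lebesgue (\<lambda>t. indicator {x<..y} t * F t)" for x y :: real
    using integrable_mult_indicator[OF _ F, of "{x<..y}"] by simp
  have "0 \<le> real N * \<tau>" "real N * \<tau> \<le> real (Suc N) * \<tau>" using \<tau> by simp_all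
  then have "indicator {0<..real (Suc N) * \<tau>} t * F t
      = indicator {0<..real N * \<tau>} t * F t + indicator {real N * \<tau><..real (Suc N) * \<tau>} t * F t" for t
    by (auto simp: indicator_def)
  then show ?case using Suc i by simp
qed simp

context gelfand_triple
begin

text \<open>Cauchy--Schwarz against the constant 1 on a step of length \<open>\<tau>\<close>. The
  weight \<open>\<tau>\<close> on the left makes the bounds summable over the steps.\<close>

lemma avg_Q_estimates:
  assumes Q: "Q \<in> bochner_Lp 2 (opH j) (normH j) (lebesgue_on {0<..<T})"
    and \<tau>: "\<tau> > 0" and n: "1 \<le> n" "real n * \<tau> \<le> T"
    and G: "G = (\<lambda>t. if t \<in> {0<..<T} then (norm (JH (Q t)))\<^sup>2 else 0)"
  shows "integrable lebesgue G" "avg_Q j Q \<tau> n \<in> opH j"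
    "\<tau> * (norm (JH (avg_Q j Q \<tau> n)))\<^sup>2 \<le> (\<integral>t. indicator {(real n - 1) * \<tau><..real n * \<tau>} t * G t \<partial>lebesgue)"
proof -
  interpret H: hilbert_carrier "opH j" "normH j" JH "Ew wH" by (rule carrier_H)
  interpret H0: hilbert_carrier_measure "opH j" "normH j" JH "Ew wH" "lebesgue_on {0<..<T}"
    by (intro hilbert_carrier_measure.intro carrier_H complete_measure_lebesgue_on) simp
  let ?I = "{(real n - 1) * \<tau>..real n * \<tau>}"
  let ?M = "lebesgue_on ?I"
  interpret HI: hilbert_carrier_measure "opH j" "normH j" JH "Ew wH" ?M
    by (intro hilbert_carrier_measure.intro carrier_H complete_measure_lebesgue_on) simp
  interpret finite_measure ?M by (rule finite_measure_lebesgue_on_Icc)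
  have sub: "?I \<subseteq> {0..T}" using \<tau> n by (auto intro: order_trans mult_nonneg_nonneg)
  have len: "measure ?M (space ?M) = \<tau>"
    using measure_lebesgue_on_Icc[of "(real n - 1) * \<tau>" "real n * \<tau>"] \<tau> by (simp add: algebra_simps)
  \<comment> \<open>\<open>Q\<close> is controlled only on the open interval, whereas a closed step
    may contain 0 or \<open>T\<close>. The extension by zero agrees with the coordinates of
    \<open>Q\<close> up to these two points.\<close>
  define g where "g t = (if t \<in> {0<..<T} then JH (Q t) else 0)" for t
  have QX: "AE t in lebesgue_on {0<..<T}. Q t \<in> opH j"
    and Qm: "(\<lambda>t. JH (Q t)) \<in> borel_measurable (lebesgue_on {0<..<T})"
    and Qi: "integrable (lebesgue_on {0<..<T}) (\<lambda>t. (norm (JH (Q t)))\<^sup>2)"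
    using Q by (auto simp: H0.bochner_Lp_iff)
  have gm: "g \<in> borel_measurable lebesgue"
    using Qm unfolding g_def by (subst (asm) measurable_restrict_space_iff[of _ _ 0]) auto
  have Gg: "G t = (norm (g t))\<^sup>2" for t by (simp add: G g_def)
  have "integrable lebesgue (\<lambda>t. indicator {0<..<T} t *\<^sub>R (norm (JH (Q t)))\<^sup>2)"
    using Qi by (subst (asm) integrable_restrict_space) auto
  moreover have "(\<lambda>t. indicator {0<..<T} t *\<^sub>R (norm (JH (Q t)))\<^sup>2) = G" by (auto simp: G indicator_def)
  ultimately show Gi: "integrable lebesgue G" by simp
  have gmI [measurable]: "g \<in> borel_measurable ?M" by (rule measurable_restrict_space1[OF gm])
  have giI: "integrable ?M (\<lambda>t. (norm (g t))\<^sup>2)"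
    using integrable_mult_indicator[OF _ Gi, of ?I] by (subst integrable_restrict_space) (auto simp: Gg[abs_def])
  have AE: "AE t in ?M. Q t \<in> opH j \<and> g t = JH (Q t)"
  proof -
    have "AE t in lebesgue. t \<in> {0<..<T} \<longrightarrow> Q t \<in> opH j"
      using QX by (subst (asm) AE_restrict_space_iff) auto
    then have "AE t in lebesgue. t \<in> ?I \<longrightarrow> Q t \<in> opH j \<and> g t = JH (Q t)"
      using AE_lebesgue_neq[of 0] AE_lebesgue_neq[of T]
      by eventually_elim (use sub in \<open>force simp: g_def\<close>)
    then show ?thesis by (subst AE_restrict_space_iff) auto
  qed
  have AEX: "AE t in ?M. Q t \<in> opH j" and AEg: "AE t in ?M. g t = JH (Q t)" using AE by (auto elim: AE_mp)
  have gint: "integrable ?M g"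
  proof (rule Bochner_Integration.integrable_bound[of _ "\<lambda>t. 1 + (norm (g t))\<^sup>2"])
    show "integrable ?M (\<lambda>t. 1 + (norm (g t))\<^sup>2)" using giI by simp
    have "norm x \<le> 1 + (norm x)\<^sup>2" for x :: ell2
      using zero_le_power2[of "norm x - 1"] by (simp add: power2_diff) (use norm_ge_zero[of x] in linarith)
    then show "AE t in ?M. norm (g t) \<le> norm (1 + (norm (g t))\<^sup>2)" by (simp add: abs_of_nonneg)
  qed measurable
  have JQm: "(\<lambda>t. JH (Q t)) \<in> borel_measurable ?M" by (rule HI.borel_measurable_AE_eq[OF gmI AEg])
  have JQi: "integrable ?M (\<lambda>t. JH (Q t))"
    using gint JQm AEg by (subst integrable_cong_AE[of _ _ g]) (auto elim: AE_mp)
  define S where "S = bochner_int (opH j) (normH j) ?M Q"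
  have S: "S \<in> opH j" "JH S = (\<integral>t. g t \<partial>?M)"
    unfolding S_def HI.integral_AE_eq[OF gmI AEg, symmetric] using HI.bochner_int_eq[OF AEX JQi] by auto
  have avg: "avg_Q j Q \<tau> n = (1 / \<tau>) *\<^sub>R S" by (simp add: avg_Q_def S_def)
  show "avg_Q j Q \<tau> n \<in> opH j" unfolding avg by (rule H.X_scale[OF S(1)])
  have "norm (\<integral>t. g t \<partial>?M) \<le> (\<integral>t. norm (g t) \<partial>?M)" by (rule integral_norm_bound)
  also have "\<dots> = (\<integral>t. inner (norm (g t)) 1 \<partial>?M)" by simp
  also have "\<dots> \<le> \<bar>\<integral>t. inner (norm (g t)) 1 \<partial>?M\<bar>" by simp
  also have "\<dots> \<le> sqrt (\<integral>t. (norm (norm (g t)))\<^sup>2 \<partial>?M) * sqrt (\<integral>t. (norm (1::real))\<^sup>2 \<partial>?M)"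
    by (rule integral_inner_cauchy_schwarz) (use giI in auto)
  also have "\<dots> = sqrt (\<integral>t. (norm (g t))\<^sup>2 \<partial>?M) * sqrt \<tau>" using len by simp
  finally have "(norm (JH S))\<^sup>2 \<le> (sqrt (\<integral>t. (norm (g t))\<^sup>2 \<partial>?M) * sqrt \<tau>)\<^sup>2"
    unfolding S(2) by (rule power_mono) simp
  also have "\<dots> = (\<integral>t. (norm (g t))\<^sup>2 \<partial>?M) * \<tau>" using \<tau> by (simp add: power_mult_distrib)
  finally have "\<tau> * (norm (JH (avg_Q j Q \<tau> n)))\<^sup>2 \<le> (\<integral>t. (norm (g t))\<^sup>2 \<partial>?M)"
    using \<tau> by (simp add: avg H.J_scale S(1) power_divide field_simps power2_eq_square[of \<tau>])
  also have "\<dots> = (\<integral>t. indicator ?I t *\<^sub>R G t \<partial>lebesgue)"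
    by (subst integral_restrict_space) (auto simp: Gg)
  also have "\<dots> = (\<integral>t. indicator {(real n - 1) * \<tau><..real n * \<tau>} t * G t \<partial>lebesgue)"
  proof (rule integral_cong_AE)
    show "AE t in lebesgue. indicator ?I t *\<^sub>R G t = indicator {(real n - 1) * \<tau><..real n * \<tau>} t * G t"
      using AE_lebesgue_neq[of "(real n - 1) * \<tau>"] by eventually_elim (auto simp: indicator_def)
  qed (auto intro!: borel_measurable_times borel_measurable_indicator borel_measurable_integrable[OF Gi])
  finally show "\<tau> * (norm (JH (avg_Q j Q \<tau> n)))\<^sup>2 \<le> (\<integral>t. indicator {(real n - 1) * \<tau><..real n * \<tau>} t * G t \<partial>lebesgue)" .
qed

end

section \<open>Interpolation in time\<close>

lemma time_index_eq:
  fixes \<tau> :: real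
  assumes "\<tau> > 0" "n \<ge> 1" "(real n - 1) * \<tau> < t" "t \<le> real n * \<tau>"
  shows "nat \<lceil>t / \<tau>\<rceil> = n"
proof -
  have "of_int (int n) - 1 < t / \<tau>" using assms by (simp add: pos_less_divide_eq)
  moreover have "t / \<tau> \<le> of_int (int n)" using assms by (simp add: pos_divide_le_eq)
  ultimately have "\<lceil>t / \<tau>\<rceil> = int n" by (rule ceiling_unique)
  then show ?thesis by simp
qed

lemma time_index:
  fixes \<tau> :: real
  assumes \<tau>: "\<tau> > 0" and t: "0 < t" "t \<le> real N * \<tau>" and n: "n = nat \<lceil>t / \<tau>\<rceil>"
  shows "n \<in> {1..N}" "(real n - 1) * \<tau> < t" "t \<le> real n * \<tau>"
proof -
  have p: "0 < t / \<tau>" using \<tau> t by simp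
  have le: "t / \<tau> \<le> real N" using \<tau> t by (simp add: pos_divide_le_eq)
  have c: "0 < \<lceil>t / \<tau>\<rceil>" using p by (simp add: zero_less_ceiling)
  have rn: "real n = of_int \<lceil>t / \<tau>\<rceil>" using c n by simp
  have "\<lceil>t / \<tau>\<rceil> \<le> int N" using le by (simp add: ceiling_le_iff)
  then show "n \<in> {1..N}" using c unfolding n atLeastAtMost_iff by linarith
  have "real n - 1 < t / \<tau>" "t / \<tau> \<le> real n" unfolding rn using ceiling_correct[of "t / \<tau>"] by auto
  then show "(real n - 1) * \<tau> < t" "t \<le> real n * \<tau>" using \<tau> by (simp_all add: pos_less_divide_eq pos_divide_le_eq)
qed

lemma time_index_measurable:
  fixes f :: "nat \<Rightarrow> 'b::topological_space"
  shows "(\<lambda>t :: real. f (nat \<lceil>t / \<tau>\<rceil>)) \<in> borel_measurable (lebesgue_on S)"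
proof -
  have 1: "(\<lambda>t :: real. nat \<lceil>t / \<tau>\<rceil>) \<in> measurable borel (count_space UNIV)" by measurable
  have "(\<lambda>t :: real. f (nat \<lceil>t / \<tau>\<rceil>)) \<in> borel_measurable borel"
    by (rule measurable_compose[OF 1]) simp
  then show ?thesis by (intro measurable_restrict_space1 measurable_completion) simp
qed

text \<open>Up to the end point \<open>T\<close>, which is a null set, the half-open steps tile the
  open interval, so the integral of a step function is \<open>\<tau>\<close> times a sum.\<close>

lemma time_index_integral:
  fixes f :: "nat \<Rightarrow> real"
  assumes \<tau>: "\<tau> > 0" and T: "T = real N * \<tau>"
  shows "integrable (lebesgue_on {0<..<T}) (\<lambda>t. f (nat \<lceil>t / \<tau>\<rceil>))"
    "(\<integral>t. f (nat \<lceil>t / \<tau>\<rceil>) \<partial>lebesgue_on {0<..<T}) = \<tau> * (\<Sum>n=1..N. f n)"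
proof -
  let ?M = "lebesgue_on {0<..<T}"
  let ?K = "\<lambda>n. {(real n - 1) * \<tau><..real n * \<tau>}"
  have ind: "integrable ?M (indicator (?K n) :: real \<Rightarrow> real) \<and> (\<integral>t. indicator (?K n) t \<partial>?M) = \<tau>"
    if n: "n \<in> {1..N}" for n
  proof -
    have le: "0 \<le> (real n - 1) * \<tau>" "real n * \<tau> \<le> T" using n \<tau> by (auto simp: T)
    have hb: "has_bochner_integral lebesgue (indicator (?K n) :: real \<Rightarrow> real) \<tau>"
    proof -
      have "measure lebesgue (?K n) = \<tau>" using \<tau> by (simp add: algebra_simps)
      moreover have "(real n - 1) * \<tau> \<le> real n * \<tau>" using \<tau> by (simp add: algebra_simps)
      ultimately show ?thesis
        using has_bochner_integral_real_indicator[of "?K n" lebesgue] by (simp add: emeasure_lborel_Ioc)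
    qed
    have "AE t in lebesgue. (indicator (?K n) t :: real) = indicator {0<..<T} t *\<^sub>R indicator (?K n) t"
      using AE_lebesgue_neq[of T] by eventually_elim (use le in \<open>auto simp: indicator_def\<close>)
    then have "has_bochner_integral lebesgue (\<lambda>t. indicator {0<..<T} t *\<^sub>R (indicator (?K n) t :: real)) \<tau>"
      using hb by (subst (asm) has_bochner_integral_cong_AE)
        (auto intro!: borel_measurable_times borel_measurable_scaleR borel_measurable_indicator)
    then show ?thesis
      by (subst integrable_restrict_space, simp, subst integral_restrict_space, simp) (auto simp: has_bochner_integral_iff)
  qed
  have eq: "f (nat \<lceil>t / \<tau>\<rceil>) = (\<Sum>n=1..N. indicator (?K n) t * f n)" if "t \<in> space ?M" for t
  proof -
    define m where "m = nat \<lceil>t / \<tau>\<rceil>"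
    have t: "0 < t" "t \<le> real N * \<tau>" using that T by auto
    note m = time_index[OF \<tau> t m_def]
    have "indicator (?K n) t * f n = (if n = m then f m else 0)" if "n \<in> {1..N}" for n
    proof (cases "t \<in> ?K n")
      case True
      then have "m = n" unfolding m_def using that by (intro time_index_eq[OF \<tau>]) auto
      then show ?thesis using True by simp
    next
      case False
      then have "n \<noteq> m" using m(2,3) by auto
      then show ?thesis using False by simp
    qed
    then have "(\<Sum>n=1..N. indicator (?K n) t * f n) = (\<Sum>n=1..N. if n = m then f m else 0)" by (intro sum.cong) auto
    then show ?thesis using m(1) by (simp add: m_def)
  qed
  have i: "integrable ?M (\<lambda>t. \<Sum>n=1..N. indicator (?K n) t * f n)"
    using ind by (intro Bochner_Integration.integrable_sum integrable_mult_left) auto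
  then show "integrable ?M (\<lambda>t. f (nat \<lceil>t / \<tau>\<rceil>))"
    by (rule Bochner_Integration.integrable_cong[THEN iffD2, rotated 2]) (use eq in auto)
  have "(\<integral>t. f (nat \<lceil>t / \<tau>\<rceil>) \<partial>?M) = (\<integral>t. (\<Sum>n=1..N. indicator (?K n) t * f n) \<partial>?M)"
    by (rule Bochner_Integration.integral_cong[OF refl eq])
  also have "\<dots> = (\<Sum>n=1..N. \<tau> * f n)"
    using ind by (subst Bochner_Integration.integral_sum) auto
  finally show "(\<integral>t. f (nat \<lceil>t / \<tau>\<rceil>) \<partial>?M) = \<tau> * (\<Sum>n=1..N. f n)" by (simp add: sum_distrib_left)
qed

section \<open>Test functions and integration by parts\<close>

lemma test_function_facts:
  assumes "test_function T \<phi>"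
  shows "(\<phi> has_real_derivative deriv \<phi> x) (at x)" "continuous_on UNIV (deriv \<phi>)" "\<phi> 0 = 0" "\<phi> T = 0"
proof -
  have d: "(deriv ^^ n) \<phi> field_differentiable (at x)" for n x using assms by (simp add: test_function_def)
  show "(\<phi> has_real_derivative deriv \<phi> x) (at x)" using d[of 0 x] by (simp add: DERIV_deriv_iff_field_differentiable)
  have "isCont (deriv \<phi>) x" for x using field_differentiable_imp_continuous_at[OF d[of 1 x]] by simp
  then show "continuous_on UNIV (deriv \<phi>)" by (simp add: continuous_at_imp_continuous_on)
  show "\<phi> 0 = 0" "\<phi> T = 0" using assms by (auto simp: test_function_def)
qed

lemma test_function_bounded:
  assumes "test_function T \<phi>"
  obtains K where "\<forall>t\<in>{0..T}. \<bar>\<phi> t\<bar> \<le> K" "\<forall>t\<in>{0..T}. \<bar>deriv \<phi> t\<bar> \<le> K"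
proof -
  have "continuous_on {0..T} \<phi>"
    using test_function_facts(1)[OF assms] by (intro continuous_at_imp_continuous_on ballI) (auto intro: DERIV_isCont)
  then have "bounded (\<phi> ` {0..T})" by (intro compact_imp_bounded compact_continuous_image) auto
  then obtain K1 where "\<forall>x\<in>\<phi> ` {0..T}. norm x \<le> K1" unfolding bounded_iff by blast
  then have K1: "\<bar>\<phi> t\<bar> \<le> K1" if "t \<in> {0..T}" for t using that by simp
  have "continuous_on {0..T} (deriv \<phi>)" by (rule continuous_on_subset[OF test_function_facts(2)[OF assms]]) simp
  then have "bounded (deriv \<phi> ` {0..T})" by (intro compact_imp_bounded compact_continuous_image) auto
  then obtain K2 where "\<forall>x\<in>deriv \<phi> ` {0..T}. norm x \<le> K2" unfolding bounded_iff by blast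
  then have K2: "\<bar>deriv \<phi> t\<bar> \<le> K2" if "t \<in> {0..T}" for t using that by simp
  show ?thesis
    by (rule that[of "max K1 K2"]; rule ballI; rule max.coboundedI1 max.coboundedI2; (rule K1 | rule K2))
qed

lemma continuous_imp_lebesgue_on_measurable:
  fixes f :: "real \<Rightarrow> real"
  assumes "continuous_on UNIV f"
  shows "f \<in> borel_measurable (lebesgue_on S)"
proof -
  have "f \<in> borel_measurable borel" using assms by (rule borel_measurable_continuous_onI)
  then show ?thesis by (intro measurable_restrict_space1 measurable_completion) simp
qed

lemma test_function_measurable:
  assumes "test_function T \<phi>"
  shows "\<phi> \<in> borel_measurable (lebesgue_on S)" "deriv \<phi> \<in> borel_measurable (lebesgue_on S)"
proof -
  have "continuous_on UNIV \<phi>"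
    using test_function_facts(1)[OF assms] by (intro continuous_at_imp_continuous_on ballI) (auto intro: DERIV_isCont)
  then show "\<phi> \<in> borel_measurable (lebesgue_on S)" by (rule continuous_imp_lebesgue_on_measurable)
  show "deriv \<phi> \<in> borel_measurable (lebesgue_on S)"
    by (rule continuous_imp_lebesgue_on_measurable[OF test_function_facts(2)[OF assms]])
qed

text \<open>On each step the integrand is the derivative of \<open>\<phi>\<close> times an affine
  function. The boundary terms cancel from step to step because the interpolant is
  continuous.\<close>

lemma pw_linear_by_parts_has_integral:
  fixes p :: "nat \<Rightarrow> real"
  assumes \<phi>: "test_function T \<phi>" and \<tau>: "\<tau> > 0"
  shows "((\<lambda>t. deriv \<phi> t * pw_linear \<tau> p t + \<phi> t * (let n = nat \<lceil>t / \<tau>\<rceil> in (p n - p (n - 1)) / \<tau>))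
    has_integral \<phi> (real m * \<tau>) * p m - \<phi> 0 * p 0) {0..real m * \<tau>}"
proof (induction m)
  case 0
  then show ?case by (simp add: has_integral_refl(2))
next
  case (Suc m)
  let ?f = "\<lambda>t. deriv \<phi> t * pw_linear \<tau> p t + \<phi> t * (let n = nat \<lceil>t / \<tau>\<rceil> in (p n - p (n - 1)) / \<tau>)"
  let ?x = "real m * \<tau>"
  let ?y = "real (Suc m) * \<tau>"
  define d where "d = (p (Suc m) - p m) / \<tau>"
  define g where "g t = deriv \<phi> t * ((t - ?x) * d + p m) + \<phi> t * d" for t
  have xy: "0 \<le> ?x" "?x \<le> ?y" using \<tau> by (simp_all add: algebra_simps)
  have "(g has_integral \<phi> ?y * ((?y - ?x) * d + p m) - \<phi> ?x * ((?x - ?x) * d + p m)) {?x..?y}"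
  proof (rule fundamental_theorem_of_calculus[OF xy(2)])
    fix t
    have "((\<lambda>t. \<phi> t * ((t - ?x) * d + p m)) has_real_derivative g t) (at t)"
      unfolding g_def by (rule derivative_eq_intros test_function_facts(1)[OF \<phi>] refl)+ simp
    then show "((\<lambda>t. \<phi> t * ((t - ?x) * d + p m)) has_vector_derivative g t) (at t within {?x..?y})"
      by (simp add: has_real_derivative_iff_has_vector_derivative has_vector_derivative_at_within)
  qed
  moreover have "(?y - ?x) * d + p m = p (Suc m)" using \<tau> by (simp add: d_def algebra_simps) (simp add: field_simps)
  ultimately have gi: "(g has_integral \<phi> ?y * p (Suc m) - \<phi> ?x * p m) {?x..?y}" by simp
  have "(?f has_integral \<phi> ?y * p (Suc m) - \<phi> ?x * p m) {?x..?y}"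
  proof (rule has_integral_spike_finite[OF _ _ gi])
    \<comment> \<open>At the left end point the index is still \<open>m\<close>; this single point
      is discarded.\<close>
    fix t assume t: "t \<in> {?x..?y} - {?x}"
    have n: "nat \<lceil>t / \<tau>\<rceil> = Suc m" by (rule time_index_eq[OF \<tau>]) (use t in auto)
    show "?f t = g t" unfolding pw_linear_def Let_def n by (simp add: g_def d_def)
  qed simp
  from has_integral_combine[OF xy Suc this] show ?case by simp
qed

lemma pw_linear_by_parts:
  fixes p :: "nat \<Rightarrow> real"
  assumes \<phi>: "test_function T \<phi>" and \<tau>: "\<tau> > 0" and T: "T = real N * \<tau>"
    and i: "integrable (lebesgue_on {0<..<T}) (\<lambda>t. deriv \<phi> t * pw_linear \<tau> p t)"
    and i': "integrable (lebesgue_on {0<..<T}) (\<lambda>t. \<phi> t * (let n = nat \<lceil>t / \<tau>\<rceil> in (p n - p (n - 1)) / \<tau>))"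
  shows "(\<integral>t. deriv \<phi> t * pw_linear \<tau> p t \<partial>lebesgue_on {0<..<T})
    = - (\<integral>t. \<phi> t * (let n = nat \<lceil>t / \<tau>\<rceil> in (p n - p (n - 1)) / \<tau>) \<partial>lebesgue_on {0<..<T})"
proof -
  let ?f = "\<lambda>t. deriv \<phi> t * pw_linear \<tau> p t + \<phi> t * (let n = nat \<lceil>t / \<tau>\<rceil> in (p n - p (n - 1)) / \<tau>)"
  have "(?f has_integral (\<integral>t. ?f t \<partial>lebesgue_on {0<..<T})) {0<..<T}"
    by (rule has_integral_integral_lebesgue_on) (use i i' in auto)
  moreover have "(?f has_integral 0) {0<..<T}"
    using pw_linear_by_parts_has_integral[OF \<phi> \<tau>, of p N] test_function_facts(3,4)[OF \<phi>]
    by (simp add: T[symmetric] has_integral_Icc_iff_Ioo)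
  ultimately have "(\<integral>t. ?f t \<partial>lebesgue_on {0<..<T}) = 0" by (rule has_integral_unique)
  then show ?thesis using i i' by simp
qed

lemma finite_measure_lebesgue_on_Ioo: "finite_measure (lebesgue_on {x<..<y :: real})"
  by (rule finite_measureI) (use emeasure_bounded_finite[of "{x<..<y}"] in \<open>simp add: emeasure_restrict_space less_top\<close>)

lemma norm_le_1_plus_sq: "norm (x :: 'a::real_normed_vector) \<le> 1 + (norm x)\<^sup>2"
proof -
  have "0 \<le> (norm x - 1)\<^sup>2" by simp
  then have "2 * norm x \<le> 1 + (norm x)\<^sup>2" by (simp add: power2_diff)
  then show ?thesis using norm_ge_zero[of x] by linarith
qed

section \<open>Stability of weak convergence, and weak derivatives in coordinates\<close>

lemma weakly_converges_subseq:
  assumes "weakly_converges_Lp p X N M F f" "strict_mono r"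
  shows "weakly_converges_Lp p X N M (\<lambda>k. F (r k)) f"
  using assms LIMSEQ_subseq_LIMSEQ[OF _ assms(2)] unfolding weakly_converges_Lp_def by (auto simp: o_def)

lemma (in hilbert_carrier_measure) bochner_L2_imp_L1:
  assumes "finite_measure M" "f \<in> bochner_Lp 2 X N M"
  shows "f \<in> bochner_Lp 1 X N M" "integrable M (\<lambda>t. J (f t))"
proof -
  interpret finite_measure M by fact
  have f: "AE t in M. f t \<in> X" "(\<lambda>t. J (f t)) \<in> borel_measurable M" "integrable M (\<lambda>t. (norm (J (f t)))\<^sup>2)"
    using assms(2) by (auto simp: bochner_Lp_iff)
  have i: "integrable M (\<lambda>t. 1 + (norm (J (f t)))\<^sup>2)" using f(3) by simp
  show 1: "integrable M (\<lambda>t. J (f t))"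
    by (rule Bochner_Integration.integrable_bound[OF i f(2)]) (use norm_le_1_plus_sq in \<open>auto simp: abs_of_nonneg\<close>)
  show "f \<in> bochner_Lp 1 X N M" using f(1,2) integrable_norm[OF 1] by (simp add: bochner_Lp_iff)
qed

text \<open>A perturbation that tends to zero in mean square leaves the weak limit unchanged. It
  identifies the limits of the two interpolants.\<close>

lemma (in hilbert_carrier_measure) weakly_converges_perturb:
  assumes w: "weakly_converges_Lp 2 X N M F f" and G: "\<And>k. G k \<in> bochner_Lp 2 X N M"
    and d: "(\<lambda>k. \<integral>t. (norm (J (G k t) - J (F k t)))\<^sup>2 \<partial>M) \<longlonglongrightarrow> 0"
  shows "weakly_converges_Lp 2 X N M G f"
  unfolding weakly_converges_Lp_def
proof (intro conjI allI ballI)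
  show "G k \<in> bochner_Lp 2 X N M" for k by (rule G)
  show "f \<in> bochner_Lp 2 X N M" using w by (simp add: weakly_converges_Lp_def)
  fix \<Phi> assume \<Phi>: "\<Phi> \<in> bochner_Lp_dual 2 X N M"
  have F: "F k \<in> bochner_Lp 2 X N M" for k using w by (simp add: weakly_converges_Lp_def)
  have lim: "(\<lambda>k. \<Phi> (F k)) \<longlonglongrightarrow> \<Phi> f" using w \<Phi> unfolding weakly_converges_Lp_def by blast
  obtain K where K: "\<And>f. f \<in> bochner_Lp 2 X N M \<Longrightarrow> \<bar>\<Phi> f\<bar> \<le> K * bochner_Lp_norm 2 N M f"
    and add: "\<And>f g. f \<in> bochner_Lp 2 X N M \<Longrightarrow> g \<in> bochner_Lp 2 X N M \<Longrightarrow> \<Phi> (\<lambda>t. f t + g t) = \<Phi> f + \<Phi> g"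
    using \<Phi> unfolding bochner_Lp_dual_def by blast
  define D where "D k t = G k t + (- 1) *\<^sub>R F k t" for k t
  have D: "D k \<in> bochner_Lp 2 X N M" for k
    unfolding D_def[abs_def] by (intro bochner_Lp_add bochner_Lp_scale G F)
  have eq: "\<Phi> (G k) - \<Phi> (F k) = \<Phi> (D k)" for k
  proof -
    have "(\<lambda>t. F k t + D k t) = G k" by (simp add: D_def)
    then show ?thesis using add[OF F D, of k k] by simp
  qed
  have nD: "bochner_Lp_norm 2 N M (D k) = sqrt (\<integral>t. (norm (J (G k t) - J (F k t)))\<^sup>2 \<partial>M)" for k
    unfolding Lp_norm_2[OF D]
  proof (rule arg_cong[where f = sqrt], rule integral_AE_eq)
    have GX: "AE t in M. G k t \<in> X" "(\<lambda>t. J (G k t)) \<in> borel_measurable M"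
      and FX: "AE t in M. F k t \<in> X" "(\<lambda>t. J (F k t)) \<in> borel_measurable M"
      using G[of k] F[of k] by (auto simp: bochner_Lp_iff)
    show "(\<lambda>t. (norm (J (G k t) - J (F k t)))\<^sup>2) \<in> borel_measurable M" using GX(2) FX(2) by measurable
    show "AE t in M. (norm (J (G k t) - J (F k t)))\<^sup>2 = (norm (J (D k t)))\<^sup>2"
      using GX(1) FX(1) by eventually_elim (simp add: D_def J_diff)
  qed
  have 0: "(\<lambda>k. K * sqrt (\<integral>t. (norm (J (G k t) - J (F k t)))\<^sup>2 \<partial>M)) \<longlonglongrightarrow> 0"
    using tendsto_mult_left[OF tendsto_real_sqrt[OF d], of K] by simp
  have "norm (\<Phi> (G k) - \<Phi> (F k)) \<le> K * sqrt (\<integral>t. (norm (J (G k t) - J (F k t)))\<^sup>2 \<partial>M)" for k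
    using K[OF D, of k] unfolding nD eq real_norm_def .
  then have "(\<lambda>k. \<Phi> (G k) - \<Phi> (F k)) \<longlonglongrightarrow> 0"
    by (intro Lim_null_comparison[OF always_eventually 0] allI)
  from tendsto_add[OF this lim] show "(\<lambda>k. \<Phi> (G k)) \<longlonglongrightarrow> \<Phi> f" by simp
qed

text \<open>The identity of Bochner integrals is checked after applying the injective
  \<open>J\<close> and pairing with an arbitrary vector of \<open>ell2\<close>, which reduces it to
  real integrals.\<close>

lemma weak_derivative_from_coordinates:
  fixes X :: "'b::real_vector set"
  assumes "hilbert_carrier_measure X N J E (lebesgue_on {0<..<T})"
    and f: "f \<in> bochner_Lp 2 X N (lebesgue_on {0<..<T})" and g: "g \<in> bochner_Lp 2 X N (lebesgue_on {0<..<T})"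
    and eq: "\<And>\<phi> y. test_function T \<phi> \<Longrightarrow>
      (\<integral>t. inner (J (f t)) (deriv \<phi> t *\<^sub>R y) \<partial>lebesgue_on {0<..<T}) = - (\<integral>t. inner (J (g t)) (\<phi> t *\<^sub>R y) \<partial>lebesgue_on {0<..<T})"
  shows "has_weak_derivative X N T f g"
proof -
  let ?M = "lebesgue_on {0<..<T}"
  interpret hilbert_carrier_measure X N J E ?M by fact
  have fin: "finite_measure ?M" by (rule finite_measure_lebesgue_on_Ioo)
  have int: "AE t in ?M. \<psi> t *\<^sub>R u t \<in> X" "integrable ?M (\<lambda>t. \<psi> t *\<^sub>R J (u t))"
    "integrable ?M (\<lambda>t. J (\<psi> t *\<^sub>R u t))" "(\<integral>t. J (\<psi> t *\<^sub>R u t) \<partial>?M) = (\<integral>t. \<psi> t *\<^sub>R J (u t) \<partial>?M)"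
    if u: "u \<in> bochner_Lp 2 X N ?M" and m [measurable]: "\<psi> \<in> borel_measurable ?M" and K: "\<forall>t\<in>{0..T}. \<bar>\<psi> t\<bar> \<le> K" for u \<psi> K
  proof -
    have uX: "AE t in ?M. u t \<in> X" and um [measurable]: "(\<lambda>t. J (u t)) \<in> borel_measurable ?M" using u by (auto simp: bochner_Lp_iff)
    show "AE t in ?M. \<psi> t *\<^sub>R u t \<in> X" using uX by eventually_elim (rule X_scale)
    have Ki: "integrable ?M (\<lambda>t. K *\<^sub>R J (u t))" using bochner_L2_imp_L1(2)[OF fin u] by simp
    show i: "integrable ?M (\<lambda>t. \<psi> t *\<^sub>R J (u t))"
    proof (rule Bochner_Integration.integrable_bound[OF Ki])
      show "AE t in ?M. norm (\<psi> t *\<^sub>R J (u t)) \<le> norm (K *\<^sub>R J (u t))"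
      proof (rule AE_I2)
        fix t assume "t \<in> space ?M"
        then have "t \<in> {0..T}" by simp
        then have "\<bar>\<psi> t\<bar> \<le> K" by (rule bspec[OF K])
        then have "\<bar>\<psi> t\<bar> \<le> \<bar>K\<bar>" by linarith
        then show "norm (\<psi> t *\<^sub>R J (u t)) \<le> norm (K *\<^sub>R J (u t))" by (simp add: mult_right_mono)
      qed
    qed measurable
    have AE: "AE t in ?M. \<psi> t *\<^sub>R J (u t) = J (\<psi> t *\<^sub>R u t)" using uX by eventually_elim (simp add: J_scale)
    have mi: "(\<lambda>t. \<psi> t *\<^sub>R J (u t)) \<in> borel_measurable ?M" by measurable
    show "(\<integral>t. J (\<psi> t *\<^sub>R u t) \<partial>?M) = (\<integral>t. \<psi> t *\<^sub>R J (u t) \<partial>?M)" by (rule integral_AE_eq[OF mi AE])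
    show "integrable ?M (\<lambda>t. J (\<psi> t *\<^sub>R u t))"
      using i borel_measurable_AE_eq[OF mi AE] mi AE by (subst integrable_cong_AE[of _ _ "\<lambda>t. \<psi> t *\<^sub>R J (u t)"]) (auto elim: AE_mp)
  qed
  have "bochner_int X N ?M (\<lambda>t. deriv \<phi> t *\<^sub>R f t) = - bochner_int X N ?M (\<lambda>t. \<phi> t *\<^sub>R g t)"
    if \<phi>: "test_function T \<phi>" for \<phi>
  proof -
    obtain K where K: "\<forall>t\<in>{0..T}. \<bar>\<phi> t\<bar> \<le> K" "\<forall>t\<in>{0..T}. \<bar>deriv \<phi> t\<bar> \<le> K"
      by (rule test_function_bounded[OF \<phi>])
    note F = int[OF f test_function_measurable(2)[OF \<phi>] K(2)]
    note G = int[OF g test_function_measurable(1)[OF \<phi>] K(1)]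
    note BF = bochner_int_eq[OF F(1,3)] and BG = bochner_int_eq[OF G(1,3)]
    have "inner (\<integral>t. deriv \<phi> t *\<^sub>R J (f t) \<partial>?M) y = inner (- (\<integral>t. \<phi> t *\<^sub>R J (g t) \<partial>?M)) y" for y
    proof -
      have "inner (\<integral>t. deriv \<phi> t *\<^sub>R J (f t) \<partial>?M) y = (\<integral>t. inner (J (f t)) (deriv \<phi> t *\<^sub>R y) \<partial>?M)"
        using integral_inner_left[OF F(2), of y] by simp
      also have "\<dots> = - (\<integral>t. inner (J (g t)) (\<phi> t *\<^sub>R y) \<partial>?M)" by (rule eq[OF \<phi>])
      also have "\<dots> = - inner (\<integral>t. \<phi> t *\<^sub>R J (g t) \<partial>?M) y"
        using integral_inner_left[OF G(2), of y] by simp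
      finally show ?thesis by simp
    qed
    then have "(\<integral>t. deriv \<phi> t *\<^sub>R J (f t) \<partial>?M) = - (\<integral>t. \<phi> t *\<^sub>R J (g t) \<partial>?M)" by (metis vector_eq_rdot)
    then have "J (bochner_int X N ?M (\<lambda>t. deriv \<phi> t *\<^sub>R f t)) = (- 1) *\<^sub>R J (bochner_int X N ?M (\<lambda>t. \<phi> t *\<^sub>R g t))"
      unfolding BF(3) BG(3) F(4) G(4) by simp
    also have "\<dots> = J ((- 1) *\<^sub>R bochner_int X N ?M (\<lambda>t. \<phi> t *\<^sub>R g t))" by (rule J_scale[OF BG(2), symmetric])
    finally have "bochner_int X N ?M (\<lambda>t. deriv \<phi> t *\<^sub>R f t) = (- 1) *\<^sub>R bochner_int X N ?M (\<lambda>t. \<phi> t *\<^sub>R g t)"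
      by (rule J_inj[OF BF(2) X_scale[OF BG(2)]])
    then show ?thesis by simp
  qed
  then show ?thesis
    unfolding has_weak_derivative_def using bochner_L2_imp_L1(1)[OF fin f] bochner_L2_imp_L1(1)[OF fin g] by blast
qed

lemma bounded_scaleR_sq_integrable:
  fixes T :: real
  assumes "finite_measure (lebesgue_on {0<..<T})" and [measurable]: "\<psi> \<in> borel_measurable (lebesgue_on {0<..<T})"
    and b: "\<forall>t\<in>{0..T}. \<bar>\<psi> t\<bar> \<le> K"
  shows "integrable (lebesgue_on {0<..<T}) (\<lambda>t. (norm (\<psi> t *\<^sub>R (y :: 'a::{second_countable_topology,real_normed_vector})))\<^sup>2)"
proof -
  interpret finite_measure "lebesgue_on {0<..<T}" by fact
  show ?thesis
  proof (rule integrable_const_bound[where B = "(K * norm y)\<^sup>2"])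
    show "AE t in lebesgue_on {0<..<T}. norm ((norm (\<psi> t *\<^sub>R y))\<^sup>2) \<le> (K * norm y)\<^sup>2"
    proof (rule AE_I2)
      fix t assume "t \<in> space (lebesgue_on {0<..<T})"
      then have "t \<in> {0..T}" by simp
      then have "\<bar>\<psi> t\<bar> \<le> K" by (rule bspec[OF b])
      then have "norm (\<psi> t *\<^sub>R y) \<le> K * norm y" by (simp add: mult_right_mono)
      from power_mono[OF this, of 2] show "norm ((norm (\<psi> t *\<^sub>R y))\<^sup>2) \<le> (K * norm y)\<^sup>2" by simp
    qed
  qed measurable
qed

section \<open>Uniform bounds and passage to the limit\<close>

text \<open>The classical derivative of \<open>pw_linear\<close> away from the nodes; it serves as
  the weak derivative.\<close>

definition pw_slope :: "real \<Rightarrow> (nat \<Rightarrow> 'b::real_vector) \<Rightarrow> real \<Rightarrow> 'b" where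
  "pw_slope \<tau> P t = (let n = nat \<lceil>t / \<tau>\<rceil> in (1 / \<tau>) *\<^sub>R (P n - P (n - 1)))"

text \<open>The bound on \<open>\<gamma>\<close> is kept in multiplied form, as the absorption of
  the square uses it.\<close>

locale riccati_data = gelfand_triple j B
  for j :: "'v::{real_inner,banach,second_countable_topology} \<Rightarrow>\<^sub>L 'h::{real_inner,banach,second_countable_topology}" and B +
  fixes C T \<mu> \<eta> \<gamma> :: real and a :: "real \<Rightarrow> 'v \<Rightarrow> 'v \<Rightarrow> real" and Q :: "real \<Rightarrow> 'v oper" and P0 :: "'v oper"
  assumes C: "\<And>v. norm (blinfun_apply j v) \<le> C * norm v"
    and T: "T > 0"
    and a_bilinear: "\<And>t. t \<in> {0..T} \<Longrightarrow> bilinear (a t)"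
    and a_measurable: "\<And>u v. (\<lambda>t. a t u v) \<in> borel_measurable (lebesgue_on {0..T})"
    and \<mu>: "\<mu> > 0" and \<eta>: "\<eta> > 0"
    and a_coercive: "\<And>t u. t \<in> {0..T} \<Longrightarrow> a t u u \<ge> \<mu> * (norm u)\<^sup>2"
    and a_bounded: "\<And>t u v. t \<in> {0..T} \<Longrightarrow> \<bar>a t u v\<bar> \<le> \<eta> * norm u * norm v"
    and \<gamma>: "0 \<le> \<gamma>" "\<gamma> * C\<^sup>2 \<le> \<mu>"
    and Q: "Q \<in> bochner_Lp 2 (opH j) (normH j) (lebesgue_on {0<..<T})"
    and P0: "P0 \<in> opH j"
begin

abbreviation "M \<equiv> lebesgue_on {0<..<T}"

sublocale V: hilbert_carrier_measure "opV j" "normV j" JV "Ew wV" M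
  by (intro hilbert_carrier_measure.intro carrier_V complete_measure_lebesgue_on) simp
sublocale H: hilbert_carrier_measure "opH j" "normH j" JH "Ew wH" M
  by (intro hilbert_carrier_measure.intro carrier_H complete_measure_lebesgue_on) simp
sublocale D: hilbert_carrier_measure "opD j" "normD j" JD "Ew wD" M
  by (intro hilbert_carrier_measure.intro carrier_D complete_measure_lebesgue_on) simp

lemma opV_opH: "R \<in> opV j \<Longrightarrow> R \<in> opH j" and opH_opD: "R \<in> opH j \<Longrightarrow> R \<in> opD j"
  using opV_subset_opH opH_subset_opD by auto

sublocale VH: hilbert_embedding "opV j" "normV j" JV "Ew wV" "opH j" "normH j" JH "Ew wH" M "sqrt (C\<^sup>2 / 2)"
proof unfold_locales
  fix R assume R: "R \<in> opV j"
  from real_sqrt_le_mono[OF norm_JH_le_JV[OF C R]] show "normH j R \<le> sqrt (C\<^sup>2 / 2) * normV j R"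
    by (simp only: normH_eq[OF opV_opH[OF R]] normV_eq[OF R] real_sqrt_mult real_sqrt_abs abs_norm_cancel)
qed (use opV_subset_opH in auto)

sublocale HD: hilbert_embedding "opH j" "normH j" JH "Ew wH" "opD j" "normD j" JD "Ew wD" M "sqrt ((norm j)\<^sup>2 + 1)"
proof unfold_locales
  show "normD j R \<le> sqrt ((norm j)\<^sup>2 + 1) * normH j R" if R: "R \<in> opH j" for R
    using norm_JD_le_JH[OF R] by (simp only: normH_eq[OF R] normD_eq[OF opH_opD[OF R]])
qed (use opH_subset_opD in auto)

lemma finite_M: "finite_measure M"
  by (rule finite_measure_lebesgue_on_Ioo)

text \<open>Extended by zero so that its integrals over consecutive steps add up on the whole line. \<open>K0\<close> and
  \<open>K1\<close> are the bounds, independent of the step size, of the energy and of the squared norm of the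
  discrete derivative.\<close>

definition Qsq :: "real \<Rightarrow> real" where "Qsq t = (if t \<in> {0<..<T} then (norm (JH (Q t)))\<^sup>2 else 0)"
definition KQ :: real where "KQ = (\<integral>t. Qsq t \<partial>lebesgue)"
definition K0 :: real where "K0 = (norm (JH P0))\<^sup>2 + C\<^sup>2 / \<mu> * KQ"
definition K1 :: real where
  "K1 = 3 * (((norm j)\<^sup>2 + 1) * KQ + 2 * \<eta>\<^sup>2 * (2 * K0 / \<mu>) + ((norm j)\<^sup>2 + 1) * (T * K0\<^sup>2))"

section \<open>Bounds independent of the step size\<close>

context
  fixes N :: nat and P :: "nat \<Rightarrow> 'v oper" and \<tau> :: real
  assumes N: "N > 0" and \<tau>_eq: "\<tau> = T / real N" and scheme: "backward_euler j a Q P0 \<gamma> \<tau> N P"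
begin

lemma \<tau>: "\<tau> > 0" and N\<tau>: "T = real N * \<tau>"
  using N T by (simp_all add: \<tau>_eq)

lemma n\<tau>_le: "n \<in> {1..N} \<Longrightarrow> real n * \<tau> \<le> T"
  using \<tau> by (simp add: N\<tau> mult_right_mono)

lemma P_V: "n \<in> {1..N} \<Longrightarrow> P n \<in> opV j"
  using scheme by (simp add: backward_euler_def)

lemma P_0: "P 0 = P0"
  using scheme by (simp add: backward_euler_def)

lemma P_H: "n \<le> N \<Longrightarrow> P n \<in> opH j"
  using P_V[of n] P0 P_0 opV_opH by (cases "n = 0") auto

text \<open>The share of the n-th step in \<open>KQ\<close>, which bounds \<open>\<tau>\<close>
  times the squared norm of the averaged right-hand side.\<close>

definition qn :: "nat \<Rightarrow> real" where
  "qn n = (\<integral>t. indicator {(real n - 1) * \<tau><..real n * \<tau>} t * Qsq t \<partial>lebesgue)"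

lemma Qsq_integrable: "integrable lebesgue Qsq"
  using avg_Q_estimates(1)[OF Q \<tau>, of 1 Qsq] n\<tau>_le[of 1] N by (simp add: Qsq_def[abs_def])

lemma sum_qn_le: "m \<le> N \<Longrightarrow> (\<Sum>n=1..m. qn n) \<le> KQ"
  unfolding qn_def integral_consecutive_intervals[OF Qsq_integrable \<tau>] KQ_def
  using integrable_mult_indicator[OF _ Qsq_integrable, of "{0<..real m * \<tau>}"]
  by (intro integral_mono Qsq_integrable) (auto simp: indicator_def Qsq_def)

lemma step_estimates:
  assumes n: "n \<in> {1..N}"
  shows "(norm (JH (P n)))\<^sup>2 - (norm (JH (P (n - 1))))\<^sup>2 + (norm (JH (P n - P (n - 1))))\<^sup>2
      + \<mu> / 2 * \<tau> * (norm (JV (P n)))\<^sup>2 \<le> C\<^sup>2 / \<mu> * qn n"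
    and "\<tau> * (norm (JD ((1 / \<tau>) *\<^sub>R (P n - P (n - 1)))))\<^sup>2
      \<le> 3 * (((norm j)\<^sup>2 + 1) * qn n + 2 * \<eta>\<^sup>2 * (\<tau> * (norm (JV (P n)))\<^sup>2) + ((norm j)\<^sup>2 + 1) * (\<tau> * ((norm (JH (P n)))\<^sup>2)\<^sup>2))"
proof -
  have n1: "1 \<le> n" using n by simp
  have ge: "op_ge j (P n) (- \<gamma>)" using scheme n by (simp add: backward_euler_def)
  have eq: "(1 / \<tau>) *\<^sub>R (P n - P (n - 1)) + lyapunov (avg_A a \<tau> n) (P n) + square_op (P n) = avg_Q j Q \<tau> n"
    using scheme n by (simp add: backward_euler_def lyapunov_def square_op_def add.assoc)
  have P': "P (n - 1) \<in> opH j" using n by (intro P_H) auto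
  have Qn: "avg_Q j Q \<tau> n \<in> opH j" "\<tau> * (norm (JH (avg_Q j Q \<tau> n)))\<^sup>2 \<le> qn n"
    unfolding qn_def by (rule avg_Q_estimates[OF Q \<tau> n1 n\<tau>_le[OF n]], simp add: Qsq_def[abs_def])+
  note A = avg_A_estimates[OF a_bilinear a_measurable a_coercive a_bounded \<tau> n1 n\<tau>_le[OF n]]
  note est = euler_step_estimates[OF P_V[OF n] ge P' Qn(1) eq C A less_imp_le[OF \<eta>] \<mu> \<tau> \<gamma>]
  have "C\<^sup>2 / \<mu> * \<tau> * (norm (JH (avg_Q j Q \<tau> n)))\<^sup>2 \<le> C\<^sup>2 / \<mu> * qn n"
    using mult_left_mono[OF Qn(2), of "C\<^sup>2 / \<mu>"] \<mu> by (simp add: mult_ac)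
  with est(1) show "(norm (JH (P n)))\<^sup>2 - (norm (JH (P (n - 1))))\<^sup>2 + (norm (JH (P n - P (n - 1))))\<^sup>2
      + \<mu> / 2 * \<tau> * (norm (JV (P n)))\<^sup>2 \<le> C\<^sup>2 / \<mu> * qn n" by (rule order_trans)
  have "\<tau> * (norm (JD ((1 / \<tau>) *\<^sub>R (P n - P (n - 1)))))\<^sup>2
      \<le> \<tau> * (3 * (((norm j)\<^sup>2 + 1) * (norm (JH (avg_Q j Q \<tau> n)))\<^sup>2 + 2 * \<eta>\<^sup>2 * (norm (JV (P n)))\<^sup>2 + ((norm j)\<^sup>2 + 1) * ((norm (JH (P n)))\<^sup>2)\<^sup>2))"
    using est(2) \<tau> by (intro mult_left_mono) auto
  also have "\<dots> = 3 * (((norm j)\<^sup>2 + 1) * (\<tau> * (norm (JH (avg_Q j Q \<tau> n)))\<^sup>2) + 2 * \<eta>\<^sup>2 * (\<tau> * (norm (JV (P n)))\<^sup>2) + ((norm j)\<^sup>2 + 1) * (\<tau> * ((norm (JH (P n)))\<^sup>2)\<^sup>2))"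
    by (simp add: algebra_simps)
  also have "\<dots> \<le> 3 * (((norm j)\<^sup>2 + 1) * qn n + 2 * \<eta>\<^sup>2 * (\<tau> * (norm (JV (P n)))\<^sup>2) + ((norm j)\<^sup>2 + 1) * (\<tau> * ((norm (JH (P n)))\<^sup>2)\<^sup>2))"
    using mult_left_mono[OF Qn(2), of "(norm j)\<^sup>2 + 1"] norm_j_sq1 by simp
  finally show "\<tau> * (norm (JD ((1 / \<tau>) *\<^sub>R (P n - P (n - 1)))))\<^sup>2
      \<le> 3 * (((norm j)\<^sup>2 + 1) * qn n + 2 * \<eta>\<^sup>2 * (\<tau> * (norm (JV (P n)))\<^sup>2) + ((norm j)\<^sup>2 + 1) * (\<tau> * ((norm (JH (P n)))\<^sup>2)\<^sup>2))" .
qed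

text \<open>The differences of squared norms telescope.\<close>

lemma energy_sum:
  "m \<le> N \<Longrightarrow> (norm (JH (P m)))\<^sup>2 + (\<Sum>n=1..m. (norm (JH (P n - P (n - 1))))\<^sup>2) + \<mu> / 2 * (\<tau> * (\<Sum>n=1..m. (norm (JV (P n)))\<^sup>2))
    \<le> (norm (JH P0))\<^sup>2 + C\<^sup>2 / \<mu> * (\<Sum>n=1..m. qn n)"
proof (induction m)
  case 0
  then show ?case by (simp add: P_0)
next
  case (Suc m)
  then show ?case using step_estimates(1)[of "Suc m"] by (simp add: algebra_simps)
qed

lemma energy_bounds:
  shows "n \<le> N \<Longrightarrow> (norm (JH (P n)))\<^sup>2 \<le> K0"
    and "(\<Sum>n=1..N. (norm (JH (P n - P (n - 1))))\<^sup>2) \<le> K0"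
    and "\<tau> * (\<Sum>n=1..N. (norm (JV (P n)))\<^sup>2) \<le> 2 * K0 / \<mu>"
    and "\<tau> * (\<Sum>n=1..N. (norm (JD ((1 / \<tau>) *\<^sub>R (P n - P (n - 1)))))\<^sup>2) \<le> K1"
proof -
  have b: "(norm (JH (P m)))\<^sup>2 + (\<Sum>n=1..m. (norm (JH (P n - P (n - 1))))\<^sup>2) + \<mu> / 2 * (\<tau> * (\<Sum>n=1..m. (norm (JV (P n)))\<^sup>2)) \<le> K0"
    if "m \<le> N" for m
    using energy_sum[OF that] mult_left_mono[OF sum_qn_le[OF that], of "C\<^sup>2 / \<mu>"] \<mu> by (simp add: K0_def)
  have nn: "0 \<le> (\<Sum>n=1..m. (norm (JH (P n - P (n - 1))))\<^sup>2)" "0 \<le> \<mu> / 2 * (\<tau> * (\<Sum>n=1..m. (norm (JV (P n)))\<^sup>2))" for m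
    using \<mu> \<tau> by (auto intro!: sum_nonneg mult_nonneg_nonneg)
  show 1: "(norm (JH (P n)))\<^sup>2 \<le> K0" if "n \<le> N" for n using b[OF that] nn[of n] by linarith
  show "(\<Sum>n=1..N. (norm (JH (P n - P (n - 1))))\<^sup>2) \<le> K0"
    using b[of N] nn(2)[of N] zero_le_power2[of "norm (JH (P N))"] by linarith
  have "\<mu> / 2 * (\<tau> * (\<Sum>n=1..N. (norm (JV (P n)))\<^sup>2)) \<le> K0"
    using b[of N] nn(1)[of N] zero_le_power2[of "norm (JH (P N))"] by linarith
  then show 3: "\<tau> * (\<Sum>n=1..N. (norm (JV (P n)))\<^sup>2) \<le> 2 * K0 / \<mu>" using \<mu> by (simp add: field_simps)
  define c where "c = (norm j)\<^sup>2 + 1"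
  have c: "c \<ge> 0" using norm_j_sq1 by (simp add: c_def)
  \<comment> \<open>The quartic term is controlled by the uniform bound in H alone, since the step
    lengths add up to \<open>T\<close>.\<close>
  have "(\<Sum>n=1..N. \<tau> * ((norm (JH (P n)))\<^sup>2)\<^sup>2) \<le> (\<Sum>n=1..N. \<tau> * K0\<^sup>2)"
    using 1 \<tau> by (intro sum_mono mult_left_mono power_mono) auto
  then have 4: "(\<Sum>n=1..N. \<tau> * ((norm (JH (P n)))\<^sup>2)\<^sup>2) \<le> T * K0\<^sup>2" by (simp add: N\<tau> mult_ac)
  have "\<tau> * (\<Sum>n=1..N. (norm (JD ((1 / \<tau>) *\<^sub>R (P n - P (n - 1)))))\<^sup>2)
      = (\<Sum>n=1..N. \<tau> * (norm (JD ((1 / \<tau>) *\<^sub>R (P n - P (n - 1)))))\<^sup>2)" by (rule sum_distrib_left)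
  also have "\<dots> \<le> (\<Sum>n=1..N. 3 * (c * qn n + 2 * \<eta>\<^sup>2 * (\<tau> * (norm (JV (P n)))\<^sup>2) + c * (\<tau> * ((norm (JH (P n)))\<^sup>2)\<^sup>2)))"
    unfolding c_def by (intro sum_mono step_estimates(2))
  also have "\<dots> = 3 * (c * (\<Sum>n=1..N. qn n) + 2 * \<eta>\<^sup>2 * (\<tau> * (\<Sum>n=1..N. (norm (JV (P n)))\<^sup>2)) + c * (\<Sum>n=1..N. \<tau> * ((norm (JH (P n)))\<^sup>2)\<^sup>2))"
    by (simp add: sum.distrib sum_distrib_left)
  also have "\<dots> \<le> 3 * (c * KQ + 2 * \<eta>\<^sup>2 * (2 * K0 / \<mu>) + c * (T * K0\<^sup>2))"
    by (intro mult_left_mono add_mono sum_qn_le 3 4 c) auto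
  finally show "\<tau> * (\<Sum>n=1..N. (norm (JD ((1 / \<tau>) *\<^sub>R (P n - P (n - 1)))))\<^sup>2) \<le> K1"
    by (simp add: K1_def c_def)
qed

lemma index: "t \<in> {0<..<T} \<Longrightarrow> nat \<lceil>t / \<tau>\<rceil> \<in> {1..N}"
  using time_index(1)[OF \<tau>, of t N] by (simp add: N\<tau>)

lemma pw_const_V:
  shows "pw_const \<tau> P \<in> bochner_Lp 2 (opV j) (normV j) M" "(\<integral>t. (norm (JV (pw_const \<tau> P t)))\<^sup>2 \<partial>M) \<le> 2 * K0 / \<mu>"
    "AE t in M. norm (JH (pw_const \<tau> P t)) \<le> sqrt K0"
proof -
  have m: "(\<lambda>t. JV (pw_const \<tau> P t)) \<in> borel_measurable M"
    unfolding pw_const_def by (rule time_index_measurable[where f = "\<lambda>n. JV (P n)"])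
  note i = time_index_integral[OF \<tau> N\<tau>, of "\<lambda>n. (norm (JV (P n)))\<^sup>2"]
  have "AE t in M. pw_const \<tau> P t \<in> opV j"
    by (rule AE_I2) (use index P_V in \<open>simp add: pw_const_def\<close>)
  then show "pw_const \<tau> P \<in> bochner_Lp 2 (opV j) (normV j) M"
    using m i(1) by (simp add: V.bochner_Lp_iff pw_const_def)
  show "(\<integral>t. (norm (JV (pw_const \<tau> P t)))\<^sup>2 \<partial>M) \<le> 2 * K0 / \<mu>"
    using energy_bounds(3) by (simp add: pw_const_def i(2))
  show "AE t in M. norm (JH (pw_const \<tau> P t)) \<le> sqrt K0"
  proof (rule AE_I2)
    fix t assume "t \<in> space M"
    then show "norm (JH (pw_const \<tau> P t)) \<le> sqrt K0"
      using energy_bounds(1)[of "nat \<lceil>t / \<tau>\<rceil>"] index[of t] unfolding pw_const_def by (intro real_le_rsqrt) auto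
  qed
qed

lemma index_le: "t \<in> {0<..<T} \<Longrightarrow> nat \<lceil>t / \<tau>\<rceil> \<le> N" "t \<in> {0<..<T} \<Longrightarrow> nat \<lceil>t / \<tau>\<rceil> - 1 \<le> N"
  using index[of t] unfolding atLeastAtMost_iff by linarith+

lemma JH_pw_linear:
  assumes t: "t \<in> {0<..<T}" and n: "n = nat \<lceil>t / \<tau>\<rceil>"
  shows "pw_linear \<tau> P t \<in> opH j"
    "JH (pw_linear \<tau> P t) = ((t - (real n - 1) * \<tau>) / \<tau>) *\<^sub>R (JH (P n) - JH (P (n - 1))) + JH (P (n - 1))"
    "0 \<le> (t - (real n - 1) * \<tau>) / \<tau>" "(t - (real n - 1) * \<tau>) / \<tau> \<le> 1"
proof -
  have t': "0 < t" "t \<le> real N * \<tau>" using t N\<tau> by auto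
  note ti = time_index[OF \<tau> t' n]
  have PH: "P n \<in> opH j" "P (n - 1) \<in> opH j" using ti(1) by (auto intro: P_H)
  have pl: "pw_linear \<tau> P t = ((t - (real n - 1) * \<tau>) / \<tau>) *\<^sub>R (P n - P (n - 1)) + P (n - 1)"
    by (simp add: pw_linear_def n[symmetric] Let_def)
  show "pw_linear \<tau> P t \<in> opH j" unfolding pl by (intro H.X_add H.X_scale H.X_diff PH)
  show "JH (pw_linear \<tau> P t) = ((t - (real n - 1) * \<tau>) / \<tau>) *\<^sub>R (JH (P n) - JH (P (n - 1))) + JH (P (n - 1))"
    unfolding pl by (simp add: H.J_add H.J_scale H.J_diff H.X_scale H.X_diff PH del: One_nat_def)
  show "0 \<le> (t - (real n - 1) * \<tau>) / \<tau>" using ti(2) \<tau> by simp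
  show "(t - (real n - 1) * \<tau>) / \<tau> \<le> 1" using ti(3) \<tau> by (simp add: algebra_simps)
qed

text \<open>The bounds are in H because on the first step the interpolant involves
  \<open>P0\<close>, which lies only in \<open>opH\<close>. The numerical dissipation in the energy
  estimate gives the last bound.\<close>

lemma pw_linear_H:
  shows "pw_linear \<tau> P \<in> bochner_Lp 2 (opH j) (normH j) M" "AE t in M. norm (JH (pw_linear \<tau> P t)) \<le> sqrt K0"
    "(\<integral>t. (norm (JH (pw_linear \<tau> P t) - JH (pw_const \<tau> P t)))\<^sup>2 \<partial>M) \<le> \<tau> * K0"
proof -
  interpret finite_measure M by (rule finite_M)
  let ?n = "\<lambda>t. nat \<lceil>t / \<tau>\<rceil>"
  have [measurable]: "(\<lambda>t. f (?n t)) \<in> borel_measurable M" for f :: "nat \<Rightarrow> real" by (rule time_index_measurable)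
  have [measurable]: "(\<lambda>t. f (?n t)) \<in> borel_measurable M" for f :: "nat \<Rightarrow> ell2" by (rule time_index_measurable)
  have idm [measurable]: "(\<lambda>t. t) \<in> borel_measurable M" by (rule measurable_restrict_space1, rule measurable_completion) simp
  have mexp: "(\<lambda>t. ((t - (real (?n t) - 1) * \<tau>) / \<tau>) *\<^sub>R (JH (P (?n t)) - JH (P (?n t - 1))) + JH (P (?n t - 1))) \<in> borel_measurable M"
    using time_index_measurable[of "\<lambda>n. real n" \<tau> "{0<..<T}"] time_index_measurable[of "\<lambda>n. JH (P n)" \<tau> "{0<..<T}"]
      time_index_measurable[of "\<lambda>n. JH (P (n - 1))" \<tau> "{0<..<T}"] idm by measurable
  have m: "(\<lambda>t. JH (pw_linear \<tau> P t)) \<in> borel_measurable M"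
    by (rule measurable_cong[THEN iffD2, OF _ mexp]) (use JH_pw_linear(2) in auto)
  have mc: "(\<lambda>t. JH (pw_const \<tau> P t)) \<in> borel_measurable M"
    unfolding pw_const_def by (rule time_index_measurable[where f = "\<lambda>n. JH (P n)"])
  have le: "norm (JH (pw_linear \<tau> P t)) \<le> sqrt K0" if t: "t \<in> {0<..<T}" for t
  proof -
    note pl = JH_pw_linear[OF t refl]
    define \<theta> where "\<theta> = (t - (real (?n t) - 1) * \<tau>) / \<tau>"
    have th: "0 \<le> \<theta>" "\<theta> \<le> 1" unfolding \<theta>_def by (rule pl(3), rule pl(4))
    have P: "norm (JH (P (?n t))) \<le> sqrt K0" "norm (JH (P (?n t - 1))) \<le> sqrt K0"
      by (intro real_le_rsqrt energy_bounds(1) index_le t)+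
    \<comment> \<open>A convex combination of two consecutive values, so the bound for the nodes
      persists.\<close>
    have "JH (pw_linear \<tau> P t) = \<theta> *\<^sub>R JH (P (?n t)) + (1 - \<theta>) *\<^sub>R JH (P (?n t - 1))"
      unfolding pl(2) \<theta>_def[symmetric] by (simp add: algebra_simps)
    then have "norm (JH (pw_linear \<tau> P t)) \<le> \<theta> * norm (JH (P (?n t))) + (1 - \<theta>) * norm (JH (P (?n t - 1)))"
      using th norm_triangle_ineq[of "\<theta> *\<^sub>R JH (P (?n t))" "(1 - \<theta>) *\<^sub>R JH (P (?n t - 1))"] by simp
    also have "\<dots> \<le> \<theta> * sqrt K0 + (1 - \<theta>) * sqrt K0"
      using P th by (intro add_mono mult_left_mono) auto
    finally show ?thesis by (simp add: algebra_simps)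
  qed
  then show AE: "AE t in M. norm (JH (pw_linear \<tau> P t)) \<le> sqrt K0" by (intro AE_I2) simp
  have "integrable M (\<lambda>t. (norm (JH (pw_linear \<tau> P t)))\<^sup>2)"
  proof (rule integrable_const_bound[where B = "(sqrt K0)\<^sup>2"])
    show "AE t in M. norm ((norm (JH (pw_linear \<tau> P t)))\<^sup>2) \<le> (sqrt K0)\<^sup>2"
      using AE by eventually_elim (simp only: real_norm_def abs_power2 power_mono norm_ge_zero)
  qed (use m in measurable)
  moreover have "AE t in M. pw_linear \<tau> P t \<in> opH j" by (rule AE_I2) (use JH_pw_linear(1) in auto)
  ultimately show "pw_linear \<tau> P \<in> bochner_Lp 2 (opH j) (normH j) M" using m by (simp add: H.bochner_Lp_iff)
  note i = time_index_integral[OF \<tau> N\<tau>, of "\<lambda>n. (norm (JH (P n - P (n - 1))))\<^sup>2"]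
  have dle: "(norm (JH (pw_linear \<tau> P t) - JH (pw_const \<tau> P t)))\<^sup>2 \<le> (norm (JH (P (?n t) - P (?n t - 1))))\<^sup>2"
    if t: "t \<in> {0<..<T}" for t
  proof (rule power_mono)
    note pl = JH_pw_linear[OF t refl]
    define \<theta> where "\<theta> = (t - (real (?n t) - 1) * \<tau>) / \<tau>"
    have PH: "P (?n t) \<in> opH j" "P (?n t - 1) \<in> opH j" by (intro P_H index_le t)+
    have "JH (pw_linear \<tau> P t) - JH (pw_const \<tau> P t) = (\<theta> - 1) *\<^sub>R JH (P (?n t) - P (?n t - 1))"
      unfolding pl(2) \<theta>_def[symmetric] H.J_diff[OF PH] by (simp add: pw_const_def algebra_simps)
    then have "norm (JH (pw_linear \<tau> P t) - JH (pw_const \<tau> P t)) = \<bar>\<theta> - 1\<bar> * norm (JH (P (?n t) - P (?n t - 1)))" by simp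
    also have "\<dots> \<le> 1 * norm (JH (P (?n t) - P (?n t - 1)))"
      using pl(3,4) by (intro mult_right_mono) (auto simp: \<theta>_def)
    finally show "norm (JH (pw_linear \<tau> P t) - JH (pw_const \<tau> P t)) \<le> norm (JH (P (?n t) - P (?n t - 1)))" by simp
  qed simp
  have "(\<integral>t. (norm (JH (pw_linear \<tau> P t) - JH (pw_const \<tau> P t)))\<^sup>2 \<partial>M) \<le> (\<integral>t. (norm (JH (P (?n t) - P (?n t - 1))))\<^sup>2 \<partial>M)"
  proof (rule integral_mono_AE[OF _ i(1)])
    show "AE t in M. (norm (JH (pw_linear \<tau> P t) - JH (pw_const \<tau> P t)))\<^sup>2 \<le> (norm (JH (P (?n t) - P (?n t - 1))))\<^sup>2"
      by (rule AE_I2) (use dle in auto)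
    then show "integrable M (\<lambda>t. (norm (JH (pw_linear \<tau> P t) - JH (pw_const \<tau> P t)))\<^sup>2)"
      by (intro Bochner_Integration.integrable_bound[OF i(1)]) (use m mc in auto)
  qed
  also have "\<dots> \<le> \<tau> * K0" unfolding i(2) using energy_bounds(2) \<tau> by (intro mult_left_mono) auto
  finally show "(\<integral>t. (norm (JH (pw_linear \<tau> P t) - JH (pw_const \<tau> P t)))\<^sup>2 \<partial>M) \<le> \<tau> * K0" .
qed

lemma pw_slope_D:
  shows "pw_slope \<tau> P \<in> bochner_Lp 2 (opD j) (normD j) M" "(\<integral>t. (norm (JD (pw_slope \<tau> P t)))\<^sup>2 \<partial>M) \<le> K1"
proof -
  let ?f = "\<lambda>n. (1 / \<tau>) *\<^sub>R (P n - P (n - 1))"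
  have sl: "pw_slope \<tau> P t = ?f (nat \<lceil>t / \<tau>\<rceil>)" for t by (simp add: pw_slope_def Let_def)
  have m: "(\<lambda>t. JD (pw_slope \<tau> P t)) \<in> borel_measurable M"
    unfolding sl by (rule time_index_measurable[where f = "\<lambda>n. JD (?f n)"])
  note i = time_index_integral[OF \<tau> N\<tau>, of "\<lambda>n. (norm (JD (?f n)))\<^sup>2"]
  have "pw_slope \<tau> P t \<in> opD j" if "t \<in> {0<..<T}" for t
    unfolding sl by (intro opH_opD H.X_scale H.X_diff P_H index_le that)
  then have "AE t in M. pw_slope \<tau> P t \<in> opD j" by (intro AE_I2) simp
  then show "pw_slope \<tau> P \<in> bochner_Lp 2 (opD j) (normD j) M" using m i(1) by (simp add: D.bochner_Lp_iff sl)
  show "(\<integral>t. (norm (JD (pw_slope \<tau> P t)))\<^sup>2 \<partial>M) \<le> K1"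
    unfolding sl i(2) by (rule energy_bounds(4))
qed

text \<open>Pairing with \<open>y\<close> commutes with interpolation, so this is the scalar formula
  for the nodal values \<open>p n\<close>.\<close>

lemma pw_linear_slope_by_parts:
  assumes \<phi>: "test_function T \<phi>"
  shows "(\<integral>t. inner (JD (pw_linear \<tau> P t)) (deriv \<phi> t *\<^sub>R y) \<partial>M) = - (\<integral>t. inner (JD (pw_slope \<tau> P t)) (\<phi> t *\<^sub>R y) \<partial>M)"
proof -
  interpret finite_measure M by (rule finite_M)
  define p where "p n = inner (JD (P n)) y" for n
  have D: "P (nat \<lceil>t / \<tau>\<rceil>) \<in> opD j" "P (nat \<lceil>t / \<tau>\<rceil> - 1) \<in> opD j" if "t \<in> {0<..<T}" for t
    by (intro opH_opD P_H index_le that)+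
  have 1: "inner (JD (pw_linear \<tau> P t)) (deriv \<phi> t *\<^sub>R y) = deriv \<phi> t * pw_linear \<tau> p t" if "t \<in> space M" for t
    using D[of t] that by (simp add: pw_linear_def Let_def D.J_add D.J_scale D.J_diff D.X_scale D.X_diff p_def
        inner_add_left inner_diff_left del: One_nat_def)
  have 2: "inner (JD (pw_slope \<tau> P t)) (\<phi> t *\<^sub>R y) = \<phi> t * (let n = nat \<lceil>t / \<tau>\<rceil> in (p n - p (n - 1)) / \<tau>)" if "t \<in> space M" for t
    using D[of t] that by (simp add: pw_slope_def Let_def D.J_scale D.J_diff D.X_diff p_def inner_diff_left del: One_nat_def)
  obtain K where K: "\<forall>t\<in>{0..T}. \<bar>\<phi> t\<bar> \<le> K" "\<forall>t\<in>{0..T}. \<bar>deriv \<phi> t\<bar> \<le> K"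
    by (rule test_function_bounded[OF \<phi>])
  have int: "integrable M (\<lambda>t. inner (JD (f t)) (\<psi> t *\<^sub>R y))"
    if f: "f \<in> bochner_Lp 2 (opD j) (normD j) M" and \<psi> [measurable]: "\<psi> \<in> borel_measurable M" and b: "\<forall>t\<in>{0..T}. \<bar>\<psi> t\<bar> \<le> K" for f \<psi>
    by (rule integrable_inner_of_norm_sq) (use f bounded_scaleR_sq_integrable[OF finite_M \<psi> b] in \<open>auto simp: D.bochner_Lp_iff\<close>)
  have "integrable M (\<lambda>t. inner (JD (pw_linear \<tau> P t)) (deriv \<phi> t *\<^sub>R y))"
    by (rule int[OF HD.bochner_L2_mono(1)[OF pw_linear_H(1)] test_function_measurable(2)[OF \<phi>] K(2)])
  also have "?this \<longleftrightarrow> integrable M (\<lambda>t. deriv \<phi> t * pw_linear \<tau> p t)"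
    by (rule Bochner_Integration.integrable_cong[OF refl], rule 1)
  finally have i1: "integrable M (\<lambda>t. deriv \<phi> t * pw_linear \<tau> p t)" .
  have "integrable M (\<lambda>t. inner (JD (pw_slope \<tau> P t)) (\<phi> t *\<^sub>R y))"
    by (rule int[OF pw_slope_D(1) test_function_measurable(1)[OF \<phi>] K(1)])
  also have "?this \<longleftrightarrow> integrable M (\<lambda>t. \<phi> t * (let n = nat \<lceil>t / \<tau>\<rceil> in (p n - p (n - 1)) / \<tau>))"
    by (rule Bochner_Integration.integrable_cong[OF refl], rule 2)
  finally have i2: "integrable M (\<lambda>t. \<phi> t * (let n = nat \<lceil>t / \<tau>\<rceil> in (p n - p (n - 1)) / \<tau>))" .
  have "(\<integral>t. inner (JD (pw_linear \<tau> P t)) (deriv \<phi> t *\<^sub>R y) \<partial>M) = (\<integral>t. deriv \<phi> t * pw_linear \<tau> p t \<partial>M)"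
    by (rule Bochner_Integration.integral_cong[OF refl], rule 1)
  also have "\<dots> = - (\<integral>t. \<phi> t * (let n = nat \<lceil>t / \<tau>\<rceil> in (p n - p (n - 1)) / \<tau>) \<partial>M)"
    by (rule pw_linear_by_parts[OF \<phi> \<tau> N\<tau> i1 i2])
  also have "(\<integral>t. \<phi> t * (let n = nat \<lceil>t / \<tau>\<rceil> in (p n - p (n - 1)) / \<tau>) \<partial>M) = (\<integral>t. inner (JD (pw_slope \<tau> P t)) (\<phi> t *\<^sub>R y) \<partial>M)"
    by (rule Bochner_Integration.integral_cong[OF refl], rule 2[symmetric])
  finally show ?thesis .
qed

end

section \<open>The limit along a sequence of step sizes\<close>

context
  fixes N :: "nat \<Rightarrow> nat" and P :: "nat \<Rightarrow> nat \<Rightarrow> 'v oper"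
  assumes N: "\<And>k. N k > 0" and N_lim: "filterlim N at_top sequentially"
    and scheme: "\<And>k. backward_euler j a Q P0 \<gamma> (T / real (N k)) (N k) (P k)"
begin

abbreviation "Pc k \<equiv> pw_const (T / real (N k)) (P k)"
abbreviation "Pl k \<equiv> pw_linear (T / real (N k)) (P k)"
abbreviation "Ps k \<equiv> pw_slope (T / real (N k)) (P k)"

text \<open>Both sides of the discrete integration by parts are weakly continuous, since
  \<open>\<phi>\<close> and its derivative times a fixed vector are admissible test
  functions.\<close>

lemma weak_limit_derivative:
  assumes w: "weakly_converges_Lp 2 (opD j) (normD j) M (\<lambda>k. Pl (r k)) f"
    and s: "weakly_converges_Lp 2 (opD j) (normD j) M (\<lambda>k. Ps (r k)) g"
  shows "has_weak_derivative (opD j) (normD j) T f g"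
proof (rule weak_derivative_from_coordinates[OF D.hilbert_carrier_measure_axioms])
  interpret finite_measure M by (rule finite_M)
  show "f \<in> bochner_Lp 2 (opD j) (normD j) M" "g \<in> bochner_Lp 2 (opD j) (normD j) M"
    using w s by (simp_all add: weakly_converges_Lp_def)
  fix \<phi> y assume \<phi>: "test_function T \<phi>"
  obtain K where K: "\<forall>t\<in>{0..T}. \<bar>\<phi> t\<bar> \<le> K" "\<forall>t\<in>{0..T}. \<bar>deriv \<phi> t\<bar> \<le> K"
    by (rule test_function_bounded[OF \<phi>])
  note m = test_function_measurable[OF \<phi>, of "{0<..<T}"]
  have "(\<lambda>k. \<integral>t. inner (JD (Pl (r k) t)) (deriv \<phi> t *\<^sub>R y) \<partial>M) \<longlonglongrightarrow> (\<integral>t. inner (JD (f t)) (deriv \<phi> t *\<^sub>R y) \<partial>M)"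
    by (rule D.weakly_converges_inner[OF w borel_measurable_scaleR[OF m(2) borel_measurable_const]
          bounded_scaleR_sq_integrable[OF finite_M m(2) K(2)]])
  moreover have "(\<lambda>k. - (\<integral>t. inner (JD (Ps (r k) t)) (\<phi> t *\<^sub>R y) \<partial>M)) \<longlonglongrightarrow> - (\<integral>t. inner (JD (g t)) (\<phi> t *\<^sub>R y) \<partial>M)"
    by (rule tendsto_minus[OF D.weakly_converges_inner[OF s borel_measurable_scaleR[OF m(1) borel_measurable_const]
          bounded_scaleR_sq_integrable[OF finite_M m(1) K(1)]]])
  ultimately show "(\<integral>t. inner (JD (f t)) (deriv \<phi> t *\<^sub>R y) \<partial>M) = - (\<integral>t. inner (JD (g t)) (\<phi> t *\<^sub>R y) \<partial>M)"
    unfolding pw_linear_slope_by_parts[OF N refl scheme \<phi>] by (rule LIMSEQ_unique)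
qed

lemma pw_linear_has_weak_derivative: "has_weak_derivative (opD j) (normD j) T (Pl k) (Ps k)"
  by (rule weak_derivative_from_coordinates[OF D.hilbert_carrier_measure_axioms
        HD.bochner_L2_mono(1)[OF pw_linear_H(1)[OF N refl scheme]] pw_slope_D(1)[OF N refl scheme]
        pw_linear_slope_by_parts[OF N refl scheme]])

text \<open>Compactness is used twice, in V for the piecewise constant interpolants and in D for the
  slopes. The piecewise linear ones then share the limit in H, and the uniform bound in H upgrades
  weak to weak* convergence.\<close>

theorem convergent_subsequence:
  obtains r f g where "strict_mono (r :: nat \<Rightarrow> nat)"
    "weakly_converges_Lp 2 (opV j) (normV j) M (\<lambda>k. Pc (r k)) f"
    "weakstar_converges_Linf (opH j) (normH j) (innerH j) M (\<lambda>k. Pl (r k)) f"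
    "weakstar_converges_Linf (opH j) (normH j) (innerH j) M (\<lambda>k. Pc (r k)) f"
    "weakly_converges_Lp 2 (opD j) (normD j) M (\<lambda>k. Ps (r k)) g"
    "has_weak_derivative (opD j) (normD j) T f g"
proof -
  obtain r1 f where r1: "strict_mono r1" "weakly_converges_Lp 2 (opV j) (normV j) M (\<lambda>k. Pc (r1 k)) f"
    by (rule V.bounded_imp_weakly_convergent_subseq[OF pw_const_V(1,2)[OF N refl scheme]])
  obtain r2 g where r2: "strict_mono r2" "weakly_converges_Lp 2 (opD j) (normD j) M (\<lambda>k. Ps (r1 (r2 k))) g"
    by (rule D.bounded_imp_weakly_convergent_subseq[of "\<lambda>k. Ps (r1 k)", OF pw_slope_D[OF N refl scheme]])
  define r where "r k = r1 (r2 k)" for k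
  have r: "strict_mono r" using strict_mono_o[OF r1(1) r2(1)] by (simp add: r_def[abs_def] o_def)
  have wV: "weakly_converges_Lp 2 (opV j) (normV j) M (\<lambda>k. Pc (r k)) f"
    unfolding r_def using weakly_converges_subseq[OF r1(2) r2(1)] .
  have wD: "weakly_converges_Lp 2 (opD j) (normD j) M (\<lambda>k. Ps (r k)) g" unfolding r_def by (rule r2(2))
  have wH: "weakly_converges_Lp 2 (opH j) (normH j) M (\<lambda>k. Pc (r k)) f" by (rule VH.weakly_converges_mono[OF wV])
  \<comment> \<open>The step sizes tend to zero, and with them the mean-square distance of the two
    interpolants.\<close>
  have "filterlim (\<lambda>k. N (r k)) at_top sequentially"
    by (rule filterlim_compose[OF N_lim filterlim_subseq[OF r]])
  then have "(\<lambda>k. T / real (N (r k))) \<longlonglongrightarrow> 0"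
    by (rule real_tendsto_divide_at_top[OF tendsto_const filterlim_compose[OF filterlim_real_sequentially]])
  then have lim: "(\<lambda>k. T / real (N (r k)) * K0) \<longlonglongrightarrow> 0" by (rule tendsto_mult_left_zero)
  have lH: "weakly_converges_Lp 2 (opH j) (normH j) M (\<lambda>k. Pl (r k)) f"
  proof (rule H.weakly_converges_perturb[OF wH pw_linear_H(1)[OF N refl scheme]])
    show "(\<lambda>k. \<integral>t. (norm (JH (Pl (r k) t) - JH (Pc (r k) t)))\<^sup>2 \<partial>M) \<longlonglongrightarrow> 0"
    proof (rule Lim_null_comparison[OF always_eventually lim], rule allI)
      fix k
      have "0 \<le> (\<integral>t. (norm (JH (Pl (r k) t) - JH (Pc (r k) t)))\<^sup>2 \<partial>M)" by (rule integral_nonneg_AE) simp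
      then show "norm (\<integral>t. (norm (JH (Pl (r k) t) - JH (Pc (r k) t)))\<^sup>2 \<partial>M) \<le> T / real (N (r k)) * K0"
        using pw_linear_H(3)[OF N refl scheme, of "r k"] unfolding real_norm_def by linarith
    qed
  qed
  show ?thesis
  proof (rule that[OF r wV _ _ wD])
    show "weakstar_converges_Linf (opH j) (normH j) (innerH j) M (\<lambda>k. Pl (r k)) f"
      by (rule H.weakstar_from_weak[OF finite_M lH pw_linear_H(2)[OF N refl scheme] innerH_eq])
    show "weakstar_converges_Linf (opH j) (normH j) (innerH j) M (\<lambda>k. Pc (r k)) f"
      by (rule H.weakstar_from_weak[OF finite_M wH pw_const_V(3)[OF N refl scheme] innerH_eq])
    show "has_weak_derivative (opD j) (normD j) T f g"
      by (rule weak_limit_derivative[OF HD.weakly_converges_mono[OF lH] wD])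
  qed
qed

end

end

theorem lemma4p3:
  fixes j :: "'v::{real_inner,banach,second_countable_topology}
                \<Rightarrow>\<^sub>L 'h::{real_inner,banach,second_countable_topology}"
    and C T \<mu> \<eta> \<gamma> :: real
    and a :: "real \<Rightarrow> 'v \<Rightarrow> 'v \<Rightarrow> real"
    and Q :: "real \<Rightarrow> 'v oper"
    and P0 :: "'v oper"
    and N :: "nat \<Rightarrow> nat"
    and P :: "nat \<Rightarrow> nat \<Rightarrow> 'v oper"
  assumes inj: "inj (blinfun_apply j)"
    and dense: "closure (range (blinfun_apply j)) = UNIV"
    and compact: "compact (closure (blinfun_apply j ` cball 0 1))"
    and embedding_const: "\<And>v. norm (blinfun_apply j v) \<le> C * norm v"
    and T: "T > 0"
    and a_bilinear: "\<And>t. t \<in> {0..T} \<Longrightarrow> bilinear (a t)"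
    and a_measurable: "\<And>u v. (\<lambda>t. a t u v) \<in> borel_measurable (lebesgue_on {0..T})"
    and constants_pos: "\<mu> > 0" "\<eta> > 0"
    and a_coercive: "\<And>t u. t \<in> {0..T} \<Longrightarrow> a t u u \<ge> \<mu> * (norm u)\<^sup>2"
    and a_bounded: "\<And>t u v. t \<in> {0..T} \<Longrightarrow> \<bar>a t u v\<bar> \<le> \<eta> * norm u * norm v"
    and gamma: "0 \<le> \<gamma>" "\<gamma> < \<mu> / C\<^sup>2"
    and Q_L2: "Q \<in> bochner_Lp 2 (opH j) (normH j) (lebesgue_on {0<..<T})"
    and Q_self_adjoint: "AE t in lebesgue_on {0<..<T}. self_adjoint_op j (Q t)"
    and Q_ge: "AE t in lebesgue_on {0<..<T}. op_ge j (Q t) (- (\<gamma>\<^sup>2))"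
    and P0_mem: "P0 \<in> opH j"
    and P0_self_adjoint: "self_adjoint_op j P0"
    and P0_ge: "op_ge j P0 (- \<gamma>)"
    and N_pos: "\<And>k. N k > 0"
    and N_tendsto: "filterlim N at_top sequentially"
    and step_size: "(SUP k. T / real (N k)) < \<mu> / (2 * C\<^sup>2)"
    and scheme: "\<And>k. backward_euler j a Q P0 \<gamma> (T / real (N k)) (N k) (P k)"
  shows "\<exists>r Plim dPlim dP.
           strict_mono (r :: nat \<Rightarrow> nat) \<and>
           Plim \<in> bochner_Linf (opH j) (normH j) (lebesgue_on {0<..<T}) \<and>
           Plim \<in> bochner_Lp 2 (opV j) (normV j) (lebesgue_on {0<..<T}) \<and>
           has_weak_derivative (opD j) (normD j) T Plim dPlim \<and>
           dPlim \<in> bochner_Lp 2 (opD j) (normD j) (lebesgue_on {0<..<T}) \<and>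
           Plim \<in> W1 j T \<and>
           weakly_converges_Lp 2 (opV j) (normV j) (lebesgue_on {0<..<T})
             (\<lambda>k. pw_const (T / real (N (r k))) (P (r k))) Plim \<and>
           weakstar_converges_Linf (opH j) (normH j) (innerH j) (lebesgue_on {0<..<T})
             (\<lambda>k. pw_linear (T / real (N (r k))) (P (r k))) Plim \<and>
           weakstar_converges_Linf (opH j) (normH j) (innerH j) (lebesgue_on {0<..<T})
             (\<lambda>k. pw_const (T / real (N (r k))) (P (r k))) Plim \<and>
           (\<forall>k. has_weak_derivative (opD j) (normD j) T
                  (pw_linear (T / real (N (r k))) (P (r k))) (dP k)) \<and>
           weakly_converges_Lp 2 (opD j) (normD j) (lebesgue_on {0<..<T}) dP dPlim"
proof -
  obtain B where "gelfand_triple j B"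
  proof (rule spectral_basis[OF inj compact])
    fix B assume B: "onb B"
      "\<And>b w. b \<in> B \<Longrightarrow> inner (blinfun_apply j b) (blinfun_apply j w) = (norm (blinfun_apply j b))\<^sup>2 * inner b w"
    have "gelfand_triple j B" by (rule gelfand_triple.intro[OF inj dense B])
    then show thesis by (rule that)
  qed
  \<comment> \<open>Division by zero gives 0, so \<open>C = 0\<close> would make the two bounds on
    \<open>\<gamma>\<close> contradictory.\<close>
  have "C \<noteq> 0" using gamma by auto
  then have g: "\<gamma> * C\<^sup>2 \<le> \<mu>" using gamma(2) by (simp add: field_simps)
  interpret riccati_data j B C T \<mu> \<eta> \<gamma> a Q P0
    by (intro riccati_data.intro riccati_data_axioms.intro; fact)
  obtain r f g where r: "strict_mono (r :: nat \<Rightarrow> nat)"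
    and wV: "weakly_converges_Lp 2 (opV j) (normV j) M (\<lambda>k. pw_const (T / real (N (r k))) (P (r k))) f"
    and sH: "weakstar_converges_Linf (opH j) (normH j) (innerH j) M (\<lambda>k. pw_linear (T / real (N (r k))) (P (r k))) f"
      "weakstar_converges_Linf (opH j) (normH j) (innerH j) M (\<lambda>k. pw_const (T / real (N (r k))) (P (r k))) f"
    and wD: "weakly_converges_Lp 2 (opD j) (normD j) M (\<lambda>k. pw_slope (T / real (N (r k))) (P (r k))) g"
    and d: "has_weak_derivative (opD j) (normD j) T f g"
    by (rule convergent_subsequence[OF N_pos N_tendsto scheme])
  have f: "f \<in> bochner_Lp 2 (opV j) (normV j) M" "f \<in> bochner_Linf (opH j) (normH j) M"
    and g: "g \<in> bochner_Lp 2 (opD j) (normD j) M"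
    using wV sH(1) wD by (simp_all add: weakly_converges_Lp_def weakstar_converges_Linf_def)
  \<comment> \<open>The derivative lies entirely in the second summand of the space required by
    \<open>W1\<close>, so the first one is zero.\<close>
  have "(\<lambda>t. 0) \<in> bochner_Lp 1 (opH j) (normH j) M"
    using H.X_0 H.J_0 by (simp add: H.bochner_Lp_iff)
  then have "f \<in> W1 j T"
    unfolding W1_def using f(1) g d by (intro CollectI conjI bexI[of _ "\<lambda>t. 0"] bexI[of _ g]) simp_all
  then show ?thesis
    using r f g d wV sH wD pw_linear_has_weak_derivative[OF N_pos N_tendsto scheme]
    by (intro exI[of _ r] exI[of _ f] exI[of _ g] exI[of _ "\<lambda>k. pw_slope (T / real (N (r k))) (P (r k))"] conjI allI)
qed

end
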